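(* Let $p$ be a prime number and $e\in\mathbb{N}$. Let $b$ be an algebraic number such that $0$ is periodic under $f = T^{p^e}+b$. Then there exists a constant $c=c(p,e,b)>0$, depending only on $p$, $e$ and $b$, such that every $f$-wandering algebraic number $\alpha$ satisfies $$\hat h_f(\alpha)\ge \frac{c}{[\mathbb{Q}(\alpha):\mathbb{Q}]^2}.$$
   Context: $\mathbb{N}=\{1,2,\ldots\}$, $\mathbb{N}_0=\mathbb{N}\cup\{0\}$. $f^{(n)}$ is the $n$-th iterate of $f$, with $f^{(0)}=T$. A point $\alpha$ is $f$-periodic if $f^{(n)}(\alpha)=\alpha$ for some $n\ge1$; it is $f$-wandering if its forward orbit $\{f^{(n)}(\alpha): n\in\mathbb{N}_0\}$ is infinite. Heights. For a number field $L$, a place $v\in M_L$ is a non-trivial absolute value $|\cdot|_v$ on $L$ whose restriction to $\mathbb{Q}$ is the standard absolute value or a $p$-adic absolute value normalized by $|p|_v=1/p$; $L_v$ is the completion and $d_v=[L_v:\mathbb{Q}_w]$, where $w=v|_{\mathbb{Q}}$. With $\log^+t=\log\max\{1,t\}$, for a polynomial $f$ of degree $d\ge2$ with coefficients in $L$ and $\alpha\in L$, put $\lambda_{f,v}(\alpha)=\lim_{n\to\infty} d^{-n}\log^+|f^{(n)}(\alpha)|_v$ (the limit exists). The canonical height is $\hat h_f(\alpha)=\sum_{v\in M_L}\frac{d_v}{[L:\mathbb{Q}]}\lambda_{f,v}(\alpha)$; it is independent of the number field $L$ containing $\alpha$ and the coefficients of $f$. *)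

theory Defs
  imports
    "HOL-Algebra.Embedded_Algebras"
    "HOL-Algebra.Generated_Fields"
    "HOL-Algebra.Algebraic_Closure_Type"
    "HOL-Analysis.Analysis"
    "HOL-Computational_Algebra.Computational_Algebra"
begin

section \<open>Number fields inside the complex numbers\<close>

text \<open>
  Algebraic numbers are the algebraic elements of \<^typ>\<open>complex\<close>, and number fields are
  subfields of \<^typ>\<open>complex\<close> of finite degree over \<open>\<rat>\<close>.
\<close>

abbreviation complex_field :: "complex ring" where
  "complex_field \<equiv> ring_of_type_algebra"

definition adjoin :: "complex set \<Rightarrow> complex set" where
  "adjoin A = generate_field complex_field A"

definition field_degree :: "complex set \<Rightarrow> nat" where
  "field_degree L = ring.dim complex_field \<rat> L"

section \<open>Places\<close>

definition absolute_value_on :: "complex set \<Rightarrow> (complex \<Rightarrow> real) \<Rightarrow> bool" where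
  "absolute_value_on L v \<longleftrightarrow>
     (\<forall>x\<in>L. v x \<ge> 0) \<and>
     (\<forall>x\<in>L. v x = 0 \<longleftrightarrow> x = 0) \<and>
     (\<forall>x\<in>L. \<forall>y\<in>L. v (x * y) = v x * v y) \<and>
     (\<forall>x\<in>L. \<forall>y\<in>L. v (x + y) \<le> v x + v y)"

definition padic_abs :: "nat \<Rightarrow> rat \<Rightarrow> real" where
  "padic_abs p q =
     (if q = 0 then 0
      else case quotient_of q of (a, b) \<Rightarrow>
        real p powi (int (multiplicity (int p) b) - int (multiplicity (int p) a)))"

text \<open>
  Membership in \<^term>\<open>extensional L\<close> makes an absolute value on \<open>L\<close> a unique element
  of the function type.
\<close>

definition places :: "complex set \<Rightarrow> (complex \<Rightarrow> real) set" where
  "places L =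
     {v \<in> extensional L. absolute_value_on L v \<and> (\<exists>x\<in>L. x \<noteq> 0 \<and> v x \<noteq> 1) \<and>
        ((\<forall>q::rat. v (of_rat q) = \<bar>of_rat q\<bar>) \<or>
         (\<exists>p::nat. Factorial_Ring.prime p \<and> (\<forall>q::rat. v (of_rat q) = padic_abs p q)))}"

section \<open>Completions and local degrees\<close>

definition cauchy_ring :: "complex set \<Rightarrow> (complex \<Rightarrow> real) \<Rightarrow> (nat \<Rightarrow> complex) ring" where
  "cauchy_ring L v =
     \<lparr>carrier = {x. range x \<subseteq> L \<and> (\<forall>\<epsilon>>0. \<exists>N. \<forall>m\<ge>N. \<forall>n\<ge>N. v (x m - x n) < \<epsilon>)},
      monoid.mult = (\<lambda>x y n. x n * y n), one = (\<lambda>n. 1),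
      ring.zero = (\<lambda>n. 0), add = (\<lambda>x y n. x n + y n)\<rparr>"

definition null_sequences :: "complex set \<Rightarrow> (complex \<Rightarrow> real) \<Rightarrow> (nat \<Rightarrow> complex) set" where
  "null_sequences L v = {x. range x \<subseteq> L \<and> (\<lambda>n. v (x n)) \<longlonglongrightarrow> 0}"

definition completion :: "complex set \<Rightarrow> (complex \<Rightarrow> real) \<Rightarrow> (nat \<Rightarrow> complex) set ring" where
  "completion L v = cauchy_ring L v Quot null_sequences L v"

text \<open>
  For \<open>w\<close> the restriction of \<open>v\<close> to \<open>\<rat>\<close>, the completion of \<open>\<rat>\<close> at \<open>w\<close> is identified with
  its image in the completion of \<open>L\<close> at \<open>v\<close>: the classes of the rational Cauchy sequences.
\<close>

definition base_completion :: "complex set \<Rightarrow> (complex \<Rightarrow> real) \<Rightarrow> (nat \<Rightarrow> complex) set set" where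
  "base_completion L v =
     (\<lambda>x. null_sequences L v +>\<^bsub>cauchy_ring L v\<^esub> x) ` carrier (cauchy_ring \<rat> v)"

definition local_degree :: "complex set \<Rightarrow> (complex \<Rightarrow> real) \<Rightarrow> nat" where
  "local_degree L v =
     ring.dim (completion L v) (base_completion L v) (carrier (completion L v))"

section \<open>Canonical heights\<close>

definition log_plus :: "real \<Rightarrow> real" where
  "log_plus t = ln (max 1 t)"

definition local_height :: "complex poly \<Rightarrow> (complex \<Rightarrow> real) \<Rightarrow> complex \<Rightarrow> real" where
  "local_height f v \<alpha> = lim (\<lambda>n. log_plus (v ((poly f ^^ n) \<alpha>)) / real (Polynomial.degree f) ^ n)"

definition canonical_height_over :: "complex set \<Rightarrow> complex poly \<Rightarrow> complex \<Rightarrow> real" where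
  "canonical_height_over L f \<alpha> =
     (\<Sum>\<^sub>\<infinity>v\<in>places L. real (local_degree L v) / real (field_degree L) * local_height f v \<alpha>)"

text \<open>
  The value of \<^const>\<open>canonical_height_over\<close> is the same for every number field containing
  \<open>\<alpha>\<close> and the coefficients of \<open>f\<close>; it is taken here over the smallest such field.
\<close>

definition canonical_height :: "complex poly \<Rightarrow> complex \<Rightarrow> real" where
  "canonical_height f \<alpha> = canonical_height_over (adjoin (insert \<alpha> (set (coeffs f)))) f \<alpha>"

section \<open>Periodic and wandering points\<close>

definition periodic_point :: "complex poly \<Rightarrow> complex \<Rightarrow> bool" where
  "periodic_point f \<alpha> \<longleftrightarrow> (\<exists>n\<ge>1. (poly f ^^ n) \<alpha> = \<alpha>)"

definition wandering_point :: "complex poly \<Rightarrow> complex \<Rightarrow> bool" where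
  "wandering_point f \<alpha> \<longleftrightarrow> infinite (range (\<lambda>n. (poly f ^^ n) \<alpha>))"

end

theory Submission
  imports Defs "Jordan_Normal_Form.Char_Poly"
begin

text \<open>
  First let \<open>\<alpha>\<close> be an algebraic integer of degree \<open>D\<close>. Split \<open>f\<close> into the steps
  \<open>x \<mapsto> x ^ p\<close>, adding \<open>b\<close> in every \<open>e\<close>-th one. Over a field containing \<open>b\<close> and a primitive
  \<open>p\<close>-th root of unity, Kummer theory shows that a step either keeps the degree of the iterate of
  \<open>\<alpha>\<close> or divides it by \<open>p\<close>. As \<open>0\<close> is periodic, a fixed number of iterations of \<open>f\<close> acts modulo \<open>p\<close>
  as a power of Frobenius, which up to nilpotents fixes the integers of the base field; hence a later iterate is
  \<open>p\<close>-adically close to the conjugates of an earlier one, and every step that keeps the degree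
  contributes a further factor \<open>p\<close> to the product of the differences. Ramification excludes steps
  that divide the degree once the number \<open>m\<close> of the others satisfies \<open>p ^ m > c * D\<close>, unless an
  iterate of \<open>\<alpha>\<close> lies in the radical of \<open>p\<close>; in that case it is attracted to \<open>0\<close> \<open>p\<close>-adically, and
  the product formula bounds the height from below. Otherwise the conjugates of boundedly many
  iterates have a discriminant divisible by a large power of \<open>p\<close>. An upper bound for this
  discriminant by the archimedean Green functions gives a height of at least \<open>c / D ^ 2\<close>.

  If \<open>\<alpha>\<close> is not integral, a subring of the number field that is maximal among those containing
  \<open>1 / \<alpha>\<close> but not \<open>\<alpha>\<close> is the valuation ring of a place \<open>v\<close> with \<open>v \<alpha> \<ge> 2 powr (1 / D)\<close>.
\<close>

text \<open>The archimedean bound loses about \<open>2 * Ec * ln N\<close> per point, while the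
  \<open>p\<close>-adic gain between two levels of the orbit is only about \<open>ln Dg\<close>,
  where \<open>Dg\<close> is the degree over the base field. One pair of levels may therefore lose.
  With \<open>Jn + 1\<close> levels every point gains from \<open>Jn\<close> others, and the loss
  stays logarithmic in the number of points. So a \<open>Jn\<close> above \<open>2 * Ec\<close>
  wins, and it depends on the constants alone. The square in the result comes from two facts. The
  number of points at level \<open>j\<close> times the growth \<open>(p ^ e) ^ j\<close> of the
  height equals \<open>Dg * p ^ mm\<close>, because a drop of the degree offsets the growth exactly;
  and the level is chosen so that \<open>p ^ mm\<close> is comparable with \<open>Dg\<close>. The
  \<open>p\<close>-adic side of the integral case is divisibility among algebraic integers together
  with norms, so places above \<open>p\<close> do not occur in it. Places are needed to reach the
  canonical height, and there nonnegative local heights and \<open>local_degree \<ge> 1\<close>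
  suffice for a lower bound.\<close>

section \<open>Finitely generated modules and the ring of algebraic integers\<close>

definition zspan :: "complex set \<Rightarrow> complex set" where
  "zspan E = range (\<lambda>a::complex \<Rightarrow> int. \<Sum>e\<in>E. of_int (a e) * e)"

lemma zspan_superset: "finite E \<Longrightarrow> e \<in> E \<Longrightarrow> e \<in> zspan E"
  unfolding zspan_def
  by (rule image_eqI[of _ _ "\<lambda>x. if x = e then 1 else 0"]) (auto simp: if_distrib if_distribR cong: if_cong)

lemma zspan_add: "x \<in> zspan E \<Longrightarrow> y \<in> zspan E \<Longrightarrow> x + y \<in> zspan E"
  unfolding zspan_def
proof clarify
  fix a b :: "complex \<Rightarrow> int"
  show "(\<Sum>e\<in>E. of_int (a e) * e) + (\<Sum>e\<in>E. of_int (b e) * e) \<in> range (\<lambda>a. \<Sum>e\<in>E. of_int (a e) * e)"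
    by (rule image_eqI[of _ _ "\<lambda>e. a e + b e"]) (auto simp: algebra_simps sum.distrib)
qed

lemma zspan_scale: "x \<in> zspan E \<Longrightarrow> of_int k * x \<in> zspan E"
  unfolding zspan_def
proof clarify
  fix a :: "complex \<Rightarrow> int"
  show "of_int k * (\<Sum>e\<in>E. of_int (a e) * e) \<in> range (\<lambda>a. \<Sum>e\<in>E. of_int (a e) * e)"
    by (rule image_eqI[of _ _ "\<lambda>e. k * a e"]) (auto simp: algebra_simps sum_distrib_left)
qed

lemma zspan_0: "0 \<in> zspan E"
  unfolding zspan_def by (rule image_eqI[of _ _ "\<lambda>_. 0"]) auto

lemma zspan_sum: "(\<And>i. i \<in> A \<Longrightarrow> g i \<in> zspan E) \<Longrightarrow> (\<Sum>i\<in>A. of_int (k i) * g i) \<in> zspan E"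
  by (induction A rule: infinite_finite_induct) (auto intro: zspan_0 zspan_add zspan_scale)

lemma zspan_mult_closed:
  assumes "\<And>e. e \<in> E \<Longrightarrow> x * e \<in> zspan E" "z \<in> zspan E"
  shows "x * z \<in> zspan E"
proof -
  obtain a where z: "z = (\<Sum>e\<in>E. of_int (a e) * e)"
    using assms(2) by (auto simp: zspan_def)
  have "x * z = (\<Sum>e\<in>E. of_int (a e) * (x * e))"
    by (simp add: z sum_distrib_left mult_ac)
  also have "\<dots> \<in> zspan E" by (rule zspan_sum) (rule assms(1))
  finally show ?thesis .
qed

text \<open>Determinant trick: multiplication by \<open>x\<close> on the generators is an integer
  matrix, the vector of generators is a nonzero eigenvector, and the characteristic polynomial is
  monic and integral.\<close>

lemma algebraic_int_if_zspan_stable: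
  assumes fin: "finite E" and ne: "\<exists>e\<in>E. e \<noteq> 0" and st: "\<And>e. e \<in> E \<Longrightarrow> x * e \<in> zspan E"
  shows "algebraic_int x"
proof -
  obtain h where h: "bij_betw h {0..<card E} E"
    using ex_bij_betw_nat_finite[OF fin] by blast
  define n where "n = card E"
  have h: "bij_betw h {0..<n} E" using h by (simp add: n_def)
  have "\<exists>a::complex \<Rightarrow> int. x * e = (\<Sum>e'\<in>E. of_int (a e') * e')" if "e \<in> E" for e
    using st[OF that] by (auto simp: zspan_def)
  then obtain a :: "complex \<Rightarrow> complex \<Rightarrow> int" where
    a: "\<And>e. e \<in> E \<Longrightarrow> x * e = (\<Sum>e'\<in>E. of_int (a e e') * e')" by metis
  define B :: "int mat" where "B = mat n n (\<lambda>(i,j). a (h i) (h j))"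
  define A :: "complex mat" where "A = map_mat of_int B"
  define v where "v = vec n h"
  have A: "A \<in> carrier_mat n n" and B: "B \<in> carrier_mat n n" by (auto simp: A_def B_def)
  have hE: "h i \<in> E" if "i < n" for i using h that by (auto simp: bij_betw_def)
  have "A *\<^sub>v v = x \<cdot>\<^sub>v v"
  proof (rule eq_vecI)
    fix i assume "i < dim_vec (x \<cdot>\<^sub>v v)"
    then have i: "i < n" by (simp add: v_def)
    have "(A *\<^sub>v v) $ i = (\<Sum>j = 0..<n. of_int (a (h i) (h j)) * h j)"
      using i by (simp add: A_def B_def v_def scalar_prod_def)
    also have "\<dots> = (\<Sum>e\<in>E. of_int (a (h i) e) * e)"
      by (rule sum.reindex_bij_betw[OF h])
    also have "\<dots> = x * h i" using a[OF hE[OF i]] by simp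
    finally show "(A *\<^sub>v v) $ i = (x \<cdot>\<^sub>v v) $ i" using i by (simp add: v_def)
  qed (use A in \<open>auto simp: v_def\<close>)
  moreover have "v \<noteq> 0\<^sub>v n"
  proof
    assume v0: "v = 0\<^sub>v n"
    obtain e where e: "e \<in> E" "e \<noteq> 0" using ne by blast
    then obtain i where "i < n" "h i = e" using h by (auto simp: bij_betw_def)
    then show False using e v0 by (metis index_vec index_zero_vec(1) v_def)
  qed
  ultimately have "eigenvalue A x"
    unfolding eigenvalue_def eigenvector_def using A by (intro exI[of _ v]) (auto simp: v_def)
  then have "poly (char_poly A) x = 0" using eigenvalue_root_char_poly[OF A] by simp
  moreover have "char_poly A = map_poly of_int (char_poly B)"
    unfolding A_def by (rule of_int_hom.char_poly_hom[OF B])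
  moreover have "lead_coeff (char_poly A) = 1" using degree_monic_char_poly[OF A] by simp
  ultimately show ?thesis
    by (intro algebraic_int.intros[of "char_poly A"]) auto
qed

lemma monic_power_reduce:
  fixes P :: "complex poly"
  assumes "lead_coeff P = 1" "poly P x = 0"
  shows "x ^ Polynomial.degree P = - (\<Sum>i<Polynomial.degree P. Polynomial.coeff P i * x ^ i)"
proof -
  have "poly P x = (\<Sum>i\<le>Polynomial.degree P. Polynomial.coeff P i * x ^ i)" by (rule poly_altdef)
  also have "\<dots> = (\<Sum>i<Polynomial.degree P. Polynomial.coeff P i * x ^ i) + x ^ Polynomial.degree P"
    using assms(1) by (simp flip: lessThan_Suc_atMost)
  finally show ?thesis using assms(2) by (simp add: eq_neg_iff_add_eq_0 add.commute)
qed

text \<open>Multiplication by \<open>x\<close> and by \<open>y\<close> maps the module generated by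
  the monomials \<open>x ^ i * y ^ j\<close>, with exponents below the degrees of the two monic
  equations, into itself.\<close>

lemma algebraic_int_add_mult:
  fixes x y :: complex
  assumes "algebraic_int x" "algebraic_int y"
  shows "algebraic_int (x + y) \<and> algebraic_int (x * y)"
proof -
  obtain P where P: "lead_coeff P = 1" "\<And>i. Polynomial.coeff P i \<in> \<int>" "poly P x = 0"
    using assms(1) by (auto simp: algebraic_int.simps)
  obtain Q where Q: "lead_coeff Q = 1" "\<And>i. Polynomial.coeff Q i \<in> \<int>" "poly Q y = 0"
    using assms(2) by (auto simp: algebraic_int.simps)
  define m n where "m = Polynomial.degree P" and "n = Polynomial.degree Q"
  obtain c where c: "\<And>i. Polynomial.coeff P i = of_int (c i)"
    using choice[of "\<lambda>i k. Polynomial.coeff P i = of_int k"] P(2) by (auto simp: Ints_def)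
  obtain d where d: "\<And>i. Polynomial.coeff Q i = of_int (d i)"
    using choice[of "\<lambda>i k. Polynomial.coeff Q i = of_int k"] Q(2) by (auto simp: Ints_def)
  have mpos: "m > 0"
  proof (rule ccontr)
    assume "\<not> m > 0"
    then have "P = 1" using P(1) m_def by (metis monic_degree_0 not_gr_zero)
    then show False using P(3) by simp
  qed
  have npos: "n > 0"
  proof (rule ccontr)
    assume "\<not> n > 0"
    then have "Q = 1" using Q(1) n_def by (metis monic_degree_0 not_gr_zero)
    then show False using Q(3) by simp
  qed
  define E where "E = (\<lambda>(i,j). x ^ i * y ^ j) ` ({..<m} \<times> {..<n})"
  have fin: "finite E" by (simp add: E_def)
  have mem: "x ^ i * y ^ j \<in> zspan E" if "i < m" "j < n" for i j
    by (rule zspan_superset[OF fin]) (use that in \<open>auto simp: E_def\<close>)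
  have xE: "x * e \<in> zspan E" if e: "e \<in> E" for e
  proof -
    obtain i j where ij: "i < m" "j < n" "e = x ^ i * y ^ j" using e by (auto simp: E_def)
    show ?thesis
    proof (cases "Suc i < m")
      case True
      then show ?thesis using mem[of "Suc i" j] ij by (simp add: mult_ac)
    next
      case False
      then have "m = Suc i" using ij by simp
      then have "x * e = x ^ m * y ^ j" by (simp add: ij mult_ac)
      also have "\<dots> = (\<Sum>k<m. of_int (- c k) * (x ^ k * y ^ j))"
        using monic_power_reduce[OF P(1,3)] by (simp add: m_def c sum_distrib_left sum_negf mult_ac)
      also have "\<dots> \<in> zspan E" by (rule zspan_sum) (use ij mem in auto)
      finally show ?thesis .
    qed
  qed
  have yE: "y * e \<in> zspan E" if e: "e \<in> E" for e
  proof -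
    obtain i j where ij: "i < m" "j < n" "e = x ^ i * y ^ j" using e by (auto simp: E_def)
    show ?thesis
    proof (cases "Suc j < n")
      case True
      then show ?thesis using mem[of i "Suc j"] ij by (simp add: mult_ac)
    next
      case False
      then have "n = Suc j" using ij by simp
      then have "y * e = x ^ i * y ^ n" by (simp add: ij mult_ac)
      also have "\<dots> = (\<Sum>k<n. of_int (- d k) * (x ^ i * y ^ k))"
        using monic_power_reduce[OF Q(1,3)] by (simp add: n_def d sum_distrib_left sum_negf mult_ac)
      also have "\<dots> \<in> zspan E" by (rule zspan_sum) (use ij mem in auto)
      finally show ?thesis .
    qed
  qed
  have "1 \<in> E"
    unfolding E_def by (rule image_eqI[of _ _ "(0,0)"]) (simp_all add: mpos npos)
  then have ne: "\<exists>e\<in>E. e \<noteq> 0" by (intro bexI[of _ 1]) simp_all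
  show ?thesis
  proof
    show "algebraic_int (x + y)"
      by (rule algebraic_int_if_zspan_stable[OF fin ne])
         (simp add: distrib_right zspan_add xE yE)
    show "algebraic_int (x * y)"
      by (rule algebraic_int_if_zspan_stable[OF fin ne])
         (simp add: mult.assoc zspan_mult_closed xE yE)
  qed
qed

lemma algebraic_int_add [intro]: "algebraic_int (x::complex) \<Longrightarrow> algebraic_int y \<Longrightarrow> algebraic_int (x + y)"
  and algebraic_int_mult [intro]: "algebraic_int (x::complex) \<Longrightarrow> algebraic_int y \<Longrightarrow> algebraic_int (x * y)"
  by (simp_all add: algebraic_int_add_mult)

lemma algebraic_int_diff [intro]:
  "algebraic_int (x::complex) \<Longrightarrow> algebraic_int y \<Longrightarrow> algebraic_int (x - y)"
  using algebraic_int_add[of x "- y"] by simp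

lemma algebraic_int_of_nat' [simp, intro]: "algebraic_int (of_nat n :: complex)"
  by (rule int_imp_algebraic_int) auto

lemma algebraic_int_of_int' [simp, intro]: "algebraic_int (of_int n :: complex)"
  by (rule int_imp_algebraic_int) auto

lemma algebraic_int_power [intro]: "algebraic_int (x::complex) \<Longrightarrow> algebraic_int (x ^ n)"
  by (induction n) auto

lemma algebraic_int_sum [intro]:
  "(\<And>i. i \<in> A \<Longrightarrow> algebraic_int (g i :: complex)) \<Longrightarrow> algebraic_int (sum g A)"
  by (induction A rule: infinite_finite_induct) auto

lemma algebraic_int_prod [intro]:
  "(\<And>i. i \<in> A \<Longrightarrow> algebraic_int (g i :: complex)) \<Longrightarrow> algebraic_int (prod g A)"
  by (induction A rule: infinite_finite_induct) auto

lemma algebraic_int_power_iff: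
  assumes "n > 0" shows "algebraic_int ((x::complex) ^ n) \<longleftrightarrow> algebraic_int x"
proof
  assume x: "algebraic_int (x ^ n)"
  have "\<forall>i. Polynomial.coeff (Polynomial.monom (1::complex) n) i \<in> \<int>"
    by simp
  moreover have "poly (Polynomial.monom 1 n) x = x ^ n" by (simp add: poly_monom)
  moreover have "lead_coeff (Polynomial.monom (1::complex) n) = 1" by (simp add: Polynomial.degree_monom_eq)
  moreover have "Polynomial.degree (Polynomial.monom (1::complex) n) > 0"
    using assms by (simp add: Polynomial.degree_monom_eq)
  ultimately show "algebraic_int x" using algebraic_int_root[OF x] by blast
qed (rule algebraic_int_power)

subsection \<open>Divisibility of algebraic integers\<close>

text \<open>Divisibility in the ring of all algebraic integers: no number field has to be named, and
  that ring contains the roots of its elements, so \<open>c ^ N\<close> dividing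
  \<open>x ^ N\<close> forces \<open>c\<close> to divide \<open>x\<close> for
  \<open>c \<noteq> 0\<close> and \<open>N > 0\<close>.\<close>

definition alg_dvd :: "complex \<Rightarrow> complex \<Rightarrow> bool"  (infix \<open>advd\<close> 50) where
  "c advd x \<longleftrightarrow> (\<exists>t. algebraic_int t \<and> x = c * t)"

lemma advdI [intro?]: "algebraic_int t \<Longrightarrow> x = c * t \<Longrightarrow> c advd x" by (auto simp: alg_dvd_def)
lemma advdE [elim?]: "c advd x \<Longrightarrow> (\<And>t. algebraic_int t \<Longrightarrow> x = c * t \<Longrightarrow> P) \<Longrightarrow> P" by (auto simp: alg_dvd_def)
lemma advd_0 [simp]: "c advd 0" by (rule advdI[of 0]) auto

lemma advd_add: assumes "c advd x" "c advd y" shows "c advd (x + y)"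
proof -
  obtain s t where "algebraic_int s" "x = c * s" "algebraic_int t" "y = c * t"
    using assms by (elim advdE)
  then show ?thesis by (intro advdI[of "s + t"]) (auto simp: distrib_left)
qed
lemma advd_minus: assumes "c advd x" shows "c advd (- x)"
proof -
  obtain s where "algebraic_int s" "x = c * s" using assms by (elim advdE)
  then show ?thesis by (intro advdI[of "- s"]) auto
qed
lemma advd_diff_commute: "c advd (x - y) \<Longrightarrow> c advd (y - x)"
  using advd_minus[of c "x - y"] by simp
lemma advd_diff_trans: "c advd (x - y) \<Longrightarrow> c advd (y - z) \<Longrightarrow> c advd (x - z)"
  using advd_add[of c "x - y" "y - z"] by simp
lemma advd_cancel: "c advd (x - y) \<Longrightarrow> c advd y \<Longrightarrow> c advd x"
  using advd_add[of c "x - y" y] by simp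
lemma advd_mult: assumes "c advd x" "d advd y" shows "(c * d) advd (x * y)"
proof -
  obtain s t where "algebraic_int s" "x = c * s" "algebraic_int t" "y = d * t"
    using assms by (elim advdE)
  then show ?thesis by (intro advdI[of "s * t"]) (auto simp: mult_ac)
qed
lemma advd_1_iff: "1 advd x \<longleftrightarrow> algebraic_int x"
  by (simp add: alg_dvd_def)
lemma advd_mult_right: "c advd x \<Longrightarrow> algebraic_int y \<Longrightarrow> c advd (x * y)"
  using advd_mult[of c x 1 y] by (simp add: advd_1_iff)
lemma advd_mult_left: "c advd x \<Longrightarrow> algebraic_int y \<Longrightarrow> c advd (y * x)"
  using advd_mult_right[of c x y] by (simp add: mult.commute)
lemma advd_trans: assumes "c advd d" "d advd x" shows "c advd x"
proof -
  obtain s t where "algebraic_int s" "d = c * s" "algebraic_int t" "x = d * t"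
    using assms by (elim advdE)
  then show ?thesis by (intro advdI[of "s * t"]) (auto simp: mult_ac)
qed
lemma advd_power_self: "c advd x \<Longrightarrow> algebraic_int x \<Longrightarrow> n > 0 \<Longrightarrow> c advd (x ^ n)"
  by (cases n) (auto intro: advd_mult_right)
lemma advd_sum: "(\<And>i. i \<in> A \<Longrightarrow> c advd g i) \<Longrightarrow> c advd (sum g A)"
  by (induction A rule: infinite_finite_induct) (auto intro: advd_add)
lemma advd_iff_divide: "c \<noteq> 0 \<Longrightarrow> c advd x \<longleftrightarrow> algebraic_int (x / c)"
  by (auto simp: alg_dvd_def intro!: exI[of _ "x / c"])

lemma advd_power_diff:
  assumes "c advd (x - y)" "algebraic_int x" "algebraic_int y" shows "c advd (x ^ n - y ^ n)"
  unfolding power_diff_sumr2[of x n y]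
  by (rule advd_mult_right[OF assms(1)]) (use assms in auto)

lemma advd_prod_diff:
  assumes "\<And>i. i \<in> A \<Longrightarrow> c advd (g i - h i)" "\<And>i. i \<in> A \<Longrightarrow> algebraic_int (g i)" "\<And>i. i \<in> A \<Longrightarrow> algebraic_int (h i)"
  shows "c advd (prod g A - prod h A)"
  using assms
proof (induction A rule: infinite_finite_induct)
  case (insert a A)
  have eq: "prod g (insert a A) - prod h (insert a A) = (g a - h a) * prod g A + h a * (prod g A - prod h A)"
    using insert by (simp add: algebra_simps)
  show ?case unfolding eq
    using insert by (intro advd_add advd_mult_right advd_mult_left) auto
qed auto

text \<open>Every inner binomial term contains \<open>p\<close>, \<open>x\<close> and
  \<open>y\<close>. The factor \<open>x * y\<close> is kept in the error because differences of
  iterates are factored with it later.\<close>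

lemma frobenius_prime:
  fixes x y :: complex
  assumes p: "Factorial_Ring.prime (p::nat)" and "algebraic_int x" "algebraic_int y"
  shows "\<exists>w. algebraic_int w \<and> (x + y) ^ p = x ^ p + y ^ p + of_nat p * x * y * w"
proof -
  have p2: "p \<ge> 2" using p by (rule prime_ge_2_nat)
  define w where "w = (\<Sum>k=1..<p. of_nat ((p choose k) div p) * x ^ (k - 1) * y ^ (p - k - 1))"
  have ch: "of_nat (p choose k) = of_nat p * (of_nat ((p choose k) div p) :: complex)" if "k \<in> {1..<p}" for k
  proof -
    have "p dvd (p choose k)" using that p by (intro dvd_choose_prime) auto
    then show ?thesis by (metis dvd_mult_div_cancel of_nat_mult)
  qed
  have "(x + y) ^ p = (\<Sum>k\<le>p. of_nat (p choose k) * x ^ k * y ^ (p - k))" by (rule binomial_ring)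
  also have "{..p} = insert 0 (insert p {1..<p})" using p2 by auto
  also have "(\<Sum>k\<in>insert 0 (insert p {1..<p}). of_nat (p choose k) * x ^ k * y ^ (p - k))
      = y ^ p + x ^ p + (\<Sum>k=1..<p. of_nat (p choose k) * x ^ k * y ^ (p - k))"
    using p2 by simp
  also have "(\<Sum>k=1..<p. of_nat (p choose k) * x ^ k * y ^ (p - k)) = of_nat p * x * y * w"
    unfolding w_def sum_distrib_left
  proof (rule sum.cong[OF refl], goal_cases)
    case (1 k)
    have "x ^ k = x * x ^ (k - 1)" using 1 by (cases k) auto
    moreover have "y ^ (p - k) = y * y ^ (p - k - 1)" using 1 by (cases "p - k") auto
    ultimately show ?case using ch[OF 1] by (simp add: mult_ac)
  qed
  finally have "(x + y) ^ p = x ^ p + y ^ p + of_nat p * x * y * w" by simp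
  moreover have "algebraic_int w" unfolding w_def using assms by auto
  ultimately show ?thesis by blast
qed

text \<open>Write the power for \<open>a\<close> as \<open>u + v + p * t\<close> and expand its
  \<open>p\<close>-th power twice; \<open>u\<close> and \<open>v\<close> are positive powers of
  \<open>x\<close> and \<open>y\<close>, which returns the factor \<open>x * y\<close> in the
  error.\<close>

lemma frobenius_prime_power:
  fixes x y :: complex
  assumes p: "Factorial_Ring.prime (p::nat)" and x: "algebraic_int x" and y: "algebraic_int y"
  shows "\<exists>w. algebraic_int w \<and> (x + y) ^ (p ^ a) = x ^ (p ^ a) + y ^ (p ^ a) + of_nat p * x * y * w"
proof (induction a)
  case 0
  show ?case by (rule exI[of _ 0]) auto
next
  case (Suc a)
  have p0: "p > 0" using p prime_gt_0_nat by blast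
  obtain w where w: "algebraic_int w" "(x + y) ^ (p ^ a) = x ^ (p ^ a) + y ^ (p ^ a) + of_nat p * x * y * w"
    using Suc by blast
  define u v t where "u = x ^ (p ^ a)" and "v = y ^ (p ^ a)" and "t = x * y * w"
  have alg: "algebraic_int u" "algebraic_int v" "algebraic_int t" using x y w by (auto simp: u_def v_def t_def)
  obtain w1 where w1: "algebraic_int w1" "(u + v) ^ p = u ^ p + v ^ p + of_nat p * u * v * w1"
    using frobenius_prime[OF p alg(1,2)] by blast
  obtain w2 where w2: "algebraic_int w2"
    "((u + v) + of_nat p * t) ^ p = (u + v) ^ p + (of_nat p * t) ^ p + of_nat p * (u + v) * (of_nat p * t) * w2"
    using frobenius_prime[OF p, of "u + v" "of_nat p * t"] alg by auto
  define r u1 v1 where "r = (of_nat p * t) ^ (p - 1)" and "u1 = x ^ (p ^ a - 1)" and "v1 = y ^ (p ^ a - 1)"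
  have "p ^ a > 0" using p0 by simp
  then have XX: "u = x * u1" and YY: "v = y * v1"
    using power_minus_mult[of "p ^ a" x] power_minus_mult[of "p ^ a" y]
    by (simp_all add: u_def v_def u1_def v1_def mult.commute)
  have alg': "algebraic_int r" "algebraic_int u1" "algebraic_int v1"
    using alg x y by (auto simp: r_def u1_def v1_def)
  have pt: "(of_nat p * t) ^ p = of_nat p * t * r"
    using p0 power_minus_mult[of p "of_nat p * t"] by (simp add: r_def mult.commute)
  have e1: "of_nat p * u * v * w1 = of_nat p * x * y * (u1 * v1 * w1)"
    by (simp add: XX YY mult_ac)
  have e2: "of_nat p * t * r = of_nat p * x * y * (w * r)"
    by (simp add: t_def mult_ac)
  have e3: "of_nat p * (u + v) * (of_nat p * t) * w2 = of_nat p * x * y * ((u + v) * of_nat p * w * w2)"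
    by (simp add: t_def mult_ac)
  have "(x + y) ^ (p ^ a) = u + v + of_nat p * t"
    using w(2) by (simp add: u_def v_def t_def mult.assoc)
  then have "(x + y) ^ (p ^ Suc a) = ((u + v) + of_nat p * t) ^ p"
    by (metis power_Suc2 power_mult)
  also have "\<dots> = u ^ p + v ^ p + of_nat p * u * v * w1 + of_nat p * t * r
       + of_nat p * (u + v) * (of_nat p * t) * w2"
    by (simp only: w2(2) w1(2) pt)
  also have "\<dots> = u ^ p + v ^ p + of_nat p * x * y * (u1 * v1 * w1 + w * r + (u + v) * of_nat p * w * w2)"
    unfolding e1 e2 e3 by (simp only: distrib_left add.assoc)
  also have "u ^ p = x ^ (p ^ Suc a)"
    unfolding u_def by (metis power_Suc2 power_mult)
  also have "v ^ p = y ^ (p ^ Suc a)"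
    unfolding v_def by (metis power_Suc2 power_mult)
  finally have "(x + y) ^ (p ^ Suc a) = x ^ (p ^ Suc a) + y ^ (p ^ Suc a)
      + of_nat p * x * y * (u1 * v1 * w1 + w * r + (u + v) * of_nat p * w * w2)" .
  moreover have "algebraic_int (u1 * v1 * w1 + w * r + (u + v) * of_nat p * w * w2)"
    using alg alg' w w1 w2 by (intro algebraic_int_add algebraic_int_mult) auto
  ultimately show ?case by blast
qed

lemma frobenius_add:
  assumes "Factorial_Ring.prime (p::nat)" "algebraic_int x" "algebraic_int y"
  shows "of_nat p advd ((x + y) ^ (p ^ a) - (x ^ (p ^ a) + y ^ (p ^ a)))"
proof -
  obtain w where "algebraic_int w" "(x + y) ^ (p ^ a) = x ^ (p ^ a) + y ^ (p ^ a) + of_nat p * x * y * w"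
    using frobenius_prime_power[OF assms] by blast
  then show ?thesis using assms by (intro advdI[of "x * y * w"]) auto
qed

text \<open>This is \<open>frobenius_prime\<close> for the pair \<open>x - y\<close>,
  \<open>y\<close>. As the error retains \<open>x - y\<close>, the left side is \<open>x - y\<close>
  times a cofactor congruent to \<open>(x - y) ^ (p - 1)\<close> modulo \<open>p\<close>.\<close>

lemma frobenius_diff_explicit:
  fixes x y :: complex
  assumes "Factorial_Ring.prime (p::nat)" "algebraic_int x" "algebraic_int y"
  shows "\<exists>w. algebraic_int w \<and> x ^ p - y ^ p = (x - y) ^ p + of_nat p * (x - y) * w"
proof -
  obtain w where w: "algebraic_int w" "((x - y) + y) ^ p = (x - y) ^ p + y ^ p + of_nat p * (x - y) * y * w"
    using frobenius_prime[OF assms(1), of "x - y" y] assms by blast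
  then show ?thesis using assms by (intro exI[of _ "y * w"]) (auto simp: mult_ac)
qed

lemma frobenius_diff:
  assumes "Factorial_Ring.prime (p::nat)" "algebraic_int x" "algebraic_int y"
  shows "of_nat p advd ((x - y) ^ (p ^ a) - (x ^ (p ^ a) - y ^ (p ^ a)))"
  using advd_minus[OF frobenius_add[OF assms(1), of "x - y" y a]] assms by (simp add: algebra_simps algebraic_int_diff)

lemma frobenius_sum:
  assumes p: "Factorial_Ring.prime (p::nat)" and "\<And>i. i \<in> A \<Longrightarrow> algebraic_int (g i)"
  shows "of_nat p advd ((\<Sum>i\<in>A. g i) ^ (p ^ a) - (\<Sum>i\<in>A. g i ^ (p ^ a)))"
  using assms(2)
proof (induction A rule: infinite_finite_induct)
  case (insert i A)
  have "of_nat p advd ((g i + sum g A) ^ (p ^ a) - (g i ^ (p ^ a) + sum g A ^ (p ^ a)))"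
    using insert by (intro frobenius_add p) auto
  moreover have "of_nat p advd (sum g A ^ (p ^ a) - (\<Sum>i\<in>A. g i ^ (p ^ a)))" using insert by auto
  ultimately have "of_nat p advd (((g i + sum g A) ^ (p ^ a) - (g i ^ (p ^ a) + sum g A ^ (p ^ a)))
       + (sum g A ^ (p ^ a) - (\<Sum>i\<in>A. g i ^ (p ^ a))))" by (rule advd_add)
  then show ?case using insert by (simp add: algebra_simps)
qed (use p prime_gt_0_nat in \<open>auto simp: zero_power\<close>)

section \<open>Rational polynomials at complex numbers, and algebraic numbers\<close>

definition rp :: "rat poly \<Rightarrow> complex \<Rightarrow> complex" where
  "rp h x = poly (map_poly of_rat h) x"

lemma map_poly_of_rat_add: "map_poly of_rat (p + q) = (map_poly of_rat p + map_poly of_rat q :: complex poly)"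
  by (rule poly_eqI) (simp add: coeff_map_poly of_rat_add)
lemma map_poly_of_rat_smult: "map_poly of_rat (Polynomial.smult c q) = (Polynomial.smult (of_rat c) (map_poly of_rat q) :: complex poly)"
  by (rule poly_eqI) (simp add: coeff_map_poly of_rat_mult)

lemma rp_0 [simp]: "rp 0 x = 0" by (simp add: rp_def)
lemma rp_pCons [simp]: "rp (pCons a p) x = of_rat a + x * rp p x"
  by (simp add: rp_def of_rat_hom.map_poly_pCons_hom)
lemma rp_1 [simp]: "rp 1 x = 1" by (simp add: one_pCons)
lemma rp_add [simp]: "rp (p + q) x = rp p x + rp q x"
  by (simp add: rp_def map_poly_of_rat_add)
lemma rp_smult [simp]: "rp (Polynomial.smult c q) x = of_rat c * rp q x"
  by (simp add: rp_def map_poly_of_rat_smult)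
lemma rp_uminus [simp]: "rp (- p) x = - rp p x"
  using rp_smult[of "-1" p x] by (simp add: of_rat_minus)
lemma rp_diff [simp]: "rp (p - q) x = rp p x - rp q x"
  using rp_add[of p "- q" x] by simp
lemma rp_mult [simp]: "rp (p * q) x = rp p x * rp q x"
  by (induction p) (simp_all add: algebra_simps)
lemma rp_pcompose [simp]: "rp (pcompose p q) x = rp p (rp q x)"
  by (induction p) (simp_all add: pcompose_pCons)
lemma rp_sum [simp]: "rp (sum g A) x = (\<Sum>i\<in>A. rp (g i) x)"
  by (induction A rule: infinite_finite_induct) simp_all
lemma coeff_map_poly_of_rat: "Polynomial.coeff (map_poly of_rat h) i = of_rat (Polynomial.coeff h i)"
  by (simp add: coeff_map_poly)

lemma map_poly_of_rat_eq_0_iff: "map_poly of_rat h = (0 :: complex poly) \<longleftrightarrow> h = 0"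
  by (metis coeff_0 coeff_map_poly_of_rat of_rat_eq_0_iff poly_eqI)

lemma rats_coeffs_rat_poly:
  fixes P :: "complex poly"
  assumes "\<And>i. Polynomial.coeff P i \<in> \<rat>"
  shows "\<exists>h. map_poly of_rat h = P"
proof -
  have "\<exists>f. \<forall>i. Polynomial.coeff P i = of_rat (f i)"
    using assms unfolding Rats_def by (intro choice) auto
  then obtain f where f: "\<And>i. Polynomial.coeff P i = of_rat (f i)" by blast
  have "Polynomial.coeff (Abs_poly f) = f"
  proof (rule coeff_Abs_poly)
    fix i assume "i > Polynomial.degree P"
    then have "of_rat (f i) = (0::complex)" using f[of i] by (simp add: coeff_eq_0)
    then show "f i = 0" by simp
  qed
  then show ?thesis
    by (intro exI[of _ "Abs_poly f"] poly_eqI) (simp add: coeff_map_poly_of_rat f)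
qed

lemma algebraic_iff_rp: "algebraic x \<longleftrightarrow> (\<exists>h. h \<noteq> 0 \<and> rp h x = 0)"
proof
  assume "algebraic x"
  then obtain P where P: "\<And>i. Polynomial.coeff P i \<in> \<rat>" "P \<noteq> 0" "poly P x = 0"
    unfolding algebraic_altdef by blast
  obtain h where h: "map_poly of_rat h = P" using rats_coeffs_rat_poly P(1) by blast
  then have "h \<noteq> 0" "rp h x = 0" using P by (auto simp: rp_def)
  then show "\<exists>h. h \<noteq> 0 \<and> rp h x = 0" by blast
next
  assume "\<exists>h. h \<noteq> 0 \<and> rp h x = 0"
  then obtain h where h: "h \<noteq> 0" "rp h x = 0" by blast
  have "Polynomial.coeff (map_poly of_rat h :: complex poly) i \<in> \<rat>" for i
    by (simp add: coeff_map_poly_of_rat)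
  then show "algebraic x"
    unfolding algebraic_altdef using h map_poly_of_rat_eq_0_iff[of h]
    by (intro exI[of _ "map_poly of_rat h"]) (simp add: rp_def)
qed

lemma algebraic_scaled_int:
  fixes x :: complex
  assumes "algebraic x"
  obtains n :: nat where "n > 0" "algebraic_int (of_nat n * x)"
proof -
  obtain P where P: "\<And>i. Polynomial.coeff P i \<in> \<int>" "P \<noteq> 0" "poly P x = 0"
    using assms by (elim algebraicE) blast
  define n where "n = Polynomial.degree P"
  define a where "a = lead_coeff P"
  have a0: "a \<noteq> 0" using P by (auto simp: a_def)
  define E where "E = (\<lambda>i. a ^ i * x ^ i) ` {..<n}"
  have npos: "n > 0"
  proof (rule ccontr)
    assume "\<not> n > 0"
    then obtain c where "P = [:c:]" using n_def degree_eq_zeroE[of P] by auto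
    then show False using P by simp
  qed
  obtain d where d: "\<And>i. Polynomial.coeff P i = of_int (d i)"
    using choice[of "\<lambda>i k. Polynomial.coeff P i = of_int k"] P(1) by (auto simp: Ints_def)
  have ad: "a = of_int (d n)" using d by (simp add: a_def n_def)
  have fin: "finite E" by (simp add: E_def)
  have mem: "a ^ i * x ^ i \<in> zspan E" if "i < n" for i
    by (rule zspan_superset[OF fin]) (use that in \<open>simp add: E_def\<close>)
  have st: "(a * x) * e \<in> zspan E" if e: "e \<in> E" for e
  proof -
    obtain i where i: "i < n" "e = a ^ i * x ^ i" using e by (auto simp: E_def)
    show ?thesis
    proof (cases "Suc i < n")
      case True
      then show ?thesis using mem[of "Suc i"] i by (simp add: mult_ac)
    next
      case False
      then have ni: "n = Suc i" using i by simp
      have "poly P x = (\<Sum>k<n. Polynomial.coeff P k * x ^ k) + a * x ^ n"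
        unfolding poly_altdef n_def a_def by (simp flip: lessThan_Suc_atMost)
      then have s: "a * x ^ n = - (\<Sum>k<n. of_int (d k) * x ^ k)"
        using P(3) by (simp add: d eq_neg_iff_add_eq_0 add.commute)
      \<comment> \<open>Here \<open>a * x ^ n\<close> is the top term of the equation of
        \<open>x\<close>; the remaining \<open>a ^ i\<close> supplies the \<open>a ^ k\<close> that
        each lower monomial of \<open>E\<close> carries.\<close>
      have "(a * x) * e = a ^ i * (a * x ^ n)" by (simp add: i ni mult_ac)
      also have "\<dots> = (\<Sum>k<n. of_int (- d k * d n ^ (i - k)) * (a ^ k * x ^ k))"
        unfolding s sum_negf[symmetric] sum_distrib_left
      proof (rule sum.cong[OF refl])
        fix k assume "k \<in> {..<n}"
        then have "a ^ i = a ^ k * a ^ (i - k)" using ni by (simp flip: power_add)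
        then show "a ^ i * - (of_int (d k) * x ^ k) = of_int (- d k * d n ^ (i - k)) * (a ^ k * x ^ k)"
          by (simp add: ad mult_ac)
      qed
      also have "\<dots> \<in> zspan E" by (rule zspan_sum) (use mem in simp)
      finally show ?thesis .
    qed
  qed
  have "1 \<in> E" unfolding E_def by (rule image_eqI[of _ _ 0]) (simp_all add: npos)
  then have "algebraic_int (a * x)"
    by (intro algebraic_int_if_zspan_stable[OF fin _ st]) (auto intro!: bexI[of _ 1])
  then have "algebraic_int (of_int \<bar>d n\<bar> * x)"
    unfolding ad by (cases "d n \<ge> 0") simp_all
  then have "algebraic_int (of_nat (nat \<bar>d n\<bar>) * x)" by simp
  moreover have "nat \<bar>d n\<bar> > 0" using a0 ad by auto
  ultimately show ?thesis using that by blast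
qed

lemma algebraic_of_scaled_int:
  fixes x :: complex
  assumes "n > 0" "algebraic_int (of_nat n * x)"
  shows "algebraic x"
proof -
  have "algebraic (of_nat n * x)" using assms(2) by (rule algebraic_int_imp_algebraic)
  then obtain h where h: "h \<noteq> 0" "rp h (of_nat n * x) = 0" unfolding algebraic_iff_rp by blast
  have "pcompose h [:0, of_nat n:] \<noteq> 0"
    using h(1) assms(1) by (simp add: pcompose_eq_0_iff)
  moreover have "rp (pcompose h [:0, of_nat n:]) x = 0" using h(2) by (simp add: mult.commute)
  ultimately show ?thesis unfolding algebraic_iff_rp by blast
qed

lemma algebraic_add_nat_mult:
  fixes x y :: complex
  assumes "algebraic x" "algebraic y"
  shows "algebraic (x + of_nat t * y)"
proof -
  obtain n where n: "n > 0" "algebraic_int (of_nat n * x)" using algebraic_scaled_int[OF assms(1)] by blast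
  obtain k where k: "k > 0" "algebraic_int (of_nat k * y)" using algebraic_scaled_int[OF assms(2)] by blast
  have "algebraic_int (of_nat k * (of_nat n * x) + of_nat (n * t) * (of_nat k * y))"
    by (rule algebraic_int_add[OF algebraic_int_mult[OF algebraic_int_of_nat' n(2)] algebraic_int_mult[OF algebraic_int_of_nat' k(2)]])
  also have "of_nat k * (of_nat n * x) + of_nat (n * t) * (of_nat k * y) = of_nat (n * k) * (x + of_nat t * y)"
    by (simp add: algebra_simps)
  finally show ?thesis using n k by (intro algebraic_of_scaled_int[of "n * k"]) auto
qed

subsection \<open>Minimal polynomials\<close>

lemma minpoly_exists:
  assumes "algebraic x"
  obtains m where "m \<noteq> 0" "rp m x = 0" "\<And>h. rp h x = 0 \<Longrightarrow> m dvd h"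
proof -
  obtain h0 where "h0 \<noteq> 0 \<and> rp h0 x = 0" using assms unfolding algebraic_iff_rp by blast
  then obtain m where m: "m \<noteq> 0 \<and> rp m x = 0"
    and least: "\<And>h. h \<noteq> 0 \<and> rp h x = 0 \<Longrightarrow> Polynomial.degree m \<le> Polynomial.degree h"
    using ex_has_least_nat[of "\<lambda>h. h \<noteq> 0 \<and> rp h x = 0" h0 Polynomial.degree] by blast
  have "m dvd h" if "rp h x = 0" for h
  proof -
    have "h = h div m * m + h mod m" by simp
    then have "rp h x = rp (h div m) x * rp m x + rp (h mod m) x" by (metis rp_add rp_mult)
    then have "rp (h mod m) x = 0" using that m by simp
    moreover have "h mod m = 0 \<or> Polynomial.degree (h mod m) < Polynomial.degree m"
      using m degree_mod_less by blast
    ultimately have "h mod m = 0" using least[of "h mod m"] by force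
    then show ?thesis by (simp add: mod_eq_0_iff_dvd)
  qed
  then show ?thesis using that m by blast
qed

text \<open>Fixed only up to a nonzero rational factor; its degree, its roots and divisibility by it
  do not depend on that factor.\<close>

definition minpoly :: "complex \<Rightarrow> rat poly" where
  "minpoly x = (SOME m. m \<noteq> 0 \<and> rp m x = 0 \<and> (\<forall>h. rp h x = 0 \<longrightarrow> m dvd h))"

lemma minpoly:
  assumes "algebraic x"
  shows "minpoly x \<noteq> 0" "rp (minpoly x) x = 0" "rp h x = 0 \<longleftrightarrow> minpoly x dvd h"
proof -
  have "\<exists>m. m \<noteq> 0 \<and> rp m x = 0 \<and> (\<forall>h. rp h x = 0 \<longrightarrow> m dvd h)"
    using minpoly_exists[OF assms] by metis
  then have *: "minpoly x \<noteq> 0 \<and> rp (minpoly x) x = 0 \<and> (\<forall>h. rp h x = 0 \<longrightarrow> minpoly x dvd h)"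
    unfolding minpoly_def by (rule someI_ex)
  then show "minpoly x \<noteq> 0" "rp (minpoly x) x = 0" by auto
  show "rp h x = 0 \<longleftrightarrow> minpoly x dvd h"
    using * by (auto elim!: dvdE)
qed

lemma rat_poly_bezout:
  fixes p q :: "rat poly"
  obtains u v where "u * p + v * q = gcd p q"
  using bezout_coefficients_fst_snd[of p q] by blast

lemma rp_degree_0: "Polynomial.degree h = 0 \<Longrightarrow> h \<noteq> 0 \<Longrightarrow> rp h x \<noteq> 0"
  by (elim degree_eq_zeroE) auto

text \<open>Irreducibility in disguise: \<open>m\<close> is \<open>gcd m h\<close> times
  \<open>k\<close>, and one factor vanishes at \<open>x\<close>. If it is the gcd, \<open>m\<close>
  divides \<open>h\<close>; if it is \<open>k\<close>, the degree of \<open>k\<close> leaves only a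
  constant gcd, which cannot vanish at \<open>y\<close>.\<close>

lemma minpoly_conjugate:
  assumes x: "algebraic x" and y: "rp (minpoly x) y = 0"
  shows "rp h y = 0 \<longleftrightarrow> minpoly x dvd h"
proof
  assume h: "rp h y = 0"
  define m where "m = minpoly x"
  note m = minpoly[OF x, folded m_def]
  obtain u v where uv: "u * m + v * h = gcd m h" by (rule rat_poly_bezout)
  have "rp (gcd m h) y = rp u y * rp m y + rp v y * rp h y" by (simp flip: uv)
  then have gy: "rp (gcd m h) y = 0" using y h by (simp add: m_def)
  obtain k where k: "m = gcd m h * k" by (meson dvdE gcd_dvd1)
  have "rp (gcd m h) x * rp k x = 0" using m(2) k by (metis rp_mult)
  then consider "rp (gcd m h) x = 0" | "rp k x = 0" by auto
  then show "minpoly x dvd h"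
  proof cases
    case 1
    then show ?thesis using m(3) gcd_dvd2 dvd_trans unfolding m_def by blast
  next
    case 2
    then have "m dvd k" using m(3) by blast
    moreover have k0: "k \<noteq> 0" "gcd m h \<noteq> 0" using k m(1) by auto
    ultimately have "Polynomial.degree m \<le> Polynomial.degree k" by (intro dvd_imp_degree_le)
    moreover have "Polynomial.degree m = Polynomial.degree (gcd m h) + Polynomial.degree k"
      using k k0 by (metis degree_mult_eq)
    ultimately have "Polynomial.degree (gcd m h) = 0" by simp
    then show ?thesis using rp_degree_0 k0 gy by blast
  qed
qed (use y in \<open>auto elim!: dvdE\<close>)

lemma minpoly_conjugate_eq_0:
  assumes x: "algebraic x" and y: "rp (minpoly x) y = 0"
  shows "rp h y = 0 \<longleftrightarrow> rp h x = 0"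
  using minpoly_conjugate[OF assms] minpoly(3)[OF x] by blast

lemma degree_minpoly_pos: "algebraic x \<Longrightarrow> Polynomial.degree (minpoly x) > 0"
  using rp_degree_0[of "minpoly x" x] minpoly(1,2)[of x] by blast

lemma map_poly_pderiv: "pderiv (map_poly of_rat h :: complex poly) = map_poly of_rat (pderiv h)"
  by (rule poly_eqI) (simp add: coeff_pderiv coeff_map_poly of_rat_mult of_rat_add)

lemma minpoly_simple_root:
  assumes x: "algebraic x" and y: "rp (minpoly x) y = 0"
  shows "rp (pderiv (minpoly x)) y \<noteq> 0"
proof
  assume "rp (pderiv (minpoly x)) y = 0"
  then have "minpoly x dvd pderiv (minpoly x)" using minpoly_conjugate[OF x y] by blast
  then show False using degree_minpoly_pos[OF x] by simp
qed

lemma card_roots_minpoly: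
  assumes x: "algebraic x"
  shows "finite {y. rp (minpoly x) y = 0}" "card {y. rp (minpoly x) y = 0} = Polynomial.degree (minpoly x)"
proof -
  define P where "P = (map_poly of_rat (minpoly x) :: complex poly)"
  have P0: "P \<noteq> 0" using minpoly(1)[OF x] by (simp add: P_def map_poly_of_rat_eq_0_iff)
  have eq: "{y. rp (minpoly x) y = 0} = {y. poly P y = 0}" by (simp add: P_def rp_def)
  show fin: "finite {y. rp (minpoly x) y = 0}" unfolding eq using P0 by (rule poly_roots_finite)
  have "rsquarefree P"
    unfolding rsquarefree_roots
  proof (intro allI notI)
    fix a assume a: "poly P a = 0 \<and> poly (pderiv P) a = 0"
    then have "rp (minpoly x) a = 0" "rp (pderiv (minpoly x)) a = 0"
      by (auto simp: P_def rp_def map_poly_pderiv)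
    then show False using minpoly_simple_root[OF x] by blast
  qed
  then have "Polynomial.smult (lead_coeff P) (\<Prod>z | poly P z = 0. [:- z, 1:]) = P"
    by (rule complex_poly_decompose_rsquarefree)
  then have "Polynomial.degree P = Polynomial.degree (\<Prod>z | poly P z = 0. [:- z, 1:])"
    by (metis P0 degree_smult_eq smult_eq_0_iff)
  also have "\<dots> = card {z. poly P z = 0}"
    by (subst degree_prod_sum_eq) auto
  finally show "card {y. rp (minpoly x) y = 0} = Polynomial.degree (minpoly x)"
    unfolding eq by (simp add: P_def degree_map_poly)
qed

subsection \<open>Subfields of the complex numbers\<close>

text \<open>Since \<open>inverse 0 = 0\<close>, closure under inverses can be stated without
  excluding \<open>0\<close>.\<close>

definition subfld :: "complex set \<Rightarrow> bool" where
  "subfld E \<longleftrightarrow> 1 \<in> E \<and> (\<forall>x\<in>E. \<forall>y\<in>E. x - y \<in> E \<and> x * y \<in> E) \<and> (\<forall>x\<in>E. inverse x \<in> E)"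

lemma subfldD:
  assumes "subfld E"
  shows "1 \<in> E" "0 \<in> E" "x \<in> E \<Longrightarrow> y \<in> E \<Longrightarrow> x - y \<in> E" "x \<in> E \<Longrightarrow> y \<in> E \<Longrightarrow> x * y \<in> E"
    "x \<in> E \<Longrightarrow> inverse x \<in> E" "x \<in> E \<Longrightarrow> - x \<in> E" "x \<in> E \<Longrightarrow> y \<in> E \<Longrightarrow> x + y \<in> E"
    "x \<in> E \<Longrightarrow> y \<in> E \<Longrightarrow> x / y \<in> E" "x \<in> E \<Longrightarrow> x ^ n \<in> E"
proof -
  show 1: "1 \<in> E" "x \<in> E \<Longrightarrow> y \<in> E \<Longrightarrow> x - y \<in> E" "x \<in> E \<Longrightarrow> y \<in> E \<Longrightarrow> x * y \<in> E"
    "x \<in> E \<Longrightarrow> inverse x \<in> E" for x y using assms by (auto simp: subfld_def)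
  show 0: "0 \<in> E" using 1(1) 1(2)[of 1 1] by simp
  show m: "x \<in> E \<Longrightarrow> - x \<in> E" for x using 1(2)[of 0 x] 0 by simp
  show "x \<in> E \<Longrightarrow> y \<in> E \<Longrightarrow> x + y \<in> E" using 1(2)[of x "- y"] m by simp
  show "x \<in> E \<Longrightarrow> y \<in> E \<Longrightarrow> x / y \<in> E" using 1(3)[of x "inverse y"] 1(4) by (simp add: divide_inverse)
  show "x \<in> E \<Longrightarrow> x ^ n \<in> E" by (induction n) (simp_all add: 1)
qed

lemma subfld_of_nat: "subfld E \<Longrightarrow> of_nat n \<in> E"
  by (induction n) (simp_all add: subfldD)
lemma subfld_of_int: "subfld E \<Longrightarrow> of_int n \<in> E"
  by (cases n rule: int_cases2) (simp_all add: subfld_of_nat subfldD)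
lemma subfld_of_rat: "subfld E \<Longrightarrow> of_rat r \<in> E"
  by (cases r) (simp add: of_rat_rat subfld_of_int subfldD)
lemma subfld_rp: "subfld E \<Longrightarrow> x \<in> E \<Longrightarrow> rp h x \<in> E"
  by (induction h) (simp_all add: subfld_of_rat subfldD)
lemma subfld_sum: "subfld E \<Longrightarrow> (\<And>i. i \<in> A \<Longrightarrow> g i \<in> E) \<Longrightarrow> sum g A \<in> E"
  by (induction A rule: infinite_finite_induct) (simp_all add: subfldD)
lemma subfld_prod: "subfld E \<Longrightarrow> (\<And>i. i \<in> A \<Longrightarrow> g i \<in> E) \<Longrightarrow> prod g A \<in> E"
  by (induction A rule: infinite_finite_induct) (simp_all add: subfldD)

text \<open>The rational polynomials in an algebraic \<open>x\<close> already form a field: Bezout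
  coefficients for the minimal polynomial and \<open>h\<close> invert \<open>rp h x\<close>.\<close>

lemma subfld_range_rp:
  assumes x: "algebraic x" shows "subfld (range (\<lambda>h. rp h x))"
  unfolding subfld_def
proof (intro conjI ballI)
  show "1 \<in> range (\<lambda>h. rp h x)" by (rule image_eqI[of _ _ 1]) simp_all
next
  fix y z assume "y \<in> range (\<lambda>h. rp h x)" "z \<in> range (\<lambda>h. rp h x)"
  then obtain h k where "y = rp h x" "z = rp k x" by blast
  then show "y - z \<in> range (\<lambda>h. rp h x)" "y * z \<in> range (\<lambda>h. rp h x)"
    by (simp_all flip: rp_diff rp_mult)
next
  fix y assume "y \<in> range (\<lambda>h. rp h x)"
  then obtain h where h: "y = rp h x" by blast
  show "inverse y \<in> range (\<lambda>h. rp h x)"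
  proof (cases "y = 0")
    case True
    then show ?thesis by (intro image_eqI[of _ _ 0]) simp_all
  next
    case False
    define m where "m = minpoly x"
    note m = minpoly[OF x, folded m_def]
    obtain u v where uv: "u * m + v * h = gcd m h" by (rule rat_poly_bezout)
    have e: "rp (gcd m h) x = rp v x * y" using m(2) by (simp flip: uv add: h)
    obtain k where k: "m = gcd m h * k" by (meson dvdE gcd_dvd1)
    have k0: "k \<noteq> 0" "gcd m h \<noteq> 0" using k m(1) by auto
    have "rp (gcd m h) x * rp k x = 0" using m(2) k by (metis rp_mult)
    moreover have "rp (gcd m h) x \<noteq> 0"
    proof
      assume "rp (gcd m h) x = 0"
      then have "m dvd h" using m(3) gcd_dvd2 dvd_trans by blast
      then show False using m(3) False h by blast
    qed
    ultimately have "m dvd k" using m(3) by simp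
    then have "Polynomial.degree m \<le> Polynomial.degree k" using k0 by (intro dvd_imp_degree_le)
    moreover have "Polynomial.degree m = Polynomial.degree (gcd m h) + Polynomial.degree k"
      using k k0 by (metis degree_mult_eq)
    ultimately have "Polynomial.degree (gcd m h) = 0" by simp
    then obtain c where c: "gcd m h = [:c:]" by (elim degree_eq_zeroE)
    then have "rp v x * y = of_rat c" using e by simp
    moreover have "c \<noteq> 0" using c k0 by auto
    ultimately have "inverse y = rp (Polynomial.smult (inverse c) v) x"
      using False by (simp add: of_rat_inverse of_rat_divide field_simps)
    then show ?thesis by blast
  qed
qed

subsection \<open>The primitive element theorem\<close>

text \<open>A polynomial over \<open>E\<close> is a complex polynomial with coefficients in
  \<open>E\<close>, so long division is repeated to see that the remainder stays over
  \<open>E\<close>.\<close>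

lemma subfld_poly_division:
  fixes d P :: "complex poly"
  assumes E: "subfld E" and d: "d \<noteq> 0" "\<And>i. Polynomial.coeff d i \<in> E"
    and P: "\<And>i. Polynomial.coeff P i \<in> E"
  shows "\<exists>q. (\<forall>i. Polynomial.coeff (P - d * q) i \<in> E) \<and> (P - d * q = 0 \<or> Polynomial.degree (P - d * q) < Polynomial.degree d)"
  using P
proof (induction "Polynomial.degree P" arbitrary: P rule: less_induct)
  case (less P)
  show ?case
  proof (cases "P = 0 \<or> Polynomial.degree P < Polynomial.degree d")
    case True
    then show ?thesis using less.prems by (intro exI[of _ 0]) simp
  next
    case False
    define c where "c = lead_coeff P / lead_coeff d"
    define k where "k = Polynomial.degree P - Polynomial.degree d"
    define t where "t = Polynomial.monom c k"
    define P' where "P' = P - d * t"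
    have cE: "c \<in> E" unfolding c_def using less.prems d by (intro subfldD[OF E]) auto
    have coeff_dt: "Polynomial.coeff (d * t) i = (if k \<le> i then c * Polynomial.coeff d (i - k) else 0)" for i
      by (simp add: t_def coeff_monom_mult mult.commute[of d])
    have P'E: "Polynomial.coeff P' i \<in> E" for i
      using less.prems[of i] d(2)[of "i - k"] cE subfldD(2-4)[OF E] by (simp add: P'_def coeff_dt)
    have "Polynomial.degree (d * t) \<le> Polynomial.degree P"
      using False d by (intro order.trans[OF degree_mult_le]) (simp add: t_def k_def order.trans[OF add_left_mono[OF degree_monom_le]])
    then have "Polynomial.degree P' \<le> Polynomial.degree P"
      unfolding P'_def by (intro degree_diff_le) auto
    moreover have "Polynomial.coeff P' (Polynomial.degree P) = 0"
      using False d by (simp add: P'_def coeff_dt k_def c_def)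
    ultimately have "P' = 0 \<or> Polynomial.degree P' < Polynomial.degree P"
      by (rule eq_zero_or_degree_less)
    then show ?thesis
    proof
      assume "P' = 0"
      then show ?thesis using P'E by (intro exI[of _ t]) (simp add: P'_def)
    next
      assume "Polynomial.degree P' < Polynomial.degree P"
      then obtain q where q: "\<forall>i. Polynomial.coeff (P' - d * q) i \<in> E"
        "P' - d * q = 0 \<or> Polynomial.degree (P' - d * q) < Polynomial.degree d"
        using less.hyps P'E by blast
      have "P' - d * q = P - d * (t + q)" by (simp add: P'_def algebra_simps)
      then show ?thesis using q by metis
    qed
  qed
qed

text \<open>A polynomial \<open>d\<close> of least degree over \<open>E\<close> vanishing at
  \<open>\<beta>\<close> divides \<open>A\<close> and \<open>B\<close>. Its roots are common roots,
  so all equal \<open>\<beta>\<close>, and a double root would contradict simplicity in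
  \<open>B\<close>. Hence \<open>d\<close> is linear.\<close>

lemma unique_common_root_in_subfld:
  fixes A B :: "complex poly"
  assumes E: "subfld E" and A: "\<And>i. Polynomial.coeff A i \<in> E" and B: "\<And>i. Polynomial.coeff B i \<in> E"
    and B0: "B \<noteq> 0" and rA: "poly A \<beta> = 0" and rB: "poly B \<beta> = 0" and simple: "poly (pderiv B) \<beta> \<noteq> 0"
    and uniq: "\<And>y. poly A y = 0 \<Longrightarrow> poly B y = 0 \<Longrightarrow> y = \<beta>"
  shows "\<beta> \<in> E"
proof -
  define Q where "Q d \<longleftrightarrow> d \<noteq> 0 \<and> (\<forall>i. Polynomial.coeff d i \<in> E) \<and> poly d \<beta> = 0" for d
  have "Q B" using B B0 rB by (simp add: Q_def)
  then obtain d where d: "Q d" and least: "\<And>h. Q h \<Longrightarrow> Polynomial.degree d \<le> Polynomial.degree h"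
    using ex_has_least_nat[of Q B Polynomial.degree] by blast
  have dvd: "d dvd P" if P: "\<And>i. Polynomial.coeff P i \<in> E" "poly P \<beta> = 0" for P
  proof -
    obtain q where q: "\<forall>i. Polynomial.coeff (P - d * q) i \<in> E"
        "P - d * q = 0 \<or> Polynomial.degree (P - d * q) < Polynomial.degree d"
      using subfld_poly_division[OF E, of d P] d P(1) by (auto simp: Q_def)
    have "P - d * q = 0"
    proof (rule ccontr)
      assume n: "P - d * q \<noteq> 0"
      then have "Q (P - d * q)" using q P d by (simp add: Q_def)
      then show False using least[of "P - d * q"] q n by simp
    qed
    then have "P = d * q" by simp
    then show ?thesis by simp
  qed
  have dA: "d dvd A" and dB: "d dvd B" using dvd[OF A rA] dvd[OF B rB] by simp_all
  have "[:- \<beta>, 1:] dvd d" using d by (simp add: Q_def poly_eq_0_iff_dvd)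
  then obtain d1 where d1: "d = [:- \<beta>, 1:] * d1" by (elim dvdE)
  have "d1 \<noteq> 0" using d d1 by (auto simp: Q_def)
  have "Polynomial.degree d1 = 0"
  proof (rule ccontr)
    assume "Polynomial.degree d1 \<noteq> 0"
    then obtain y where y: "poly d1 y = 0" using alg_closed_imp_poly_has_root[of d1] by auto
    then have "poly d y = 0" using d1 by simp
    then have "poly A y = 0" "poly B y = 0" using dA dB by (auto elim!: dvdE)
    then have "y = \<beta>" by (rule uniq)
    then have "[:- \<beta>, 1:] dvd d1" using y by (simp add: poly_eq_0_iff_dvd)
    then obtain d2 where d2: "d1 = [:- \<beta>, 1:] * d2" by (elim dvdE)
    obtain k where k: "B = d * k" using dB by (elim dvdE)
    have "B = [:- \<beta>, 1:] * ([:- \<beta>, 1:] * (d2 * k))" by (simp only: k d1 d2 mult.assoc)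
    then have "poly (pderiv B) \<beta> = 0" by (simp only: pderiv_mult poly_add poly_mult) simp
    then show False using simple by blast
  qed
  then obtain c where c: "d1 = [:c:]" by (elim degree_eq_zeroE)
  have c0: "c \<noteq> 0" using c \<open>d1 \<noteq> 0\<close> by auto
  have "d = [:- \<beta> * c, c:]" using d1 c by simp
  then have "Polynomial.coeff d 0 = - \<beta> * c" "Polynomial.coeff d 1 = c" by simp_all
  moreover have "Polynomial.coeff d 0 \<in> E" "Polynomial.coeff d 1 \<in> E" using d by (simp_all add: Q_def)
  ultimately have "- \<beta> * c \<in> E" "c \<in> E" by simp_all
  then have "- ((- \<beta> * c) / c) \<in> E" by (intro subfldD(6,8)[OF E])
  also have "- ((- \<beta> * c) / c) = \<beta>" using c0 by simp
  finally show ?thesis .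
qed

lemma subfld_coeff_mult:
  assumes E: "subfld E" and "\<And>i. Polynomial.coeff p i \<in> E" "\<And>i. Polynomial.coeff q i \<in> E"
  shows "Polynomial.coeff (p * q) i \<in> E"
  unfolding coeff_mult by (intro subfld_sum[OF E] subfldD(4)[OF E] assms(2,3))

lemma subfld_coeff_pcompose:
  assumes E: "subfld E" and p: "\<And>i. Polynomial.coeff p i \<in> E" and q: "\<And>i. Polynomial.coeff q i \<in> E"
  shows "Polynomial.coeff (pcompose p q) i \<in> E"
  using p
proof (induction p arbitrary: i)
  case 0
  then show ?case using subfldD(2)[OF E] by simp
next
  case (pCons a p)
  have p: "Polynomial.coeff p j \<in> E" for j using pCons.prems[of "Suc j"] by simp
  have a: "a \<in> E" using pCons.prems[of 0] by simp
  have "Polynomial.coeff [:a:] i \<in> E" using a subfldD(2)[OF E] by (cases i) simp_all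
  then show ?case
    using subfld_coeff_mult[OF E q, of "pcompose p q"] pCons.IH[OF p]
    by (simp add: pcompose_pCons subfldD(7)[OF E] del: coeff_pCons_0)
qed

text \<open>For all \<open>t\<close> outside the finite set \<open>S\<close>, \<open>\<beta>\<close>
  is the only common root of its own minimal polynomial and of that of \<open>\<alpha>\<close>
  composed with \<open>g - t * Y\<close>. Both have coefficients in the field generated by
  \<open>g\<close>.\<close>

lemma primitive_element_pair:
  fixes \<alpha> \<beta> :: complex
  assumes a: "algebraic \<alpha>" and b: "algebraic \<beta>"
  obtains t :: nat where "\<alpha> \<in> range (\<lambda>h. rp h (\<alpha> + of_nat t * \<beta>))" "\<beta> \<in> range (\<lambda>h. rp h (\<alpha> + of_nat t * \<beta>))"
proof -
  define S where "S = (\<lambda>(x, y). (x - \<alpha>) / (\<beta> - y)) ` ({x. rp (minpoly \<alpha>) x = 0} \<times> {y. rp (minpoly \<beta>) y = 0})"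
  have fS: "finite S" unfolding S_def using card_roots_minpoly(1) a b by simp
  have inf: "infinite (range (of_nat :: nat \<Rightarrow> complex))"
    by (rule range_inj_infinite) (simp add: inj_on_def)
  have "\<not> range (of_nat :: nat \<Rightarrow> complex) \<subseteq> S"
    by (rule notI) (rule notE[OF inf finite_subset[OF _ fS]])
  then obtain t :: nat where t: "of_nat t \<notin> S" by blast
  define g where "g = \<alpha> + of_nat t * \<beta>"
  define E where "E = range (\<lambda>h. rp h g)"
  have "algebraic g" unfolding g_def using a b by (rule algebraic_add_nat_mult)
  then have E: "subfld E" unfolding E_def by (rule subfld_range_rp)
  have gE: "g \<in> E" unfolding E_def by (rule image_eqI[of _ _ "[:0,1:]"]) simp_all
  define B where "B = (map_poly of_rat (minpoly \<beta>) :: complex poly)"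
  define A where "A = pcompose (map_poly of_rat (minpoly \<alpha>) :: complex poly) [:g, - of_nat t:]"
  have polyA: "poly A y = rp (minpoly \<alpha>) (g - of_nat t * y)" for y
    by (simp add: A_def poly_pcompose rp_def mult.commute)
  have polyB: "poly B y = rp (minpoly \<beta>) y" for y by (simp add: B_def rp_def)
  have "\<beta> \<in> E"
  proof (rule unique_common_root_in_subfld[OF E, of A B])
    show "Polynomial.coeff A i \<in> E" for i
      unfolding A_def
    proof (rule subfld_coeff_pcompose[OF E])
      show "Polynomial.coeff [:g, - of_nat t:] i \<in> E" for i
        using gE subfldD(2,6)[OF E] subfld_of_nat[OF E, of t] by (cases i; cases "i - 1") simp_all
    qed (simp add: coeff_map_poly_of_rat subfld_of_rat[OF E])
    show "Polynomial.coeff B i \<in> E" for i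
      by (simp add: B_def coeff_map_poly_of_rat subfld_of_rat[OF E])
    show "B \<noteq> 0" using minpoly(1)[OF b] by (simp add: B_def map_poly_of_rat_eq_0_iff)
    show "poly A \<beta> = 0" using minpoly(2)[OF a] by (simp add: polyA g_def)
    show "poly B \<beta> = 0" using minpoly(2)[OF b] by (simp add: polyB)
    show "poly (pderiv B) \<beta> \<noteq> 0"
      using minpoly_simple_root[OF b minpoly(2)[OF b]] by (simp add: B_def map_poly_pderiv rp_def)
    fix y assume y: "poly A y = 0" "poly B y = 0"
    show "y = \<beta>"
    proof (rule ccontr)
      assume "y \<noteq> \<beta>"
      then have "of_nat t = (\<lambda>(x, y). (x - \<alpha>) / (\<beta> - y)) (g - of_nat t * y, y)"
        by (simp add: g_def field_simps)
      moreover have "(g - of_nat t * y, y) \<in> {x. rp (minpoly \<alpha>) x = 0} \<times> {y. rp (minpoly \<beta>) y = 0}"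
        using y by (simp add: polyA polyB)
      ultimately have "of_nat t \<in> S" unfolding S_def by (rule image_eqI)
      then show False using t by blast
    qed
  qed
  moreover from this have "g - of_nat t * \<beta> \<in> E" using gE subfld_of_nat[OF E] subfldD(3,4)[OF E] by blast
  then have "\<alpha> \<in> E" by (simp add: g_def)
  ultimately show ?thesis using that unfolding E_def g_def by blast
qed

text \<open>The explicit combination for \<open>\<theta>\<close> is part of the claim: when
  \<open>R\<close> is closed under conjugation, it shows that the conjugates of
  \<open>\<theta>\<close> remain in the field.\<close>

theorem primitive_element:
  assumes "finite R" "\<And>r. r \<in> R \<Longrightarrow> algebraic r"
  shows "\<exists>\<theta> (t :: complex \<Rightarrow> nat). algebraic \<theta> \<and> \<theta> = (\<Sum>r\<in>R. of_nat (t r) * r) \<and> R \<subseteq> range (\<lambda>h. rp h \<theta>)"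
  using assms
proof (induction R rule: finite_induct)
  case empty
  then show ?case by (intro exI[of _ 0]) simp
next
  case (insert \<beta> R)
  then obtain \<theta> and t :: "complex \<Rightarrow> nat" where \<theta>: "algebraic \<theta>" "\<theta> = (\<Sum>r\<in>R. of_nat (t r) * r)"
    "R \<subseteq> range (\<lambda>h. rp h \<theta>)" by auto
  have b: "algebraic \<beta>" using insert.prems by simp
  obtain k where k: "\<theta> \<in> range (\<lambda>h. rp h (\<theta> + of_nat k * \<beta>))" "\<beta> \<in> range (\<lambda>h. rp h (\<theta> + of_nat k * \<beta>))"
    using primitive_element_pair[OF \<theta>(1) b] by blast
  define g where "g = \<theta> + of_nat k * \<beta>"
  have alg: "algebraic g" unfolding g_def using \<theta>(1) b by (rule algebraic_add_nat_mult)
  have "r \<in> range (\<lambda>h. rp h g)" if "r \<in> R" for r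
  proof -
    obtain h where "r = rp h \<theta>" using \<theta>(3) \<open>r \<in> R\<close> by blast
    then show ?thesis using subfld_rp[OF subfld_range_rp[OF alg]] k(1) by (simp add: g_def)
  qed
  moreover have "g = (\<Sum>r\<in>insert \<beta> R. of_nat ((t(\<beta> := k)) r) * r)"
  proof -
    have "(\<Sum>r\<in>R. of_nat ((t(\<beta> := k)) r) * r) = \<theta>"
      unfolding \<theta>(2) by (rule sum.cong) (use insert.hyps in auto)
    then show ?thesis using insert.hyps by (simp add: g_def)
  qed
  ultimately show ?case using alg k(2) by (intro exI[of _ g] exI[of _ "t(\<beta> := k)"]) (auto simp: g_def)
qed

subsection \<open>Galois groups\<close>

text \<open>The elements of \<open>G\<close> matter only on \<open>M\<close>; they are bijections of all complex numbers so that
  composition needs no restriction to \<open>M\<close>.\<close>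

locale galois =
  fixes M :: "complex set" and G :: "(complex \<Rightarrow> complex) set"
  assumes subfld_M: "subfld M"
    and finite_G: "finite G" and id_G: "id \<in> G"
    and comp_G: "s \<in> G \<Longrightarrow> t \<in> G \<Longrightarrow> s \<circ> t \<in> G"
    and bij_G: "s \<in> G \<Longrightarrow> bij s"
    and closed_G: "s \<in> G \<Longrightarrow> x \<in> M \<Longrightarrow> s x \<in> M"
    and add_G: "s \<in> G \<Longrightarrow> x \<in> M \<Longrightarrow> y \<in> M \<Longrightarrow> s (x + y) = s x + s y"
    and mult_G: "s \<in> G \<Longrightarrow> x \<in> M \<Longrightarrow> y \<in> M \<Longrightarrow> s (x * y) = s x * s y"
    and one_G: "s \<in> G \<Longrightarrow> s 1 = 1"
    and fixed_G: "x \<in> M \<Longrightarrow> (\<And>s. s \<in> G \<Longrightarrow> s x = x) \<Longrightarrow> x \<in> \<rat>"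

text \<open>\<open>R\<close> contains all conjugates of \<open>S\<close>, so the field of
  \<open>\<theta>\<close> is normal. An automorphism is given by the conjugate \<open>w\<close> to
  which \<open>\<theta>\<close> is sent: it evaluates a representing polynomial at \<open>w\<close>
  instead of \<open>\<theta>\<close>, and it is the identity outside \<open>M\<close>.\<close>

theorem galois_exists:
  assumes fin: "finite S" and alg: "\<And>x. x \<in> S \<Longrightarrow> algebraic x"
  shows "\<exists>M G. galois M G \<and> S \<subseteq> M"
proof -
  define R where "R = (\<Union>a\<in>S. {y. rp (minpoly a) y = 0})"
  have finR: "finite R" unfolding R_def using fin alg card_roots_minpoly(1) by auto
  have SR: "S \<subseteq> R" unfolding R_def using minpoly(2)[OF alg] by blast
  have algR: "algebraic r" if r: "r \<in> R" for r
  proof -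
    obtain a where "a \<in> S" "rp (minpoly a) r = 0" using r by (auto simp: R_def)
    then show ?thesis using minpoly(1)[OF alg] unfolding algebraic_iff_rp by blast
  qed
  obtain \<theta> and t :: "complex \<Rightarrow> nat" where \<theta>: "algebraic \<theta>" and \<theta>eq: "\<theta> = (\<Sum>r\<in>R. of_nat (t r) * r)"
    and R\<theta>: "R \<subseteq> range (\<lambda>h. rp h \<theta>)"
    using primitive_element[OF finR algR] by blast
  define M where "M = range (\<lambda>h. rp h \<theta>)"
  define m where "m = minpoly \<theta>"
  note m = minpoly[OF \<theta>, folded m_def]
  have M: "subfld M" unfolding M_def by (rule subfld_range_rp[OF \<theta>])
  define hh where "hh x = (SOME h. rp h \<theta> = x)" for x
  have hh: "rp (hh x) \<theta> = x" if "x \<in> M" for x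
    unfolding hh_def by (rule someI_ex) (use that in \<open>auto simp: M_def\<close>)
  define s where "s w x = (if x \<in> M then rp (hh x) w else x)" for w x
  define W where "W = {w. rp m w = 0}"
  have sw: "s w (rp h \<theta>) = rp h w" if w: "w \<in> W" for w h
  proof -
    have "rp h \<theta> \<in> M" by (simp add: M_def)
    then have "rp (hh (rp h \<theta>) - h) \<theta> = 0" using hh by simp
    then have "rp (hh (rp h \<theta>) - h) w = 0"
      using minpoly_conjugate_eq_0[OF \<theta>] w by (simp add: W_def m_def del: rp_diff)
    then show ?thesis using \<open>rp h \<theta> \<in> M\<close> by (simp add: s_def)
  qed
  have ME: "\<exists>h. x = rp h \<theta>" if "x \<in> M" for x using that by (auto simp: M_def)
  have out: "s w x = x" if "x \<notin> M" for w x using that by (simp add: s_def)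
  have s_add: "s w (x + y) = s w x + s w y" if "w \<in> W" "x \<in> M" "y \<in> M" for w x y
    using ME[OF that(2)] ME[OF that(3)] sw[OF that(1)] by (metis rp_add)
  have s_mult: "s w (x * y) = s w x * s w y" if "w \<in> W" "x \<in> M" "y \<in> M" for w x y
    using ME[OF that(2)] ME[OF that(3)] sw[OF that(1)] by (metis rp_mult)
  have s_one: "s w 1 = 1" if "w \<in> W" for w using sw[OF that, of 1] by simp
  have s_0: "s w 0 = 0" if "w \<in> W" for w using sw[OF that, of 0] by simp
  have RM: "R \<subseteq> M" using R\<theta> by (simp add: M_def)
  have sR: "s w r \<in> R" if w: "w \<in> W" and r: "r \<in> R" for w r
  proof -
    obtain a where a: "a \<in> S" "rp (minpoly a) r = 0" using r by (auto simp: R_def)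
    obtain h where h: "r = rp h \<theta>" using r RM ME by blast
    have "rp (pcompose (minpoly a) h) \<theta> = 0" using a h by simp
    then have "rp (pcompose (minpoly a) h) w = 0"
      using minpoly_conjugate_eq_0[OF \<theta>] w by (simp add: W_def m_def del: rp_pcompose)
    then have "rp (minpoly a) (s w r) = 0" using sw[OF w] h by simp
    then show ?thesis using a by (auto simp: R_def)
  qed
  have s_sum: "s w (\<Sum>r\<in>A. of_nat (t r) * r) = (\<Sum>r\<in>A. of_nat (t r) * s w r)"
    if w: "w \<in> W" and A: "finite A" "A \<subseteq> R" for w A
    using A
  proof (induction A rule: finite_induct)
    case empty
    then show ?case using s_0[OF w] by simp
  next
    case (insert r A)
    have rM: "r \<in> M" using insert RM by blast
    have nM: "of_nat (t r) \<in> M" by (rule subfld_of_nat[OF M])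
    have nn: "s w (of_nat (t r)) = of_nat (t r)"
      using sw[OF w, of "[:of_nat (t r):]"] by simp
    have sM: "(\<Sum>r\<in>A. of_nat (t r) * r) \<in> M"
      using insert.prems RM by (intro subfld_sum[OF M] subfldD(4)[OF M] subfld_of_nat[OF M]) auto
    have "s w (of_nat (t r) * r + (\<Sum>r\<in>A. of_nat (t r) * r)) = of_nat (t r) * s w r + (\<Sum>r\<in>A. of_nat (t r) * s w r)"
      using insert s_add[OF w subfldD(4)[OF M nM rM] sM] s_mult[OF w nM rM] nn by simp
    then show ?case using insert.hyps by simp
  qed
  have \<theta>M: "\<theta> \<in> M" unfolding M_def by (rule image_eqI[of _ _ "[:0,1:]"]) simp_all
  have s\<theta>: "s w \<theta> = w" if "w \<in> W" for w using sw[OF that, of "[:0,1:]"] by simp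
  have WM: "w \<in> M" if w: "w \<in> W" for w
  proof -
    \<comment> \<open>Normality: \<open>\<theta>\<close> is a combination of elements of
      \<open>R\<close>, and \<open>s w\<close> maps \<open>R\<close> into itself.\<close>
    have "w = (\<Sum>r\<in>R. of_nat (t r) * s w r)"
      using s_sum[OF w finR order.refl] s\<theta>[OF w] \<theta>eq by simp
    also have "\<dots> \<in> M"
      using sR[OF w] RM by (intro subfld_sum[OF M] subfldD(4)[OF M] subfld_of_nat[OF M]) auto
    finally show ?thesis .
  qed
  have sM: "s w x \<in> M" if "w \<in> W" "x \<in> M" for w x
    using subfld_rp[OF M WM[OF that(1)]] that(2) by (simp add: s_def)
  have \<theta>W: "\<theta> \<in> W" using m(2) by (simp add: W_def)
  have sid: "s \<theta> = id"
  proof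
    fix x show "s \<theta> x = id x" using hh[of x] by (simp add: s_def)
  qed
  have sWW: "s v w \<in> W" if v: "v \<in> W" and w: "w \<in> W" for v w
  proof -
    obtain k where k: "w = rp k \<theta>" using ME[OF WM[OF w]] by blast
    have "rp (pcompose m k) \<theta> = 0" using w k by (simp add: W_def)
    then have "rp (pcompose m k) v = 0"
      using minpoly_conjugate_eq_0[OF \<theta>] v by (simp add: W_def m_def del: rp_pcompose)
    then show ?thesis using sw[OF v] k by (simp add: W_def)
  qed
  have scomp: "s v \<circ> s w = s (s v w)" if v: "v \<in> W" and w: "w \<in> W" for v w
  proof
    fix x
    show "(s v \<circ> s w) x = s (s v w) x"
    proof (cases "x \<in> M")
      case True
      then obtain h where h: "x = rp h \<theta>" using ME by blast
      obtain k where k: "w = rp k \<theta>" using ME[OF WM[OF w]] by blast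
      have "s v (s w x) = s v (rp (pcompose h k) \<theta>)" using sw[OF w] h k by simp
      also have "\<dots> = rp h (s v w)" using sw[OF v] k by (metis rp_pcompose)
      also have "\<dots> = s (s v w) x" using sw[OF sWW[OF v w]] h by simp
      finally show ?thesis by simp
    next
      case False
      then show ?thesis using out by simp
    qed
  qed
  have sinj: "inj (s w)" if w: "w \<in> W" for w
  proof (rule injI)
    fix x y assume eq: "s w x = s w y"
    show "x = y"
    proof (cases "x \<in> M")
      case True
      then have "y \<in> M" using eq sM[OF w True] out by metis
      then obtain h k where hk: "x = rp h \<theta>" "y = rp k \<theta>" using True ME by blast
      then have "rp (h - k) w = 0" using eq sw[OF w] by simp
      then have "rp (h - k) \<theta> = 0"
        using minpoly_conjugate_eq_0[OF \<theta>] w by (simp add: W_def m_def del: rp_diff)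
      then show ?thesis using hk by simp
    next
      case False
      then have "y \<notin> M" using eq sM[OF w] out by metis
      then show ?thesis using False eq out by simp
    qed
  qed
  define G where "G = s ` W"
  have finW: "finite W" unfolding W_def m_def by (rule card_roots_minpoly(1)[OF \<theta>])
  have finG: "finite G" using finW by (simp add: G_def)
  have compG: "a \<circ> c \<in> G" if "a \<in> G" "c \<in> G" for a c
    using that scomp sWW by (auto simp: G_def)
  have bijG: "bij a" if a: "a \<in> G" for a
  proof -
    have "inj a" using a sinj by (auto simp: G_def)
    then have "inj_on (\<lambda>c. a \<circ> c) G" by (auto simp: inj_on_def fun_eq_iff)
    moreover have "(\<lambda>c. a \<circ> c) ` G \<subseteq> G" using compG a by blast
    \<comment> \<open>Left translation by \<open>a\<close> is an injective self-map of a finite set;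
      a preimage of \<open>id\<close> is a right inverse of \<open>a\<close>.\<close>
    ultimately have "(\<lambda>c. a \<circ> c) ` G = G" using finG by (simp add: endo_inj_surj)
    moreover have "id \<in> G" using sid \<theta>W by (metis G_def image_eqI)
    ultimately obtain c where "id = a \<circ> c" by blast
    then have "surj a" by (metis comp_apply id_apply surjI)
    then show ?thesis using \<open>inj a\<close> by (simp add: bij_def)
  qed
  have fixG: "x \<in> \<rat>" if x: "x \<in> M" and fixed: "\<And>a. a \<in> G \<Longrightarrow> a x = x" for x
  proof -
    obtain h where h: "x = rp h \<theta>" using ME[OF x] by blast
    define k where "k = h mod m"
    have hk: "h = h div m * m + k" by (simp add: k_def)
    have kw: "rp k w = rp h w" if "w \<in> W" for w
    proof -
      have "rp h w = rp (h div m) w * rp m w + rp k w"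
        using arg_cong[OF hk, of "\<lambda>z. rp z w"] by (simp only: rp_add rp_mult)
      then show ?thesis using that by (simp add: W_def)
    qed
    have root: "poly (map_poly of_rat k - [:x:]) w = 0" if "w \<in> W" for w
    proof -
      have "s w x = x" using fixed that by (auto simp: G_def)
      then have "rp h w = x" using sw[OF that] h by simp
      then show ?thesis using kw[OF that] by (simp add: rp_def)
    qed
    define P where "P = map_poly of_rat k - [:x:]"
    \<comment> \<open>The degree of \<open>P\<close> is below that of \<open>m\<close>, yet
      \<open>P\<close> vanishes at every conjugate of \<open>\<theta>\<close>, and there are as many
      as the degree of \<open>m\<close>.\<close>
    have "P = 0"
    proof (rule ccontr)
      assume P0: "P \<noteq> 0"
      have "Polynomial.degree P \<le> max (Polynomial.degree k) 0"
        unfolding P_def by (intro order.trans[OF degree_diff_le_max]) (simp add: degree_map_poly)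
      moreover have "k = 0 \<or> Polynomial.degree k < Polynomial.degree m"
        unfolding k_def using degree_mod_less m(1) by blast
      ultimately have "Polynomial.degree P < Polynomial.degree m"
        using degree_minpoly_pos[OF \<theta>] by (auto simp: m_def)
      moreover have "card W \<le> card {w. poly P w = 0}"
        using root P0 by (intro card_mono poly_roots_finite) (auto simp: P_def)
      moreover have "card {w. poly P w = 0} \<le> Polynomial.degree P" using P0 by (rule card_poly_roots_bound)
      moreover have "card W = Polynomial.degree m" unfolding W_def m_def by (rule card_roots_minpoly(2)[OF \<theta>])
      ultimately show False by simp
    qed
    then have "map_poly of_rat k = [:x:]" by (simp add: P_def)
    then have "Polynomial.coeff (map_poly of_rat k) 0 = x" by simp
    then have "x = of_rat (Polynomial.coeff k 0)" by (simp only: coeff_map_poly_of_rat)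
    then show ?thesis by simp
  qed
  have "galois M G"
  proof
    show "subfld M" by (rule M)
    show "finite G" by (rule finG)
    show "id \<in> G" using sid \<theta>W by (metis G_def image_eqI)
  qed (use compG bijG fixG sM s_add s_mult s_one in \<open>auto simp: G_def\<close>)
  then show ?thesis using SR RM by blast
qed

section \<open>Orbit polynomials, norms and degrees\<close>

definition root_poly :: "complex set \<Rightarrow> complex poly" where
  "root_poly A = (\<Prod>y\<in>A. [:- y, 1:])"

lemma poly_root_poly: "poly (root_poly A) z = (\<Prod>y\<in>A. z - y)"
  by (simp add: root_poly_def poly_prod)

lemma degree_root_poly: "Polynomial.degree (root_poly A) = card A"
  unfolding root_poly_def by (subst degree_prod_sum_eq) auto

lemma lead_coeff_root_poly: "Polynomial.coeff (root_poly A) (card A) = 1"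
proof -
  have "lead_coeff (root_poly A) = 1"
    unfolding root_poly_def lead_coeff_prod by simp
  then show ?thesis by (simp add: degree_root_poly)
qed

lemma root_poly_insert:
  "finite A \<Longrightarrow> a \<notin> A \<Longrightarrow> root_poly (insert a A) = [:- a, 1:] * root_poly A"
  by (simp add: root_poly_def)

lemma coeff_linear_mult:
  "Polynomial.coeff ([:- a, 1:] * (P :: complex poly)) i = (case i of 0 \<Rightarrow> 0 | Suc j \<Rightarrow> Polynomial.coeff P j) - a * Polynomial.coeff P i"
  by (simp add: coeff_pCons split: nat.splits)

lemma algebraic_int_coeff_root_poly:
  assumes "finite A" "\<And>y. y \<in> A \<Longrightarrow> algebraic_int y"
  shows "algebraic_int (Polynomial.coeff (root_poly A) i)"
  using assms
proof (induction A arbitrary: i rule: finite_induct)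
  case empty
  then show ?case by (cases i) (simp_all add: root_poly_def)
next
  case (insert a A)
  have "algebraic_int a" using insert.prems by simp
  moreover have IH: "algebraic_int (Polynomial.coeff (root_poly A) j)" for j
    using insert.IH insert.prems by simp
  ultimately have "algebraic_int (a * Polynomial.coeff (root_poly A) i)" by (rule algebraic_int_mult)
  moreover have "algebraic_int (case i of 0 \<Rightarrow> 0 | Suc j \<Rightarrow> Polynomial.coeff (root_poly A) j)"
    using IH by (cases i) simp_all
  ultimately show ?case
    unfolding root_poly_insert[OF insert.hyps] coeff_linear_mult by (intro algebraic_int_diff)
qed

definition orb :: "(complex \<Rightarrow> complex) set \<Rightarrow> complex \<Rightarrow> complex set" where
  "orb H x = (\<lambda>t. t x) ` H"

context galois
begin

lemmas M = subfldD[OF subfld_M]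

lemma zero_G: "s \<in> G \<Longrightarrow> s 0 = 0"
  using add_G[of s 0 0] M(2) by simp

lemma uminus_G: assumes "s \<in> G" "x \<in> M" shows "s (- x) = - s x"
  using add_G[OF assms M(6)[OF assms(2)]] zero_G[OF assms(1)] by (simp add: eq_neg_iff_add_eq_0 add.commute)

lemma diff_G: assumes "s \<in> G" "x \<in> M" "y \<in> M" shows "s (x - y) = s x - s y"
  using add_G[OF assms(1,2) M(6)[OF assms(3)]] uminus_G[OF assms(1,3)] by simp

lemma of_nat_G: "s \<in> G \<Longrightarrow> s (of_nat n) = of_nat n"
  by (induction n) (simp_all add: zero_G add_G one_G subfld_of_nat[OF subfld_M] M)

lemma of_int_G: "s \<in> G \<Longrightarrow> s (of_int n) = of_int n"
  by (cases n rule: int_cases2) (simp_all add: of_nat_G uminus_G subfld_of_nat[OF subfld_M])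

lemma inj_G: "s \<in> G \<Longrightarrow> s x = s y \<longleftrightarrow> x = y"
  using bij_G[of s] by (auto simp: bij_def inj_def)

lemma eq_0_G: "s \<in> G \<Longrightarrow> s x = 0 \<longleftrightarrow> x = 0"
  using inj_G[of s x 0] zero_G[of s] by simp

lemma divide_G: assumes "s \<in> G" "x \<in> M" "y \<in> M" shows "s (x / y) = s x / s y"
proof (cases "y = 0")
  case False
  have "s (x / y) * s y = s x" using mult_G[OF assms(1) M(8)[OF assms(2,3)] assms(3)] False by simp
  then show ?thesis using False eq_0_G[OF assms(1)] by (simp add: field_simps)
qed (simp add: zero_G assms)

lemma of_rat_G: assumes s: "s \<in> G" shows "s (of_rat r) = of_rat r"
  by (cases r) (simp add: of_rat_rat divide_G[OF s] of_int_G[OF s] subfld_of_int[OF subfld_M])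

lemma power_G: "s \<in> G \<Longrightarrow> x \<in> M \<Longrightarrow> s (x ^ n) = s x ^ n"
  by (induction n) (simp_all add: one_G mult_G M)

lemma prod_G: "s \<in> G \<Longrightarrow> (\<And>i. i \<in> A \<Longrightarrow> g i \<in> M) \<Longrightarrow> s (prod g A) = (\<Prod>i\<in>A. s (g i))"
  by (induction A rule: infinite_finite_induct) (simp_all add: one_G mult_G subfld_prod[OF subfld_M])

lemma rp_G: "s \<in> G \<Longrightarrow> x \<in> M \<Longrightarrow> s (rp h x) = rp h (s x)"
  by (induction h) (simp_all add: zero_G of_rat_G add_G mult_G subfld_rp[OF subfld_M] subfld_of_rat[OF subfld_M] M)

lemma algebraic_int_G:
  assumes "s \<in> G" "x \<in> M" "algebraic_int x" shows "algebraic_int (s x)"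
proof -
  obtain P where P: "lead_coeff P = 1" "\<And>i. Polynomial.coeff P i \<in> \<int>" "poly P x = 0"
    using assms(3) by (auto simp: algebraic_int.simps)
  have "Polynomial.coeff P i \<in> \<rat>" for i using P(2)[of i] Ints_subset_Rats by blast
  then obtain h where h: "map_poly of_rat h = P" using rats_coeffs_rat_poly by blast
  have "rp h (s x) = 0" using rp_G[OF assms(1,2), of h] P(3) h zero_G[OF assms(1)] by (simp add: rp_def)
  then have "poly P (s x) = 0" using h by (simp add: rp_def)
  then show ?thesis using P by (intro algebraic_int.intros[of P]) simp_all
qed

lemma inv_G:
  assumes s: "s \<in> G" shows "inv_into UNIV s \<in> G"
proof -
  have "inj_on (\<lambda>c. s \<circ> c) G" using inj_G[OF s] by (auto simp: inj_on_def fun_eq_iff)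
  moreover have "(\<lambda>c. s \<circ> c) ` G \<subseteq> G" using comp_G s by blast
  ultimately have "(\<lambda>c. s \<circ> c) ` G = G" using finite_G by (simp add: endo_inj_surj)
  then obtain c where c: "id = s \<circ> c" "c \<in> G" using id_G by blast
  have "inv_into UNIV s = c" using inv_unique_comp[of s c] c bij_G[OF s]
    by (metis bij_is_inj inv_o_cancel comp_assoc comp_id id_comp)
  then show ?thesis using c by simp
qed

lemma inv_apply_G: "s \<in> G \<Longrightarrow> s (inv_into UNIV s x) = x" "s \<in> G \<Longrightarrow> inv_into UNIV s (s x) = x"
  using bij_G[of s] by (auto simp: bij_def surj_f_inv_f)

lemma bij_betw_comp_right_G:
  assumes t: "t \<in> G" shows "bij_betw (\<lambda>s. s \<circ> t) G G"
proof (rule bij_betw_byWitness[where f' = "\<lambda>s. s \<circ> inv_into UNIV t"])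
  show "\<forall>a\<in>G. (a \<circ> t) \<circ> inv_into UNIV t = a" "\<forall>a\<in>G. (a \<circ> inv_into UNIV t) \<circ> t = a"
    using inv_apply_G[OF t] by (auto simp: fun_eq_iff)
qed (use comp_G t inv_G[OF t] in auto)

lemma bij_betw_comp_left_G:
  assumes t: "t \<in> G" shows "bij_betw (\<lambda>s. t \<circ> s) G G"
proof (rule bij_betw_byWitness[where f' = "\<lambda>s. inv_into UNIV t \<circ> s"])
  show "\<forall>a\<in>G. inv_into UNIV t \<circ> (t \<circ> a) = a" "\<forall>a\<in>G. t \<circ> (inv_into UNIV t \<circ> a) = a"
    using inv_apply_G[OF t] by (auto simp: fun_eq_iff)
qed (use comp_G t inv_G[OF t] in auto)

lemma sum_comp_right_G:
  assumes "t \<in> G" shows "(\<Sum>s\<in>G. \<phi> (s \<circ> t)) = (\<Sum>s\<in>G. \<phi> s)"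
  by (rule sum.reindex_bij_betw[OF bij_betw_comp_right_G[OF assms]])

lemma card_G_pos: "card G > 0"
  using finite_G id_G by (auto simp: card_gt_0_iff)

text \<open>Inverses follow from the finiteness of \<open>G\<close>.\<close>

definition subgrp :: "(complex \<Rightarrow> complex) set \<Rightarrow> bool" where
  "subgrp H \<longleftrightarrow> H \<subseteq> G \<and> id \<in> H \<and> (\<forall>s\<in>H. \<forall>t\<in>H. s \<circ> t \<in> H)"

lemma subgrp_G: "subgrp G" using id_G comp_G by (auto simp: subgrp_def)

text \<open>The Galois group over the field generated by \<open>b\<close> and \<open>z\<close>,
  which serves as base field for the degrees along the orbit.\<close>

definition stab :: "complex \<Rightarrow> complex \<Rightarrow> (complex \<Rightarrow> complex) set" where
  "stab b z = {s \<in> G. s b = b \<and> s z = z}"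

lemma subgrp_stab: "subgrp (stab b z)"
  using id_G comp_G by (auto simp: subgrp_def stab_def)

lemma orb_self: "subgrp H \<Longrightarrow> x \<in> orb H x"
  unfolding orb_def by (rule image_eqI[of _ _ id]) (auto simp: subgrp_def)

lemma finite_orb: "subgrp H \<Longrightarrow> finite (orb H x)"
  using finite_G finite_subset by (auto simp: orb_def subgrp_def)

lemma card_orb_pos: "subgrp H \<Longrightarrow> card (orb H x) > 0"
  using orb_self[of H x] finite_orb[of H x] by (auto simp: card_gt_0_iff)

lemma orb_subset_M: "subgrp H \<Longrightarrow> x \<in> M \<Longrightarrow> orb H x \<subseteq> M"
  using closed_G by (auto simp: orb_def subgrp_def)

lemma algebraic_int_orb: "subgrp H \<Longrightarrow> x \<in> M \<Longrightarrow> algebraic_int x \<Longrightarrow> y \<in> orb H x \<Longrightarrow> algebraic_int y"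
  using algebraic_int_G by (auto simp: orb_def subgrp_def)

lemma image_orb:
  assumes H: "subgrp H" and t: "t \<in> H" shows "t ` orb H x = orb H x"
proof (rule endo_inj_surj)
  show "finite (orb H x)" by (rule finite_orb[OF H])
  show "t ` orb H x \<subseteq> orb H x"
  proof
    fix y assume "y \<in> t ` orb H x"
    then obtain s where "s \<in> H" "y = t (s x)" by (auto simp: orb_def)
    then show "y \<in> orb H x" unfolding orb_def
      by (intro image_eqI[of _ _ "t \<circ> s"]) (use H t in \<open>auto simp: subgrp_def\<close>)
  qed
  show "inj_on t (orb H x)" using H t inj_G by (auto simp: inj_on_def subgrp_def)
qed

lemma orb_mem_orb:
  assumes H: "subgrp H" and y: "y \<in> orb H x" and t: "t \<in> H" shows "t y \<in> orb H x"
  using image_orb[OF H t, of x] y by blast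

lemma orb_eq:
  assumes H: "subgrp H" and y: "y \<in> orb H x" shows "orb H y = orb H x"
proof
  show "orb H y \<subseteq> orb H x" using orb_mem_orb[OF H y] by (auto simp: orb_def)
  obtain s where s: "s \<in> H" "y = s x" using y by (auto simp: orb_def)
  have "x \<in> orb H y"
  proof -
    have "y \<in> s ` orb H y" using image_orb[OF H s(1), of y] orb_self[OF H, of y] by simp
    then obtain w where "w \<in> orb H y" "s x = s w" using s by auto
    then show ?thesis using inj_G s(1) H by (auto simp: subgrp_def)
  qed
  then show "orb H x \<subseteq> orb H y" using orb_mem_orb[OF H] by (auto simp: orb_def)
qed

lemma orb_image_hom:
  assumes H: "subgrp H" and \<phi>: "\<And>t. t \<in> H \<Longrightarrow> t (\<phi> x) = \<phi> (t x)"
  shows "orb H (\<phi> x) = \<phi> ` orb H x"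
  unfolding orb_def image_image by (rule image_cong[OF refl]) (rule \<phi>)

lemma coeff_root_poly_M:
  assumes "finite A" "A \<subseteq> M"
  shows "Polynomial.coeff (root_poly A) i \<in> M"
  using assms
proof (induction A arbitrary: i rule: finite_induct)
  case empty
  then show ?case using M by (cases i) (simp_all add: root_poly_def)
next
  case (insert a A)
  have IH: "Polynomial.coeff (root_poly A) j \<in> M" for j using insert by simp
  have "(case i of 0 \<Rightarrow> 0 | Suc j \<Rightarrow> Polynomial.coeff (root_poly A) j) \<in> M"
    using IH M(2) by (cases i) simp_all
  then show ?case
    unfolding root_poly_insert[OF insert.hyps] coeff_linear_mult using insert.prems IH
    by (intro M(3,4)) simp_all
qed

lemma coeff_root_poly_G:
  assumes s: "s \<in> G" and "finite A" "A \<subseteq> M"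
  shows "s (Polynomial.coeff (root_poly A) i) = Polynomial.coeff (root_poly (s ` A)) i"
  using assms(2,3)
proof (induction A arbitrary: i rule: finite_induct)
  case empty
  then show ?case using s by (cases i) (simp_all add: root_poly_def one_G zero_G)
next
  case (insert a A)
  have aM: "a \<in> M" and AM: "A \<subseteq> M" using insert.prems by auto
  have cM: "Polynomial.coeff (root_poly A) j \<in> M" for j
    using coeff_root_poly_M insert.hyps(1) AM by simp
  have sa: "s a \<notin> s ` A" using insert.hyps inj_G[OF s] by auto
  have IH: "s (Polynomial.coeff (root_poly A) j) = Polynomial.coeff (root_poly (s ` A)) j" for j
    using insert.IH AM by simp
  have c0: "(case i of 0 \<Rightarrow> 0 | Suc j \<Rightarrow> Polynomial.coeff (root_poly A) j) \<in> M"
    using cM M(2) by (cases i) simp_all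
  have "s (case i of 0 \<Rightarrow> 0 | Suc j \<Rightarrow> Polynomial.coeff (root_poly A) j) =
      (case i of 0 \<Rightarrow> 0 | Suc j \<Rightarrow> Polynomial.coeff (root_poly (s ` A)) j)"
    using IH zero_G[OF s] by (cases i) simp_all
  then have "s (Polynomial.coeff (root_poly (insert a A)) i) = Polynomial.coeff ([:- s a, 1:] * root_poly (s ` A)) i"
    unfolding root_poly_insert[OF insert.hyps] coeff_linear_mult
    using diff_G[OF s c0 M(4)[OF aM cM]] mult_G[OF s aM cM] IH by simp
  also have "[:- s a, 1:] * root_poly (s ` A) = root_poly (insert (s a) (s ` A))"
    using root_poly_insert[OF _ sa] insert.hyps(1) by simp
  finally show ?case by simp
qed

lemma coeff_root_poly_orb_fixed:
  assumes H: "subgrp H" and x: "x \<in> M" and s: "s \<in> H"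
  shows "s (Polynomial.coeff (root_poly (orb H x)) i) = Polynomial.coeff (root_poly (orb H x)) i"
  using coeff_root_poly_G[of s "orb H x" i] H s finite_orb[OF H] orb_subset_M[OF H x] image_orb[OF H s]
  by (auto simp: subgrp_def)

lemma coeff_root_poly_orb_Rats:
  assumes x: "x \<in> M" shows "Polynomial.coeff (root_poly (orb G x)) i \<in> \<rat>"
  using coeff_root_poly_orb_fixed[OF subgrp_G x] coeff_root_poly_M[OF finite_orb[OF subgrp_G] orb_subset_M[OF subgrp_G x]]
  by (intro fixed_G)

lemma coeff_root_poly_orb_Ints:
  assumes x: "x \<in> M" "algebraic_int x" shows "Polynomial.coeff (root_poly (orb G x)) i \<in> \<int>"
  using coeff_root_poly_orb_Rats[OF x(1)] algebraic_int_coeff_root_poly[OF finite_orb[OF subgrp_G] algebraic_int_orb[OF subgrp_G x]]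
  by (intro rational_algebraic_int_is_int) simp_all

lemma poly_root_poly_orb:
  assumes H: "subgrp H" shows "poly (root_poly (orb H x)) x = 0"
  unfolding poly_root_poly using finite_orb[OF H] orb_self[OF H, of x] by (simp add: prod_zero_iff)

lemma card_orb_le_degree:
  assumes x: "x \<in> M" and h: "h \<noteq> 0" "rp h x = 0"
  shows "card (orb G x) \<le> Polynomial.degree h"
proof -
  define P where "P = (map_poly of_rat h :: complex poly)"
  have P0: "P \<noteq> 0" using h by (simp add: P_def map_poly_of_rat_eq_0_iff)
  have "orb G x \<subseteq> {y. poly P y = 0}"
  proof
    fix y assume "y \<in> orb G x"
    then obtain s where s: "s \<in> G" "y = s x" by (auto simp: orb_def)
    have "rp h y = 0" using rp_G[OF s(1) x, of h] h zero_G[OF s(1)] s by simp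
    then show "y \<in> {y. poly P y = 0}" by (simp add: P_def rp_def)
  qed
  then have "card (orb G x) \<le> card {y. poly P y = 0}"
    using P0 by (intro card_mono poly_roots_finite)
  also have "\<dots> \<le> Polynomial.degree P" using P0 by (rule card_poly_roots_bound)
  finally show ?thesis by (simp add: P_def degree_map_poly)
qed

text \<open>The product is the absolute value of a norm, hence of a nonzero rational integer. It
  takes the place of the product formula for integral points.\<close>

lemma norm_prod_G_ge_1:
  assumes y: "y \<in> M" "algebraic_int y" "y \<noteq> 0"
  shows "1 \<le> (\<Prod>s\<in>G. norm (s y))"
proof -
  define N where "N = (\<Prod>s\<in>G. s y)"
  have NM: "N \<in> M" unfolding N_def using y closed_G by (intro subfld_prod[OF subfld_M])
  have "t N = N" if t: "t \<in> G" for t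
  proof -
    have "t N = (\<Prod>s\<in>G. (t \<circ> s) y)" unfolding N_def using prod_G[OF t, of G "\<lambda>s. s y"] y closed_G by simp
    also have "\<dots> = N" unfolding N_def
      by (rule prod.reindex_bij_betw[OF bij_betw_comp_left_G[OF t], of "\<lambda>s. s y"])
    finally show ?thesis .
  qed
  then have "N \<in> \<rat>" using NM by (intro fixed_G)
  moreover have "algebraic_int N" unfolding N_def using algebraic_int_G y by (intro algebraic_int_prod)
  ultimately have "N \<in> \<int>" by (intro rational_algebraic_int_is_int)
  then obtain k where k: "N = of_int k" by (auto simp: Ints_def)
  have "N \<noteq> 0" unfolding N_def using finite_G eq_0_G y by (simp add: prod_zero_iff)
  then have "norm N \<ge> 1" using k by simp
  then show ?thesis by (simp add: N_def prod_norm)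
qed

lemma sum_ln_norm_G_nonneg:
  assumes y: "y \<in> M" "algebraic_int y" "y \<noteq> 0"
  shows "0 \<le> (\<Sum>s\<in>G. ln (norm (s y)))"
proof -
  have "(\<Sum>s\<in>G. ln (norm (s y))) = ln (\<Prod>s\<in>G. norm (s y))"
    using finite_G eq_0_G y by (subst ln_prod) simp_all
  then show ?thesis using norm_prod_G_ge_1[OF y] by simp
qed

text \<open>Translation by a suitable element of \<open>G\<close> carries one fibre of
  \<open>s \<mapsto> s x\<close> onto another, so all fibres have the same size.\<close>

lemma card_fiber_G:
  assumes z: "z \<in> orb G x"
  shows "card {s \<in> G. s x = z} * card (orb G x) = card G"
proof -
  have eq: "card {s \<in> G. s x = w} = card {s \<in> G. s x = z}" if w: "w \<in> orb G x" for w
  proof -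
    obtain a where a: "a \<in> G" "z = a x" using z by (auto simp: orb_def)
    obtain c where c: "c \<in> G" "w = c x" using w by (auto simp: orb_def)
    define u where "u = a \<circ> inv_into UNIV c"
    have u: "u \<in> G" unfolding u_def using a c inv_G comp_G by blast
    have uw: "u w = z" by (simp add: u_def a c inv_apply_G)
    have "bij_betw (\<lambda>s. u \<circ> s) {s \<in> G. s x = w} {s \<in> G. s x = z}"
    proof (rule bij_betw_byWitness[where f' = "\<lambda>s. inv_into UNIV u \<circ> s"])
      show "(\<lambda>s. u \<circ> s) ` {s \<in> G. s x = w} \<subseteq> {s \<in> G. s x = z}" using u uw comp_G by auto
      show "(\<lambda>s. inv_into UNIV u \<circ> s) ` {s \<in> G. s x = z} \<subseteq> {s \<in> G. s x = w}"
        using u uw comp_G inv_G inv_apply_G(2)[OF u, of w] by auto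
    qed (use inv_apply_G[OF u] in \<open>auto simp: fun_eq_iff\<close>)
    then show ?thesis by (rule bij_betw_same_card)
  qed
  have "card G = (\<Sum>w\<in>orb G x. card {s \<in> G. s x = w})"
    unfolding orb_def using finite_G card_eq_sum sum.image_gen[of G "\<lambda>_. 1::nat" "\<lambda>s. s x"] by simp
  also have "\<dots> = (\<Sum>w\<in>orb G x. card {s \<in> G. s x = z})" by (rule sum.cong[OF refl]) (rule eq)
  finally show ?thesis by simp
qed

text \<open>Elements of \<open>G\<close> that agree on \<open>b\<close> and \<open>z\<close> form a
  coset of the stabiliser, and over one coset the images of \<open>x\<close> are a translate of its
  orbit under the stabiliser. Passing from the base field to the rationals thus costs a bounded
  factor.\<close>

lemma card_orb_G_le:
  "card (orb G x) \<le> card ((\<lambda>s. (s b, s z)) ` G) * card (orb (stab b z) x)"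
proof -
  define J where "J = (\<lambda>s. (s b, s z)) ` G"
  define A where "A j = {s x | s. s \<in> G \<and> (s b, s z) = j}" for j
  have "orb G x = (\<Union>j\<in>J. A j)" by (auto simp: orb_def J_def A_def)
  also have "card \<dots> \<le> (\<Sum>j\<in>J. card (A j))" by (rule card_UN_le) (simp add: J_def finite_G)
  also have "\<dots> \<le> (\<Sum>j\<in>J. card (orb (stab b z) x))"
  proof (rule sum_mono)
    fix j assume "j \<in> J"
    then obtain s where s: "s \<in> G" "j = (s b, s z)" by (auto simp: J_def)
    have "A j \<subseteq> s ` orb (stab b z) x"
    proof
      fix w assume "w \<in> A j"
      then obtain s' where s': "s' \<in> G" "s' b = s b" "s' z = s z" "w = s' x" using s by (auto simp: A_def)
      define t where "t = inv_into UNIV s \<circ> s'"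
      have "t \<in> stab b z"
        unfolding stab_def t_def using s s' inv_G comp_G inv_apply_G(2)[OF s(1)] by auto
      moreover have "w = s (t x)" by (simp add: t_def s' inv_apply_G s)
      ultimately show "w \<in> s ` orb (stab b z) x" by (auto simp: orb_def)
    qed
    then have "card (A j) \<le> card (s ` orb (stab b z) x)"
      by (intro card_mono finite_imageI finite_orb[OF subgrp_stab])
    also have "\<dots> \<le> card (orb (stab b z) x)" by (intro card_image_le finite_orb[OF subgrp_stab])
    finally show "card (A j) \<le> card (orb (stab b z) x)" .
  qed
  finally show ?thesis by (simp add: J_def)
qed

end

subsection \<open>Roots of unity of prime order\<close>

lemma prime_root_of_unity_inj:
  fixes z :: complex
  assumes p: "Factorial_Ring.prime (p::nat)" and z: "z ^ p = 1" "z \<noteq> 1" and k: "0 < k" "k < p"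
  shows "z ^ k \<noteq> 1"
proof
  assume zk: "z ^ k = 1"
  have "coprime k p" using p k by (metis coprime_commute nat_dvd_not_less prime_imp_coprime)
  then obtain x y where xy: "k * x = p * y + 1"
    using bezout_nat[of k p] k by (auto simp: coprime_iff_gcd_eq_1)
  have "(z ^ k) ^ x = z ^ (p * y + 1)" by (simp only: xy power_mult[symmetric])
  also have "\<dots> = z" using z(1) by (simp add: power_mult)
  finally show False using zk z(2) by simp
qed

lemma prime_root_of_unity_inj_on:
  fixes z :: complex
  assumes p: "Factorial_Ring.prime (p::nat)" and z: "z ^ p = 1" "z \<noteq> 1"
  shows "inj_on (\<lambda>i. z ^ i) {..<p}"
proof -
  have p0: "p > 0" using p prime_gt_0_nat by blast
  have z0: "z \<noteq> 0" using z p0 by (auto simp: zero_power)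
  have "False" if ij: "i < j" "j < p" "z ^ i = z ^ j" for i j
  proof -
    have "z ^ j = z ^ i * z ^ (j - i)" using power_add[of z i "j - i"] ij(1) by simp
    then have "z ^ (j - i) = 1" using ij z0 by simp
    then show False using prime_root_of_unity_inj[OF p z, of "j - i"] ij by simp
  qed
  then show ?thesis by (intro inj_onI) (metis lessThan_iff nat_neq_iff)
qed

lemma power_diff_factor_roots_of_unity:
  fixes x y z :: complex
  assumes p: "Factorial_Ring.prime (p::nat)" and z: "z ^ p = 1" "z \<noteq> 1"
  shows "x ^ p - y ^ p = (\<Prod>i<p. x - z ^ i * y)"
proof -
  have p0: "p > 0" using p prime_gt_0_nat by blast
  define A where "A = (\<lambda>i. z ^ i) ` {..<p}"
  have inj: "inj_on (\<lambda>i. z ^ i) {..<p}" by (rule prime_root_of_unity_inj_on[OF p z])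
  have cA: "card A = p" unfolding A_def using card_image[OF inj] by simp
  define P where "P = Polynomial.monom 1 p - 1 - root_poly A"
  have "P = 0"
  proof (rule ccontr)
    assume P0: "P \<noteq> 0"
    have "Polynomial.degree P \<le> p"
      unfolding P_def using degree_root_poly[of A] cA
      by (intro degree_diff_le) (simp_all add: Polynomial.degree_monom_le)
    moreover have "Polynomial.coeff P p = 0"
      unfolding P_def using lead_coeff_root_poly[of A] cA p0 by simp
    ultimately have "Polynomial.degree P < p" using eq_zero_or_degree_less P0 by blast
    moreover have "A \<subseteq> {w. poly P w = 0}"
    proof
      fix w assume w: "w \<in> A"
      have "w ^ p = 1" using w z by (auto simp: A_def simp flip: power_mult) (metis mult.commute power_mult power_one)
      moreover have "poly (root_poly A) w = 0"
        unfolding poly_root_poly using w by (simp add: A_def prod_zero_iff)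
      ultimately show "w \<in> {w. poly P w = 0}" by (simp add: P_def poly_monom)
    qed
    then have "p \<le> card {w. poly P w = 0}"
      using card_mono[OF poly_roots_finite[OF P0]] cA by metis
    ultimately show False using card_poly_roots_bound[OF P0] by simp
  qed
  then have "root_poly A = Polynomial.monom 1 p - 1" by (simp add: P_def)
  then have e: "w ^ p - 1 = (\<Prod>i<p. w - z ^ i)" for w
    using poly_root_poly[of A w] unfolding A_def prod.reindex[OF inj] by (simp add: poly_monom)
  show ?thesis
  proof (cases "y = 0")
    case True
    then show ?thesis using p0 by (simp add: zero_power)
  next
    case False
    have "x ^ p - y ^ p = y ^ p * ((x / y) ^ p - 1)" using False by (simp add: power_divide field_simps)
    also have "\<dots> = (\<Prod>i<p. y * (x / y - z ^ i))" by (simp add: e prod.distrib)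
    also have "\<dots> = (\<Prod>i<p. x - z ^ i * y)" using False by (intro prod.cong) (simp_all add: field_simps)
    finally show ?thesis .
  qed
qed

lemma prime_root_of_unity_power:
  fixes z :: complex
  assumes p: "Factorial_Ring.prime (p::nat)" and z: "z ^ p = 1" "z \<noteq> 1" and w: "w ^ p = 1"
  shows "\<exists>i<p. w = z ^ i"
proof -
  have "(\<Prod>i<p. w - z ^ i * 1) = 0" using power_diff_factor_roots_of_unity[OF p z, of w 1] w by simp
  then show ?thesis by (auto simp: prod_zero_iff)
qed

section \<open>Unicritical iteration modulo \<open>p\<close>\<close>

lemma inj_iterates_if_infinite:
  fixes f :: "'a \<Rightarrow> 'a"
  assumes inf: "infinite (range (\<lambda>k. (f ^^ k) x))" shows "inj (\<lambda>k::nat. (f ^^ k) x)"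
proof (rule injI, rule ccontr)
  have False if jk: "j < k" "(f ^^ j) x = (f ^^ k) x" for j k :: nat
  proof -
    have "(f ^^ i) x \<in> (\<lambda>k. (f ^^ k) x) ` {..<k}" for i
    proof (induction i rule: less_induct)
      case (less i)
      show ?case
      proof (cases "i < k")
        case False
        have "(f ^^ i) x = (f ^^ (i - k)) ((f ^^ k) x)"
          using False funpow_add[of "i - k" k f] by (simp add: fun_eq_iff)
        also have "\<dots> = (f ^^ (i - k + j)) x" using jk by (simp add: funpow_add)
        finally show ?thesis using less[of "i - k + j"] False jk by simp
      qed simp
    qed
    then have "range (\<lambda>k. (f ^^ k) x) \<subseteq> (\<lambda>k. (f ^^ k) x) ` {..<k}" by auto
    then have "finite (range (\<lambda>k. (f ^^ k) x))" by (rule finite_subset) simp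
    then show False using inf by simp
  qed
  then show "False" if "(f ^^ j) x = (f ^^ k) x" "j \<noteq> k" for j k
    using that by (metis nat_neq_iff)
qed

definition uni :: "nat \<Rightarrow> complex \<Rightarrow> complex \<Rightarrow> complex" where
  "uni q c x = x ^ q + c"

lemma uni_iterate_M:
  assumes "subfld E" "c \<in> E" "x \<in> E" shows "(uni q c ^^ k) x \<in> E"
  by (induction k) (simp_all add: uni_def subfldD[OF assms(1)] assms)

lemma algebraic_int_uni_iterate:
  assumes "algebraic_int c" "algebraic_int x" shows "algebraic_int ((uni q c ^^ k) x)"
  by (induction k) (simp_all add: uni_def algebraic_int_add algebraic_int_power assms)

text \<open>Raising to the power \<open>p ^ e\<close> is additive modulo \<open>p\<close>, so the
  iterates of \<open>x\<close> and of \<open>0\<close> separate.\<close>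

lemma uni_iterate_frobenius:
  assumes p: "Factorial_Ring.prime (p::nat)" and c: "algebraic_int c" and x: "algebraic_int x"
  shows "of_nat p advd ((uni (p ^ e) c ^^ k) x - (x ^ ((p ^ e) ^ k) + (uni (p ^ e) c ^^ k) 0))"
proof (induction k)
  case (Suc k)
  define a where "a = (uni (p ^ e) c ^^ k) x"
  define d where "d = (uni (p ^ e) c ^^ k) 0"
  define y where "y = x ^ ((p ^ e) ^ k)"
  have alg: "algebraic_int a" "algebraic_int d" "algebraic_int y"
    unfolding a_def d_def y_def using c x by (simp_all add: algebraic_int_uni_iterate algebraic_int_power)
  have "of_nat p advd (a ^ (p ^ e) - (y + d) ^ (p ^ e))"
    using Suc alg by (intro advd_power_diff algebraic_int_add) (simp_all add: a_def d_def y_def)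
  moreover have "of_nat p advd ((y + d) ^ (p ^ e) - (y ^ (p ^ e) + d ^ (p ^ e)))"
    using alg by (intro frobenius_add p)
  ultimately have "of_nat p advd (a ^ (p ^ e) - (y ^ (p ^ e) + d ^ (p ^ e)))" by (rule advd_diff_trans)
  moreover have "y ^ (p ^ e) = x ^ ((p ^ e) ^ Suc k)"
    unfolding y_def by (metis power_Suc2 power_mult)
  moreover have "(uni (p ^ e) c ^^ Suc k) x = a ^ (p ^ e) + c"
    by (simp add: a_def uni_def[of _ _ "(uni (p ^ e) c ^^ k) x"])
  moreover have "(uni (p ^ e) c ^^ Suc k) 0 = d ^ (p ^ e) + c"
    by (simp add: d_def uni_def[of _ _ "(uni (p ^ e) c ^^ k) 0"])
  ultimately show ?case by (simp only: add_diff_add diff_self add_0_right add.assoc[symmetric] add_diff_cancel_right)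
qed simp

text \<open>The powers of \<open>c\<close> lie in a module with at most \<open>B\<close> generators,
  which has at most \<open>p ^ B\<close> residues modulo \<open>p\<close>, one fewer than the
  exponents \<open>0\<close> to \<open>p ^ B\<close>. The bound depends on the degree of
  \<open>c\<close> alone.\<close>

lemma pigeonhole_power_congruence:
  fixes c :: complex
  assumes p: "Factorial_Ring.prime (p::nat)" and P: "lead_coeff P = 1" "\<And>i. Polynomial.coeff P i \<in> \<int>" "poly P c = 0"
    and d: "Polynomial.degree P \<le> B" and c: "algebraic_int c"
  shows "\<exists>i j. i < j \<and> j \<le> p ^ B \<and> of_nat p advd (c ^ (Q ^ i) - c ^ (Q ^ j))"
proof -
  have p0: "p > 0" using p prime_gt_0_nat by blast
  define d where "d = Polynomial.degree P"
  have dpos: "d > 0"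
  proof (rule ccontr)
    assume "\<not> d > 0"
    then have "P = 1" using P(1) d_def by (metis monic_degree_0 not_gr_zero)
    then show False using P(3) by simp
  qed
  obtain a where a: "\<And>i. Polynomial.coeff P i = of_int (a i)"
    using choice[of "\<lambda>i k. Polynomial.coeff P i = of_int k"] P(2) by (auto simp: Ints_def)
  define E where "E = (\<lambda>i. c ^ i) ` {..<d}"
  have finE: "finite E" and cardE: "card E \<le> d" unfolding E_def using card_image_le[of "{..<d}"] by auto
  have algE: "algebraic_int x" if "x \<in> E" for x using that c algebraic_int_power by (auto simp: E_def)
  have mem: "c ^ i \<in> zspan E" if "i < d" for i
    by (rule zspan_superset[OF finE]) (use that in \<open>simp add: E_def\<close>)
  have st: "c * x \<in> zspan E" if x: "x \<in> E" for x
  proof -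
    obtain i where i: "i < d" "x = c ^ i" using x by (auto simp: E_def)
    show ?thesis
    proof (cases "Suc i < d")
      case True
      then show ?thesis using mem[of "Suc i"] i by simp
    next
      case False
      then have "d = Suc i" using i by simp
      then have "c * x = c ^ d" using i by simp
      also have "\<dots> = (\<Sum>k<d. of_int (- a k) * c ^ k)"
        using monic_power_reduce[OF P(1,3)] by (simp add: d_def a sum_negf)
      also have "\<dots> \<in> zspan E" by (rule zspan_sum) (use mem in simp)
      finally show ?thesis .
    qed
  qed
  have pw: "c ^ k \<in> zspan E" for k
  proof (induction k)
    case 0
    then show ?case using mem[of 0] dpos by simp
  next
    case (Suc k)
    then show ?case using zspan_mult_closed[of E c "c ^ k"] st by simp
  qed
  have "\<exists>f\<in>E \<rightarrow>\<^sub>E {..<p}. of_nat p advd (c ^ k - (\<Sum>x\<in>E. of_nat (f x) * x))" for k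
  proof -
    obtain g where g: "c ^ k = (\<Sum>x\<in>E. of_int (g x) * x)" using pw[of k] by (auto simp: zspan_def)
    define f where "f = restrict (\<lambda>x. nat (g x mod int p)) E"
    have "f \<in> E \<rightarrow>\<^sub>E {..<p}" unfolding f_def using p0 by (auto simp: nat_less_iff)
    moreover have "c ^ k - (\<Sum>x\<in>E. of_nat (f x) * x) = (\<Sum>x\<in>E. of_nat p * (of_int (g x div int p) * x))"
      unfolding g sum_subtractf[symmetric]
    proof (rule sum.cong[OF refl])
      fix x assume x: "x \<in> E"
      have "g x = int p * (g x div int p) + int (f x)"
        using x p0 by (simp add: f_def)
      then have "of_int (g x) = (of_int (int p * (g x div int p) + int (f x)) :: complex)" by simp
      then have "of_int (g x) = (of_nat p * of_int (g x div int p) + of_nat (f x) :: complex)"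
        by (simp only: of_int_add of_int_mult of_int_of_nat_eq)
      then show "of_int (g x) * x - of_nat (f x) * x = of_nat p * (of_int (g x div int p) * x)"
        by (simp add: algebra_simps)
    qed
    moreover have "of_nat p advd (\<Sum>x\<in>E. of_nat p * (of_int (g x div int p) * x))"
    proof (rule advd_sum)
      fix x assume "x \<in> E"
      show "of_nat p advd (of_nat p * (of_int (g x div int p) * x))"
        by (rule advdI[OF algebraic_int_mult[OF algebraic_int_of_int' algE[OF \<open>x \<in> E\<close>]] refl])
    qed
    ultimately show ?thesis by (intro bexI[of _ f]) simp_all
  qed
  then obtain f where f: "\<And>k. f k \<in> E \<rightarrow>\<^sub>E {..<p}"
    "\<And>k. of_nat p advd (c ^ k - (\<Sum>x\<in>E. of_nat (f k x) * x))" by metis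
  have "card ((\<lambda>i. f (Q ^ i)) ` {..p ^ B}) \<le> card (E \<rightarrow>\<^sub>E {..<p})"
    using f(1) by (intro card_mono finite_PiE finE) auto
  also have "\<dots> = p ^ card E" using finE by (simp add: card_PiE)
  also have "\<dots> \<le> p ^ B" using cardE d p0 by (intro power_increasing) (simp_all add: d_def)
  finally have "\<not> inj_on (\<lambda>i. f (Q ^ i)) {..p ^ B}"
    by (intro notI) (drule card_image, simp)
  then obtain i j where ij: "i \<le> p ^ B" "j \<le> p ^ B" "i \<noteq> j" "f (Q ^ i) = f (Q ^ j)"
    by (auto simp: inj_on_def)
  have cong: "of_nat p advd (c ^ (Q ^ i) - c ^ (Q ^ j))" if "f (Q ^ i) = f (Q ^ j)" for i j
    using advd_diff_trans[OF f(2)[of "Q ^ i"], of "c ^ (Q ^ j)"] advd_diff_commute[OF f(2)[of "Q ^ j"]] that by simp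
  show ?thesis
  proof (cases "i < j")
    case True
    then show ?thesis using ij cong by blast
  next
    case False
    then have "j < i" using ij by simp
    then show ?thesis using ij cong[of j i] by metis
  qed
qed

text \<open>Modulo \<open>p\<close> the sequence \<open>c ^ (Q ^ m)\<close> is periodic from
  \<open>m = p ^ B\<close> on, with period at most \<open>p ^ B\<close>. The factorial is a multiple
  of every such period, and the outer exponent passes the preperiod, as \<open>p\<close>-power maps
  are additive modulo \<open>p\<close>. Both exponents are uniform in \<open>c\<close>.\<close>

lemma uniform_frobenius_period:
  fixes c :: complex
  assumes p: "Factorial_Ring.prime (p::nat)" and P: "lead_coeff P = 1" "\<And>i. Polynomial.coeff P i \<in> \<int>" "poly P c = 0"
    and d: "Polynomial.degree P \<le> B" and c: "algebraic_int c" and Q: "Q = p ^ a"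
  shows "of_nat p advd ((c ^ (Q ^ (fact (p ^ B) * r)) - c) ^ (Q ^ (p ^ B)))"
proof -
  obtain i j where ij: "i < j" "j \<le> p ^ B" "of_nat p advd (c ^ (Q ^ i) - c ^ (Q ^ j))"
    using pigeonhole_power_congruence[OF p P d c] by blast
  define k where "k = j - i"
  have ca: "algebraic_int (c ^ m)" for m using c by (rule algebraic_int_power)
  have step: "of_nat p advd (c ^ (Q ^ m) - c ^ (Q ^ (m + k)))" if m: "m \<ge> i" for m
  proof -
    have "of_nat p advd ((c ^ (Q ^ i)) ^ (Q ^ (m - i)) - (c ^ (Q ^ j)) ^ (Q ^ (m - i)))"
      by (rule advd_power_diff[OF ij(3) ca ca])
    moreover have "(c ^ (Q ^ i)) ^ (Q ^ (m - i)) = c ^ (Q ^ m)"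
      using m by (simp flip: power_mult power_add)
    moreover have "(c ^ (Q ^ j)) ^ (Q ^ (m - i)) = c ^ (Q ^ (m + k))"
    proof -
      have "j + (m - i) = m + k" using m ij by (simp add: k_def)
      then show ?thesis by (simp only: power_mult[symmetric] power_add[symmetric])
    qed
    ultimately show ?thesis by simp
  qed
  have steps: "of_nat p advd (c ^ (Q ^ (p ^ B)) - c ^ (Q ^ (p ^ B + k * m)))" for m
  proof (induction m)
    case (Suc m)
    have "of_nat p advd (c ^ (Q ^ (p ^ B + k * m)) - c ^ (Q ^ (p ^ B + k * m + k)))"
      using ij by (intro step) simp
    from advd_diff_trans[OF Suc this] show ?case by (simp add: algebra_simps)
  qed simp
  have "k dvd fact (p ^ B)" using ij by (intro dvd_fact) (simp_all add: k_def)
  then obtain m where m: "fact (p ^ B) = k * m" by (elim dvdE)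
  define N where "N = fact (p ^ B) * r"
  have 1: "of_nat p advd (c ^ (Q ^ (p ^ B + N)) - c ^ (Q ^ (p ^ B)))"
    using advd_diff_commute[OF steps[of "m * r"]] by (simp add: N_def m mult.assoc)
  have "Q ^ (p ^ B) = p ^ (a * p ^ B)" by (simp add: Q power_mult)
  then have "of_nat p advd ((c ^ (Q ^ N) - c) ^ (Q ^ (p ^ B)) - ((c ^ (Q ^ N)) ^ (Q ^ (p ^ B)) - c ^ (Q ^ (p ^ B))))"
    using frobenius_diff[OF p ca c, of "Q ^ N" "a * p ^ B"] by simp
  moreover have "(c ^ (Q ^ N)) ^ (Q ^ (p ^ B)) = c ^ (Q ^ (p ^ B + N))"
    by (simp add: add.commute flip: power_mult power_add)
  ultimately have "of_nat p advd ((c ^ (Q ^ N) - c) ^ (Q ^ (p ^ B)) - (c ^ (Q ^ (p ^ B + N)) - c ^ (Q ^ (p ^ B))))"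
    by (simp only:)
  then have "of_nat p advd ((c ^ (Q ^ N) - c) ^ (Q ^ (p ^ B)))" using 1 by (rule advd_cancel)
  then show ?thesis by (simp add: N_def)
qed

subsection \<open>Degrees along the orbit\<close>

text \<open>\<open>card_bz\<close> bounds the degree of the base field generated by \<open>b\<close>
  and \<open>z\<close>. \<open>B\<close> is a separate parameter so that constants built from it do
  not depend on \<open>\<alpha>\<close> or on the field \<open>M\<close> chosen for it.\<close>

locale unicritical_galois = galois +
  fixes p e n B :: nat and b z \<alpha> :: complex
  assumes p: "Factorial_Ring.prime p" and e: "e \<ge> 1" and n: "n \<ge> 1"
    and bM: "b \<in> M" and zM: "z \<in> M" and z: "z ^ p = 1" "z \<noteq> 1" and \<alpha>M: "\<alpha> \<in> M"
    and b_int: "algebraic_int b" and \<alpha>_int: "algebraic_int \<alpha>"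
    and periodic: "(uni (p ^ e) b ^^ n) 0 = 0"
    and wandering: "infinite (range (\<lambda>k. (uni (p ^ e) b ^^ k) \<alpha>))"
    and card_bz: "card ((\<lambda>s. (s b, s z)) ` G) \<le> B"
begin

abbreviation "F \<equiv> uni (p ^ e) b"
abbreviation "H \<equiv> stab b z"

lemma p0: "p > 0" using p prime_gt_0_nat by blast
lemma p2: "p \<ge> 2" using p by (rule prime_ge_2_nat)
lemma z0: "z \<noteq> 0" using z p0 by (auto simp: zero_power)

lemma H_G: "t \<in> H \<Longrightarrow> t \<in> G" and H_b: "t \<in> H \<Longrightarrow> t b = b" and H_z: "t \<in> H \<Longrightarrow> t z = z"
  by (auto simp: stab_def)

lemmas H = subgrp_stab[of b z]

lemma z_int: "algebraic_int z"
proof -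
  have "algebraic_int (z ^ p)" using z by simp
  then show ?thesis using algebraic_int_power_iff[OF p0] by blast
qed

text \<open>The intermediate stages between iterates of \<open>f\<close> isolate single
  \<open>p\<close>-th powers, the steps to which Kummer theory applies.\<close>

primrec Ph :: "nat \<Rightarrow> complex \<Rightarrow> complex" where
  "Ph 0 x = x"
| "Ph (Suc i) x = Ph i x ^ p + (if e dvd Suc i then b else 0)"

lemma Ph_power: "i < e \<Longrightarrow> Ph (e * j + i) x = Ph (e * j) x ^ (p ^ i)"
proof (induction i)
  case (Suc i)
  have "\<not> e dvd Suc (e * j + i)"
  proof
    assume "e dvd Suc (e * j + i)"
    then have "e dvd Suc i" using dvd_add_right_iff[of e "e * j" "Suc i"] by simp
    then show False using Suc.prems by (auto dest: dvd_imp_le)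
  qed
  moreover have "Ph (e * j + i) x = Ph (e * j) x ^ (p ^ i)" using Suc by simp
  ultimately show ?case by (simp flip: power_mult add: mult.commute)
qed simp

lemma Ph_eq_iterate: "Ph (e * j) x = (F ^^ j) x"
proof (induction j)
  case (Suc j)
  obtain i where i: "e = Suc i" using e by (cases e) auto
  have ee: "e * Suc j = Suc (e * j + i)" using i by simp
  have "e dvd Suc (e * j + i)" unfolding ee[symmetric] by (rule dvd_triv_left)
  then have "Ph (e * Suc j) x = Ph (e * j + i) x ^ p + b" unfolding ee by simp
  also have "Ph (e * j + i) x = Ph (e * j) x ^ (p ^ i)" by (rule Ph_power) (simp add: i)
  also have "(Ph (e * j) x ^ (p ^ i)) ^ p = Ph (e * j) x ^ (p ^ e)"
    by (simp add: i mult.commute flip: power_mult)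
  finally have "Ph (e * Suc j) x = (F ^^ j) x ^ (p ^ e) + b" by (simp only: Suc)
  then show ?case by (simp add: uni_def[of _ _ "(F ^^ j) x"])
qed simp

lemma Ph_M: "x \<in> M \<Longrightarrow> Ph i x \<in> M"
  by (induction i) (simp_all add: M bM)

lemma Ph_int: "algebraic_int x \<Longrightarrow> algebraic_int (Ph i x)"
  by (induction i) (simp_all add: algebraic_int_add algebraic_int_power b_int)

lemma Ph_H: "t \<in> H \<Longrightarrow> x \<in> M \<Longrightarrow> t (Ph i x) = Ph i (t x)"
  by (induction i) (simp_all add: add_G power_G Ph_M M bM H_G H_b zero_G)

lemma F_M: "x \<in> M \<Longrightarrow> (F ^^ k) x \<in> M"
  by (rule uni_iterate_M[OF subfld_M bM])

lemma F_int: "algebraic_int x \<Longrightarrow> algebraic_int ((F ^^ k) x)"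
  by (rule algebraic_int_uni_iterate[OF b_int])

lemma F_H: "t \<in> H \<Longrightarrow> x \<in> M \<Longrightarrow> t ((F ^^ k) x) = (F ^^ k) (t x)"
  using Ph_H[of t x "e * k"] by (simp add: Ph_eq_iterate)

lemma F_iterate_add: "(F ^^ j) ((F ^^ k) x) = (F ^^ (j + k)) x"
  by (simp add: funpow_add)

lemma F_inj: "(F ^^ j) \<alpha> = (F ^^ k) \<alpha> \<longleftrightarrow> j = k"
  using inj_iterates_if_infinite[OF wandering] by (auto simp: inj_def)

lemma F_neq_0: "(F ^^ j) \<alpha> \<noteq> 0"
proof
  assume 0: "(F ^^ j) \<alpha> = 0"
  have "(F ^^ (n + j)) \<alpha> = (F ^^ n) ((F ^^ j) \<alpha>)" by (simp add: funpow_add)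
  also have "\<dots> = (F ^^ j) \<alpha>" using 0 periodic by simp
  finally show False using F_inj[of "n + j" j] n by simp
qed

lemma Ph_neq_0: "Ph i \<alpha> \<noteq> 0"
proof -
  have "i = e * (i div e) + i mod e" by simp
  moreover have "i mod e < e" using e by simp
  ultimately have "Ph i \<alpha> = Ph (e * (i div e)) \<alpha> ^ (p ^ (i mod e))" using Ph_power by metis
  then show ?thesis using F_neq_0 by (simp add: Ph_eq_iterate)
qed

text \<open>The conjugates over the base field, so that the cardinality is a degree over it.\<close>

definition orbs :: "nat \<Rightarrow> complex set" where "orbs k = orb H (Ph k \<alpha>)"

definition ph :: "nat \<Rightarrow> complex \<Rightarrow> complex" where
  "ph k y = y ^ p + (if e dvd Suc k then b else 0)"

lemma orbs_Suc: "orbs (Suc k) = ph k ` orbs k"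
  unfolding orbs_def
proof -
  have "t (ph k (Ph k \<alpha>)) = ph k (t (Ph k \<alpha>))" if t: "t \<in> H" for t
    using t by (simp add: ph_def add_G power_G Ph_M M bM H_G H_b zero_G \<alpha>M)
  then have "orb H (ph k (Ph k \<alpha>)) = ph k ` orb H (Ph k \<alpha>)" by (rule orb_image_hom[OF H])
  then show "orb H (Ph (Suc k) \<alpha>) = ph k ` orb H (Ph k \<alpha>)" by (simp add: ph_def)
qed

lemma finite_orbs: "finite (orbs k)" and card_orbs_pos: "card (orbs k) > 0"
  and orbs_M: "y \<in> orbs k \<Longrightarrow> y \<in> M" and orbs_int: "y \<in> orbs k \<Longrightarrow> algebraic_int y"
  unfolding orbs_def using finite_orb[OF H] card_orb_pos[OF H] orb_subset_M[OF H Ph_M[OF \<alpha>M]]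
    algebraic_int_orb[OF H Ph_M[OF \<alpha>M] Ph_int[OF \<alpha>_int]] by blast+

lemma orbs_neq_0: "y \<in> orbs k \<Longrightarrow> y \<noteq> 0"
  unfolding orbs_def orb_def using eq_0_G H_G Ph_neq_0 by auto

lemma z_power_H: "t \<in> H \<Longrightarrow> t (z ^ i) = z ^ i"
  by (simp add: power_G[OF H_G zM] H_z)

text \<open>Because \<open>z\<close> is fixed by \<open>H\<close>, Kummer theory leaves only two possibilities for the step from
  \<open>x\<close> to \<open>x ^ p + c\<close>: the degree stays the same, or it drops by the factor \<open>p\<close>.\<close>

lemma orbs_z_closed:
  assumes ninj: "\<not> inj_on (ph k) (orbs k)" and y: "y \<in> orbs k"
  shows "z ^ i * y \<in> orbs k"
proof -
  obtain y1 y2 where y12: "y1 \<in> orbs k" "y2 \<in> orbs k" "y1 \<noteq> y2" "ph k y1 = ph k y2"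
    using ninj by (auto simp: inj_on_def)
  have y10: "y1 \<noteq> 0" using orbs_neq_0 y12 by blast
  have pw: "y1 ^ p = y2 ^ p" using y12(4) by (simp add: ph_def)
  define w where "w = y2 / y1"
  have w: "w ^ p = 1" unfolding w_def power_divide pw[symmetric] using y10 by simp
  have w1: "w \<noteq> 1" using y12 y10 by (simp add: w_def)
  obtain a where a: "w = z ^ a" using prime_root_of_unity_power[OF p z w] by blast
  obtain i0 where i0: "z = w ^ i0" using prime_root_of_unity_power[OF p w w1 z(1)] by blast
  have "orbs k = orb H y1" using orb_eq[OF H] y12(1) unfolding orbs_def by metis
  then obtain u where u: "u \<in> H" "y2 = u y1" using y12(2) by (auto simp: orb_def)
  have uw: "u y1 = w * y1" using u y10 by (simp add: w_def)
  have iter: "w ^ m * y1 \<in> orbs k" for m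
  proof (induction m)
    case 0
    then show ?case using y12 by simp
  next
    case (Suc m)
    have "u (w ^ m * y1) = w ^ m * u y1"
      using mult_G[OF H_G[OF u(1)], of "w ^ m" y1] orbs_M[OF y12(1)] z_power_H[OF u(1), of "a * m"] M(9)[OF zM]
      by (simp add: a flip: power_mult)
    also have "\<dots> = w ^ Suc m * y1" by (simp add: uw)
    finally show ?case using orb_mem_orb[OF H Suc[unfolded orbs_def] u(1)] by (simp add: orbs_def)
  qed
  have "z ^ i * y1 \<in> orbs k" using iter[of "i0 * i"] by (simp add: i0 power_mult)
  moreover obtain v where v: "v \<in> H" "y = v y1" using y \<open>orbs k = orb H y1\<close> by (auto simp: orb_def)
  moreover have "v (z ^ i * y1) = z ^ i * y"
    using mult_G[OF H_G[OF v(1)], of "z ^ i" y1] orbs_M[OF y12(1)] z_power_H[OF v(1)] M(9)[OF zM] v by simp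
  ultimately show ?thesis using orb_mem_orb[OF H, of "z ^ i * y1" "Ph k \<alpha>" v] by (simp add: orbs_def)
qed

text \<open>A single coincidence makes the whole orbit stable under multiplication by
  \<open>z\<close>, so every fibre consists of all \<open>p\<close> rotations of one point.\<close>

lemma orbs_fiber:
  assumes ninj: "\<not> inj_on (ph k) (orbs k)" and y: "y \<in> orbs k"
  shows "{w \<in> orbs k. ph k w = ph k y} = (\<lambda>i. z ^ i * y) ` {..<p}" (is "?A = ?B")
    and "inj_on (\<lambda>i. z ^ i * y) {..<p}"
proof -
  have y0: "y \<noteq> 0" using orbs_neq_0 y by blast
  show "inj_on (\<lambda>i. z ^ i * y) {..<p}"
    using prime_root_of_unity_inj_on[OF p z] y0 by (auto simp: inj_on_def)
  show "?A = ?B"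
  proof
    show "?A \<subseteq> ?B"
    proof
      fix w assume "w \<in> ?A"
      then have "w ^ p = y ^ p" by (simp add: ph_def)
      then have "(w / y) ^ p = 1" using y0 by (simp add: power_divide)
      then obtain i where "i < p" "w / y = z ^ i" using prime_root_of_unity_power[OF p z] by blast
      then show "w \<in> ?B" using y0 by (intro image_eqI[of _ _ i]) (simp_all add: field_simps)
    qed
    show "?B \<subseteq> ?A"
    proof clarify
      fix i
      have "(z ^ i * y) ^ p = (z ^ p) ^ i * y ^ p" by (simp add: power_mult_distrib mult.commute flip: power_mult)
      then show "z ^ i * y \<in> orbs k \<and> ph k (z ^ i * y) = ph k y"
        using orbs_z_closed[OF assms] z by (simp add: ph_def)
    qed
  qed
qed

section \<open>Steps that keep the degree, and the product of differences\<close>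

definition inj_step :: "nat \<Rightarrow> bool" where "inj_step k \<longleftrightarrow> inj_on (ph k) (orbs k)"

lemma card_orbs_Suc_inj: "inj_step k \<Longrightarrow> card (orbs (Suc k)) = card (orbs k)"
  by (simp add: orbs_Suc inj_step_def card_image)

lemma card_orbs_Suc_drop:
  assumes "\<not> inj_step k" shows "card (orbs k) = p * card (orbs (Suc k))"
proof -
  have ninj: "\<not> inj_on (ph k) (orbs k)" using assms by (simp add: inj_step_def)
  have "card (orbs k) = (\<Sum>w\<in>ph k ` orbs k. card {y \<in> orbs k. ph k y = w})"
    using finite_orbs card_eq_sum sum.image_gen[of "orbs k" "\<lambda>_. 1::nat" "ph k"] by simp
  also have "\<dots> = (\<Sum>w\<in>ph k ` orbs k. p)"
  proof (rule sum.cong[OF refl])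
    fix w assume "w \<in> ph k ` orbs k"
    then obtain y where y: "y \<in> orbs k" "w = ph k y" by blast
    show "card {y \<in> orbs k. ph k y = w} = p"
      using orbs_fiber[OF ninj y(1)] y by (simp add: card_image)
  qed
  finally show ?thesis by (simp add: orbs_Suc mult.commute)
qed

text \<open>Counts the degree-keeping steps among the first \<open>k\<close>; up to a bounded loss
  it is also the exponent of \<open>p\<close> in the product of differences.\<close>

primrec mm :: "nat \<Rightarrow> nat" where
  "mm 0 = 0"
| "mm (Suc k) = mm k + (if inj_step k then 1 else 0)"

lemma card_orbs_mm: "card (orbs k) * p ^ k = card (orbs 0) * p ^ mm k"
proof (induction k)
  case (Suc k)
  show ?case
  proof (cases "inj_step k")
    case True
    then show ?thesis using Suc by (simp add: card_orbs_Suc_inj mult.left_commute)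
  next
    case False
    then show ?thesis using Suc by (simp add: card_orbs_Suc_drop mult_ac)
  qed
qed simp

text \<open>The minimal polynomial of \<open>Ph k \<alpha>\<close> over the base field, evaluated at
  \<open>Ph k T\<close>.\<close>

definition dprod :: "complex \<Rightarrow> nat \<Rightarrow> complex" where
  "dprod T k = (\<Prod>y\<in>orbs k. Ph k T - y)"

lemma dprod_int: "algebraic_int T \<Longrightarrow> algebraic_int (dprod T k)"
  unfolding dprod_def by (rule algebraic_int_prod) (blast intro: algebraic_int_diff Ph_int orbs_int)

text \<open>Over one fibre of rotations of \<open>y\<close> the differences multiply to
  \<open>Ph k T ^ p - y ^ p\<close>, which is the new difference.\<close>

lemma dprod_Suc_drop:
  assumes "\<not> inj_step k" shows "dprod T (Suc k) = dprod T k"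
proof -
  have ninj: "\<not> inj_on (ph k) (orbs k)" using assms by (simp add: inj_step_def)
  have "dprod T k = (\<Prod>w\<in>ph k ` orbs k. \<Prod>y\<in>{y \<in> orbs k. ph k y = w}. Ph k T - y)"
    unfolding dprod_def by (rule prod.image_gen[OF finite_orbs])
  also have "\<dots> = (\<Prod>w\<in>ph k ` orbs k. Ph (Suc k) T - w)"
  proof (rule prod.cong[OF refl])
    fix w assume "w \<in> ph k ` orbs k"
    then obtain y where y: "y \<in> orbs k" "w = ph k y" by blast
    have "(\<Prod>y\<in>{y \<in> orbs k. ph k y = w}. Ph k T - y) = (\<Prod>i<p. Ph k T - z ^ i * y)"
      unfolding y(2) orbs_fiber(1)[OF ninj y(1)] by (subst prod.reindex[OF orbs_fiber(2)[OF ninj y(1)]]) simp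
    also have "\<dots> = Ph k T ^ p - y ^ p" by (rule power_diff_factor_roots_of_unity[OF p z, symmetric])
    also have "\<dots> = Ph (Suc k) T - w" by (simp add: y ph_def)
    finally show "(\<Prod>y\<in>{y \<in> orbs k. ph k y = w}. Ph k T - y) = Ph (Suc k) T - w" .
  qed
  finally show ?thesis by (simp add: dprod_def orbs_Suc)
qed

text \<open>By \<open>frobenius_diff_explicit\<close> each difference acquires a cofactor congruent
  to its power with exponent \<open>p - 1\<close>; \<open>W\<close> is the product of the
  cofactors.\<close>

lemma dprod_Suc_inj:
  assumes "inj_step k" and T: "algebraic_int T"
  shows "\<exists>W. algebraic_int W \<and> dprod T (Suc k) = dprod T k * W \<and> of_nat p advd (W - dprod T k ^ (p - 1))"
proof -
  have "\<exists>w. algebraic_int w \<and> Ph k T ^ p - y ^ p = (Ph k T - y) ^ p + of_nat p * (Ph k T - y) * w" if "y \<in> orbs k" for y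
    by (rule frobenius_diff_explicit[OF p Ph_int[OF T] orbs_int[OF that]])
  then obtain w where w: "\<And>y. y \<in> orbs k \<Longrightarrow> algebraic_int (w y)"
    "\<And>y. y \<in> orbs k \<Longrightarrow> Ph k T ^ p - y ^ p = (Ph k T - y) ^ p + of_nat p * (Ph k T - y) * w y" by metis
  define W where "W = (\<Prod>y\<in>orbs k. (Ph k T - y) ^ (p - 1) + of_nat p * w y)"
  have d: "algebraic_int (Ph k T - y)" if "y \<in> orbs k" for y
    using Ph_int[OF T] orbs_int[OF that] by (rule algebraic_int_diff)
  have g: "algebraic_int ((Ph k T - y) ^ (p - 1) + of_nat p * w y)" if "y \<in> orbs k" for y
    by (rule algebraic_int_add[OF algebraic_int_power[OF d[OF that]] algebraic_int_mult[OF algebraic_int_of_nat' w(1)[OF that]]])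
  have "dprod T (Suc k) = (\<Prod>y\<in>orbs k. Ph (Suc k) T - ph k y)"
    unfolding dprod_def orbs_Suc using assms(1) by (subst prod.reindex) (simp_all add: inj_step_def)
  also have "\<dots> = (\<Prod>y\<in>orbs k. (Ph k T - y) * ((Ph k T - y) ^ (p - 1) + of_nat p * w y))"
  proof (rule prod.cong[OF refl])
    fix y assume y: "y \<in> orbs k"
    have "Ph (Suc k) T - ph k y = (Ph k T - y) ^ p + of_nat p * (Ph k T - y) * w y"
      using w(2)[OF y] by (simp add: ph_def)
    also have "(Ph k T - y) ^ p = (Ph k T - y) * (Ph k T - y) ^ (p - 1)"
      using power_minus_mult[OF p0, of "Ph k T - y"] by (simp add: mult.commute)
    finally show "Ph (Suc k) T - ph k y = (Ph k T - y) * ((Ph k T - y) ^ (p - 1) + of_nat p * w y)"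
      by (simp only: distrib_left mult_ac)
  qed
  also have "\<dots> = dprod T k * W" by (simp add: dprod_def W_def prod.distrib)
  finally have 1: "dprod T (Suc k) = dprod T k * W" .
  have "of_nat p advd (W - (\<Prod>y\<in>orbs k. (Ph k T - y) ^ (p - 1)))"
    unfolding W_def
  proof (rule advd_prod_diff)
    fix y assume y: "y \<in> orbs k"
    show "of_nat p advd ((Ph k T - y) ^ (p - 1) + of_nat p * w y - (Ph k T - y) ^ (p - 1))"
      by (rule advdI[OF w(1)[OF y]]) simp
  qed (use g d algebraic_int_power in blast)+
  then have "of_nat p advd (W - dprod T k ^ (p - 1))" by (simp add: dprod_def prod_power_distrib)
  moreover have "algebraic_int W" unfolding W_def using g by (rule algebraic_int_prod)
  ultimately show ?thesis using 1 by blast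
qed

text \<open>Two estimates are carried together. The \<open>N\<close>-th power gains a factor
  \<open>p\<close> at each degree-keeping step, because the cofactor is a power of the product
  modulo \<open>p\<close>. Once \<open>mm k \<ge> N\<close>, the product itself is divisible by
  \<open>p\<close>, hence so is the cofactor, and from then on the product gains a full factor
  \<open>p\<close> each time. \<open>N\<close> is the loss up to that moment.\<close>

lemma dprod_close:
  assumes T: "algebraic_int T" and N: "N > 0" and base: "of_nat p advd (dprod T 0 ^ N)"
  shows "(of_nat p ^ (mm k - N)) advd dprod T k \<and> (of_nat p ^ (mm k + 1)) advd (dprod T k ^ N)"
proof (induction k)
  case 0
  then show ?case using base dprod_int[OF T, of 0] by (simp add: advd_1_iff)
next
  case (Suc k)
  have pne: "(of_nat p :: complex) \<noteq> 0" using p0 by simp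
  show ?case
  proof (cases "inj_step k")
    case False
    then show ?thesis using Suc by (simp add: dprod_Suc_drop)
  next
    case True
    define V where "V = dprod T k"
    have V: "algebraic_int V" unfolding V_def by (rule dprod_int[OF T])
    obtain W where W: "algebraic_int W" "dprod T (Suc k) = V * W" "of_nat p advd (W - V ^ (p - 1))"
      using dprod_Suc_inj[OF True T] by (auto simp: V_def)
    have IH: "(of_nat p ^ (mm k - N)) advd V" "(of_nat p ^ (mm k + 1)) advd (V ^ N)"
      using Suc by (simp_all add: V_def)
    have "of_nat p advd (of_nat p * of_nat p ^ mm k)"
      by (rule advdI[OF algebraic_int_power[OF algebraic_int_of_nat'] refl])
    then have "of_nat p advd (of_nat p ^ (mm k + 1))" by simp
    then have pVN: "of_nat p advd (V ^ N)" using IH(2) by (rule advd_trans)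
    have "of_nat p advd ((V ^ N) ^ (p - 1))"
      by (rule advd_power_self[OF pVN algebraic_int_power[OF V]]) (use p2 in simp)
    then have "of_nat p advd ((V ^ (p - 1)) ^ N)" by (simp add: mult.commute flip: power_mult)
    moreover have "of_nat p advd (W ^ N - (V ^ (p - 1)) ^ N)"
      by (rule advd_power_diff[OF W(3,1) algebraic_int_power[OF V]])
    ultimately have pWN: "of_nat p advd (W ^ N)"
      using advd_add[of "of_nat p" "W ^ N - (V ^ (p - 1)) ^ N" "(V ^ (p - 1)) ^ N"] by simp
    have "(of_nat p ^ (mm k + 1) * of_nat p) advd (V ^ N * W ^ N)" by (rule advd_mult[OF IH(2) pWN])
    then have 2: "(of_nat p ^ (mm (Suc k) + 1)) advd (dprod T (Suc k) ^ N)"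
      using True by (simp add: W(2) power_mult_distrib mult_ac)
    have "(of_nat p ^ (mm (Suc k) - N)) advd dprod T (Suc k)"
    proof (cases "mm k \<ge> N")
      case False
      then have "mm (Suc k) - N = 0" using True by simp
      then show ?thesis using dprod_int[OF T, of "Suc k"] by (simp add: advd_1_iff)
    next
      case le: True
      have "(of_nat p ^ N) advd (of_nat p ^ (mm k + 1))"
      proof (rule advdI)
        show "algebraic_int ((of_nat p :: complex) ^ (mm k + 1 - N))" by (intro algebraic_int_power algebraic_int_of_nat')
        show "(of_nat p :: complex) ^ (mm k + 1) = of_nat p ^ N * of_nat p ^ (mm k + 1 - N)"
          using le by (simp flip: power_add)
      qed
      then have "(of_nat p ^ N) advd (V ^ N)" using IH(2) by (rule advd_trans)
      \<comment> \<open>Integral closedness turns divisibility of \<open>V ^ N\<close> by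
        \<open>p ^ N\<close> into divisibility of \<open>V\<close> by \<open>p\<close>.\<close>
      then have "algebraic_int ((V / of_nat p) ^ N)"
        using pne by (simp add: advd_iff_divide power_divide)
      then have "of_nat p advd V"
        using algebraic_int_power_iff[OF N] advd_iff_divide[OF pne] by blast
      then have "of_nat p advd (V ^ (p - 1))" using V p2 by (intro advd_power_self) simp_all
      then have "of_nat p advd W"
        using advd_add[OF W(3), of "V ^ (p - 1)"] by simp
      then have "(of_nat p ^ (mm k - N) * of_nat p) advd (V * W)" by (rule advd_mult[OF IH(1)])
      moreover have "mm (Suc k) - N = Suc (mm k - N)" using True le by simp
      ultimately show ?thesis by (simp add: W(2) mult.commute)
    qed
    then show ?thesis using 2 by blast
  qed
qed

section \<open>Frobenius on the base field\<close>

text \<open>\<open>Q\<close> is the degree of \<open>F ^^ n\<close>, which fixes \<open>0\<close>.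
  For elements of degree at most \<open>B\<close>, \<open>L\<close> is a common period of the
  \<open>Q\<close>-th power map modulo \<open>p\<close>, and \<open>Mx\<close> is the exponent that
  passes the preperiod.\<close>

definition Q :: nat where "Q = (p ^ e) ^ n"
definition L :: nat where "L = fact (p ^ B)"
definition Mx :: nat where "Mx = Q ^ (p ^ B)"

lemma Q_p: "Q = p ^ (e * n)" by (simp add: Q_def power_mult)
lemma Mx_p: "Mx = p ^ (e * n * p ^ B)" by (simp add: Mx_def Q_p flip: power_mult)
lemma Mx_pos: "Mx > 0" using p0 by (simp add: Mx_p)

lemma F_frobenius:
  assumes x: "algebraic_int x" shows "of_nat p advd ((F ^^ (n * j)) x - x ^ (Q ^ j))"
proof (induction j)
  case (Suc j)
  define y where "y = (F ^^ (n * j)) x"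
  have y: "algebraic_int y" unfolding y_def by (rule F_int[OF x])
  have "(F ^^ (n * Suc j)) x = (F ^^ n) y" by (simp add: y_def funpow_add)
  moreover have "of_nat p advd ((F ^^ n) y - y ^ Q)"
    using uni_iterate_frobenius[OF p b_int y, where e = e and k = n] periodic by (simp add: Q_def)
  moreover have "of_nat p advd (y ^ Q - (x ^ (Q ^ j)) ^ Q)"
    using Suc by (intro advd_power_diff y algebraic_int_power x) (simp add: y_def)
  ultimately have "of_nat p advd ((F ^^ (n * Suc j)) x - (x ^ (Q ^ j)) ^ Q)"
    using advd_diff_trans by metis
  moreover have "(x ^ (Q ^ j)) ^ Q = x ^ (Q ^ Suc j)" by (simp add: mult.commute flip: power_mult)
  ultimately show ?case by metis
qed simp

text \<open>An element of the base field has at most \<open>B\<close> conjugates, so the uniform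
  period applies to it.\<close>

lemma H_fixed_frobenius:
  assumes c: "c \<in> M" "algebraic_int c" and fixed: "\<And>t. t \<in> H \<Longrightarrow> t c = c"
  shows "of_nat p advd ((c ^ (Q ^ (L * r)) - c) ^ Mx)"
proof -
  have "orb H c = {c}" using fixed orb_self[OF H, of c] by (auto simp: orb_def)
  then have "card (orb G c) \<le> B" using card_orb_G_le[of c b z] card_bz by simp
  moreover have "lead_coeff (root_poly (orb G c)) = 1"
    using lead_coeff_root_poly by (simp add: degree_root_poly)
  ultimately show ?thesis unfolding Mx_def L_def
    using uniform_frobenius_period[OF p, of "root_poly (orb G c)" c B Q "e * n" r]
      coeff_root_poly_orb_Ints[OF c] poly_root_poly_orb[OF subgrp_G, of c] c(2) Q_p
    by (simp add: degree_root_poly)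
qed

text \<open>Let \<open>R\<close> be the minimal polynomial of \<open>\<alpha>\<close> over the base
  field. Raising its equation at \<open>\<alpha>\<close> to the power \<open>Q'\<close> gives,
  modulo \<open>p\<close>, an equation for \<open>\<alpha> ^ Q'\<close> whose coefficients are the
  \<open>Q'\<close>-th powers. These agree with the coefficients of \<open>R\<close> up to
  nilpotents, and \<open>T\<close> is congruent to \<open>\<alpha> ^ Q'\<close>, so \<open>R\<close>
  at \<open>T\<close> is nilpotent modulo \<open>p\<close>, with exponent \<open>Mx\<close>.\<close>

lemma dprod_base: "of_nat p advd (dprod ((F ^^ (n * (L * r))) \<alpha>) 0 ^ Mx)"
proof -
  define T where "T = (F ^^ (n * (L * r))) \<alpha>"
  define Q' where "Q' = Q ^ (L * r)"
  define R where "R = root_poly (orbs 0)"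
  define c where "c i = Polynomial.coeff R i" for i
  define d where "d = card (orbs 0)"
  have Q'p: "Q' = p ^ (e * n * (L * r))" by (simp add: Q'_def Q_p flip: power_mult)
  have T: "algebraic_int T" unfolding T_def by (rule F_int[OF \<alpha>_int])
  have orb0: "orbs 0 = orb H \<alpha>" by (simp add: orbs_def)
  have cM: "c i \<in> M" for i unfolding c_def R_def
    using finite_orbs orbs_M by (intro coeff_root_poly_M) auto
  have ci: "algebraic_int (c i)" for i unfolding c_def R_def
    using finite_orbs orbs_int by (intro algebraic_int_coeff_root_poly)
  have cfix: "t (c i) = c i" if "t \<in> H" for t i unfolding c_def R_def orb0
    by (rule coeff_root_poly_orb_fixed[OF H \<alpha>M that])
  have ap: "algebraic_int (\<alpha> ^ k)" for k using \<alpha>_int by (rule algebraic_int_power)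
  have polyR: "poly R x = (\<Sum>i\<le>d. c i * x ^ i)" for x
    unfolding poly_altdef c_def by (simp add: R_def d_def degree_root_poly)
  have "of_nat p advd (dprod T 0 - poly R (\<alpha> ^ Q'))"
    unfolding dprod_def R_def poly_root_poly
  proof (rule advd_prod_diff)
    fix y assume y: "y \<in> orbs 0"
    show "of_nat p advd ((Ph 0 T - y) - (\<alpha> ^ Q' - y))"
      using F_frobenius[OF \<alpha>_int, of "L * r"] by (simp add: T_def Q'_def)
    show "algebraic_int (Ph 0 T - y)" "algebraic_int (\<alpha> ^ Q' - y)"
      using T orbs_int[OF y] ap by (simp_all add: algebraic_int_diff)
  qed
  moreover have "of_nat p advd (poly R (\<alpha> ^ Q') - (\<Sum>i\<le>d. (c i - c i ^ Q') * (\<alpha> ^ i) ^ Q'))"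
  proof -
    have "of_nat p advd ((\<Sum>i\<le>d. c i * \<alpha> ^ i) ^ Q' - (\<Sum>i\<le>d. (c i * \<alpha> ^ i) ^ Q'))"
      unfolding Q'p by (rule frobenius_sum[OF p]) (rule algebraic_int_mult[OF ci ap])
    moreover have "(\<Sum>i\<le>d. c i * \<alpha> ^ i) = 0"
      using poly_root_poly_orb[OF H, of \<alpha>] polyR[of \<alpha>] by (simp add: R_def orb0)
    moreover have "Q' > 0" using p0 by (simp add: Q'p)
    ultimately have "of_nat p advd (\<Sum>i\<le>d. (c i * \<alpha> ^ i) ^ Q')"
      using advd_minus by (fastforce simp: zero_power)
    moreover have "poly R (\<alpha> ^ Q') - (\<Sum>i\<le>d. (c i - c i ^ Q') * (\<alpha> ^ i) ^ Q') = (\<Sum>i\<le>d. (c i * \<alpha> ^ i) ^ Q')"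
      unfolding polyR sum_subtractf[symmetric]
      by (rule sum.cong[OF refl]) (simp add: algebra_simps power_mult_distrib flip: power_mult)
    ultimately show ?thesis by simp
  qed
  ultimately have 1: "of_nat p advd (dprod T 0 - (\<Sum>i\<le>d. (c i - c i ^ Q') * (\<alpha> ^ i) ^ Q'))"
    by (rule advd_diff_trans)
  define S where "S = (\<Sum>i\<le>d. (c i - c i ^ Q') * (\<alpha> ^ i) ^ Q')"
  have t: "algebraic_int ((c i - c i ^ Q') * (\<alpha> ^ i) ^ Q')" for i
    by (rule algebraic_int_mult[OF algebraic_int_diff[OF ci algebraic_int_power[OF ci]] algebraic_int_power[OF ap]])
  have S: "algebraic_int S" unfolding S_def by (rule algebraic_int_sum) (rule t)
  have "of_nat p advd (S ^ Mx - (\<Sum>i\<le>d. ((c i - c i ^ Q') * (\<alpha> ^ i) ^ Q') ^ Mx))"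
    unfolding S_def Mx_p by (rule frobenius_sum[OF p]) (rule t)
  moreover have "of_nat p advd (\<Sum>i\<le>d. ((c i - c i ^ Q') * (\<alpha> ^ i) ^ Q') ^ Mx)"
  proof (rule advd_sum)
    fix i
    have "of_nat p advd ((c i ^ Q' - c i) ^ Mx)"
      unfolding Q'_def using cM ci cfix by (intro H_fixed_frobenius)
    then have "of_nat p advd ((-1) ^ Mx * (c i ^ Q' - c i) ^ Mx)"
      by (intro advd_mult_left algebraic_int_power) simp_all
    then have "of_nat p advd ((c i - c i ^ Q') ^ Mx)"
      by (simp flip: power_mult_distrib)
    then show "of_nat p advd (((c i - c i ^ Q') * (\<alpha> ^ i) ^ Q') ^ Mx)"
      unfolding power_mult_distrib by (intro advd_mult_right algebraic_int_power \<alpha>_int)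
  qed
  ultimately have "of_nat p advd (S ^ Mx)"
    using advd_add[of "of_nat p" "S ^ Mx - (\<Sum>i\<le>d. ((c i - c i ^ Q') * (\<alpha> ^ i) ^ Q') ^ Mx)"] by fastforce
  moreover have "of_nat p advd (dprod T 0 ^ Mx - S ^ Mx)"
    using 1 dprod_int[OF T] S by (intro advd_power_diff) (simp_all add: S_def)
  ultimately show ?thesis
    using advd_add[of "of_nat p" "dprod T 0 ^ Mx - S ^ Mx" "S ^ Mx"] by (simp add: T_def)
qed

lemma dprod_advd: "(of_nat p ^ (mm k - Mx)) advd dprod ((F ^^ (n * (L * r))) \<alpha>) k"
  using dprod_close[OF F_int[OF \<alpha>_int] Mx_pos dprod_base] by blast

end

subsection \<open>The radical of a rational prime\<close>

text \<open>Membership in all primes above \<open>p\<close>, phrased as nilpotence modulo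
  \<open>p\<close> so that no prime ideal has to be introduced.\<close>

definition in_rad :: "nat \<Rightarrow> complex \<Rightarrow> bool" where
  "in_rad p x \<longleftrightarrow> algebraic_int x \<and> (\<exists>j>0. of_nat p advd (x ^ j))"

lemma in_rad_0: "in_rad p 0"
  unfolding in_rad_def by (intro conjI exI[of _ 1]) simp_all

lemma in_rad_prime_power:
  assumes p: "Factorial_Ring.prime (p::nat)" and x: "in_rad p x"
  shows "\<exists>a. \<forall>a'\<ge>a. of_nat p advd (x ^ (p ^ a'))"
proof -
  obtain j where j: "j > 0" "of_nat p advd (x ^ j)" and xi: "algebraic_int x" using x by (auto simp: in_rad_def)
  have "of_nat p advd (x ^ (p ^ a'))" if "a' \<ge> j" for a'
  proof -
    have "j \<le> p ^ a'" using that power_gt_expt[of p a'] prime_gt_1_nat[OF p] by simp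
    then have "x ^ (p ^ a') = x ^ j * x ^ (p ^ a' - j)" by (simp flip: power_add)
    then show ?thesis using advd_mult_right[OF j(2) algebraic_int_power[OF xi]] by simp
  qed
  then show ?thesis by blast
qed

lemma in_rad_add:
  assumes p: "Factorial_Ring.prime (p::nat)" and x: "in_rad p x" and y: "in_rad p y"
  shows "in_rad p (x + y)"
proof -
  have int: "algebraic_int x" "algebraic_int y" using x y by (auto simp: in_rad_def)
  obtain a c where "\<forall>a'\<ge>a. of_nat p advd (x ^ (p ^ a'))" "\<forall>a'\<ge>c. of_nat p advd (y ^ (p ^ a'))"
    using in_rad_prime_power[OF p] x y by metis
  then have "of_nat p advd (x ^ (p ^ max a c) + y ^ (p ^ max a c))" by (intro advd_add) simp_all
  then have "of_nat p advd ((x + y) ^ (p ^ max a c))"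
    using advd_cancel[OF frobenius_add[OF p int]] by blast
  moreover have "p ^ max a c > 0" using p prime_gt_0_nat by simp
  ultimately show ?thesis unfolding in_rad_def using int algebraic_int_add by blast
qed

lemma in_rad_mult:
  assumes x: "in_rad p x" and y: "algebraic_int y" shows "in_rad p (x * y)"
proof -
  obtain j where j: "j > 0" "of_nat p advd (x ^ j)" using x by (auto simp: in_rad_def)
  have "of_nat p advd ((x * y) ^ j)"
    unfolding power_mult_distrib using advd_mult_right[OF j(2) algebraic_int_power[OF y]] .
  moreover have "algebraic_int (x * y)" using x y by (auto simp: in_rad_def intro: algebraic_int_mult)
  ultimately show ?thesis using j(1) unfolding in_rad_def by blast
qed

lemma in_rad_power_cancel:
  assumes "in_rad p (x ^ k)" "k > 0" "algebraic_int x" shows "in_rad p x"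
proof -
  obtain j where "j > 0" "of_nat p advd ((x ^ k) ^ j)" using assms by (auto simp: in_rad_def)
  then have "k * j > 0" "of_nat p advd (x ^ (k * j))" using assms by (simp_all add: power_mult)
  then show ?thesis unfolding in_rad_def using assms by blast
qed

lemma in_rad_advd: "of_nat p advd x \<Longrightarrow> algebraic_int x \<Longrightarrow> in_rad p x"
  unfolding in_rad_def by (intro conjI exI[of _ 1]) simp_all

lemma in_rad_cong:
  assumes p: "Factorial_Ring.prime (p::nat)" and "in_rad p y" "of_nat p advd (x - y)" "algebraic_int x"
  shows "in_rad p x"
proof -
  have "algebraic_int y" using assms by (simp add: in_rad_def)
  then have "in_rad p (x - y)" using assms by (intro in_rad_advd algebraic_int_diff)
  from in_rad_add[OF p this assms(2)] show ?thesis by simp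
qed

text \<open>The quotient of \<open>X ^ p - 1\<close> by \<open>X - 1\<close>, evaluated at
  \<open>1\<close> once as a geometric sum and once as a product.\<close>

lemma prod_one_minus_roots_of_unity:
  fixes z :: complex
  assumes p: "Factorial_Ring.prime (p::nat)" and z: "z ^ p = 1" "z \<noteq> 1"
  shows "(\<Prod>i=1..<p. 1 - z ^ i) = of_nat p"
proof -
  have p0: "p > 0" using p prime_gt_0_nat by blast
  define A where "A = (\<Sum>j<p. Polynomial.monom (1::complex) j)"
  define B where "B = (\<Prod>i=1..<p. [:- (z ^ i), 1:])"
  have "poly (A * [:-1, 1:]) x = poly (B * [:-1, 1:]) x" for x
  proof -
    have "poly (A * [:-1, 1:]) x = (\<Sum>j<p. x ^ j) * (x - 1)"
      by (simp add: A_def poly_sum poly_monom algebra_simps)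
    also have "\<dots> = (x - 1) * (\<Sum>j<p. x ^ j)" by (rule mult.commute)
    also have "\<dots> = x ^ p - 1" by (rule power_diff_1_eq[symmetric])
    also have "\<dots> = (\<Prod>i<p. x - z ^ i)"
      using power_diff_factor_roots_of_unity[OF p z, of x 1] by simp
    also have "{..<p} = insert 0 {1..<p}" using p0 by auto
    also have "(\<Prod>i\<in>insert 0 {1..<p}. x - z ^ i) = (x - 1) * (\<Prod>i=1..<p. x - z ^ i)" by simp
    also have "\<dots> = poly (B * [:-1, 1:]) x" by (simp add: B_def poly_prod algebra_simps)
    finally show ?thesis .
  qed
  then have "poly (A * [:-1, 1:]) = poly (B * [:-1, 1:])" by blast
  then have "A * [:-1, 1:] = B * [:-1, 1:]" by (simp only: poly_eq_poly_eq_iff)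
  then have "A = B" by (subst (asm) mult_cancel_right) simp
  then have "poly A 1 = poly B 1" by simp
  then show ?thesis by (simp add: A_def B_def poly_sum poly_monom poly_prod)
qed

text \<open>\<open>1 - z\<close> and \<open>1 - z ^ i\<close> divide each other, since
  \<open>z\<close> is in turn a power of \<open>z ^ i\<close>. So \<open>p\<close>, the product of
  the \<open>1 - z ^ i\<close>, is a unit times \<open>(1 - z) ^ (p - 1)\<close>.\<close>

lemma cyclotomic_unit:
  fixes z :: complex
  assumes p: "Factorial_Ring.prime (p::nat)" and z: "z ^ p = 1" "z \<noteq> 1"
  obtains g h where "algebraic_int g" "algebraic_int h" "g * h = 1" "(1 - z) ^ (p - 1) = of_nat p * h"
proof -
  have p0: "p > 0" using p prime_gt_0_nat by blast
  have "algebraic_int (z ^ p)" using z by simp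
  then have zi: "algebraic_int z" using algebraic_int_power_iff[OF p0] by blast
  have zk: "algebraic_int (z ^ k)" for k using zi by (rule algebraic_int_power)
  have "\<exists>a. algebraic_int a \<and> 1 - z ^ i = (1 - z) * a" for i
  proof -
    have "1 - z ^ i = (1 - z) * (\<Sum>j<i. z ^ j)" by (rule one_diff_power_eq)
    moreover have "algebraic_int (\<Sum>j<i. z ^ j)" by (rule algebraic_int_sum) (rule zk)
    ultimately show ?thesis by blast
  qed
  then obtain a where a: "\<And>i. algebraic_int (a i)" "\<And>i. 1 - z ^ i = (1 - z) * a i" by metis
  have "\<exists>c. algebraic_int c \<and> 1 - z = (1 - z ^ i) * c" if i: "i \<in> {1..<p}" for i
  proof -
    have "z ^ i \<noteq> 1" using prime_root_of_unity_inj[OF p z] i by simp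
    moreover have "(z ^ i) ^ p = 1" by (simp add: power_mult[symmetric] mult.commute[of i] power_mult z)
    ultimately obtain m where m: "z = (z ^ i) ^ m"
      using prime_root_of_unity_power[OF p _ _ z(1), of "z ^ i"] by blast
    have "1 - (z ^ i) ^ m = (1 - z ^ i) * (\<Sum>j<m. (z ^ i) ^ j)" by (rule one_diff_power_eq)
    moreover have "algebraic_int (\<Sum>j<m. (z ^ i) ^ j)"
      by (rule algebraic_int_sum) (rule algebraic_int_power[OF zk])
    ultimately show ?thesis using m by metis
  qed
  then obtain c where c: "\<And>i. i \<in> {1..<p} \<Longrightarrow> algebraic_int (c i)"
    "\<And>i. i \<in> {1..<p} \<Longrightarrow> 1 - z = (1 - z ^ i) * c i" by metis
  define g where "g = (\<Prod>i=1..<p. a i)"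
  define h where "h = (\<Prod>i=1..<p. c i)"
  have "(1 - z) ^ (p - 1) = (\<Prod>i=1..<p. 1 - z)" by simp
  also have "\<dots> = (\<Prod>i=1..<p. (1 - z ^ i) * c i)" by (rule prod.cong[OF refl]) (rule c(2))
  also have "\<dots> = of_nat p * h" by (simp only: prod.distrib prod_one_minus_roots_of_unity[OF p z] h_def)
  finally have 1: "(1 - z) ^ (p - 1) = of_nat p * h" .
  have "of_nat p = (\<Prod>i=1..<p. 1 - z ^ i)" by (simp only: prod_one_minus_roots_of_unity[OF p z])
  also have "\<dots> = (\<Prod>i=1..<p. (1 - z) * a i)" by (rule prod.cong[OF refl]) (rule a(2))
  also have "\<dots> = (1 - z) ^ (p - 1) * g" unfolding prod.distrib g_def by simp
  finally have "of_nat p = of_nat p * (g * h)" using 1 by (simp add: mult_ac)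
  then have "g * h = 1" using p0 by simp
  moreover have "algebraic_int g" unfolding g_def by (rule algebraic_int_prod) (rule a(1))
  moreover have "algebraic_int h" unfolding h_def by (rule algebraic_int_prod) (rule c(1))
  ultimately show ?thesis using 1 that by blast
qed

context galois
begin

text \<open>If \<open>p\<close> is up to a factor outside its radical an \<open>N\<close>-th power of \<open>x\<close>, some prime above \<open>p\<close> has
  ramification index at least \<open>N\<close>; the argument inspects the lowest coefficient prime to \<open>p\<close>
  in the equation of \<open>x\<close>.\<close>

lemma card_orb_ge_ramification:
  assumes p: "Factorial_Ring.prime (p::nat)" and x: "x \<in> M" "algebraic_int x" and N: "N > 0"
    and w: "x ^ N = of_nat p * w" "algebraic_int w" "\<not> in_rad p w"
  shows "N \<le> card (orb G x)"
proof (rule ccontr)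
  assume "\<not> N \<le> card (orb G x)"
  define d where "d = card (orb G x)"
  have dN: "d < N" using \<open>\<not> N \<le> _\<close> by (simp add: d_def)
  define R where "R = root_poly (orb G x)"
  have "Polynomial.coeff R i \<in> \<int>" for i unfolding R_def by (rule coeff_root_poly_orb_Ints[OF x])
  then obtain a where a: "\<And>i. Polynomial.coeff R i = of_int (a i)"
    using choice[of "\<lambda>i k. Polynomial.coeff R i = of_int k"] by (auto simp: Ints_def)
  have dR: "Polynomial.degree R = d" by (simp add: R_def d_def degree_root_poly)
  have ad: "a d = 1" using lead_coeff_root_poly[of "orb G x"] a[of d] by (simp add: R_def d_def)
  have p1: "\<not> int p dvd 1" using prime_gt_1_nat[OF p] by simp
  define i0 where "i0 = (LEAST i. \<not> int p dvd a i)"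
  have i0: "\<not> int p dvd a i0" unfolding i0_def by (rule LeastI[of _ d]) (use ad p1 in simp)
  have i0d: "i0 \<le> d" unfolding i0_def by (rule Least_le) (use ad p1 in simp)
  have lt: "int p dvd a i" if "i < i0" for i using not_less_Least[of i "\<lambda>i. \<not> int p dvd a i"] that by (simp add: i0_def)
  have x0: "x \<noteq> 0"
  proof
    assume "x = 0"
    then have "w = 0" using w(1) N prime_gt_0_nat[OF p] by (simp add: zero_power)
    then show False using w(3) in_rad_0 by simp
  qed
  have "poly R x = 0" unfolding R_def by (rule poly_root_poly_orb[OF subgrp_G])
  then have "(\<Sum>i\<le>d. of_int (a i) * x ^ i) = 0"
    unfolding poly_altdef dR a .
  also have "{..d} = {..<i0} \<union> insert i0 {i0<..d}" using i0d by auto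
  also have "(\<Sum>i\<in>{..<i0} \<union> insert i0 {i0<..d}. of_int (a i) * x ^ i) =
     (\<Sum>i<i0. of_int (a i) * x ^ i) + (of_int (a i0) * x ^ i0 + (\<Sum>i\<in>{i0<..d}. of_int (a i) * x ^ i))"
    by (subst sum.union_disjoint) auto
  finally have rel: "of_int (a i0) * x ^ i0 = - (\<Sum>i<i0. of_int (a i) * x ^ i) - (\<Sum>i\<in>{i0<..d}. of_int (a i) * x ^ i)"
    by (simp add: algebra_simps eq_neg_iff_add_eq_0)
  have xk: "algebraic_int (x ^ k)" for k using x(2) by (rule algebraic_int_power)
  \<comment> \<open>After multiplication by \<open>w\<close>, a term below \<open>i0\<close>
    contains \<open>p * w = x ^ N\<close> and a term above it contains \<open>x ^ Suc i0\<close>.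
    Since \<open>i0 \<le> d < N\<close>, both are multiples of \<open>x ^ Suc i0\<close>; cancelling
    \<open>x ^ i0\<close> will leave \<open>w * a i0 = x * t\<close>.\<close>
  define t where "t = - (\<Sum>i<i0. of_int (a i div int p) * x ^ (N + i - Suc i0)) - w * (\<Sum>i\<in>{i0<..d}. of_int (a i) * x ^ (i - Suc i0))"
  have t: "algebraic_int t" unfolding t_def
    by (intro algebraic_int_diff algebraic_int_mult algebraic_int_sum w(2) algebraic_int_of_int' xk algebraic_int_minus)
  have s1: "w * (\<Sum>i<i0. of_int (a i) * x ^ i) = x ^ Suc i0 * (\<Sum>i<i0. of_int (a i div int p) * x ^ (N + i - Suc i0))"
    unfolding sum_distrib_left
  proof (rule sum.cong[OF refl])
    fix i assume i: "i \<in> {..<i0}"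
    have "a i = int p * (a i div int p)" using lt i by simp
    then have "of_int (a i) = (of_nat p * of_int (a i div int p) :: complex)"
      by (metis of_int_mult of_int_of_nat_eq)
    then have "w * (of_int (a i) * x ^ i) = of_int (a i div int p) * ((of_nat p * w) * x ^ i)" by (simp only: mult_ac)
    also have "\<dots> = of_int (a i div int p) * x ^ (N + i)" by (simp only: w(1)[symmetric] power_add)
    also have "x ^ (N + i) = x ^ Suc i0 * x ^ (N + i - Suc i0)"
      using i0d dN power_add[of x "Suc i0" "N + i - Suc i0"] by simp
    finally show "w * (of_int (a i) * x ^ i) = x ^ Suc i0 * (of_int (a i div int p) * x ^ (N + i - Suc i0))"
      by (simp only: mult_ac)
  qed
  have s2: "(\<Sum>i\<in>{i0<..d}. of_int (a i) * x ^ i) = x ^ Suc i0 * (\<Sum>i\<in>{i0<..d}. of_int (a i) * x ^ (i - Suc i0))"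
    unfolding sum_distrib_left
  proof (rule sum.cong[OF refl])
    fix i assume i: "i \<in> {i0<..d}"
    have "x ^ i = x ^ Suc i0 * x ^ (i - Suc i0)"
      using i power_add[of x "Suc i0" "i - Suc i0"] by simp
    then show "of_int (a i) * x ^ i = x ^ Suc i0 * (of_int (a i) * x ^ (i - Suc i0))" by (simp only: mult_ac)
  qed
  have "x ^ i0 * (w * of_int (a i0)) = w * (of_int (a i0) * x ^ i0)" by (simp only: mult_ac)
  also have "\<dots> = - (w * (\<Sum>i<i0. of_int (a i) * x ^ i)) - w * (\<Sum>i\<in>{i0<..d}. of_int (a i) * x ^ i)"
    unfolding rel by (simp only: right_diff_distrib mult_minus_right)
  also have "\<dots> = x ^ Suc i0 * t"
    unfolding s1 s2 t_def by (simp only: right_diff_distrib mult_minus_right mult_ac)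
  finally have "x ^ i0 * (w * of_int (a i0)) = x ^ i0 * (x * t)" by (simp add: mult_ac)
  then have wa: "w * of_int (a i0) = x * t" using x0 by simp
  \<comment> \<open>The \<open>N\<close>-th power brings back \<open>x ^ N = p * w\<close>. As
    \<open>a i0\<close> is invertible modulo \<open>p\<close>, this puts \<open>w\<close> into the
    radical, a contradiction.\<close>
  have "(w * of_int (a i0)) ^ N = of_nat p * (w * t ^ N)"
    unfolding wa power_mult_distrib w(1) by (simp only: mult_ac)
  then have 1: "of_nat p advd ((w * of_int (a i0)) ^ N)"
    using algebraic_int_mult[OF w(2) algebraic_int_power[OF t]] by (intro advdI)
  have "Factorial_Ring.prime (int p)" using p by simp
  from prime_imp_coprime[OF this i0] have "gcd (a i0) (int p) = 1" by (simp add: gcd.commute coprime_iff_gcd_eq_1)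
  then obtain u v where "u * a i0 + v * int p = 1" using bezout_int[of "a i0" "int p"] by auto
  then have uv: "a i0 * u + int p * v = 1" by (simp add: mult.commute)
  have "of_nat p advd ((w * of_int (a i0)) ^ N * of_int u ^ N)"
    using 1 by (rule advd_mult_right) (rule algebraic_int_power[OF algebraic_int_of_int'])
  then have 2: "of_nat p advd ((w * of_int (a i0 * u)) ^ N)" by (simp add: power_mult_distrib mult.assoc)
  have "w * of_int (a i0 * u) = w - of_nat p * (w * of_int v)"
  proof -
    have c: "of_int (a i0 * u) = (1 - of_nat p * of_int v :: complex)"
      using arg_cong[OF uv, of "of_int :: int \<Rightarrow> complex"] by (simp add: algebra_simps)
    show ?thesis unfolding c by (simp only: right_diff_distrib mult_1_right mult_1_left mult_ac)
  qed
  then have "w - w * of_int (a i0 * u) = of_nat p * (w * of_int v)" by simp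
  then have "of_nat p advd (w - w * of_int (a i0 * u))"
    using algebraic_int_mult[OF w(2) algebraic_int_of_int'] by (intro advdI)
  then have "of_nat p advd (w ^ N - (w * of_int (a i0 * u)) ^ N)"
    by (rule advd_power_diff[OF _ w(2) algebraic_int_mult[OF w(2) algebraic_int_of_int']])
  then have "of_nat p advd (w ^ N)" using 2 by (rule advd_cancel)
  then show False using w(2,3) N unfolding in_rad_def by blast
qed

text \<open>Modulo \<open>p\<close> the equation of \<open>x\<close> reads
  \<open>x ^ i0 * (a i0 + x * t) = 0\<close>, where \<open>a i0\<close> is invertible and
  \<open>x * t\<close> is nilpotent. The second factor is therefore a unit, so \<open>p\<close>
  divides \<open>x ^ i0\<close>, and \<open>i0\<close> is at most the degree.\<close>

lemma in_rad_power_degree: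
  assumes p: "Factorial_Ring.prime (p::nat)" and x: "x \<in> M" and r: "in_rad p x"
  shows "of_nat p advd (x ^ card (orb G x))"
proof -
  have xi: "algebraic_int x" using r by (simp add: in_rad_def)
  define d where "d = card (orb G x)"
  define R where "R = root_poly (orb G x)"
  have "Polynomial.coeff R i \<in> \<int>" for i unfolding R_def by (rule coeff_root_poly_orb_Ints[OF x xi])
  then obtain a where a: "\<And>i. Polynomial.coeff R i = of_int (a i)"
    using choice[of "\<lambda>i k. Polynomial.coeff R i = of_int k"] by (auto simp: Ints_def)
  have dR: "Polynomial.degree R = d" by (simp add: R_def d_def degree_root_poly)
  have ad: "a d = 1" using lead_coeff_root_poly[of "orb G x"] a[of d] by (simp add: R_def d_def)
  have p1: "\<not> int p dvd 1" using prime_gt_1_nat[OF p] by simp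
  define i0 where "i0 = (LEAST i. \<not> int p dvd a i)"
  have i0: "\<not> int p dvd a i0" unfolding i0_def by (rule LeastI[of _ d]) (use ad p1 in simp)
  have i0d: "i0 \<le> d" unfolding i0_def by (rule Least_le) (use ad p1 in simp)
  have lt: "int p dvd a i" if "i < i0" for i using not_less_Least[of i "\<lambda>i. \<not> int p dvd a i"] that by (simp add: i0_def)
  have xk: "algebraic_int (x ^ k)" for k using xi by (rule algebraic_int_power)
  have "poly R x = 0" unfolding R_def by (rule poly_root_poly_orb[OF subgrp_G])
  then have "(\<Sum>i\<le>d. of_int (a i) * x ^ i) = 0"
    unfolding poly_altdef dR a .
  also have "{..d} = {..<i0} \<union> insert i0 {i0<..d}" using i0d by auto
  also have "(\<Sum>i\<in>{..<i0} \<union> insert i0 {i0<..d}. of_int (a i) * x ^ i) =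
     (\<Sum>i<i0. of_int (a i) * x ^ i) + (of_int (a i0) * x ^ i0 + (\<Sum>i\<in>{i0<..d}. of_int (a i) * x ^ i))"
    by (subst sum.union_disjoint) auto
  finally have rel: "of_int (a i0) * x ^ i0 + (\<Sum>i\<in>{i0<..d}. of_int (a i) * x ^ i) = - (\<Sum>i<i0. of_int (a i) * x ^ i)"
    by (simp add: algebra_simps eq_neg_iff_add_eq_0)
  define t where "t = (\<Sum>i\<in>{i0<..d}. of_int (a i) * x ^ (i - Suc i0))"
  have t: "algebraic_int t" unfolding t_def
    by (intro algebraic_int_mult algebraic_int_sum algebraic_int_of_int' xk)
  have s2: "(\<Sum>i\<in>{i0<..d}. of_int (a i) * x ^ i) = x ^ i0 * (x * t)"
    unfolding t_def sum_distrib_left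
  proof (rule sum.cong[OF refl])
    fix i assume i: "i \<in> {i0<..d}"
    have "x ^ i = x ^ Suc i0 * x ^ (i - Suc i0)"
      using i power_add[of x "Suc i0" "i - Suc i0"] by simp
    then show "of_int (a i) * x ^ i = x ^ i0 * (x * (of_int (a i) * x ^ (i - Suc i0)))" by (simp add: mult_ac)
  qed
  have "of_nat p advd (\<Sum>i<i0. of_int (a i) * x ^ i)"
  proof (rule advd_sum)
    fix i assume i: "i \<in> {..<i0}"
    have "a i = int p * (a i div int p)" using lt i by simp
    then have "of_int (a i) = (of_nat p * of_int (a i div int p) :: complex)"
      by (metis of_int_mult of_int_of_nat_eq)
    then have "of_int (a i) * x ^ i = of_nat p * (of_int (a i div int p) * x ^ i)" by (simp only: mult.assoc)
    then show "of_nat p advd (of_int (a i) * x ^ i)"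
      using algebraic_int_mult[OF algebraic_int_of_int' xk] by (intro advdI)
  qed
  then have "of_nat p advd (of_int (a i0) * x ^ i0 + x ^ i0 * (x * t))"
    using rel s2 advd_minus by metis
  then have main: "of_nat p advd (x ^ i0 * (of_int (a i0) + x * t))" by (simp only: distrib_left mult_ac)
  have "Factorial_Ring.prime (int p)" using p by simp
  from prime_imp_coprime[OF this i0] have "gcd (a i0) (int p) = 1" by (simp add: gcd.commute coprime_iff_gcd_eq_1)
  then obtain u v where "u * a i0 + v * int p = 1" using bezout_int[of "a i0" "int p"] by auto
  then have uv: "a i0 * u + int p * v = 1" by (simp add: mult.commute)
  define w where "w = - (x * t * of_int u)"
  have "in_rad p (x * (- t * of_int u))"
    using r algebraic_int_mult[OF _ algebraic_int_of_int'] t by (intro in_rad_mult) (auto simp del: mult_minus_left intro!: algebraic_int_mult algebraic_int_of_int')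
  then have wr: "in_rad p w" by (simp add: w_def mult_ac)
  then have wi: "algebraic_int w" by (simp add: in_rad_def)
  obtain J where J: "J > 0" "of_nat p advd (w ^ J)" using wr by (auto simp: in_rad_def)
  \<comment> \<open>A finite geometric series that inverts \<open>1 - w\<close> modulo
    \<open>p\<close>.\<close>
  define S where "S = (\<Sum>j<J. w ^ j)"
  have S: "algebraic_int S" unfolding S_def by (rule algebraic_int_sum) (rule algebraic_int_power[OF wi])
  have Sw: "(1 - w) * S = 1 - w ^ J" unfolding S_def by (rule one_diff_power_eq[symmetric])
  have "of_nat p advd (x ^ i0 * (of_int (a i0) + x * t) * (of_int u * S))"
    using main by (rule advd_mult_right) (rule algebraic_int_mult[OF algebraic_int_of_int' S])
  also have "x ^ i0 * (of_int (a i0) + x * t) * (of_int u * S) = x ^ i0 * ((of_int (a i0 * u) - w) * S)"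
    by (simp add: w_def algebra_simps)
  also have "of_int (a i0 * u) = (1 - of_nat p * of_int v :: complex)"
    using arg_cong[OF uv, of "of_int :: int \<Rightarrow> complex"] by (simp add: algebra_simps)
  also have "x ^ i0 * ((1 - of_nat p * of_int v - w) * S) = x ^ i0 * ((1 - w) * S) - of_nat p * (x ^ i0 * of_int v * S)"
    by (simp add: algebra_simps)
  also have "\<dots> = x ^ i0 - (w ^ J * x ^ i0 + of_nat p * (x ^ i0 * of_int v * S))"
    unfolding Sw by (simp add: algebra_simps)
  finally have "of_nat p advd (x ^ i0 - (w ^ J * x ^ i0 + of_nat p * (x ^ i0 * of_int v * S)))" .
  moreover have "of_nat p advd (w ^ J * x ^ i0 + of_nat p * (x ^ i0 * of_int v * S))"
    using J(2) xk S by (intro advd_add advd_mult_right advdI[OF _ refl] algebraic_int_mult algebraic_int_of_int')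
  ultimately have "of_nat p advd (x ^ i0)" by (rule advd_cancel)
  then have "of_nat p advd (x ^ i0 * x ^ (d - i0))" by (rule advd_mult_right) (rule xk)
  then show ?thesis using i0d by (simp add: d_def flip: power_add)
qed

end

subsection \<open>The archimedean Green function\<close>

lemma log_plus_nonneg: "log_plus t \<ge> 0" by (simp add: log_plus_def)
lemma log_plus_mono: "s \<le> t \<Longrightarrow> log_plus s \<le> log_plus t" by (simp add: log_plus_def)
lemma log_plus_mult: "s \<ge> 0 \<Longrightarrow> t \<ge> 0 \<Longrightarrow> log_plus (s * t) \<le> log_plus s + log_plus t"
proof -
  assume st: "s \<ge> 0" "t \<ge> 0"
  have "max 1 (s * t) \<le> max 1 s * max 1 t"
  proof (rule max.boundedI)
    show "1 \<le> max 1 s * max 1 t" using mult_mono[of 1 "max 1 s" 1 "max 1 t"] by simp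
    show "s * t \<le> max 1 s * max 1 t" using st by (intro mult_mono) simp_all
  qed
  then have "ln (max 1 (s * t)) \<le> ln (max 1 s * max 1 t)" by (subst ln_le_cancel_iff) (auto simp: less_max_iff_disj intro!: mult_pos_pos)
  also have "\<dots> = ln (max 1 s) + ln (max 1 t)" by (subst ln_mult) (auto simp: less_max_iff_disj)
  finally show ?thesis by (simp add: log_plus_def)
qed
lemma log_plus_power: "t \<ge> 0 \<Longrightarrow> log_plus (t ^ n) = n * log_plus t"
proof -
  assume t: "t \<ge> 0"
  have "max 1 (t ^ n) = (max 1 t) ^ n"
  proof (cases "t \<ge> 1")
    case True
    then show ?thesis by (simp add: max_def)
  next
    case False
    then show ?thesis using t power_le_one[of t n] by (simp add: max_def)
  qed
  then show ?thesis by (simp add: log_plus_def ln_realpow)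
qed
lemma ln_le_log_plus: "t > 0 \<Longrightarrow> ln t \<le> log_plus t" by (simp add: log_plus_def)

text \<open>The first term is the loss in the upper estimate of
  \<open>log_plus_power_perturb\<close>, the other two are the loss in the lower one.\<close>

definition growth_const :: "real \<Rightarrow> real" where
  "growth_const R = ln (1 + R) + ln 2 + ln (max 1 (2 * R))"

lemma growth_const_nonneg: "R \<ge> 0 \<Longrightarrow> growth_const R \<ge> 0"
  by (simp add: growth_const_def)

text \<open>If \<open>t ^ q \<ge> 2 * R\<close>, then \<open>u\<close> is at least half of
  \<open>t ^ q\<close>; otherwise \<open>t ^ q\<close> is bounded by \<open>2 * R\<close>. Stated
  for real numbers so that it serves every absolute value.\<close>

lemma log_plus_power_perturb:
  assumes t: "t \<ge> 0" and R: "R \<ge> 0" and ut: "u \<le> t ^ q + R" "t ^ q \<le> u + R"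
  shows "\<bar>log_plus u - q * log_plus t\<bar> \<le> growth_const R"
proof -
  have up: "log_plus u \<le> q * log_plus t + ln (1 + R)"
  proof -
    define m where "m = max 1 t"
    have m1: "m ^ q \<ge> 1" by (simp add: m_def)
    have "u \<le> t ^ q + R" by (rule ut)
    also have "\<dots> \<le> m ^ q + m ^ q * R"
      using m1 R mult_right_mono[of 1 "m ^ q" R] power_mono[of t m q] t by (simp add: m_def)
    finally have "max 1 (u) \<le> m ^ q * (1 + R)"
      using m1 R mult_mono[of 1 "m ^ q" 1 "1 + R"] by (simp add: algebra_simps)
    then have "ln (max 1 (u)) \<le> ln (m ^ q * (1 + R))"
      using m1 R by (subst ln_le_cancel_iff) (auto simp: less_max_iff_disj intro!: mult_pos_pos)
    also have "\<dots> = q * ln m + ln (1 + R)"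
      using m1 R by (subst ln_mult) (auto simp: ln_realpow m_def less_max_iff_disj)
    finally show ?thesis by (simp add: log_plus_def m_def)
  qed
  have lo: "q * log_plus t \<le> log_plus u + (ln 2 + ln (max 1 (2 * R)))"
  proof (cases "t \<le> 1")
    case True
    then have "log_plus t = 0" by (simp add: log_plus_def)
    then show ?thesis using R log_plus_nonneg[of u] by simp
  next
    case False
    then have w1: "t ^ q \<ge> 1" by simp
    define v where "v = max 1 (u)"
    define r where "r = max 1 (2 * R)"
    have vr: "v \<ge> 1" "r \<ge> 1" by (simp_all add: v_def r_def)
    have "t ^ q \<le> v * (2 * r)"
    proof (cases "t ^ q \<ge> 2 * R")
      case True
      have "t ^ q \<le> u + R" by (rule ut)
      then have "t ^ q \<le> 2 * u" using True by simp
      also have "\<dots> \<le> 2 * v" by (simp add: v_def)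
      also have "\<dots> \<le> 2 * v * r" using vr mult_left_mono[of 1 r "2 * v"] by simp
      finally show ?thesis by (simp add: mult_ac)
    next
      case False
      then have "t ^ q \<le> r" by (simp add: r_def)
      also have "\<dots> \<le> v * (2 * r)" using vr mult_mono[of 1 v r "2 * r"] by simp
      finally show ?thesis .
    qed
    then have "ln (t ^ q) \<le> ln (v * (2 * r))" using w1 vr by (subst ln_le_cancel_iff) (auto intro!: mult_pos_pos)
    also have "\<dots> = ln v + (ln 2 + ln r)" using vr by (simp add: ln_mult)
    finally show ?thesis using False by (simp add: log_plus_def ln_realpow v_def r_def)
  qed
  have "ln (1 + R) \<ge> 0" "ln (2::real) \<ge> 0" "ln (max 1 (2 * R)) \<ge> 0" using R by simp_all
  then show ?thesis using up lo unfolding growth_const_def abs_le_iff by linarith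
qed

lemma log_plus_uni:
  assumes c: "norm c \<le> R"
  shows "\<bar>log_plus (norm (uni q c w)) - q * log_plus (norm w)\<bar> \<le> growth_const R"
proof (rule log_plus_power_perturb)
  show "R \<ge> 0" using c norm_ge_zero order.trans by blast
  show "norm (uni q c w) \<le> norm w ^ q + R"
    unfolding uni_def using norm_triangle_ineq[of "w ^ q" c] c by (simp add: norm_power)
  show "norm w ^ q \<le> norm (uni q c w) + R"
    unfolding uni_def using norm_triangle_ineq4[of "w ^ q + c" c] c by (simp add: norm_power)
qed simp

text \<open>The increments of \<open>a\<close> are at most \<open>K / 2 ^ Suc k\<close>, and these
  bounds sum to exactly \<open>K\<close>.\<close>

lemma log_plus_tendsto:
  fixes t :: "nat \<Rightarrow> real" and q :: nat
  assumes q: "q \<ge> 2" and K: "K \<ge> 0" and t: "\<And>k. \<bar>log_plus (t (Suc k)) - q * log_plus (t k)\<bar> \<le> K"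
  defines "a \<equiv> \<lambda>k. log_plus (t k) / real q ^ k"
  shows "\<exists>l. a \<longlonglongrightarrow> l \<and> \<bar>l - log_plus (t 0)\<bar> \<le> K"
proof -
  have step: "norm (a (Suc k) - a k) \<le> K * (1/2) ^ Suc k" for k
  proof -
    have "a (Suc k) - a k = (log_plus (t (Suc k)) - q * log_plus (t k)) / real q ^ Suc k"
      using q by (simp add: a_def field_simps)
    then have "norm (a (Suc k) - a k) \<le> K / real q ^ Suc k"
      using t[of k] q by (simp add: divide_right_mono)
    also have "\<dots> \<le> K / 2 ^ Suc k"
      using q K by (intro divide_left_mono power_mono mult_pos_pos) auto
    finally show ?thesis by (simp add: power_divide)
  qed
  have g: "(\<lambda>k. K * (1/2) ^ Suc k) sums K"
  proof -
    have "(\<lambda>k. (1/2::real) ^ Suc k) sums 1" by (rule power_half_series)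
    from sums_mult[OF this, of K] show ?thesis by simp
  qed
  have sm: "summable (\<lambda>k. a (Suc k) - a k)"
    by (rule summable_comparison_test'[OF sums_summable[OF g], of 0]) (use step in simp)
  have "(\<lambda>m. \<Sum>k<m. a (Suc k) - a k) \<longlonglongrightarrow> (\<Sum>k. a (Suc k) - a k)"
    by (rule summable_LIMSEQ[OF sm])
  then have "(\<lambda>m. a m - a 0) \<longlonglongrightarrow> (\<Sum>k. a (Suc k) - a k)" by (simp only: sum_lessThan_telescope)
  from tendsto_add[OF this tendsto_const[of "a 0"]] have l: "a \<longlonglongrightarrow> (\<Sum>k. a (Suc k) - a k) + a 0" by simp
  have sn: "summable (\<lambda>k. norm (a (Suc k) - a k))"
    by (rule summable_comparison_test'[OF sums_summable[OF g], of 0]) (use step in \<open>simp del: power_Suc\<close>)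
  have "norm (\<Sum>k. a (Suc k) - a k) \<le> (\<Sum>k. norm (a (Suc k) - a k))"
    by (rule summable_norm[OF sn])
  also have "\<dots> \<le> (\<Sum>k. K * (1/2) ^ Suc k)"
    by (rule suminf_le[OF step sn sums_summable[OF g]])
  also have "\<dots> = K" using g by (rule sums_unique[symmetric])
  finally have "\<bar>((\<Sum>k. a (Suc k) - a k) + a 0) - log_plus (t 0)\<bar> \<le> K" by (simp add: a_def)
  then show ?thesis using l by blast
qed

text \<open>The Green function, or escape rate, of the map
  \<open>x \<mapsto> x ^ q + c\<close>.\<close>

definition grn :: "nat \<Rightarrow> complex \<Rightarrow> complex \<Rightarrow> real" where
  "grn q c z = lim (\<lambda>k. log_plus (norm ((uni q c ^^ k) z)) / real q ^ k)"

lemma grn_aux: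
  fixes c z :: complex and q :: nat
  assumes q: "q \<ge> 2" and c: "norm c \<le> R"
  shows "(\<lambda>k. log_plus (norm ((uni q c ^^ k) z)) / real q ^ k) \<longlonglongrightarrow> grn q c z"
    "\<bar>grn q c z - log_plus (norm z)\<bar> \<le> growth_const R"
proof -
  have "R \<ge> 0" using c norm_ge_zero order.trans by blast
  then obtain l where l: "(\<lambda>k. log_plus (norm ((uni q c ^^ k) z)) / real q ^ k) \<longlonglongrightarrow> l"
    "\<bar>l - log_plus (norm z)\<bar> \<le> growth_const R"
    using log_plus_tendsto[OF q growth_const_nonneg, of R "\<lambda>k. norm ((uni q c ^^ k) z)"] log_plus_uni[OF c, of q] by auto
  moreover have "grn q c z = l" unfolding grn_def by (rule limI[OF l(1)])
  ultimately show "(\<lambda>k. log_plus (norm ((uni q c ^^ k) z)) / real q ^ k) \<longlonglongrightarrow> grn q c z"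
    "\<bar>grn q c z - log_plus (norm z)\<bar> \<le> growth_const R" by simp_all
qed

lemma grn_nonneg: assumes "q \<ge> 2" shows "grn q c z \<ge> 0"
  by (rule LIMSEQ_le_const[OF grn_aux(1)[OF assms order.refl]]) (simp add: log_plus_nonneg)

lemma grn_uni: assumes q: "q \<ge> 2" shows "grn q c (uni q c z) = q * grn q c z"
proof -
  have "(\<lambda>k. log_plus (norm ((uni q c ^^ k) (uni q c z))) / real q ^ k) \<longlonglongrightarrow> grn q c (uni q c z)"
    by (rule grn_aux(1)[OF q order.refl])
  moreover have "(\<lambda>k. real q * (log_plus (norm ((uni q c ^^ Suc k) z)) / real q ^ Suc k)) \<longlonglongrightarrow> q * grn q c z"
    using grn_aux(1)[OF q order.refl] by (intro tendsto_mult_left LIMSEQ_Suc)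
  moreover have "(\<lambda>k. real q * (log_plus (norm ((uni q c ^^ Suc k) z)) / real q ^ Suc k)) =
      (\<lambda>k. log_plus (norm ((uni q c ^^ k) (uni q c z))) / real q ^ k)"
    using q by (simp add: funpow_Suc_right del: funpow.simps)
  ultimately show ?thesis using LIMSEQ_unique by metis
qed

lemma grn_iterate: assumes q: "q \<ge> 2" shows "grn q c ((uni q c ^^ k) z) = real q ^ k * grn q c z"
  by (induction k) (simp_all add: grn_uni[OF q])

lemma log_plus_le_grn:
  assumes "q \<ge> 2" "norm c \<le> R" shows "log_plus (norm z) \<le> grn q c z + growth_const R"
  using grn_aux(2)[OF assms, of z] by simp

text \<open>Products of iterates, indexed by the base \<open>q\<close> digits of the degree, replace the monomials:
  they exceed \<open>exp (i * grn q c z)\<close> only by a factor polynomial in \<open>i\<close>.\<close>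

lemma adapted_monic_poly:
  assumes q: "q \<ge> 2" and c: "norm c \<le> R"
  shows "\<exists>P. Polynomial.degree P = i \<and> lead_coeff P = 1 \<and>
    (\<forall>z. log_plus (norm (poly P z)) \<le> i * grn q c z + q * growth_const R + q * growth_const R / ln 2 * ln (max 1 (real i)))"
proof (induction i rule: less_induct)
  case (less i)
  define K where "K = growth_const R"
  have R: "R \<ge> 0" using c norm_ge_zero order.trans by blast
  have K: "K \<ge> 0" using growth_const_nonneg[OF R] by (simp add: K_def)
  show ?case
  proof (cases "i < q")
    case True
    have "log_plus (norm (poly (Polynomial.monom 1 i) z)) \<le> i * grn q c z + q * K + q * K / ln 2 * ln (max 1 (real i))" for z
    proof -
      have "log_plus (norm (poly (Polynomial.monom 1 i) z)) = i * log_plus (norm z)"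
        by (simp add: poly_monom norm_power log_plus_power)
      also have "\<dots> \<le> i * (grn q c z + K)"
        using log_plus_le_grn[OF q c, of z] by (intro mult_left_mono) (simp_all add: K_def)
      also have "\<dots> \<le> i * grn q c z + q * K" using True K mult_right_mono[of "real i" "real q" K] by (simp add: algebra_simps)
      also have "\<dots> \<le> i * grn q c z + q * K + q * K / ln 2 * ln (max 1 (real i))" using K by simp
      finally show ?thesis .
    qed
    then show ?thesis by (intro exI[of _ "Polynomial.monom 1 i"]) (simp add: Polynomial.degree_monom_eq K_def)
  next
    case False
    \<comment> \<open>The polynomial for \<open>d\<close> is composed with \<open>f\<close> and
      multiplied by a power with exponent \<open>i mod q\<close>. As \<open>f\<close> multiplies the
      Green function by \<open>q\<close>, the main terms add up to \<open>i\<close> times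
      it.\<close>
    define d where "d = i div q"
    have d: "d < i" "d \<ge> 1" using False q by (auto simp: d_def div_greater_zero_iff Suc_le_eq)
    obtain P where P: "Polynomial.degree P = d" "lead_coeff P = 1"
      "\<And>z. log_plus (norm (poly P z)) \<le> d * grn q c z + q * K + q * K / ln 2 * ln (max 1 (real d))"
      using less[OF d(1)] unfolding K_def by blast
    define f where "f = (Polynomial.monom 1 q + [:c:] :: complex poly)"
    have df: "Polynomial.degree f = q" unfolding f_def
      using q by (subst degree_add_eq_left) (simp_all add: Polynomial.degree_monom_eq)
    have lf: "lead_coeff f = 1" unfolding df unfolding f_def using q by (cases q) simp_all
    have fz: "poly f z = uni q c z" for z by (simp add: f_def uni_def poly_monom)
    define S where "S = pcompose P f * Polynomial.monom 1 (i mod q)"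
    have lc: "lead_coeff (pcompose P f) = 1" using P(2) lf df q by (subst lead_coeff_comp) simp_all
    have lS: "lead_coeff S = 1" unfolding S_def lead_coeff_mult lc by (simp add: Polynomial.degree_monom_eq)
    have "pcompose P f \<noteq> 0" using lc by auto
    then have "Polynomial.degree S = d * q + i mod q"
      unfolding S_def by (subst degree_mult_eq) (simp_all add: degree_pcompose P(1) df Polynomial.degree_monom_eq)
    then have dS: "Polynomial.degree S = i" by (simp add: d_def)
    have "log_plus (norm (poly S z)) \<le> i * grn q c z + q * K + q * K / ln 2 * ln (max 1 (real i))" for z
    proof -
      have "log_plus (norm (poly S z)) \<le> log_plus (norm (poly P (uni q c z))) + log_plus (norm z ^ (i mod q))"
        unfolding S_def by (simp add: poly_pcompose fz norm_mult poly_monom norm_power log_plus_mult)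
      also have "log_plus (norm z ^ (i mod q)) = (i mod q) * log_plus (norm z)" by (simp add: log_plus_power)
      also have "\<dots> \<le> (i mod q) * (grn q c z + K)"
        using log_plus_le_grn[OF q c, of z] by (intro mult_left_mono) (simp_all add: K_def)
      also have "\<dots> \<le> (i mod q) * grn q c z + q * K"
        using q K mult_right_mono[of "real (i mod q)" "real q" K] by (simp add: algebra_simps less_imp_le)
      also have "log_plus (norm (poly P (uni q c z))) \<le> d * (q * grn q c z) + q * K + q * K / ln 2 * ln (max 1 (real d))"
        using P(3)[of "uni q c z"] by (simp add: grn_uni[OF q])
      \<comment> \<open>Passing from \<open>i\<close> to \<open>d \<le> i / 2\<close> lowers the
        logarithmic term by at least \<open>q * K\<close>, which pays for the last digit.\<close>
      also have "q * K / ln 2 * ln (max 1 (real d)) \<le> q * K / ln 2 * (ln (max 1 (real i)) - ln 2)"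
      proof (rule mult_left_mono)
        have "2 * d \<le> q * d" using q by simp
        also have "\<dots> \<le> i" by (simp add: d_def)
        finally have "real d \<le> real i / 2" by simp
        then have "ln (real d) \<le> ln (real i / 2)" using d by (subst ln_le_cancel_iff) auto
        also have "\<dots> = ln (real i) - ln 2" using d by (subst ln_div) auto
        finally show "ln (max 1 (real d)) \<le> ln (max 1 (real i)) - ln 2" using d by (simp add: max_def)
      qed (use K in simp)
      also have "\<dots> = q * K / ln 2 * ln (max 1 (real i)) - q * K" by (simp add: field_simps)
      finally have "log_plus (norm (poly S z)) \<le> (real d * q + real (i mod q)) * grn q c z + q * K + q * K / ln 2 * ln (max 1 (real i))"
        by (simp add: algebra_simps)
      also have "real d * q + real (i mod q) = i"
        unfolding d_def by (metis of_nat_add of_nat_mult div_mult_mod_eq)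
      finally show ?thesis .
    qed
    then show ?thesis using dS lS by (intro exI[of _ S]) (simp add: K_def)
  qed
qed

section \<open>Upper bound for discriminants\<close>

text \<open>\<open>S\<close> equals its interpolation on the \<open>Suc n\<close> points of
  \<open>A\<close>; the claim compares the coefficients of degree \<open>n\<close>.\<close>

lemma lagrange_leading_coeff:
  fixes A :: "complex set"
  assumes fin: "finite A" and n: "card A = Suc n" and S: "Polynomial.degree S = n" "lead_coeff S = 1"
  shows "(\<Sum>x\<in>A. poly S x / (\<Prod>y\<in>A - {x}. x - y)) = 1"
proof -
  define c where "c x = poly S x / (\<Prod>y\<in>A - {x}. x - y)" for x
  define T where "T = (\<Sum>x\<in>A. Polynomial.smult (c x) (root_poly (A - {x})))"
  have cA: "card (A - {x}) = n" if "x \<in> A" for x using that n fin by simp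
  have dT: "Polynomial.degree T \<le> n"
    unfolding T_def using cA degree_root_poly fin
    by (intro degree_sum_le) (auto intro!: order.trans[OF degree_smult_le])
  have val: "poly T w = poly S w" if w: "w \<in> A" for w
  proof -
    have "poly T w = (\<Sum>x\<in>A. c x * (\<Prod>y\<in>A - {x}. w - y))"
      by (simp add: T_def poly_sum poly_root_poly)
    also have "\<dots> = (\<Sum>x\<in>{w}. c x * (\<Prod>y\<in>A - {x}. w - y))"
      using fin w by (intro sum.mono_neutral_right) (auto simp: prod_zero_iff)
    also have "\<dots> = poly S w" using fin by (simp add: c_def prod_zero_iff)
    finally show ?thesis .
  qed
  have "T - S = 0"
  proof (rule ccontr)
    assume n0: "T - S \<noteq> 0"
    have "Suc n \<le> card {w. poly (T - S) w = 0}"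
      unfolding n[symmetric] using val n0 by (intro card_mono poly_roots_finite) auto
    also have "\<dots> \<le> Polynomial.degree (T - S)" using n0 by (rule card_poly_roots_bound)
    also have "\<dots> \<le> n" using dT S by (intro degree_diff_le) simp_all
    finally show False by simp
  qed
  then have "Polynomial.coeff T n = 1" using S by simp
  moreover have "Polynomial.coeff T n = (\<Sum>x\<in>A. c x)"
    unfolding T_def coeff_sum
  proof (rule sum.cong[OF refl])
    fix x assume "x \<in> A"
    then show "Polynomial.coeff (Polynomial.smult (c x) (root_poly (A - {x}))) n = c x"
      using lead_coeff_root_poly[of "A - {x}"] cA[of x] by simp
  qed
  ultimately show ?thesis by (simp add: c_def)
qed

text \<open>Otherwise each of the \<open>Suc n\<close> Lagrange terms would be smaller than
  \<open>1 / Suc n\<close>, although they sum to \<open>1\<close>.\<close>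

lemma exists_small_difference_product:
  fixes A :: "complex set"
  assumes fin: "finite A" and n: "card A = Suc n" and S: "Polynomial.degree S = n" "lead_coeff S = 1"
  shows "\<exists>x\<in>A. (\<Prod>y\<in>A - {x}. norm (x - y)) \<le> Suc n * norm (poly S x)"
proof (rule ccontr)
  assume "\<not> ?thesis"
  then have *: "Suc n * norm (poly S x) < (\<Prod>y\<in>A - {x}. norm (x - y))" if "x \<in> A" for x
    using that by force
  have "norm (poly S x / (\<Prod>y\<in>A - {x}. x - y)) < 1 / Suc n" if x: "x \<in> A" for x
  proof -
    define r where "r = (\<Prod>y\<in>A - {x}. norm (x - y))"
    have "r > 0" unfolding r_def by (intro prod_pos) auto
    then have "norm (poly S x) / r < 1 / Suc n" using *[OF x] by (simp add: r_def[symmetric] field_simps)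
    then show ?thesis by (simp add: norm_divide r_def prod_norm)
  qed
  then have "(\<Sum>x\<in>A. norm (poly S x / (\<Prod>y\<in>A - {x}. x - y))) < (\<Sum>x\<in>A. 1 / Suc n)"
    using fin n by (intro sum_strict_mono) auto
  also have "\<dots> = 1" using n by simp
  finally have "norm (\<Sum>x\<in>A. poly S x / (\<Prod>y\<in>A - {x}. x - y)) < 1"
    by (rule le_less_trans[OF norm_sum])
  then show False using lagrange_leading_coeff[OF assms] by simp
qed

text \<open>The coefficient of the logarithm: \<open>1\<close> from the factor \<open>Suc n\<close>
  of the Lagrange estimate, the rest from the adapted polynomials.\<close>

definition disc_const :: "nat \<Rightarrow> real \<Rightarrow> real" where
  "disc_const q R = 1 + q * growth_const R / ln 2"

text \<open>Peel off one point at a time: interpolation against an adapted polynomial yields a point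
  whose product of differences is controlled by its Green function. Each difference occurs in both
  orders, whence the factors \<open>2\<close>.\<close>

theorem discriminant_bound:
  fixes A :: "complex set"
  assumes q: "q \<ge> 2" and c: "norm c \<le> R" and fin: "finite A" and N: "card A \<le> N"
  shows "(\<Sum>x\<in>A. \<Sum>y\<in>A - {x}. ln (norm (x - y))) \<le>
    2 * card A * (q * growth_const R + disc_const q R * ln (max 1 (real N))) + 2 * N * (\<Sum>x\<in>A. grn q c x)"
  using fin N
proof (induction "card A" arbitrary: A)
  case (Suc n)
  define K where "K = q * growth_const R"
  define E where "E = disc_const q R"
  have R: "R \<ge> 0" using c norm_ge_zero order.trans by blast
  have K: "K \<ge> 0" using growth_const_nonneg[OF R] by (simp add: K_def)
  obtain S where S: "Polynomial.degree S = n" "lead_coeff S = 1"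
    "\<And>z. log_plus (norm (poly S z)) \<le> n * grn q c z + K + K / ln 2 * ln (max 1 (real n))"
    using adapted_monic_poly[OF q c, of n] unfolding K_def by blast
  obtain x where x: "x \<in> A" "(\<Prod>y\<in>A - {x}. norm (x - y)) \<le> Suc n * norm (poly S x)"
    using exists_small_difference_product[OF Suc.prems(1) Suc.hyps(2)[symmetric] S(1,2)] by blast
  define A' where "A' = A - {x}"
  have A': "finite A'" "card A' = n" "x \<notin> A'" "A = insert x A'"
    using Suc x by (auto simp: A'_def)
  have pos: "(\<Prod>y\<in>A'. norm (x - y)) > 0" using A' by (intro prod_pos) auto
  have "(\<Sum>y\<in>A'. ln (norm (x - y))) = ln (\<Prod>y\<in>A'. norm (x - y))"
    using A' by (subst ln_prod) auto
  also have "\<dots> \<le> ln (Suc n * norm (poly S x))"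
    using x(2) pos by (subst ln_le_cancel_iff) (auto simp: A'_def)
  also have "\<dots> = ln (Suc n) + ln (norm (poly S x))"
    using x(2) pos by (subst ln_mult) (auto simp: A'_def zero_less_mult_iff intro: less_le_trans)
  also have "ln (norm (poly S x)) \<le> log_plus (norm (poly S x))"
    by (cases "poly S x = 0") (simp_all add: log_plus_nonneg ln_le_log_plus)
  also have "\<dots> \<le> n * grn q c x + K + K / ln 2 * ln (max 1 (real n))" by (rule S(3))
  also have "n * grn q c x \<le> N * grn q c x"
    using Suc by (intro mult_right_mono grn_nonneg[OF q]) auto
  also have "K / ln 2 * ln (max 1 (real n)) \<le> K / ln 2 * ln (max 1 (real N))"
    using K Suc by (intro mult_left_mono) auto
  also have "ln (real (Suc n)) \<le> ln (max 1 (real N))" using Suc by (subst ln_le_cancel_iff) auto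
  finally have b: "(\<Sum>y\<in>A'. ln (norm (x - y))) \<le> N * grn q c x + K + E * ln (max 1 (real N))"
    by (simp add: E_def disc_const_def K_def algebra_simps)
  have "(\<Sum>a\<in>A. \<Sum>y\<in>A - {a}. ln (norm (a - y))) = (\<Sum>y\<in>A'. ln (norm (x - y))) + (\<Sum>a\<in>A'. \<Sum>y\<in>A - {a}. ln (norm (a - y)))"
    using A' by (simp add: A'_def[symmetric])
  also have "(\<Sum>a\<in>A'. \<Sum>y\<in>A - {a}. ln (norm (a - y))) = (\<Sum>a\<in>A'. ln (norm (x - a)) + (\<Sum>y\<in>A' - {a}. ln (norm (a - y))))"
  proof (rule sum.cong[OF refl])
    fix a assume a: "a \<in> A'"
    have "A - {a} = insert x (A' - {a})" using A' a by auto
    then show "(\<Sum>y\<in>A - {a}. ln (norm (a - y))) = ln (norm (x - a)) + (\<Sum>y\<in>A' - {a}. ln (norm (a - y)))"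
      using A' by (simp add: norm_minus_commute)
  qed
  also have "\<dots> = (\<Sum>a\<in>A'. ln (norm (x - a))) + (\<Sum>a\<in>A'. \<Sum>y\<in>A' - {a}. ln (norm (a - y)))" by (rule sum.distrib)
  also have "(\<Sum>a\<in>A'. \<Sum>y\<in>A' - {a}. ln (norm (a - y))) \<le> 2 * card A' * (K + E * ln (max 1 (real N))) + 2 * N * (\<Sum>x\<in>A'. grn q c x)"
    using Suc.hyps(1)[of A'] A' Suc by (simp add: K_def E_def)
  finally have "(\<Sum>a\<in>A. \<Sum>y\<in>A - {a}. ln (norm (a - y))) \<le>
    2 * (\<Sum>y\<in>A'. ln (norm (x - y))) + (2 * card A' * (K + E * ln (max 1 (real N))) + 2 * N * (\<Sum>x\<in>A'. grn q c x))" by simp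
  also have "\<dots> \<le> 2 * (N * grn q c x + K + E * ln (max 1 (real N))) + (2 * card A' * (K + E * ln (max 1 (real N))) + 2 * N * (\<Sum>x\<in>A'. grn q c x))"
    using b by simp
  also have "\<dots> = 2 * card A * (K + E * ln (max 1 (real N))) + 2 * N * (\<Sum>x\<in>A. grn q c x)"
    using A' by (simp add: algebra_simps)
  finally show ?case by (simp add: K_def E_def)
qed simp

section \<open>Degree drops, ramification and attraction to \<open>0\<close>\<close>

context unicritical_galois
begin

text \<open>The added constants cancel in differences, and every \<open>p\<close>-th power keeps the
  factor \<open>x - y\<close> in the error.\<close>

lemma Ph_diff:
  assumes x: "algebraic_int x" and y: "algebraic_int y"
  shows "\<exists>w. algebraic_int w \<and> Ph k x - Ph k y = (x - y) ^ (p ^ k) + of_nat p * (x - y) * w"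
proof (induction k)
  case 0
  show ?case by (rule exI[of _ 0]) simp
next
  case (Suc k)
  then obtain w where w: "algebraic_int w" "Ph k x - Ph k y = (x - y) ^ (p ^ k) + of_nat p * (x - y) * w" by blast
  define d u v where "d = x - y" and "u = d ^ (p ^ k)" and "v = of_nat p * d * w"
  have d: "algebraic_int d" unfolding d_def using x y by (rule algebraic_int_diff)
  have u: "algebraic_int u" unfolding u_def using d by (rule algebraic_int_power)
  have v: "algebraic_int v" unfolding v_def using algebraic_int_mult[OF algebraic_int_mult[OF algebraic_int_of_nat' d] w(1)] .
  have uv: "Ph k x - Ph k y = u + v" using w(2) by (simp add: u_def v_def d_def)
  obtain w1 where w1: "algebraic_int w1" "Ph k x ^ p - Ph k y ^ p = (u + v) ^ p + of_nat p * (u + v) * w1"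
    using frobenius_diff_explicit[OF p Ph_int[OF x] Ph_int[OF y], of k k] unfolding uv by blast
  obtain w2 where w2: "algebraic_int w2" "(u + v) ^ p = u ^ p + v ^ p + of_nat p * u * v * w2"
    using frobenius_prime[OF p u v] by blast
  define u' where "u' = d ^ (p ^ k - 1)"
  have u': "algebraic_int u'" unfolding u'_def using d by (rule algebraic_int_power)
  have "p ^ k > 0" using p0 by simp
  then have ud: "u = d * u'" unfolding u_def u'_def using power_minus_mult[of "p ^ k" d] by (simp add: mult.commute)
  define t where "t = w * v ^ (p - 1) + u * of_nat p * w * w2 + (u' + of_nat p * w) * w1"
  have "algebraic_int t" unfolding t_def
    by (intro algebraic_int_add algebraic_int_mult algebraic_int_power u v u' w w1 w2 algebraic_int_of_nat')
  moreover have "Ph (Suc k) x - Ph (Suc k) y = (x - y) ^ (p ^ Suc k) + of_nat p * (x - y) * t"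
  proof -
    have e1: "v ^ p = of_nat p * d * (w * v ^ (p - 1))"
      using power_minus_mult[OF p0, of v] by (simp add: v_def mult_ac)
    have e2: "of_nat p * u * v * w2 = of_nat p * d * (u * of_nat p * w * w2)" by (simp add: v_def mult_ac)
    have e3: "of_nat p * (u + v) * w1 = of_nat p * d * ((u' + of_nat p * w) * w1)"
      by (simp add: ud v_def algebra_simps)
    have e4: "u ^ p = (x - y) ^ (p ^ Suc k)" unfolding u_def d_def by (metis power_Suc2 power_mult)
    have "Ph (Suc k) x - Ph (Suc k) y = Ph k x ^ p - Ph k y ^ p" by simp
    also have "\<dots> = u ^ p + v ^ p + of_nat p * u * v * w2 + of_nat p * (u + v) * w1" by (simp only: w1(2) w2(2))
    also have "\<dots> = (x - y) ^ (p ^ Suc k) + of_nat p * (x - y) * t"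
      unfolding e1 e2 e3 e4 t_def d_def by (simp only: distrib_left add.assoc)
    finally show ?thesis .
  qed
  ultimately show ?case by blast
qed

lemma orbs_eq_image: "orbs k = Ph k ` orbs 0"
  unfolding orbs_def using orb_image_hom[OF H, of "Ph k" \<alpha>] Ph_H \<alpha>M by simp

text \<open>\<open>H\<close> acts transitively on \<open>orbs 0\<close> and commutes with
  \<open>Ph k\<close>, so all fibres of \<open>Ph k\<close> there have the same size.\<close>

lemma card_orbs_pairs:
  "card {(y, y'). y \<in> orbs 0 \<and> y' \<in> orbs 0 \<and> Ph k y = Ph k y'} * card (orbs k) = card (orbs 0) * card (orbs 0)"
proof -
  define fib where "fib y = {y' \<in> orbs 0. Ph k y' = Ph k y}" for y
  have finf: "finite (fib y)" for y using finite_orbs by (simp add: fib_def)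
  have c: "card (fib y) = card (fib \<alpha>)" if y: "y \<in> orbs 0" for y
  proof -
    obtain t where t: "t \<in> H" "y = t \<alpha>" using y by (auto simp: orbs_def orb_def)
    have "fib y = t ` fib \<alpha>"
    proof
      show "t ` fib \<alpha> \<subseteq> fib y"
      proof clarify
        fix y' assume y': "y' \<in> fib \<alpha>"
        then have "y' \<in> orbs 0" "Ph k y' = Ph k \<alpha>" by (auto simp: fib_def)
        moreover from this have "t y' \<in> orbs 0" using orb_mem_orb[OF H _ t(1)] by (simp add: orbs_def)
        ultimately show "t y' \<in> fib y" using Ph_H[OF t(1)] \<alpha>M orbs_M t(2) by (simp add: fib_def) metis
      qed
      show "fib y \<subseteq> t ` fib \<alpha>"
      proof
        fix y' assume y': "y' \<in> fib y"
        then have y'0: "y' \<in> orbs 0" "Ph k y' = Ph k y" by (auto simp: fib_def)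
        then obtain v where v: "v \<in> orbs 0" "y' = t v"
          using image_orb[OF H t(1), of \<alpha>] by (auto simp: orbs_def)
        have "t (Ph k v) = t (Ph k \<alpha>)" using y'0 v t Ph_H[OF t(1)] orbs_M[OF v(1)] \<alpha>M by simp
        then have "Ph k v = Ph k \<alpha>" using inj_G[OF H_G[OF t(1)]] by simp
        then show "y' \<in> t ` fib \<alpha>" using v by (simp add: fib_def)
      qed
    qed
    then show ?thesis using inj_G[OF H_G[OF t(1)]] by (simp add: card_image inj_on_def)
  qed
  have "{(y, y'). y \<in> orbs 0 \<and> y' \<in> orbs 0 \<and> Ph k y = Ph k y'} = Sigma (orbs 0) fib"
    by (auto simp: fib_def)
  then have "card {(y, y'). y \<in> orbs 0 \<and> y' \<in> orbs 0 \<and> Ph k y = Ph k y'} = (\<Sum>y\<in>orbs 0. card (fib y))"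
    using finite_orbs finf by simp
  also have "\<dots> = card (orbs 0) * card (fib \<alpha>)" using c by simp
  finally have 1: "card {(y, y'). y \<in> orbs 0 \<and> y' \<in> orbs 0 \<and> Ph k y = Ph k y'} = card (orbs 0) * card (fib \<alpha>)" .
  have "card (orbs 0) = (\<Sum>w\<in>Ph k ` orbs 0. card {y \<in> orbs 0. Ph k y = w})"
    using finite_orbs card_eq_sum sum.image_gen[of "orbs 0" "\<lambda>_. 1::nat" "Ph k"] by simp
  also have "\<dots> = (\<Sum>w\<in>Ph k ` orbs 0. card (fib \<alpha>))"
  proof (rule sum.cong[OF refl])
    fix w assume "w \<in> Ph k ` orbs 0"
    then obtain y where "y \<in> orbs 0" "w = Ph k y" by blast
    then show "card {y \<in> orbs 0. Ph k y = w} = card (fib \<alpha>)" using c[of y] by (simp add: fib_def)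
  qed
  also have "\<dots> = card (orbs k) * card (fib \<alpha>)" by (simp add: orbs_eq_image[of k])
  finally show ?thesis unfolding 1 by (simp add: mult_ac)
qed

text \<open>A degree drop at step \<open>k\<close> produces conjugates of \<open>\<alpha>\<close> whose difference has a \<open>p ^ k * (p - 1)\<close>-th
  power of valuation \<open>v p\<close>; the resulting ramification bounds the number of earlier steps without a drop.\<close>

lemma drop_bound:
  assumes drop: "\<not> inj_step k" and nr: "\<not> in_rad p (Ph k \<alpha>)"
  shows "p ^ mm k \<le> p * B * card (orbs 0)"
proof -
  define x where "x = Ph k \<alpha>"
  have x: "algebraic_int x" unfolding x_def by (rule Ph_int[OF \<alpha>_int])
  have "x \<in> orbs k" unfolding x_def orbs_def by (rule orb_self[OF H])
  \<comment> \<open>The drop supplies \<open>u\<close> in \<open>H\<close> with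
    \<open>u x = z * x\<close>; the difference of \<open>\<alpha>\<close> and
    \<open>u \<alpha>\<close> carries the ramification.\<close>
  then have "z ^ 1 * x \<in> orbs k" using drop by (intro orbs_z_closed) (simp_all add: inj_step_def)
  then obtain u where u: "u \<in> H" "z * x = u x" by (auto simp: orbs_def orb_def x_def)
  define d where "d = \<alpha> - u \<alpha>"
  have uM: "u \<alpha> \<in> M" by (rule closed_G[OF H_G[OF u(1)] \<alpha>M])
  have ui: "algebraic_int (u \<alpha>)" by (rule algebraic_int_G[OF H_G[OF u(1)] \<alpha>M \<alpha>_int])
  have dM: "d \<in> M" unfolding d_def using \<alpha>M uM by (rule M(3))
  have di: "algebraic_int d" unfolding d_def using \<alpha>_int ui by (rule algebraic_int_diff)
  have Pu: "Ph k (u \<alpha>) = z * x" using Ph_H[OF u(1) \<alpha>M] u(2) by (simp add: x_def)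
  obtain w where w: "algebraic_int w" "x - z * x = d ^ (p ^ k) + of_nat p * d * w"
    using Ph_diff[OF \<alpha>_int ui, of k] unfolding Pu x_def[symmetric] d_def[symmetric] by blast
  obtain g h where gh: "algebraic_int g" "algebraic_int h" "g * h = 1" "(1 - z) ^ (p - 1) = of_nat p * h"
    using cyclotomic_unit[OF p z] by blast
  define \<kappa> where "\<kappa> = (1 - z) ^ (p - 2) * g"
  have \<kappa>: "algebraic_int \<kappa>" unfolding \<kappa>_def
    by (intro algebraic_int_mult algebraic_int_power algebraic_int_diff z_int gh) simp
  have "of_nat p = of_nat p * (g * h)" using gh by simp
  also have "\<dots> = (1 - z) ^ (p - 1) * g" unfolding gh(4) by (simp only: mult_ac)
  also have "p - 1 = Suc (p - 2)" using p2 by simp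
  finally have p\<kappa>: "of_nat p = (1 - z) * \<kappa>" by (simp add: \<kappa>_def)
  define v where "v = x - \<kappa> * d * w"
  have vi: "algebraic_int v" unfolding v_def by (intro algebraic_int_diff algebraic_int_mult x \<kappa> di w)
  \<comment> \<open>As \<open>p\<close> is a multiple of \<open>1 - z\<close>, the error term is
    absorbed into \<open>v\<close>, which agrees with \<open>x\<close> up to a multiple of
    \<open>d\<close>.\<close>
  have dv: "d ^ (p ^ k) = (1 - z) * v"
    using w(2) unfolding p\<kappa> v_def by (simp add: algebra_simps)
  define N where "N = p ^ k * (p - 1)"
  have N: "N > 0" using p2 by (simp add: N_def)
  define \<omega> where "\<omega> = h * v ^ (p - 1)"
  have \<omega>i: "algebraic_int \<omega>" unfolding \<omega>_def by (intro algebraic_int_mult algebraic_int_power gh vi)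
  have dN: "d ^ N = of_nat p * \<omega>"
    unfolding N_def power_mult dv power_mult_distrib gh(4) \<omega>_def by (simp only: mult_ac)
  \<comment> \<open>If \<open>\<omega>\<close> were in the radical, so would be \<open>v\<close>;
    \<open>d\<close> is there because \<open>p\<close> divides \<open>d ^ N\<close>, and then
    \<open>x\<close> would be there too.\<close>
  have nr\<omega>: "\<not> in_rad p \<omega>"
  proof
    assume "in_rad p \<omega>"
    then have "in_rad p (\<omega> * g)" using gh(1) by (rule in_rad_mult)
    also have "\<omega> * g = v ^ (p - 1) * (g * h)" by (simp only: \<omega>_def mult_ac)
    finally have "in_rad p (v ^ (p - 1))" using gh(3) by simp
    then have vr: "in_rad p v" using p2 vi by (intro in_rad_power_cancel[of p v "p - 1"]) simp_all
    have "of_nat p advd (d ^ N)" using dN \<omega>i by (intro advdI)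
    then have "in_rad p d" unfolding in_rad_def using N di by blast
    then have "in_rad p (d * (\<kappa> * w))" by (rule in_rad_mult) (rule algebraic_int_mult[OF \<kappa> w(1)])
    from in_rad_add[OF p vr this] have "in_rad p x" by (simp add: v_def mult_ac)
    then show False using nr by (simp add: x_def)
  qed
  have "N \<le> card (orb G d)" by (rule card_orb_ge_ramification[OF p dM di N dN \<omega>i nr\<omega>])
  also have "\<dots> \<le> card ((\<lambda>s. (s b, s z)) ` G) * card (orb H d)" by (rule card_orb_G_le)
  also have "\<dots> \<le> B * card (orb H d)" by (rule mult_right_mono[OF card_bz]) simp
  finally have NB: "N \<le> B * card (orb H d)" .
  define S where "S = {(y, y'). y \<in> orbs 0 \<and> y' \<in> orbs 0 \<and> Ph (Suc k) y = Ph (Suc k) y'}"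
  have finS: "finite S" by (rule finite_subset[of _ "orbs 0 \<times> orbs 0"]) (auto simp: S_def finite_orbs)
  \<comment> \<open>Only pairs in a common fibre of \<open>Ph (Suc k)\<close> occur as conjugates of
    the pair behind \<open>d\<close>. There are \<open>D0 * D0 / D1\<close> of them, and
    \<open>D1 * p ^ Suc k = D0 * p ^ mm k\<close> turns this into a bound linear in
    \<open>D0\<close>.\<close>
  have "orb H d \<subseteq> (\<lambda>(y, y'). y - y') ` S"
  proof
    fix y assume "y \<in> orb H d"
    then obtain t where t: "t \<in> H" "y = t d" by (auto simp: orb_def)
    have y: "y = t \<alpha> - t (u \<alpha>)" using t diff_G[OF H_G[OF t(1)] \<alpha>M uM] by (simp add: d_def)
    have tu: "t \<circ> u \<in> H" using H t u by (auto simp: subgrp_def)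
    have "Ph k (u \<alpha>) ^ p = Ph k \<alpha> ^ p" unfolding Pu x_def[symmetric] power_mult_distrib z(1) by simp
    then have "Ph (Suc k) (u \<alpha>) = Ph (Suc k) \<alpha>" by simp
    then have "Ph (Suc k) (t (u \<alpha>)) = Ph (Suc k) (t \<alpha>)"
      using Ph_H[OF t(1) uM, of "Suc k"] Ph_H[OF t(1) \<alpha>M, of "Suc k"] by metis
    moreover have "t \<alpha> \<in> orbs 0" "t (u \<alpha>) \<in> orbs 0" using t tu by (auto simp: orbs_def orb_def intro: image_eqI[of _ _ "t \<circ> u"])
    ultimately have "(t \<alpha>, t (u \<alpha>)) \<in> S" by (simp add: S_def)
    then show "y \<in> (\<lambda>(y, y'). y - y') ` S" unfolding y by (rule rev_image_eqI) simp
  qed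
  then have "card (orb H d) \<le> card S"
    by (meson card_image_le card_mono finS finite_imageI le_trans)
  then have NS: "N \<le> B * card S" using NB by (meson le_trans mult_le_mono2)
  define D0 D1 where "D0 = card (orbs 0)" and "D1 = card (orbs (Suc k))"
  have D0: "D0 > 0" and D1: "D1 > 0" using card_orbs_pos by (simp_all add: D0_def D1_def)
  have SD: "card S * D1 = D0 * D0" unfolding S_def D0_def D1_def by (rule card_orbs_pairs)
  have mD: "D1 * p ^ Suc k = D0 * p ^ mm k" using card_orbs_mm[of "Suc k"] drop by (simp add: D0_def D1_def)
  have "(p ^ k * D1) * ((p - 1) * p ^ mm k) \<le> (p ^ k * D1) * (p * B * D0)"
  proof -
    have "(p ^ k * D1) * ((p - 1) * p ^ mm k) = (N * D1) * p ^ mm k" by (simp add: N_def mult_ac)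
    also have "\<dots> \<le> (B * (card S * D1)) * p ^ mm k"
      using mult_right_mono[OF NS, of "D1 * p ^ mm k"] by (simp add: mult_ac)
    also have "\<dots> = B * D0 * (D1 * p ^ Suc k)" unfolding SD mD by (simp only: mult_ac)
    also have "\<dots> = (p ^ k * D1) * (p * B * D0)" by (simp add: mult_ac)
    finally show ?thesis .
  qed
  then have "(p - 1) * p ^ mm k \<le> p * B * D0" using p0 D1 by simp
  moreover have "1 * p ^ mm k \<le> (p - 1) * p ^ mm k" using p2 by (intro mult_right_mono) simp_all
  ultimately show ?thesis unfolding D0_def by linarith
qed

text \<open>Modulo \<open>p\<close>, \<open>F ^^ j\<close> acts on differences as a power map, and
  the radical is stable under powers and roots.\<close>

lemma in_rad_F_diff_iff:
  assumes x: "algebraic_int x" and y: "algebraic_int y"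
  shows "in_rad p ((F ^^ j) x - (F ^^ j) y) \<longleftrightarrow> in_rad p (x - y)"
proof -
  obtain w where w: "algebraic_int w" "(F ^^ j) x - (F ^^ j) y = (x - y) ^ (p ^ (e * j)) + of_nat p * (x - y) * w"
    using Ph_diff[OF x y, of "e * j"] unfolding Ph_eq_iterate by blast
  have d: "algebraic_int (x - y)" using x y by (rule algebraic_int_diff)
  have dp: "algebraic_int ((x - y) ^ (p ^ (e * j)))" using d by (rule algebraic_int_power)
  have Fd: "algebraic_int ((F ^^ j) x - (F ^^ j) y)" by (intro algebraic_int_diff F_int x y)
  have adv: "of_nat p advd (((F ^^ j) x - (F ^^ j) y) - (x - y) ^ (p ^ (e * j)))"
    unfolding w(2) by (rule advdI[OF algebraic_int_mult[OF d w(1)]]) (simp add: mult.assoc)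
  have pk: "p ^ (e * j) > 0" using p0 by simp
  show ?thesis
  proof
    assume "in_rad p ((F ^^ j) x - (F ^^ j) y)"
    then have "in_rad p ((x - y) ^ (p ^ (e * j)))" using advd_diff_commute[OF adv] dp by (rule in_rad_cong[OF p])
    then show "in_rad p (x - y)" using pk d by (rule in_rad_power_cancel)
  next
    assume "in_rad p (x - y)"
    moreover have "(x - y) ^ (p ^ (e * j)) = (x - y) * (x - y) ^ (p ^ (e * j) - 1)"
      using power_minus_mult[OF pk, of "x - y"] by (simp add: mult.commute)
    ultimately have "in_rad p ((x - y) ^ (p ^ (e * j)))" using in_rad_mult[OF _ algebraic_int_power[OF d]] by metis
    then show "in_rad p ((F ^^ j) x - (F ^^ j) y)" using adv Fd by (rule in_rad_cong[OF p])
  qed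
qed

lemma periodic_mult: "(F ^^ (n * j)) 0 = 0"
  by (induction j) (simp_all add: funpow_add periodic)

text \<open>Modulo the radical \<open>F\<close> is injective, so \<open>\<alpha>\<close> is
  congruent to the point \<open>w\<close> on the cycle of \<open>0\<close> that
  \<open>F ^^ j\<close> sends to \<open>0\<close>. At most \<open>n\<close> iterations bring
  \<open>w\<close> to \<open>0\<close>.\<close>

lemma in_rad_iterate:
  assumes "in_rad p (Ph k \<alpha>)" shows "\<exists>i\<le>n. in_rad p ((F ^^ i) \<alpha>)"
proof -
  define j where "j = k div e"
  have "k = e * j + k mod e" by (simp add: j_def)
  moreover have "k mod e < e" using e by simp
  ultimately have "Ph k \<alpha> = (F ^^ j) \<alpha> ^ (p ^ (k mod e))" using Ph_power[of "k mod e" j \<alpha>] by (metis Ph_eq_iterate)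
  then have "in_rad p ((F ^^ j) \<alpha> ^ (p ^ (k mod e)))" using assms by (simp only:)
  moreover have "p ^ (k mod e) > 0" using p0 by simp
  ultimately have rj: "in_rad p ((F ^^ j) \<alpha>)" using F_int[OF \<alpha>_int] by (rule in_rad_power_cancel)
  define w where "w = (F ^^ ((n - 1) * j)) 0"
  have wi: "algebraic_int w" unfolding w_def by (rule F_int) simp
  have "j + (n - 1) * j = n * j" using n by (cases n) simp_all
  then have "(F ^^ j) w = 0" unfolding w_def F_iterate_add by (simp only: periodic_mult)
  then have "in_rad p ((F ^^ j) \<alpha> - (F ^^ j) w)" using rj by simp
  then have rw: "in_rad p (\<alpha> - w)" using in_rad_F_diff_iff[OF \<alpha>_int wi] by simp
  define i0 where "i0 = ((n - 1) * j) mod n"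
  define i where "i = n - i0"
  have i0: "i0 < n" using n by (simp add: i0_def)
  have "i + (n - 1) * j = n * (((n - 1) * j) div n + 1)"
  proof -
    define u where "u = (n - 1) * j"
    have "n * (u div n) + i0 = u" by (simp add: i0_def u_def)
    moreover have "i + i0 = n" using i0 by (simp add: i_def)
    moreover have "n * (u div n + 1) = n * (u div n) + n" by simp
    ultimately show ?thesis unfolding u_def by linarith
  qed
  then have "(F ^^ i) w = 0" unfolding w_def F_iterate_add by (simp only: periodic_mult)
  then have "in_rad p ((F ^^ i) \<alpha>)" using in_rad_F_diff_iff[OF \<alpha>_int wi, of i] rw by simp
  then show ?thesis by (intro exI[of _ i]) (simp add: i_def)
qed

text \<open>\<open>F ^^ n\<close> maps \<open>y\<close> to \<open>y ^ Q + p * y * w\<close>, and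
  both terms contain one factor \<open>p\<close> more than \<open>y\<close>.\<close>

lemma superattracting_step:
  assumes y: "algebraic_int y" and d: "(of_nat p ^ Suc i) advd y"
  shows "(of_nat p ^ Suc (Suc i)) advd (F ^^ n) y"
proof -
  obtain w where w: "algebraic_int w" "(F ^^ n) y - (F ^^ n) 0 = (y - 0) ^ (p ^ (e * n)) + of_nat p * (y - 0) * w"
    using Ph_diff[OF y algebraic_int_0, of "e * n"] unfolding Ph_eq_iterate by blast
  have pd: "of_nat p advd y"
  proof (rule advd_trans[OF _ d])
    show "of_nat p advd (of_nat p ^ Suc i)"
      using advdI[OF algebraic_int_power[OF algebraic_int_of_nat'[of p], of i] refl, of "of_nat p"] by simp
  qed
  have en: "p ^ (e * n) \<ge> 2"
  proof -
    have "p ^ 1 \<le> p ^ (e * n)" using p0 e n by (intro power_increasing) simp_all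
    then show ?thesis using p2 by simp
  qed
  have "y ^ (p ^ (e * n)) = (y * y) * y ^ (p ^ (e * n) - 2)"
    using en by (simp only: power2_eq_square[symmetric] power_add[symmetric] le_add_diff_inverse)
  moreover have "(of_nat p ^ Suc i * of_nat p) advd (y * y)" using d pd by (rule advd_mult)
  ultimately have "(of_nat p ^ Suc i * of_nat p) advd (y ^ (p ^ (e * n)))"
    using advd_mult_right algebraic_int_power[OF y] by metis
  moreover have "(of_nat p ^ Suc i * of_nat p) advd (y * (of_nat p * w))"
    using d by (rule advd_mult) (rule advdI[OF w(1) refl])
  ultimately have "(of_nat p ^ Suc i * of_nat p) advd (y ^ (p ^ (e * n)) + y * (of_nat p * w))" by (rule advd_add)
  then show ?thesis using w(2) periodic by (simp add: mult_ac)
qed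

text \<open>At most \<open>n\<close> iterations reach the radical, where a power bounded by the
  degree is divisible by \<open>p\<close>. Each \<open>F ^^ n\<close> divides this exponent by
  \<open>Q\<close>; once it is \<open>1\<close>, a further \<open>C\<close> rounds yield
  \<open>Suc C\<close> factors \<open>p\<close>. The middle stage is logarithmic in the degree, so
  \<open>(p ^ e) ^ J\<close> grows only linearly.\<close>

lemma superattracted:
  assumes r: "in_rad p (Ph k \<alpha>)"
  shows "\<exists>J. (p ^ e) ^ J \<le> p ^ (e * n * (C + 2) + 1) * B * card (orbs 0) \<and> (of_nat p ^ Suc C) advd (F ^^ J) \<alpha>"
proof -
  obtain i where i: "i \<le> n" "in_rad p ((F ^^ i) \<alpha>)" using in_rad_iterate[OF r] by blast
  define x where "x = (F ^^ i) \<alpha>"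
  have xM: "x \<in> M" and xi: "algebraic_int x" unfolding x_def using F_M[OF \<alpha>M] F_int[OF \<alpha>_int] by auto
  define d where "d = card (orb G x)"
  have "d \<le> B * card (orb H x)"
    unfolding d_def using card_orb_G_le[of x b z] card_bz mult_right_mono order.trans by (meson le0 mult_le_mono1)
  also have "orb H x = (F ^^ i) ` orbs 0"
    using orbs_eq_image[of "e * i"] by (simp add: orbs_def x_def Ph_eq_iterate)
  also have "card ((F ^^ i) ` orbs 0) \<le> card (orbs 0)" by (rule card_image_le[OF finite_orbs])
  finally have dB: "d \<le> B * card (orbs 0)" by simp
  have xd: "of_nat p advd (x ^ d)" unfolding d_def using in_rad_power_degree[OF p xM] i(2) by (simp add: x_def)
  have dpos: "d > 0" unfolding d_def by (rule card_orb_pos[OF subgrp_G])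
  \<comment> \<open>The degree is rounded up to a power of \<open>p\<close>, at the price of a
    factor \<open>p\<close>.\<close>
  define r where "r = (LEAST r. d \<le> p ^ r)"
  have "d \<le> p ^ d" using power_gt_expt[of p d] p2 by simp
  then have dr: "d \<le> p ^ r" unfolding r_def by (rule LeastI)
  have rd: "p ^ r \<le> p * d"
  proof (cases r)
    case 0
    then show ?thesis using p0 dpos by (simp add: Suc_leI)
  next
    case (Suc s)
    then have "\<not> d \<le> p ^ s" using not_less_Least[of s "\<lambda>r. d \<le> p ^ r"] by (simp add: r_def)
    then show ?thesis using Suc by simp
  qed
  have "x ^ (p ^ r) = x ^ d * x ^ (p ^ r - d)" using dr by (simp flip: power_add)
  then have xr: "of_nat p advd (x ^ (p ^ r))" using advd_mult_right[OF xd algebraic_int_power[OF xi]] by simp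
  have en0: "e * n > 0" using e n by simp
  have it: "of_nat p advd ((F ^^ (n * m)) x ^ (p ^ (r - e * n * m)))" for m
  proof (induction m)
    case 0
    then show ?case using xr by simp
  next
    case (Suc m)
    define y where "y = (F ^^ (n * m)) x"
    define s s' where "s = r - e * n * m" and "s' = r - e * n * Suc m"
    have yi: "algebraic_int y" unfolding y_def by (rule F_int[OF xi])
    have IH: "of_nat p advd (y ^ (p ^ s))" using Suc by (simp add: y_def s_def)
    have Fy: "algebraic_int ((F ^^ n) y)" by (rule F_int[OF yi])
    have ss: "s \<le> e * n + s'" by (simp add: s_def s'_def)
    have "of_nat p advd ((y ^ (p ^ s)) ^ (p ^ (e * n + s' - s)))"
      using IH by (rule advd_power_self) (use yi p0 in \<open>simp_all add: algebraic_int_power\<close>)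
    also have "(y ^ (p ^ s)) ^ (p ^ (e * n + s' - s)) = (y ^ Q) ^ (p ^ s')"
      using ss by (simp add: Q_p flip: power_mult power_add)
    finally have "of_nat p advd ((y ^ Q) ^ (p ^ s'))" .
    moreover have "of_nat p advd (((F ^^ n) y) ^ (p ^ s') - (y ^ Q) ^ (p ^ s'))"
      using F_frobenius[OF yi, of 1] by (intro advd_power_diff Fy algebraic_int_power yi) simp
    ultimately have "of_nat p advd (((F ^^ n) y) ^ (p ^ s'))" using advd_cancel by blast
    moreover have "(F ^^ (n * Suc m)) x = (F ^^ n) y" by (simp add: y_def funpow_add)
    ultimately show ?case by (simp add: s'_def)
  qed
  define m where "m = r div (e * n) + 1"
  have mr: "r \<le> e * n * m" and mr': "e * n * m \<le> r + e * n"
  proof -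
    have "r = e * n * (r div (e * n)) + r mod (e * n)" by simp
    moreover have "r mod (e * n) < e * n" using en0 by simp
    moreover have "e * n * m = e * n * (r div (e * n)) + e * n" by (simp add: m_def distrib_left)
    ultimately show "r \<le> e * n * m" "e * n * m \<le> r + e * n" by linarith+
  qed
  define y where "y = (F ^^ (n * m)) x"
  have yi: "algebraic_int y" unfolding y_def by (rule F_int[OF xi])
  have "of_nat p advd y" using it[of m] mr by (simp add: y_def)
  then have C: "(of_nat p ^ Suc c) advd (F ^^ (n * c)) y" for c
  proof (induction c)
    case (Suc c)
    have "(of_nat p ^ Suc (Suc c)) advd (F ^^ n) ((F ^^ (n * c)) y)"
      using Suc F_int[OF yi] by (intro superattracting_step) simp_all
    then show ?case by (simp add: funpow_add)
  qed simp
  define J where "J = n * C + (n * m + i)"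
  have "(F ^^ (n * C)) y = (F ^^ J) \<alpha>" by (simp only: J_def y_def x_def F_iterate_add)
  then have "(of_nat p ^ Suc C) advd (F ^^ J) \<alpha>" using C[of C] by simp
  moreover have "(p ^ e) ^ J \<le> p ^ (e * n * (C + 2) + 1) * B * card (orbs 0)"
  proof -
    have "e * J \<le> r + e * n * (C + 2)"
    proof -
      have "e * i \<le> e * n" using i by simp
      moreover have "e * J = e * n * C + e * n * m + e * i" by (simp add: J_def algebra_simps)
      ultimately have "e * J \<le> e * n * C + (r + e * n) + e * n" using mr' by linarith
      then show ?thesis by (simp add: algebra_simps)
    qed
    then have "(p ^ e) ^ J \<le> p ^ (r + e * n * (C + 2))"
      unfolding power_mult[symmetric] using p0 by (intro power_increasing) simp_all
    also have "\<dots> \<le> (p * (B * card (orbs 0))) * p ^ (e * n * (C + 2))"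
      unfolding power_add using rd dB by (intro mult_right_mono) (meson le_trans mult_le_mono2, simp)
    finally show ?thesis by (simp add: mult_ac)
  qed
  ultimately show ?thesis by blast
qed

end

subsection \<open>The height of an integral point\<close>

locale unicritical_height = unicritical_galois +
  fixes R :: real
  assumes R: "\<And>s. s \<in> G \<Longrightarrow> norm (s b) \<le> R"
begin

text \<open>The archimedean part of the height as an average over the group. As
  \<open>\<alpha>\<close> and \<open>b\<close> are integral, the other places contribute
  nothing.\<close>

definition ht :: real where "ht = (\<Sum>s\<in>G. grn (p ^ e) (s b) (s \<alpha>)) / card G"

lemma q2: "p ^ e \<ge> 2"
proof -
  have "p ^ 1 \<le> p ^ e" using p0 e by (intro power_increasing) simp_all
  then show ?thesis using p2 by simp
qed

lemma R_nonneg: "R \<ge> 0" using R[OF id_G] norm_ge_zero order.trans by blast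

lemma ht_nonneg: "ht \<ge> 0"
  unfolding ht_def by (intro divide_nonneg_nonneg sum_nonneg grn_nonneg[OF q2]) simp

lemma G_F: "s \<in> G \<Longrightarrow> x \<in> M \<Longrightarrow> s ((F ^^ k) x) = (uni (p ^ e) (s b) ^^ k) (s x)"
proof (induction k)
  case (Suc k)
  then show ?case
    using F_M[OF Suc.prems(2), of k] add_G[OF Suc.prems(1) M(9)[OF F_M[OF Suc.prems(2)]] bM]
    by (simp add: uni_def[of _ _ "(F ^^ k) x"] uni_def[of _ _ "(uni (p ^ e) (s b) ^^ k) (s x)"] power_G[OF Suc.prems(1)])
qed simp

lemma sum_grn_iterate: "(\<Sum>s\<in>G. grn (p ^ e) (s b) (s ((F ^^ k) \<alpha>))) = real (p ^ e) ^ k * (card G * ht)"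
proof -
  have "(\<Sum>s\<in>G. grn (p ^ e) (s b) (s ((F ^^ k) \<alpha>))) = (\<Sum>s\<in>G. real (p ^ e) ^ k * grn (p ^ e) (s b) (s \<alpha>))"
    by (rule sum.cong[OF refl]) (simp add: G_F \<alpha>M grn_iterate[OF q2])
  also have "\<dots> = real (p ^ e) ^ k * (\<Sum>s\<in>G. grn (p ^ e) (s b) (s \<alpha>))" by (simp only: sum_distrib_left)
  finally show ?thesis using card_G_pos by (simp add: ht_def)
qed

lemma sum_grn_orb:
  assumes "y \<in> orb H x"
  shows "(\<Sum>s\<in>G. grn (p ^ e) (s b) (s y)) = (\<Sum>s\<in>G. grn (p ^ e) (s b) (s x))"
proof -
  obtain t where t: "t \<in> H" "y = t x" using assms by (auto simp: orb_def)
  have "(\<Sum>s\<in>G. grn (p ^ e) (s b) (s y)) = (\<Sum>s\<in>G. grn (p ^ e) ((s \<circ> t) b) ((s \<circ> t) x))"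
    by (simp add: t H_b)
  also have "\<dots> = (\<Sum>s\<in>G. grn (p ^ e) (s b) (s x))"
    by (rule sum_comp_right_G[OF H_G[OF t(1)]])
  finally show ?thesis .
qed

definition Dg :: nat where "Dg = card (orbs 0)"

lemma Dg_pos: "Dg > 0" by (simp add: Dg_def card_orbs_pos)

text \<open>The quotient by \<open>p ^ k\<close> is still a nonzero algebraic integer, so its norm
  has absolute value at least \<open>1\<close>.\<close>

lemma sum_ln_advd:
  assumes y: "y \<in> M" "y \<noteq> 0" "(of_nat p ^ k) advd y"
  shows "card G * (k * ln (real p)) \<le> (\<Sum>s\<in>G. ln (norm (s y)))"
proof -
  obtain t where t: "algebraic_int t" "y = of_nat p ^ k * t" using y(3) by (elim advdE)
  have pk: "(of_nat p :: complex) ^ k \<noteq> 0" using p0 by simp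
  have pkM: "of_nat p ^ k \<in> M" by (intro M subfld_of_nat[OF subfld_M])
  have "y / of_nat p ^ k = t" unfolding t(2) using pk by (rule nonzero_mult_div_cancel_left)
  then have tM: "t \<in> M" using M(8)[OF y(1) pkM] by simp
  have t0: "t \<noteq> 0" using y t by auto
  have "ln (norm (s y)) = k * ln (real p) + ln (norm (s t))" if s: "s \<in> G" for s
  proof -
    have "s y = of_nat p ^ k * s t"
      unfolding t(2) using mult_G[OF s pkM tM] power_G[OF s subfld_of_nat[OF subfld_M]] of_nat_G[OF s] by simp
    then have "norm (s y) = real p ^ k * norm (s t)" by (simp add: norm_mult norm_power)
    then show ?thesis using p0 t0 eq_0_G[OF s] by (simp add: ln_mult ln_realpow)
  qed
  then have "(\<Sum>s\<in>G. ln (norm (s y))) = card G * (k * ln (real p)) + (\<Sum>s\<in>G. ln (norm (s t)))"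
    by (simp add: sum.distrib)
  then show ?thesis using sum_ln_norm_G_nonneg[OF tM t(1) t0] by simp
qed

text \<open>\<open>C1\<close> factors \<open>p\<close> outweigh the distance between
  \<open>log_plus\<close> and the Green function; the extra one in \<open>Suc C1\<close> leaves a
  net gain of \<open>ln 2\<close>.\<close>

definition C1 :: nat where "C1 = nat \<lceil>growth_const R / ln 2\<rceil>"
lemma cst1_denom: "real (p ^ (e * n * (C1 + 2) + 1) * (B + 1)) > 0"
  unfolding of_nat_0_less_iff using p0 by (intro mult_pos_pos zero_less_power) simp_all

definition cst1 :: real where "cst1 = ln 2 / (p ^ (e * n * (C1 + 2) + 1) * (B + 1))"

text \<open>The norm of an iterate divisible by \<open>p ^ Suc C1\<close> forces archimedean size,
  so \<open>(p ^ e) ^ J * ht \<ge> ln 2\<close>, while \<open>(p ^ e) ^ J\<close> is at most linear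
  in \<open>Dg\<close>.\<close>

lemma ht_superattracted:
  assumes r: "in_rad p (Ph k \<alpha>)" shows "ht \<ge> cst1 / Dg"
proof -
  obtain J where J: "(p ^ e) ^ J \<le> p ^ (e * n * (C1 + 2) + 1) * B * card (orbs 0)"
    "(of_nat p ^ Suc C1) advd (F ^^ J) \<alpha>" using superattracted[OF r, of C1] by blast
  define y where "y = (F ^^ J) \<alpha>"
  have yM: "y \<in> M" unfolding y_def by (rule F_M[OF \<alpha>M])
  have y0: "y \<noteq> 0" unfolding y_def by (rule F_neq_0)
  have "card G * (Suc C1 * ln (real p)) \<le> (\<Sum>s\<in>G. ln (norm (s y)))"
    using J(2) by (intro sum_ln_advd yM y0) (simp add: y_def)
  also have "\<dots> \<le> (\<Sum>s\<in>G. grn (p ^ e) (s b) (s y) + growth_const R)"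
  proof (rule sum_mono)
    fix s assume s: "s \<in> G"
    have "ln (norm (s y)) \<le> log_plus (norm (s y))" using y0 eq_0_G[OF s] by (intro ln_le_log_plus) simp
    also have "\<dots> \<le> grn (p ^ e) (s b) (s y) + growth_const R" by (rule log_plus_le_grn[OF q2 R[OF s]])
    finally show "ln (norm (s y)) \<le> grn (p ^ e) (s b) (s y) + growth_const R" .
  qed
  also have "\<dots> = card G * (real (p ^ e) ^ J * ht + growth_const R)"
    using sum_grn_iterate[of J] by (simp add: sum.distrib y_def algebra_simps)
  finally have "Suc C1 * ln (real p) \<le> real (p ^ e) ^ J * ht + growth_const R"
    using card_G_pos by simp
  moreover have "Suc C1 * ln 2 \<le> Suc C1 * ln (real p)" using p2 by (intro mult_left_mono) simp_all
  moreover have "growth_const R \<le> C1 * ln 2"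
  proof -
    have "growth_const R / ln 2 \<le> real C1" unfolding C1_def by (rule real_nat_ceiling_ge)
    then show ?thesis by (simp add: field_simps)
  qed
  ultimately have "ln 2 \<le> real (p ^ e) ^ J * ht" by (simp add: algebra_simps)
  also have "\<dots> \<le> (p ^ (e * n * (C1 + 2) + 1) * (B + 1) * Dg) * ht"
  proof (rule mult_right_mono[OF _ ht_nonneg])
    have "(p ^ e) ^ J \<le> p ^ (e * n * (C1 + 2) + 1) * (B + 1) * Dg"
      using J(1) unfolding Dg_def by (rule order.trans) (intro mult_right_mono mult_left_mono, simp_all)
    then have "real ((p ^ e) ^ J) \<le> real (p ^ (e * n * (C1 + 2) + 1) * (B + 1) * Dg)" by (simp only: of_nat_le_iff)
    then show "real (p ^ e) ^ J \<le> real (p ^ (e * n * (C1 + 2) + 1) * (B + 1) * Dg)" by simp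
  qed
  finally have "ln 2 \<le> (real (p ^ (e * n * (C1 + 2) + 1) * (B + 1)) * Dg) * ht" by simp
  moreover have "real (p ^ (e * n * (C1 + 2) + 1) * (B + 1)) * Dg > 0"
    using cst1_denom Dg_pos by (intro mult_pos_pos) simp_all
  ultimately have "ln 2 / (real (p ^ (e * n * (C1 + 2) + 1) * (B + 1)) * Dg) \<le> ht"
    by (simp only: pos_divide_le_eq mult.commute)
  then show ?thesis by (simp only: cst1_def divide_divide_eq_left)
qed

text \<open>If \<open>F ^^ a\<close> sent \<open>x\<close> to a conjugate over the base field, all
  its iterates would stay in one finite orbit.\<close>

lemma orbs_disjoint_aux:
  assumes a: "a > 0" and x: "x = (F ^^ c) \<alpha>" shows "(F ^^ a) x \<notin> orb H x"
proof
  assume h: "(F ^^ a) x \<in> orb H x"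
  have xM: "x \<in> M" unfolding x by (rule F_M[OF \<alpha>M])
  have "(F ^^ (a * r)) x \<in> orb H x" for r
  proof (induction r)
    case 0
    then show ?case using orb_self[OF H] by simp
  next
    case (Suc r)
    then obtain t where t: "t \<in> H" "(F ^^ (a * r)) x = t x" by (auto simp: orb_def)
    have "(F ^^ (a * Suc r)) x = (F ^^ a) (t x)" by (simp add: funpow_add flip: t(2))
    also have "\<dots> = t ((F ^^ a) x)" using F_H[OF t(1) xM] by simp
    finally show ?case using orb_mem_orb[OF H h t(1)] by simp
  qed
  then have "range (\<lambda>r. (F ^^ (a * r)) x) \<subseteq> orb H x" by blast
  then have "finite (range (\<lambda>r. (F ^^ (a * r)) x))" using finite_orb[OF H] by (rule finite_subset)
  moreover have "inj (\<lambda>r. (F ^^ (a * r)) x)"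
    by (rule injI) (use a in \<open>simp add: x F_iterate_add F_inj\<close>)
  ultimately show False using finite_imageD[of "\<lambda>r. (F ^^ (a * r)) x" UNIV] by simp
qed

lemma mm_mono: "k \<le> k' \<Longrightarrow> mm k \<le> mm k'"
  by (induction k' rule: dec_induct) simp_all

lemma mm_add_le: "mm (k + i) \<le> mm k + i"
  by (induction i) simp_all

text \<open>Degrees are at least \<open>1\<close>, so the number of drops is at most logarithmic in
  \<open>Dg\<close>.\<close>

lemma mm_unbounded: "\<exists>j. mm (e * j) \<ge> m"
proof -
  define j where "j = m + Dg"
  define k where "k = e * j"
  have "1 * p ^ k \<le> card (orbs k) * p ^ k"
    using card_orbs_pos[of k] by (intro mult_right_mono) (simp_all only: less_eq_Suc_le One_nat_def le0)
  also have "card (orbs k) * p ^ k = Dg * p ^ mm k" using card_orbs_mm[of k] by (simp add: Dg_def)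
  also have "\<dots> < p ^ Dg * p ^ mm k" using power_gt_expt[of p Dg] p2 p0 by simp
  finally have "p ^ k < p ^ (Dg + mm k)" by (simp only: power_add mult_1)
  then have "k < Dg + mm k" using p2 by (simp add: power_strict_increasing_iff)
  moreover have "k \<ge> j" unfolding k_def using e by simp
  ultimately have "mm k \<ge> m" by (simp add: j_def)
  then show ?thesis by (auto simp: k_def)
qed

definition K1 :: real where "K1 = real (p ^ e) * growth_const R"
definition Ec :: real where "Ec = disc_const (p ^ e) R"
text \<open>Large enough for the gain from \<open>Jn\<close> other levels to outrun the archimedean
  loss with coefficient \<open>2 * Ec\<close>.\<close>

definition Jn :: nat where "Jn = nat \<lceil>2 * Ec\<rceil> + 1"
text \<open>The distance between consecutive levels: \<open>dprod_advd\<close> compares conjugates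
  with iterates that are a multiple of \<open>n * L\<close> steps ahead.\<close>

definition shift :: nat where "shift = n * L"
text \<open>The part \<open>p * B + 1\<close> excludes later drops by \<open>drop_bound\<close>; the
  exponential part makes the power of \<open>p\<close> exceed the loss \<open>Mx\<close> and all
  archimedean constants.\<close>

definition Z0 :: nat where
  "Z0 = p * B + 1 + nat \<lceil>p ^ Mx * exp (2 * K1 + 2 * Ec * ln (Jn + 1) + 1)\<rceil>"
definition cst2 :: real where
  "cst2 = 1 / (2 * (Jn + 1) * real (p ^ e) ^ (Jn * shift) * p ^ (e + 1) * Z0)"

lemma cst_pos: "cst1 > 0" "cst2 > 0"
proof -
  show "cst1 > 0" unfolding cst1_def by (rule divide_pos_pos[OF _ cst1_denom]) simp
  have "Z0 > 0" by (simp add: Z0_def)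
  then show "cst2 > 0" unfolding cst2_def using p0 by (intro divide_pos_pos) simp_all
qed

lemma Ec_pos: "Ec \<ge> 1"
  using growth_const_nonneg[OF R_nonneg] by (simp add: Ec_def disc_const_def)

lemma K1_nonneg: "K1 \<ge> 0"
  using growth_const_nonneg[OF R_nonneg] by (simp add: K1_def)

lemma Jn_ge: "2 * Ec \<le> Jn" "Jn \<ge> 1"
  using real_nat_ceiling_ge[of "2 * Ec"] by (simp_all add: Jn_def)

text \<open>\<open>m\<close> is the least exponent with \<open>p ^ m \<ge> Z0 * Dg\<close>, and
  \<open>j\<close> the first level at which \<open>mm\<close> reaches \<open>m\<close>. Rounding
  costs a factor \<open>p\<close>, and one application of \<open>f\<close> raises \<open>mm\<close>
  by at most \<open>e\<close>, whence \<open>p ^ (e + 1)\<close>.\<close>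

lemma choose_level:
  assumes nr: "\<And>k. \<not> in_rad p (Ph k \<alpha>)"
  obtains j where "p ^ mm (e * j) \<ge> Z0 * Dg" "p ^ mm (e * j) \<le> p ^ (e + 1) * Z0 * Dg"
    "\<And>k. k \<ge> e * j \<Longrightarrow> inj_step k"
proof -
  define N where "N = Z0 * Dg"
  have Npos: "N > 0" using Dg_pos by (simp add: N_def Z0_def)
  define m where "m = (LEAST m. N \<le> p ^ m)"
  have "N \<le> p ^ N" using power_gt_expt[of p N] p2 by simp
  then have m: "N \<le> p ^ m" unfolding m_def by (rule LeastI)
  have mle: "p ^ m \<le> p * N"
  proof (cases m)
    case 0
    then show ?thesis using p0 Npos by (simp add: Suc_leI)
  next
    case (Suc s)
    then have "\<not> N \<le> p ^ s" using not_less_Least[of s "\<lambda>m. N \<le> p ^ m"] by (simp add: m_def)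
    then show ?thesis using Suc by simp
  qed
  define j where "j = (LEAST j. mm (e * j) \<ge> m)"
  have j: "mm (e * j) \<ge> m" unfolding j_def by (rule LeastI_ex) (rule mm_unbounded)
  have jle: "mm (e * j) \<le> m + e"
  proof (cases j)
    case (Suc i)
    then have "\<not> mm (e * i) \<ge> m" using not_less_Least[of i "\<lambda>j. mm (e * j) \<ge> m"] by (simp add: j_def)
    then show ?thesis using mm_add_le[of "e * i" e] Suc by (simp add: add.commute)
  qed simp
  have "N \<le> p ^ mm (e * j)" using m power_increasing[OF j, of p] p0 by simp
  moreover have "p ^ mm (e * j) \<le> p ^ (e + 1) * Z0 * Dg"
  proof -
    have "p ^ mm (e * j) \<le> p ^ (m + e)" using jle p0 by (intro power_increasing) simp_all
    also have "\<dots> \<le> (p * N) * p ^ e" unfolding power_add using mle by (rule mult_right_mono) simp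
    finally show ?thesis by (simp add: N_def mult_ac)
  qed
  moreover have "inj_step k" if k: "k \<ge> e * j" for k
  proof (rule ccontr)
    assume "\<not> inj_step k"
    then have "p ^ mm k \<le> p * B * Dg" using drop_bound nr by (simp add: Dg_def)
    moreover have "N \<le> p ^ mm k"
      using m power_increasing[of m "mm k" p] j mm_mono[OF k] p0 by simp
    moreover have "p * B * Dg < N"
      unfolding N_def using Dg_pos by (intro mult_strict_right_mono) (simp_all add: Z0_def)
    ultimately show False by simp
  qed
  ultimately show ?thesis using that by (simp add: N_def)
qed

lemma ht_main:
  assumes nr: "\<And>k. \<not> in_rad p (Ph k \<alpha>)" shows "ht \<ge> cst2 / Dg ^ 2"
proof -
  obtain j where j: "p ^ mm (e * j) \<ge> Z0 * Dg" "p ^ mm (e * j) \<le> p ^ (e + 1) * Z0 * Dg"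
    "\<And>k. k \<ge> e * j \<Longrightarrow> inj_step k" using choose_level[OF nr] by blast
  define k where "k = e * j"
  \<comment> \<open>No step drops from level \<open>j\<close> on, so all the sets \<open>A i\<close>
    have the same size.\<close>
  define lev where "lev i = j + i * shift" for i
  define A where "A i = orbs (e * lev i)" for i
  define D where "D = card (orbs k)"
  define gc where "gc = card G"
  have gc: "gc > 0" unfolding gc_def by (rule card_G_pos)
  have Dpos: "D > 0" unfolding D_def by (rule card_orbs_pos)
  have "card (orbs (k + i)) = D" for i
  proof (induction i)
    case (Suc i)
    then show ?case using card_orbs_Suc_inj[of "k + i"] j(3)[of "k + i"] by (simp add: k_def)
  qed (simp add: D_def)
  moreover have levk: "e * lev i = k + e * i * shift" for i by (simp add: lev_def k_def algebra_simps)
  ultimately have cA: "card (A i) = D" for i by (simp add: A_def)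
  have finA: "finite (A i)" for i by (simp add: A_def finite_orbs)
  have AM: "x \<in> M" "algebraic_int x" if "x \<in> A i" for x i
    using that orbs_M orbs_int by (auto simp: A_def)
  have Aorb: "A i = orb H ((F ^^ lev i) \<alpha>)" for i by (simp add: A_def orbs_def Ph_eq_iterate)
  have levi: "(F ^^ lev i') \<alpha> = (F ^^ (n * (L * (i' - i)))) ((F ^^ lev i) \<alpha>)" if "i < i'" for i i'
  proof -
    have "lev i' = n * (L * (i' - i)) + lev i"
      using that by (simp add: lev_def shift_def algebra_simps diff_mult_distrib2 mult_le_mono)
    then show ?thesis by (simp only: F_iterate_add)
  qed
  have L0: "L > 0" by (simp add: L_def)
  have disj: "A i \<inter> A i' = {}" if ii: "i < i'" for i i'
  proof (rule ccontr)
    assume "A i \<inter> A i' \<noteq> {}"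
    then obtain x where "x \<in> A i" "x \<in> A i'" by blast
    then have "A i = A i'" using orb_eq[OF H] unfolding Aorb by metis
    then have "(F ^^ lev i') \<alpha> \<in> orb H ((F ^^ lev i) \<alpha>)" using orb_self[OF H] unfolding Aorb by blast
    moreover have "n * (L * (i' - i)) > 0" using n L0 ii by simp
    ultimately show False using orbs_disjoint_aux[OF _ refl, of "n * (L * (i' - i))" "lev i"] levi[OF ii] by simp
  qed
  define \<Lambda> where "\<Lambda> x y = (\<Sum>s\<in>G. ln (norm (s x - s y)))" for x y
  have \<Lambda>_sym: "\<Lambda> x y = \<Lambda> y x" for x y by (simp add: \<Lambda>_def norm_minus_commute)
  have \<Lambda>_eq: "\<Lambda> x y = (\<Sum>s\<in>G. ln (norm (s (x - y))))" if "x \<in> M" "y \<in> M" for x y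
    unfolding \<Lambda>_def using that by (intro sum.cong) (simp_all add: diff_G)
  have \<Lambda>_nonneg: "\<Lambda> x y \<ge> 0" if "x \<in> A i" "y \<in> A i'" "x \<noteq> y" for x y i i'
    using AM[OF that(1)] AM[OF that(2)] that(3) by (simp add: \<Lambda>_eq sum_ln_norm_G_nonneg M algebraic_int_diff)
  \<comment> \<open>The logarithm, summed over \<open>G\<close>, of the power of \<open>p\<close> in
    the product of differences between one point and a whole lower level.\<close>
  define \<sigma> where "\<sigma> = gc * (real (mm k - Mx) * ln (real p))"
  \<comment> \<open>An element of \<open>H\<close> moves \<open>x\<close> to the iterate
    \<open>x0\<close> and permutes \<open>A i\<close>; the product for \<open>x0\<close> is a value
    of \<open>dprod\<close>.\<close>
  have cross: "\<sigma> \<le> (\<Sum>y\<in>A i. \<Lambda> x y)" if ii: "i < i'" and x: "x \<in> A i'" for i i' x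
  proof -
    define x0 where "x0 = (F ^^ lev i') \<alpha>"
    obtain t where t: "t \<in> H" "x = t x0" using x by (auto simp: Aorb orb_def x0_def)
    have x0M: "x0 \<in> M" unfolding x0_def by (rule F_M[OF \<alpha>M])
    define T where "T = (F ^^ (n * (L * (i' - i)))) \<alpha>"
    have PhT: "Ph (e * lev i) T = x0"
      unfolding Ph_eq_iterate T_def x0_def F_iterate_add levi[OF ii] by (simp add: add.commute)
    define V where "V = dprod T (e * lev i)"
    have Veq: "V = (\<Prod>y\<in>A i. x0 - y)" by (simp add: V_def dprod_def PhT A_def)
    have x0A: "x0 \<in> A i'" unfolding Aorb x0_def by (rule orb_self[OF H])
    have V0: "V \<noteq> 0" unfolding Veq using finA disj[OF ii] x0A by (auto simp: prod_zero_iff)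
    have VM: "V \<in> M" unfolding Veq using AM x0M by (intro subfld_prod[OF subfld_M] M) auto
    have "(of_nat p ^ (mm (e * lev i) - Mx)) advd V" unfolding V_def T_def by (rule dprod_advd)
    then have "gc * (real (mm (e * lev i) - Mx) * ln (real p)) \<le> (\<Sum>s\<in>G. ln (norm (s V)))"
      unfolding gc_def by (intro sum_ln_advd VM V0)
    moreover have "\<sigma> \<le> gc * (real (mm (e * lev i) - Mx) * ln (real p))"
      unfolding \<sigma>_def using p2 mm_mono[of k "e * lev i"] levk[of i] by (intro mult_left_mono mult_right_mono) simp_all
    moreover have "(\<Sum>s\<in>G. ln (norm (s V))) = (\<Sum>s\<in>G. ln (norm ((s \<circ> t) V)))"
      by (rule sum_comp_right_G[OF H_G[OF t(1)], symmetric])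
    moreover have "t V = (\<Prod>y\<in>A i. x - y)"
    proof -
      have "t V = (\<Prod>y\<in>A i. t (x0 - y))"
        unfolding Veq using AM x0M by (intro prod_G[OF H_G[OF t(1)]] M) auto
      also have "\<dots> = (\<Prod>y\<in>A i. x - t y)"
        using AM x0M t(2) by (intro prod.cong) (simp_all add: diff_G[OF H_G[OF t(1)]])
      also have "\<dots> = (\<Prod>y\<in>t ` A i. x - y)"
        using inj_G[OF H_G[OF t(1)]] by (subst prod.reindex) (auto simp: inj_on_def)
      also have "t ` A i = A i" unfolding Aorb by (rule image_orb[OF H t(1)])
      finally show ?thesis .
    qed
    moreover have "(\<Sum>s\<in>G. ln (norm (s (\<Prod>y\<in>A i. x - y)))) = (\<Sum>y\<in>A i. \<Lambda> x y)"
    proof -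
      have "ln (norm (s (\<Prod>y\<in>A i. x - y))) = (\<Sum>y\<in>A i. ln (norm (s x - s y)))" if s: "s \<in> G" for s
      proof -
        have "s (\<Prod>y\<in>A i. x - y) = (\<Prod>y\<in>A i. s (x - y))"
          using AM AM[OF x] by (intro prod_G[OF s] M) auto
        also have "\<dots> = (\<Prod>y\<in>A i. s x - s y)"
          using AM AM[OF x] by (intro prod.cong) (simp_all add: diff_G[OF s])
        finally have "norm (s (\<Prod>y\<in>A i. x - y)) = (\<Prod>y\<in>A i. norm (s x - s y))" by (simp add: prod_norm)
        moreover have "norm (s x - s y) > 0" if "y \<in> A i" for y
          using that x disj[OF ii] inj_G[OF s] by auto
        ultimately show ?thesis using finA by (simp add: ln_prod)
      qed
      then show ?thesis unfolding \<Lambda>_def by (subst sum.swap) simp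
    qed
    ultimately show ?thesis by simp
  qed
  have cross2: "D * \<sigma> \<le> (\<Sum>x\<in>A i. \<Sum>y\<in>A i'. \<Lambda> x y)" if "i \<noteq> i'" for i i'
  proof -
    have aux: "D * \<sigma> \<le> (\<Sum>x\<in>A i'. \<Sum>y\<in>A i. \<Lambda> x y)" if "i < i'" for i i'
    proof -
      have "(\<Sum>x\<in>A i'. \<sigma>) \<le> (\<Sum>x\<in>A i'. \<Sum>y\<in>A i. \<Lambda> x y)" by (rule sum_mono) (rule cross[OF that])
      then show ?thesis using cA by simp
    qed
    show ?thesis
    proof (cases "i < i'")
      case True
      have "(\<Sum>x\<in>A i. \<Sum>y\<in>A i'. \<Lambda> x y) = (\<Sum>y\<in>A i'. \<Sum>x\<in>A i. \<Lambda> y x)"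
        by (subst sum.swap) (simp only: \<Lambda>_sym)
      then show ?thesis using aux[OF True] by simp
    next
      case False
      then show ?thesis using aux[of i' i] that by simp
    qed
  qed
  define P where "P = (\<Union>i\<in>{..Jn}. A i)"
  have disj': "i \<noteq> i' \<Longrightarrow> A i \<inter> A i' = {}" for i i' using disj by (metis inf_commute nat_neq_iff)
  have finP: "finite P" by (simp add: P_def finA)
  have sumP: "(\<Sum>x\<in>P. \<phi> x) = (\<Sum>i\<le>Jn. \<Sum>x\<in>A i. \<phi> x)" for \<phi> :: "complex \<Rightarrow> real"
    unfolding P_def using finA disj' by (intro sum.UNION_disjoint) auto
  have cP: "card P = (Jn + 1) * D"
    unfolding P_def using finA disj' cA by (subst card_UN_disjoint) auto
  \<comment> \<open>Each ordered pair of distinct levels contributes at least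
    \<open>D * \<sigma>\<close>; differences inside one level contribute something nonnegative, by
    the norm bound.\<close>
  have lower: "(Jn + 1) * (Jn * (D * \<sigma>)) \<le> (\<Sum>x\<in>P. \<Sum>y\<in>P - {x}. \<Lambda> x y)"
  proof -
    have "(\<Sum>i\<le>Jn. \<Sum>i'\<in>{..Jn} - {i}. D * \<sigma>) \<le> (\<Sum>i\<le>Jn. \<Sum>x\<in>A i. \<Sum>y\<in>P - {x}. \<Lambda> x y)"
    proof (rule sum_mono)
      fix i assume i: "i \<in> {..Jn}"
      have "(\<Sum>i'\<in>{..Jn} - {i}. D * \<sigma>) \<le> (\<Sum>i'\<in>{..Jn} - {i}. \<Sum>x\<in>A i. \<Sum>y\<in>A i'. \<Lambda> x y)"
        by (rule sum_mono) (use cross2 in auto)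
      also have "\<dots> = (\<Sum>x\<in>A i. \<Sum>i'\<in>{..Jn} - {i}. \<Sum>y\<in>A i'. \<Lambda> x y)" by (rule sum.swap)
      also have "\<dots> \<le> (\<Sum>x\<in>A i. \<Sum>y\<in>P - {x}. \<Lambda> x y)"
      proof (rule sum_mono)
        fix x assume x: "x \<in> A i"
        have "(\<Sum>i'\<in>{..Jn} - {i}. \<Sum>y\<in>A i'. \<Lambda> x y) = (\<Sum>y\<in>(\<Union>i'\<in>{..Jn} - {i}. A i'). \<Lambda> x y)"
          using finA disj' by (intro sum.UNION_disjoint[symmetric]) auto
        also have "\<dots> \<le> (\<Sum>y\<in>P - {x}. \<Lambda> x y)"
        proof (rule sum_mono2)
          show "(\<Union>i'\<in>{..Jn} - {i}. A i') \<subseteq> P - {x}" using disj' x unfolding P_def by blast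
          fix y assume "y \<in> P - {x} - (\<Union>i'\<in>{..Jn} - {i}. A i')"
          then show "0 \<le> \<Lambda> x y" using \<Lambda>_nonneg[OF x] by (auto simp: P_def)
        qed (simp add: finP)
        finally show "(\<Sum>i'\<in>{..Jn} - {i}. \<Sum>y\<in>A i'. \<Lambda> x y) \<le> (\<Sum>y\<in>P - {x}. \<Lambda> x y)" .
      qed
      finally show "(\<Sum>i'\<in>{..Jn} - {i}. D * \<sigma>) \<le> (\<Sum>x\<in>A i. \<Sum>y\<in>P - {x}. \<Lambda> x y)" .
    qed
    also have "(\<Sum>i\<le>Jn. \<Sum>i'\<in>{..Jn} - {i}. D * \<sigma>) = (\<Sum>i\<le>Jn. Jn * (D * \<sigma>))"
      by (rule sum.cong) simp_all
    also have "\<dots> = (Jn + 1) * (Jn * (D * \<sigma>))" by simp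
    finally show ?thesis by (simp add: sumP)
  qed
  define Nn where "Nn = (Jn + 1) * D"
  have Nn1: "Nn \<ge> 1" using Dpos by (simp add: Nn_def Suc_leI)
  have upper: "(\<Sum>x\<in>P. \<Sum>y\<in>P - {x}. \<Lambda> x y) \<le>
     gc * (2 * Nn * (K1 + Ec * ln (real Nn))) + 2 * Nn * (\<Sum>x\<in>P. \<Sum>s\<in>G. grn (p ^ e) (s b) (s x))"
  proof -
    have "(\<Sum>x\<in>P. \<Sum>y\<in>P - {x}. \<Lambda> x y) = (\<Sum>s\<in>G. \<Sum>x\<in>P. \<Sum>y\<in>P - {x}. ln (norm (s x - s y)))"
      unfolding \<Lambda>_def by (subst sum.swap[of _ G], subst sum.swap[of _ G P]) (rule refl)
    also have "\<dots> \<le> (\<Sum>s\<in>G. 2 * Nn * (K1 + Ec * ln (real Nn)) + 2 * Nn * (\<Sum>x\<in>P. grn (p ^ e) (s b) (s x)))"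
    proof (rule sum_mono)
      fix s assume s: "s \<in> G"
      have inj: "inj_on s P" using inj_G[OF s] by (auto simp: inj_on_def)
      have "(\<Sum>x\<in>P. \<Sum>y\<in>P - {x}. ln (norm (s x - s y))) = (\<Sum>x\<in>s ` P. \<Sum>y\<in>s ` P - {x}. ln (norm (x - y)))"
      proof (subst sum.reindex[OF inj], unfold o_def, rule sum.cong[OF refl])
        fix x assume x: "x \<in> P"
        have "s ` P - {s x} = s ` (P - {x})" using inj x by (auto simp: inj_on_def)
        then show "(\<Sum>y\<in>P - {x}. ln (norm (s x - s y))) = (\<Sum>y\<in>s ` P - {s x}. ln (norm (s x - y)))"
          using inj_on_subset[OF inj, of "P - {x}"] by (simp add: sum.reindex)
      qed
      also have "\<dots> \<le> 2 * card (s ` P) * (p ^ e * growth_const R + disc_const (p ^ e) R * ln (max 1 (real Nn)))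
          + 2 * Nn * (\<Sum>x\<in>s ` P. grn (p ^ e) (s b) x)"
      proof -
        have "finite (s ` P)" "card (s ` P) \<le> Nn" using finP by (simp_all add: card_image[OF inj] cP Nn_def)
        from discriminant_bound[OF q2 R[OF s] this] show ?thesis by simp
      qed
      also have "\<dots> = 2 * Nn * (K1 + Ec * ln (real Nn)) + 2 * Nn * (\<Sum>x\<in>P. grn (p ^ e) (s b) (s x))"
      proof -
        have "card (s ` P) = Nn" by (simp only: card_image[OF inj] cP Nn_def)
        moreover have "max 1 (real Nn) = real Nn" using Nn1 by simp
        ultimately show ?thesis by (simp add: sum.reindex[OF inj] K1_def Ec_def)
      qed
      finally show "(\<Sum>x\<in>P. \<Sum>y\<in>P - {x}. ln (norm (s x - s y))) \<le>
          2 * Nn * (K1 + Ec * ln (real Nn)) + 2 * Nn * (\<Sum>x\<in>P. grn (p ^ e) (s b) (s x))" .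
    qed
    also have "\<dots> = gc * (2 * Nn * (K1 + Ec * ln (real Nn))) + 2 * Nn * (\<Sum>s\<in>G. \<Sum>x\<in>P. grn (p ^ e) (s b) (s x))"
      by (simp add: sum.distrib gc_def sum_distrib_left)
    also have "(\<Sum>s\<in>G. \<Sum>x\<in>P. grn (p ^ e) (s b) (s x)) = (\<Sum>x\<in>P. \<Sum>s\<in>G. grn (p ^ e) (s b) (s x))" by (rule sum.swap)
    finally show ?thesis .
  qed
  define h1 where "h1 = real (p ^ e) ^ (j + Jn * shift) * (gc * ht)"
  have h1: "h1 \<ge> 0" unfolding h1_def by (intro mult_nonneg_nonneg ht_nonneg) simp_all
  have "(\<Sum>x\<in>P. \<Sum>s\<in>G. grn (p ^ e) (s b) (s x)) \<le> (\<Sum>x\<in>P. h1)"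
  proof (rule sum_mono)
    fix x assume "x \<in> P"
    then obtain i where i: "i \<le> Jn" "x \<in> A i" by (auto simp: P_def)
    have "(\<Sum>s\<in>G. grn (p ^ e) (s b) (s x)) = (\<Sum>s\<in>G. grn (p ^ e) (s b) (s ((F ^^ lev i) \<alpha>)))"
      using i(2) unfolding Aorb by (rule sum_grn_orb)
    also have "\<dots> = real (p ^ e) ^ lev i * (gc * ht)" by (simp add: sum_grn_iterate gc_def)
    also have "\<dots> \<le> h1"
      unfolding h1_def lev_def using i(1) q2 ht_nonneg p0
      by (intro mult_right_mono power_increasing add_left_mono mult_le_mono1) (simp_all add: Suc_leI)
    finally show "(\<Sum>s\<in>G. grn (p ^ e) (s b) (s x)) \<le> h1" .
  qed
  then have hb: "(\<Sum>x\<in>P. \<Sum>s\<in>G. grn (p ^ e) (s b) (s x)) \<le> Nn * h1" by (simp add: cP Nn_def)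
  have "real ((Jn + 1) * (Jn * D)) * \<sigma> \<le> gc * (2 * Nn * (K1 + Ec * ln (real Nn))) + 2 * Nn * (Nn * h1)"
  proof -
    have "real ((Jn + 1) * (Jn * D)) * \<sigma> = (Jn + 1) * (Jn * (D * \<sigma>))" by (simp only: of_nat_mult mult.assoc)
    moreover have "2 * Nn * (\<Sum>x\<in>P. \<Sum>s\<in>G. grn (p ^ e) (s b) (s x)) \<le> 2 * Nn * (Nn * h1)"
      by (rule mult_left_mono[OF hb]) simp
    ultimately show ?thesis using lower upper by linarith
  qed
  also have "real ((Jn + 1) * (Jn * D)) * \<sigma> = (gc * Nn) * (Jn * (real (mm k - Mx) * ln (real p)))"
    by (simp only: \<sigma>_def Nn_def of_nat_mult mult_ac)
  also have "gc * (2 * Nn * (K1 + Ec * ln (real Nn))) + 2 * Nn * (Nn * h1) =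
      (gc * Nn) * (2 * (K1 + Ec * ln (real Nn)) + 2 * Nn * (real (p ^ e) ^ (j + Jn * shift) * ht))"
    by (simp add: h1_def algebra_simps)
  finally have "Jn * (real (mm k - Mx) * ln (real p)) \<le>
      2 * (K1 + Ec * ln (real Nn)) + 2 * Nn * (real (p ^ e) ^ (j + Jn * shift) * ht)"
    using gc Nn1 by (subst (asm) mult_le_cancel_left_pos) simp_all
  \<comment> \<open>The number of points and the growth of the height meet here in
    \<open>D * p ^ k\<close>. It equals \<open>Dg * p ^ mm k\<close>, which the choice of the level
    keeps below a constant times \<open>Dg ^ 2\<close>.\<close>
  moreover have "2 * Nn * (real (p ^ e) ^ (j + Jn * shift) * ht) =
      2 * (Jn + 1) * real (p ^ e) ^ (Jn * shift) * (real (D * p ^ k) * ht)"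
    by (simp add: Nn_def k_def power_add power_mult algebra_simps)
  moreover have "D * p ^ k = Dg * p ^ mm k" using card_orbs_mm[of k] by (simp add: D_def Dg_def)
  ultimately have ineq: "Jn * (real (mm k - Mx) * ln (real p)) \<le>
      2 * (K1 + Ec * ln (real Nn)) + 2 * (Jn + 1) * real (p ^ e) ^ (Jn * shift) * (real (Dg * p ^ mm k) * ht)" by (simp only:)
  have lnN: "ln (real Nn) \<le> ln (real (Jn + 1)) + ln (real Dg)"
  proof -
    have "D \<le> Dg"
    proof -
      have "D * p ^ mm k \<le> D * p ^ k" using mm_add_le[of 0 k] p0 by (intro mult_left_mono power_increasing) simp_all
      then have "D * p ^ mm k \<le> Dg * p ^ mm k" using \<open>D * p ^ k = Dg * p ^ mm k\<close> by simp
      then show ?thesis using p0 by simp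
    qed
    then have "Nn \<le> (Jn + 1) * Dg" unfolding Nn_def by (rule mult_le_mono2)
    then have "real Nn \<le> real ((Jn + 1) * Dg)" by (simp only: of_nat_le_iff)
    moreover have "real Nn > 0" using Nn1 by simp
    ultimately have "ln (real Nn) \<le> ln (real ((Jn + 1) * Dg))"
      using ln_le_cancel_iff order_less_le_trans by blast
    also have "\<dots> = ln (real (Jn + 1)) + ln (real Dg)" unfolding of_nat_mult using Dg_pos by (intro ln_mult_pos) simp_all
    finally show ?thesis .
  qed
  define c0 where "c0 = 2 * K1 + 2 * Ec * ln (real (Jn + 1))"
  have c0: "c0 \<ge> 0" unfolding c0_def using K1_nonneg Ec_pos by simp
  have big: "real (mm k - Mx) * ln (real p) \<ge> ln (real Dg) + c0 + 1"
  proof -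
    have "p ^ Mx * exp (c0 + 1) \<le> real Z0"
    proof -
      have "c0 + 1 = 2 * K1 + 2 * Ec * ln (Jn + 1) + 1" by (simp add: c0_def)
      then have "real Z0 = real (p * B + 1) + real (nat \<lceil>p ^ Mx * exp (c0 + 1)\<rceil>)" by (simp only: Z0_def of_nat_add)
      then show ?thesis using real_nat_ceiling_ge[of "p ^ Mx * exp (c0 + 1)"] by linarith
    qed
    then have "p ^ Mx * exp (c0 + 1) * Dg \<le> real Z0 * Dg" by (rule mult_right_mono) simp
    also have "\<dots> \<le> real (p ^ mm k)" using j(1) by (simp add: k_def flip: of_nat_mult of_nat_power)
    finally have "ln (p ^ Mx * exp (c0 + 1) * Dg) \<le> ln (real (p ^ mm k))"
      using p0 Dg_pos by (subst ln_le_cancel_iff) simp_all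
    then have "Mx * ln (real p) + (c0 + 1) + ln (real Dg) \<le> mm k * ln (real p)"
      using p0 Dg_pos by (simp add: ln_mult ln_realpow)
    moreover have "(real (mm k) - real Mx) * ln (real p) \<le> real (mm k - Mx) * ln (real p)"
      using p2 by (intro mult_right_mono) simp_all
    ultimately show ?thesis by (simp add: algebra_simps)
  qed
  have "Jn * (ln (real Dg) + c0 + 1) \<le> Jn * (real (mm k - Mx) * ln (real p))"
    using big by (intro mult_left_mono) simp_all
  moreover have "2 * (K1 + Ec * ln (real Nn)) \<le> c0 + Jn * ln (real Dg)"
  proof -
    have "2 * Ec * ln (real Nn) \<le> 2 * Ec * (ln (real (Jn + 1)) + ln (real Dg))"
      using lnN Ec_pos by (intro mult_left_mono) simp_all
    moreover have "2 * Ec * ln (real Dg) \<le> Jn * ln (real Dg)"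
      using Jn_ge(1) Dg_pos by (intro mult_right_mono) simp_all
    ultimately show ?thesis by (simp add: c0_def algebra_simps)
  qed
  \<comment> \<open>The summand \<open>1\<close> in \<open>big\<close> is what survives after the
    archimedean terms are cancelled.\<close>
  moreover have "c0 + 1 \<le> Jn * (c0 + 1)" using Jn_ge(2) c0 mult_right_mono[of 1 "real Jn" "c0 + 1"] by simp
  ultimately have "1 \<le> 2 * (Jn + 1) * real (p ^ e) ^ (Jn * shift) * (real (Dg * p ^ mm k) * ht)"
    using ineq by (simp add: algebra_simps)
  also have "\<dots> \<le> 2 * (Jn + 1) * real (p ^ e) ^ (Jn * shift) * (real (Dg * (p ^ (e + 1) * Z0 * Dg)) * ht)"
    using j(2) ht_nonneg by (intro mult_left_mono mult_right_mono) (simp_all only: of_nat_le_iff k_def, auto)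
  also have "\<dots> = (1 / cst2) * (real Dg ^ 2 * ht)"
    by (simp add: cst2_def power2_eq_square mult_ac)
  finally have 1: "1 \<le> (1 / cst2) * (real Dg ^ 2 * ht)" .
  then show ?thesis using cst_pos(2) 1 Dg_pos by (simp add: field_simps)
qed

theorem ht_lower_bound: "ht \<ge> min cst1 cst2 / Dg ^ 2"
proof (cases "\<exists>k. in_rad p (Ph k \<alpha>)")
  case True
  have "min cst1 cst2 / Dg ^ 2 \<le> cst1 / Dg"
    using Dg_pos cst_pos by (intro frac_le) (simp_all add: power2_eq_square Suc_leI)
  then show ?thesis using True ht_superattracted by force
next
  case False
  have "min cst1 cst2 / Dg ^ 2 \<le> cst2 / Dg ^ 2" by (intro divide_right_mono) simp_all
  then show ?thesis using False ht_main by force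
qed

end

subsection \<open>Absolute values\<close>

lemma absolute_value_onD:
  assumes "absolute_value_on L v"
  shows "x \<in> L \<Longrightarrow> v x \<ge> 0" "x \<in> L \<Longrightarrow> v x = 0 \<longleftrightarrow> x = 0"
    "x \<in> L \<Longrightarrow> y \<in> L \<Longrightarrow> v (x * y) = v x * v y" "x \<in> L \<Longrightarrow> y \<in> L \<Longrightarrow> v (x + y) \<le> v x + v y"
  using assms by (auto simp: absolute_value_on_def)

locale abs_value =
  fixes L :: "complex set" and v :: "complex \<Rightarrow> real"
  assumes subfld_L: "subfld L" and av: "absolute_value_on L v"
begin

lemmas Lc = subfldD[OF subfld_L]
lemmas avD = absolute_value_onD[OF av]

lemma v_1: "v 1 = 1"
proof -
  have "v 1 * v 1 = v 1" using avD(3)[of 1 1] Lc(1) by simp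
  moreover have "v 1 \<noteq> 0" using avD(2)[of 1] Lc(1) by simp
  ultimately show ?thesis by simp
qed

lemma v_0: "v 0 = 0" using avD(2)[of 0] Lc(2) by simp

lemma v_pos: "x \<in> L \<Longrightarrow> x \<noteq> 0 \<Longrightarrow> v x > 0"
  using avD(1,2)[of x] by simp

lemma v_minus: assumes x: "x \<in> L" shows "v (- x) = v x"
proof -
  have m1: "- 1 \<in> L" using Lc(1,6) by blast
  have "v (-1) * v (-1) = 1" using avD(3)[OF m1 m1] v_1 by simp
  then have "v (-1) = 1" using avD(1)[OF m1] by (simp add: power2_eq_1_iff flip: power2_eq_square)
  then show ?thesis using avD(3)[OF m1 x] by simp
qed

lemma v_diff: "x \<in> L \<Longrightarrow> y \<in> L \<Longrightarrow> v (x - y) \<le> v x + v y"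
  using avD(4)[of x "- y"] v_minus[of y] Lc(6)[of y] by simp

lemma v_diff_ge: "x \<in> L \<Longrightarrow> y \<in> L \<Longrightarrow> v x - v y \<le> v (x - y)"
  using avD(4)[of "x - y" y] Lc(3)[of x y] by simp

lemma v_power: "x \<in> L \<Longrightarrow> v (x ^ n) = v x ^ n"
  by (induction n) (simp_all add: v_1 avD(3) Lc)

lemma v_inverse: assumes x: "x \<in> L" shows "v (inverse x) = inverse (v x)"
proof (cases "x = 0")
  case False
  have "v x * v (inverse x) = 1" using avD(3)[OF x Lc(5)[OF x]] False v_1 by simp
  then show ?thesis by (simp add: inverse_unique)
qed (simp add: v_0)

lemma v_divide: "x \<in> L \<Longrightarrow> y \<in> L \<Longrightarrow> v (x / y) = v x / v y"
  by (simp add: divide_inverse avD(3) v_inverse Lc)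

lemma powi_L: "x \<in> L \<Longrightarrow> x powi k \<in> L"
  by (simp add: power_int_def Lc)

lemma v_powi: "x \<in> L \<Longrightarrow> v (x powi k) = v x powi k"
  by (simp add: power_int_def v_power v_inverse Lc)

lemma v_sum: "finite A \<Longrightarrow> (\<And>i. i \<in> A \<Longrightarrow> g i \<in> L) \<Longrightarrow> v (sum g A) \<le> (\<Sum>i\<in>A. v (g i))"
proof (induction A rule: finite_induct)
  case (insert i A)
  then have "v (g i + sum g A) \<le> v (g i) + v (sum g A)"
    by (intro avD(4) subfld_sum[OF subfld_L]) auto
  then show ?case using insert by force
qed (simp add: v_0)

end

text \<open>After inverting \<open>x\<close> if needed, \<open>a < c\<close> are its logarithms at
  \<open>v\<close> and \<open>w\<close>. Some \<open>n\<close> makes the interval from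
  \<open>n * a\<close> to \<open>n * c\<close> longer than \<open>l\<close>, so a multiple
  \<open>k * l\<close> lies inside; the rational factor with exponent \<open>k\<close> shifts both
  logarithms by \<open>- k * l\<close>, to opposite signs.\<close>

lemma abs_value_separation:
  assumes "abs_value L v" "abs_value L w" and eq: "\<And>q::rat. v (of_rat q) = w (of_rat q)"
    and r: "0 < v (of_rat r)" "v (of_rat r) < 1" and x: "x \<in> L" "v x \<noteq> w x"
  shows "\<exists>y\<in>L. v y < 1 \<and> 1 < w y"
proof -
  interpret v: abs_value L v by fact
  interpret w: abs_value L w by fact
  have x0: "x \<noteq> 0" using x v.v_0 w.v_0 by auto
  have "\<exists>x\<in>L. x \<noteq> 0 \<and> v x < w x"
  proof (cases "v x < w x")
    case False
    then have "w x < v x" using x by simp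
    then have "inverse (v x) < inverse (w x)" using w.v_pos x x0 by (intro less_imp_inverse_less)
    then show ?thesis using x x0 v.Lc(5) v.v_inverse w.v_inverse by (intro bexI[of _ "inverse x"]) auto
  qed (use x x0 in blast)
  then obtain x where x: "x \<in> L" "x \<noteq> 0" "v x < w x" by blast
  define a c l where "a = ln (v x)" and "c = ln (w x)" and "l = - ln (v (of_rat r))"
  have l: "l > 0" using r by (simp add: l_def)
  have ac: "a < c" unfolding a_def c_def using x v.v_pos[OF x(1,2)] by (subst ln_less_cancel_iff) simp_all
  obtain n :: nat where n: "l < real n * (c - a)"
    using ac reals_Archimedean3[of "c - a"] by auto
  define k where "k = \<lfloor>n * a / l\<rfloor> + 1"
  have k1: "n * a < k * l"
  proof -
    have "n * a / l < k" unfolding k_def by linarith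
    then show ?thesis using l by (simp add: field_simps)
  qed
  have k2: "k * l < n * c"
  proof -
    have "real_of_int k \<le> n * a / l + 1" unfolding k_def by linarith
    then have "k * l \<le> n * a + l" using l mult_right_mono[of "real_of_int k" "n * a / l + 1" l] by (simp add: field_simps)
    then show ?thesis using n by (simp add: algebra_simps)
  qed
  have rL: "of_rat r \<in> L" by (rule subfld_of_rat[OF v.subfld_L])
  define y where "y = x ^ n * of_rat r powi k"
  have yL: "y \<in> L" unfolding y_def by (intro v.Lc v.powi_L x rL)
  have lnpowi: "ln (t powi k) = k * ln t" if "t > 0" for t :: real
    using that by (simp add: powr_real_of_int' [symmetric] ln_powr)
  have "v y = v x ^ n * v (of_rat r) powi k"
    unfolding y_def using x rL by (simp add: v.avD(3) v.Lc v.powi_L v.v_power v.v_powi)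
  then have "ln (v y) = n * a - k * l"
    using v.v_pos[OF x(1,2)] r(1) by (simp add: ln_mult_pos ln_realpow lnpowi a_def l_def)
  then have "ln (v y) < 0" using k1 by simp
  moreover have y0: "y \<noteq> 0" using x r v.v_0 by (auto simp: y_def)
  ultimately have 1: "v y < 1" using v.v_pos[OF yL] by (simp add: ln_less_zero_iff)
  have "w y = w x ^ n * w (of_rat r) powi k"
    unfolding y_def using x rL by (simp add: w.avD(3) w.Lc w.powi_L w.v_power w.v_powi)
  then have "ln (w y) = n * c - k * l"
    using w.v_pos[OF x(1,2)] r(1) eq[of r] by (simp add: ln_mult_pos ln_realpow lnpowi c_def l_def)
  then have "ln (w y) > 0" using k2 by simp
  then have "w y > 1" using w.v_pos[OF yL y0] by (simp add: ln_gt_zero_iff)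
  then show ?thesis using 1 yL by blast
qed

text \<open>A switch for approximation: the quotient becomes small where \<open>x\<close> is small
  and has absolute value near \<open>1\<close> where \<open>x\<close> is large.\<close>

lemma quotient_power_tendsto:
  assumes "abs_value L v" and x: "x \<in> L"
  shows "v x < 1 \<Longrightarrow> (\<lambda>n. v (x ^ n / (1 + x ^ n))) \<longlonglongrightarrow> 0"
    and "v x > 1 \<Longrightarrow> (\<lambda>n. v (x ^ n / (1 + x ^ n))) \<longlonglongrightarrow> 1"
proof -
  interpret abs_value L v by fact
  have xn: "x ^ n \<in> L" "1 + x ^ n \<in> L" for n using x Lc by auto
  have q: "v (x ^ n / (1 + x ^ n)) = v x ^ n / v (1 + x ^ n)" for n
    using xn x by (simp add: v_divide v_power)
  have v0: "v x \<ge> 0" using avD(1)[OF x] .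
  have up: "v (1 + x ^ n) \<le> 1 + v x ^ n" for n
    using avD(4)[OF Lc(1) xn(1)[of n]] v_1 v_power[OF x] by simp
  have lo1: "1 - v x ^ n \<le> v (1 + x ^ n)" for n
    using v_diff_ge[OF Lc(1) Lc(6)[OF xn(1)[of n]]] v_1 v_power[OF x] v_minus[OF xn(1)] by simp
  have lo2: "v x ^ n - 1 \<le> v (1 + x ^ n)" for n
    using v_diff_ge[OF xn(1)[of n] Lc(6)[OF Lc(1)]] v_1 v_power[OF x] v_minus[OF Lc(1)] by (simp add: add.commute)
  show "(\<lambda>n. v (x ^ n / (1 + x ^ n))) \<longlonglongrightarrow> 0" if lt: "v x < 1"
  proof -
    have t: "(\<lambda>n. v x ^ n) \<longlonglongrightarrow> 0" using lt v0 by (intro LIMSEQ_realpow_zero)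
    have "(\<lambda>n. v x ^ n / (1 - v x ^ n)) \<longlonglongrightarrow> 0 / (1 - 0)"
      by (intro tendsto_intros t) simp
    then have t2: "(\<lambda>n. v x ^ n / (1 - v x ^ n)) \<longlonglongrightarrow> 0" by simp
    show ?thesis
    proof (rule tendsto_sandwich[OF _ _ tendsto_const t2])
      show "\<forall>\<^sub>F n in sequentially. 0 \<le> v (x ^ n / (1 + x ^ n))"
        using avD(1) Lc(8)[OF xn] by simp
      show "\<forall>\<^sub>F n in sequentially. v (x ^ n / (1 + x ^ n)) \<le> v x ^ n / (1 - v x ^ n)"
      proof (rule eventually_sequentiallyI[of 1])
        fix n :: nat assume "1 \<le> n"
        then have "1 - v x ^ n > 0" using lt v0 by (simp add: power_less_one_iff)
        then show "v (x ^ n / (1 + x ^ n)) \<le> v x ^ n / (1 - v x ^ n)"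
          unfolding q using lo1[of n] v0 by (intro divide_left_mono) (auto intro!: mult_pos_pos)
      qed
    qed
  qed
  show "(\<lambda>n. v (x ^ n / (1 + x ^ n))) \<longlonglongrightarrow> 1" if gt: "v x > 1"
  proof -
    have vp: "v x > 0" using gt by simp
    have t: "(\<lambda>n. inverse (v x) ^ n) \<longlonglongrightarrow> 0" using gt by (intro LIMSEQ_realpow_zero) (simp_all add: inverse_less_1_iff)
    have "(\<lambda>n. 1 / (1 + inverse (v x) ^ n)) \<longlonglongrightarrow> 1 / (1 + 0)" by (intro tendsto_intros t) simp
    then have t1: "(\<lambda>n. 1 / (1 + inverse (v x) ^ n)) \<longlonglongrightarrow> 1" by simp
    have "(\<lambda>n. 1 / (1 - inverse (v x) ^ n)) \<longlonglongrightarrow> 1 / (1 - 0)" by (intro tendsto_intros t) simp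
    then have t2: "(\<lambda>n. 1 / (1 - inverse (v x) ^ n)) \<longlonglongrightarrow> 1" by simp
    have e1: "1 / (1 + inverse (v x) ^ n) = v x ^ n / (1 + v x ^ n)" for n
      using vp by (simp add: power_inverse field_simps)
    have e2: "1 / (1 - inverse (v x) ^ n) = v x ^ n / (v x ^ n - 1)" for n
      using vp by (simp add: power_inverse field_simps)
    show ?thesis
    proof (rule tendsto_sandwich[OF _ _ t1 t2])
      have pos: "v (1 + x ^ n) > 0" if "n \<ge> 1" for n
      proof -
        have "v x ^ n > 1" using gt that by (simp add: one_less_power)
        then show ?thesis using lo2[of n] by simp
      qed
      show "\<forall>\<^sub>F n in sequentially. 1 / (1 + inverse (v x) ^ n) \<le> v (x ^ n / (1 + x ^ n))"
        by (rule eventually_sequentiallyI[of 1]) (use up vp pos in \<open>auto simp: q e1 intro!: divide_left_mono mult_pos_pos add_pos_pos\<close>)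
      show "\<forall>\<^sub>F n in sequentially. v (x ^ n / (1 + x ^ n)) \<le> 1 / (1 - inverse (v x) ^ n)"
      proof (rule eventually_sequentiallyI[of 1])
        fix n :: nat assume n: "1 \<le> n"
        have "v x ^ n > 1" using gt n by (simp add: one_less_power)
        then show "v (x ^ n / (1 + x ^ n)) \<le> 1 / (1 - inverse (v x) ^ n)"
          unfolding q e2 using lo2[of n] pos[OF n] by (intro divide_left_mono) (auto intro!: mult_pos_pos)
      qed
    qed
  qed
qed

text \<open>Weak approximation, by induction on \<open>S\<close>. An \<open>x\<close> that works for
  \<open>S\<close> is combined with a \<open>y\<close> that separates \<open>v\<close> from the new
  \<open>u\<close>: multiply \<open>y\<close> by powers of \<open>x\<close> if
  \<open>u x = 1\<close>, and by the switch \<open>x ^ n / (1 + x ^ n)\<close> if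
  \<open>u x > 1\<close>.\<close>

lemma simultaneous_separation:
  assumes fin: "finite S" and av: "\<And>w. w \<in> insert v S \<Longrightarrow> abs_value L w"
    and nontriv: "\<exists>x\<in>L. 1 < v x"
    and sep: "\<And>w. w \<in> S \<Longrightarrow> \<exists>y\<in>L. w y < 1 \<and> 1 < v y"
  shows "\<exists>x\<in>L. 1 < v x \<and> (\<forall>w\<in>S. w x < 1)"
  using fin av sep
proof (induction S rule: finite_induct)
  case empty
  then show ?case using nontriv by simp
next
  case (insert u S)
  interpret v: abs_value L v using insert.prems by simp
  interpret u: abs_value L u using insert.prems by simp
  have avw: "abs_value L w" if "w \<in> S" for w using insert.prems that by simp
  obtain x where x: "x \<in> L" "1 < v x" "\<And>w. w \<in> S \<Longrightarrow> w x < 1"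
  proof -
    have "\<exists>x\<in>L. 1 < v x \<and> (\<forall>w\<in>S. w x < 1)"
    proof (rule insert.IH)
      show "abs_value L w" if "w \<in> insert v S" for w using that avw v.abs_value_axioms by auto
    qed (simp add: insert.prems(2))
    then show ?thesis using that by blast
  qed
  obtain y where y: "y \<in> L" "u y < 1" "1 < v y" using insert.prems(2)[of u] by auto
  have main: ?case if t: "\<And>n. t n \<in> L" "\<forall>\<^sub>F n in sequentially. 1 < v (t n)" "\<forall>\<^sub>F n in sequentially. u (t n) < 1"
    "\<And>w. w \<in> S \<Longrightarrow> \<forall>\<^sub>F n in sequentially. w (t n) < 1" for t :: "nat \<Rightarrow> complex"
  proof -
    have "\<forall>\<^sub>F n in sequentially. \<forall>w\<in>S. w (t n) < 1"
      using insert.hyps(1) t(4) by (simp add: eventually_ball_finite)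
    with t(2,3) have "\<forall>\<^sub>F n in sequentially. 1 < v (t n) \<and> u (t n) < 1 \<and> (\<forall>w\<in>S. w (t n) < 1)"
      by eventually_elim simp
    then obtain n where "1 < v (t n)" "u (t n) < 1" "\<forall>w\<in>S. w (t n) < 1"
      unfolding eventually_sequentially by blast
    then show ?thesis using t(1) by blast
  qed
  consider "u x < 1" | "u x = 1" | "u x > 1" by linarith
  then show ?case
  proof cases
    case 1
    then show ?thesis using x by blast
  next
    case 2
    show ?thesis
    proof (rule main[of "\<lambda>n. x ^ n * y"])
      show "x ^ n * y \<in> L" for n using x y v.Lc by simp
      show "\<forall>\<^sub>F n in sequentially. 1 < v (x ^ n * y)"
        using x y v.Lc by (simp add: v.avD(3) v.v_power less_1_mult' one_le_power mult.commute[of _ "v y"])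
      show "\<forall>\<^sub>F n in sequentially. u (x ^ n * y) < 1"
        using x y v.Lc 2 by (simp add: u.avD(3) u.v_power)
      fix w assume w: "w \<in> S"
      interpret w: abs_value L w by (rule avw[OF w])
      have "(\<lambda>n. w x ^ n * w y) \<longlonglongrightarrow> 0 * w y"
        using x(3)[OF w] w.avD(1)[OF x(1)] by (intro tendsto_intros LIMSEQ_realpow_zero)
      then have "\<forall>\<^sub>F n in sequentially. w x ^ n * w y < 1" by (rule order_tendstoD(2)) simp
      then show "\<forall>\<^sub>F n in sequentially. w (x ^ n * y) < 1" using x y v.Lc by (simp add: w.avD(3) w.v_power)
    qed
  next
    case 3
    have tL: "x ^ n / (1 + x ^ n) \<in> L" for n using x v.Lc by simp
    show ?thesis
    proof (rule main[of "\<lambda>n. x ^ n / (1 + x ^ n) * y"])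
      show "x ^ n / (1 + x ^ n) * y \<in> L" for n by (rule v.Lc(4)[OF tL y(1)])
      have "(\<lambda>n. v (x ^ n / (1 + x ^ n)) * v y) \<longlonglongrightarrow> 1 * v y"
        by (intro tendsto_mult tendsto_const quotient_power_tendsto(2)[OF v.abs_value_axioms x(1,2)])
      then have "\<forall>\<^sub>F n in sequentially. 1 < v (x ^ n / (1 + x ^ n)) * v y" by (rule order_tendstoD(1)) (use y in simp)
      then show "\<forall>\<^sub>F n in sequentially. 1 < v (x ^ n / (1 + x ^ n) * y)" by (simp only: v.avD(3)[OF tL y(1)])
      have "(\<lambda>n. u (x ^ n / (1 + x ^ n)) * u y) \<longlonglongrightarrow> 1 * u y"
        by (intro tendsto_mult tendsto_const quotient_power_tendsto(2)[OF u.abs_value_axioms x(1) 3])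
      then have "\<forall>\<^sub>F n in sequentially. u (x ^ n / (1 + x ^ n)) * u y < 1" by (rule order_tendstoD(2)) (use y in simp)
      then show "\<forall>\<^sub>F n in sequentially. u (x ^ n / (1 + x ^ n) * y) < 1" by (simp only: u.avD(3)[OF tL y(1)])
      fix w assume w: "w \<in> S"
      interpret w: abs_value L w by (rule avw[OF w])
      have "(\<lambda>n. w (x ^ n / (1 + x ^ n)) * w y) \<longlonglongrightarrow> 0 * w y"
        by (intro tendsto_mult tendsto_const quotient_power_tendsto(1)[OF w.abs_value_axioms x(1) x(3)[OF w]])
      then have "\<forall>\<^sub>F n in sequentially. w (x ^ n / (1 + x ^ n)) * w y < 1" by (rule order_tendstoD(2)) simp
      then show "\<forall>\<^sub>F n in sequentially. w (x ^ n / (1 + x ^ n) * y) < 1" by (simp only: w.avD(3)[OF tL y(1)])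
    qed
  qed
qed

section \<open>Finitely many absolute values above a rational one\<close>

interpretation Qv: vector_space "\<lambda>(r::rat) (x::complex). of_rat r * x"
  by unfold_locales (simp_all add: algebra_simps of_rat_add of_rat_mult)

text \<open>Each \<open>v\<close> in \<open>S\<close> receives an element that is large at
  \<open>v\<close> and very small at the others. These elements are independent over the rationals,
  so the dimension bounds their number.\<close>

lemma card_places_over_le:
  assumes L: "L \<subseteq> Qv.span Bs" and finB: "finite Bs" and finS: "finite S"
    and av: "\<And>v. v \<in> S \<Longrightarrow> abs_value L v" and ext: "\<And>v. v \<in> S \<Longrightarrow> v \<in> extensional L"
    and eq: "\<And>v q. v \<in> S \<Longrightarrow> v (of_rat q) = w q" and r: "0 < w r" "w r < 1"
  shows "card S \<le> card Bs"
proof (cases "S = {}")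
  case False
  have "\<exists>x\<in>L. 1 < v x \<and> (\<forall>u\<in>S - {v}. u x < 1)" if v: "v \<in> S" for v
  proof (rule simultaneous_separation)
    note avS = av
    interpret abs_value L v by (rule avS[OF v])
    have rL: "of_rat r \<in> L" by (rule subfld_of_rat[OF subfld_L])
    have "1 < v (inverse (of_rat r))" using r eq[OF v] by (simp add: v_inverse rL one_less_inverse_iff)
    then show "\<exists>x\<in>L. 1 < v x" using Lc(5)[OF rL] by blast
    fix u assume u: "u \<in> S - {v}"
    have "\<exists>x\<in>L. u x \<noteq> v x"
    proof (rule ccontr)
      assume "\<not> ?thesis"
      then have "u = v" using ext u v by (intro extensionalityI[of u L v]) auto
      then show False using u by simp
    qed
    then obtain x where x: "x \<in> L" "u x \<noteq> v x" by blast
    show "\<exists>y\<in>L. u y < 1 \<and> 1 < v y"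
    proof (rule abs_value_separation)
      show "u (of_rat q) = v (of_rat q)" for q using eq[of u q] eq[OF v, of q] u by simp
      show "0 < u (of_rat r)" "u (of_rat r) < 1" using eq[of u r] u r by simp_all
    qed (use avS u v x in auto)
  qed (use v finS av in auto)
  then have "\<forall>v\<in>S. \<exists>x. x \<in> L \<and> 1 < v x \<and> (\<forall>u\<in>S - {v}. u x < 1)" by blast
  then obtain x where "\<forall>v\<in>S. x v \<in> L \<and> 1 < v (x v) \<and> (\<forall>u\<in>S - {v}. u (x v) < 1)" by (rule bchoice[THEN exE])
  then have x: "\<And>v. v \<in> S \<Longrightarrow> x v \<in> L" "\<And>v. v \<in> S \<Longrightarrow> 1 < v (x v)"
    "\<And>v u. v \<in> S \<Longrightarrow> u \<in> S \<Longrightarrow> u \<noteq> v \<Longrightarrow> u (x v) < 1" by simp_all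
  have cS: "card S > 0" using False finS by (simp add: card_gt_0_iff)
  have "\<forall>\<^sub>F n in sequentially. \<forall>v\<in>S. \<forall>u\<in>S - {v}. u (x v) ^ n < 1 / card S"
  proof (intro eventually_ball_finite finS ballI finite_Diff)
    fix v u assume v: "v \<in> S" and u: "u \<in> S - {v}"
    interpret u: abs_value L u by (rule av) (use u in simp)
    have "(\<lambda>n. u (x v) ^ n) \<longlonglongrightarrow> 0"
      using x(3)[of v u] u v u.avD(1)[OF x(1)[OF v]] by (intro LIMSEQ_realpow_zero) auto
    then show "\<forall>\<^sub>F n in sequentially. u (x v) ^ n < 1 / card S" by (rule order_tendstoD(2)) (use cS in simp)
  qed
  then obtain n where "\<forall>v\<in>S. \<forall>u\<in>S - {v}. u (x v) ^ n < 1 / card S"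
    unfolding eventually_sequentially by blast
  then have n: "\<And>v u. v \<in> S \<Longrightarrow> u \<in> S \<Longrightarrow> u \<noteq> v \<Longrightarrow> u (x v) ^ n < 1 / card S" by simp
  define t where "t v = x v ^ n" for v
  have tL: "t v \<in> L" if "v \<in> S" for v
  proof -
    interpret abs_value L v by (rule av[OF that])
    show ?thesis using x(1)[OF that] Lc by (simp add: t_def)
  qed
  have big: "v (t v) \<ge> 1" if "v \<in> S" for v
  proof -
    interpret abs_value L v by (rule av[OF that])
    show ?thesis using x(1,2)[OF that] by (simp add: t_def v_power one_le_power)
  qed
  have small: "u (t v) < 1 / card S" if "v \<in> S" "u \<in> S" "u \<noteq> v" for u v
  proof -
    interpret abs_value L u by (rule av[OF that(2)])
    show ?thesis using n[OF that] x(1)[OF that(1)] by (simp add: t_def v_power)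
  qed
  have c1: "1 / card S \<le> 1" using cS by simp
  have inj: "inj_on t S"
  proof (rule inj_onI, rule ccontr)
    fix u v assume uv: "u \<in> S" "v \<in> S" "t u = t v" "u \<noteq> v"
    then show False using big[of u] small[of v u] c1 by simp
  qed
  have "Qv.independent (t ` S)"
  proof
    assume "Qv.dependent (t ` S)"
    then obtain c where c: "\<exists>y\<in>t ` S. c y \<noteq> 0" "(\<Sum>y\<in>t ` S. of_rat (c y) * y) = 0"
      using Qv.dependent_finite[of "t ` S"] finS by auto
    define d where "d v = c (t v)" for v
    have d: "\<exists>v\<in>S. d v \<noteq> 0" "(\<Sum>v\<in>S. of_rat (d v) * t v) = 0"
      using c by (auto simp: d_def sum.reindex[OF inj])
    \<comment> \<open>All of \<open>S\<close> agree on the rationals, so \<open>w\<close> measures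
      every coefficient. At the absolute value of a largest coefficient, its own term exceeds the
      sum of the others.\<close>
    define m where "m = Max ((\<lambda>v. w (d v)) ` S)"
    have "m \<in> (\<lambda>v. w (d v)) ` S" unfolding m_def using finS False by (intro Max_in) auto
    then obtain v where v: "v \<in> S" "m = w (d v)" by blast
    have le: "w (d u) \<le> m" if "u \<in> S" for u unfolding m_def using that finS by (intro Max_ge) auto
    interpret abs_value L v by (rule av[OF v(1)])
    have rat: "of_rat q \<in> L" for q by (rule subfld_of_rat[OF subfld_L])
    obtain v1 where v1: "v1 \<in> S" "d v1 \<noteq> 0" using d by blast
    have "v (of_rat (d v1)) > 0" using v1 by (intro v_pos rat) simp
    then have mpos: "m > 0" using le[OF v1(1)] eq[OF v(1)] by simp
    have "(\<Sum>u\<in>S. of_rat (d u) * t u) = of_rat (d v) * t v + (\<Sum>u\<in>S - {v}. of_rat (d u) * t u)"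
      using finS v(1) by (rule sum.remove)
    then have "of_rat (d v) * t v = - (\<Sum>u\<in>S - {v}. of_rat (d u) * t u)" using d by (simp add: eq_neg_iff_add_eq_0)
    moreover have "(\<Sum>u\<in>S - {v}. of_rat (d u) * t u) \<in> L"
      using tL rat by (intro subfld_sum[OF subfld_L] Lc(4)) auto
    ultimately have "v (of_rat (d v) * t v) = v (\<Sum>u\<in>S - {v}. of_rat (d u) * t u)" using v_minus by simp
    also have "\<dots> \<le> (\<Sum>u\<in>S - {v}. v (of_rat (d u) * t u))"
      using finS tL rat by (intro v_sum Lc(4)) auto
    also have "\<dots> \<le> (\<Sum>u\<in>S - {v}. m * (1 / card S))"
    proof (rule sum_mono)
      fix u assume u: "u \<in> S - {v}"
      have "v (of_rat (d u) * t u) = w (d u) * v (t u)" using eq[OF v(1)] avD(3)[OF rat tL] u by simp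
      also have "\<dots> \<le> m * (1 / card S)"
        using le[of u] small[of u v] u v avD(1)[OF tL[of u]] mpos by (intro mult_mono) auto
      finally show "v (of_rat (d u) * t u) \<le> m * (1 / card S)" .
    qed
    also have "\<dots> = (real (card S) - 1) * (m * (1 / card S))"
      using finS v(1) cS by (simp add: card_Diff_singleton of_nat_diff Suc_leI)
    also have "\<dots> < m" using mpos cS by (simp add: field_simps)
    finally have "v (of_rat (d v) * t v) < m" .
    moreover have "v (of_rat (d v) * t v) = m * v (t v)" using eq[OF v(1)] avD(3)[OF rat tL[OF v(1)]] v by simp
    moreover have "m * 1 \<le> m * v (t v)" using big[OF v(1)] mpos by (intro mult_left_mono) simp_all
    ultimately show False by simp
  qed
  moreover have "t ` S \<subseteq> Qv.span Bs" using tL L by blast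
  ultimately have "card (t ` S) \<le> card Bs" using Qv.independent_span_bound[OF finB] by blast
  then show ?thesis by (simp add: card_image[OF inj])
qed simp

lemma finite_places_over:
  assumes L: "L \<subseteq> Qv.span Bs" "finite Bs" and r: "0 < w r" "w r < 1"
  shows "finite {v \<in> extensional L. abs_value L v \<and> (\<forall>q. v (of_rat q) = w q)}"
proof (rule ccontr)
  assume "infinite {v \<in> extensional L. abs_value L v \<and> (\<forall>q. v (of_rat q) = w q)}"
  then obtain S where S: "finite S" "card S = Suc (card Bs)"
    "S \<subseteq> {v \<in> extensional L. abs_value L v \<and> (\<forall>q. v (of_rat q) = w q)}"
    using infinite_arbitrarily_large[of _ "Suc (card Bs)"] by blast
  then have "card S \<le> card Bs" using r by (intro card_places_over_le[OF L, of S w r]) auto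
  then show False using S by simp
qed

subsection \<open>Nonarchimedean absolute values\<close>

locale na_value = abs_value +
  assumes v_of_int: "v (of_int m) \<le> 1"
begin

text \<open>The \<open>n\<close>-th power of \<open>x + y\<close> has \<open>n + 1\<close> binomial
  terms of size at most \<open>m ^ n\<close>; an excess over \<open>m\<close> would grow
  exponentially.\<close>

lemma v_add_le_max:
  assumes x: "x \<in> L" and y: "y \<in> L" shows "v (x + y) \<le> max (v x) (v y)"
proof (rule ccontr)
  define m where "m = max (v x) (v y)"
  assume "\<not> v (x + y) \<le> max (v x) (v y)"
  then have gt: "v (x + y) > m" by (simp only: m_def not_le)
  have m0: "m \<ge> 0" using avD(1)[OF x] by (simp add: m_def)
  have xy: "x + y \<in> L" using x y Lc by simp
  have bound: "v (x + y) ^ n \<le> (n + 1) * m ^ n" for n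
  proof -
    have "v (x + y) ^ n = v (\<Sum>k\<le>n. of_nat (n choose k) * x ^ k * y ^ (n - k))"
      by (simp only: v_power[OF xy, symmetric] binomial_ring)
    also have "\<dots> \<le> (\<Sum>k\<le>n. v (of_nat (n choose k) * x ^ k * y ^ (n - k)))"
      using x y by (intro v_sum Lc subfld_of_nat[OF subfld_L]) auto
    also have "\<dots> \<le> (\<Sum>k\<le>n. m ^ n)"
    proof (rule sum_mono)
      fix k assume k: "k \<in> {..n}"
      have c: "v (of_nat (n choose k)) \<le> 1" using v_of_int[of "int (n choose k)"] by simp
      have "v (of_nat (n choose k) * x ^ k * y ^ (n - k)) = v (of_nat (n choose k)) * (v x ^ k * v y ^ (n - k))"
        using x y subfld_of_nat[OF subfld_L] by (simp add: avD(3) Lc v_power)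
      also have "\<dots> \<le> 1 * (m ^ k * m ^ (n - k))"
        using c avD(1)[OF x] avD(1)[OF y] m0 by (intro mult_mono power_mono mult_nonneg_nonneg) (auto simp: m_def)
      also have "\<dots> = m ^ n" using k by (simp flip: power_add)
      finally show "v (of_nat (n choose k) * x ^ k * y ^ (n - k)) \<le> m ^ n" .
    qed
    also have "\<dots> = (n + 1) * m ^ n" by (simp add: algebra_simps)
    finally show ?thesis by (simp add: add.commute)
  qed
  show False
  proof (cases "m = 0")
    case True
    then show ?thesis using bound[of 1] gt by simp
  next
    case False
    define t where "t = v (x + y) / m"
    have mp: "m > 0" using False m0 by simp
    have t: "t > 1" using gt mp by (simp add: t_def)
    have tb: "t ^ n \<le> n + 1" for n using bound[of n] mp by (simp add: t_def power_divide field_simps)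
    have "(\<lambda>n. real n * inverse t ^ n) \<longlonglongrightarrow> 0"
      using t by (intro powser_times_n_limit_0) (simp add: inverse_less_1_iff)
    moreover have "(\<lambda>n. inverse t ^ n) \<longlonglongrightarrow> 0"
      using t by (intro LIMSEQ_realpow_zero) (simp_all add: inverse_less_1_iff)
    ultimately have "(\<lambda>n. real n * inverse t ^ n + inverse t ^ n) \<longlonglongrightarrow> 0 + 0" by (rule tendsto_add)
    then have "\<forall>\<^sub>F n in sequentially. real n * inverse t ^ n + inverse t ^ n < 1" by (rule order_tendstoD(2)) simp
    then obtain n where "real n * inverse t ^ n + inverse t ^ n < 1" unfolding eventually_sequentially by blast
    then have "n + 1 < t ^ n" using t by (simp add: power_inverse field_simps)
    then show False using tb[of n] by simp
  qed
qed

lemma v_sum_le: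
  assumes "finite A" "\<And>i. i \<in> A \<Longrightarrow> g i \<in> L" "\<And>i. i \<in> A \<Longrightarrow> v (g i) \<le> c" "c \<ge> 0"
  shows "v (sum g A) \<le> c"
  using assms(1-3)
proof (induction A rule: finite_induct)
  case (insert i A)
  have "v (g i + sum g A) \<le> max (v (g i)) (v (sum g A))"
    using insert.prems by (intro v_add_le_max subfld_sum[OF subfld_L]) auto
  also have "\<dots> \<le> c" using insert by simp
  finally show ?case using insert.hyps by simp
qed (simp add: v_0 assms(4))

text \<open>Rational integers have absolute value at most \<open>1\<close>, so for
  \<open>v x > 1\<close> the leading term would dominate the equation.\<close>

lemma v_integral:
  assumes P: "\<And>i. Polynomial.coeff P i \<in> \<int>" "v (lead_coeff P) = 1" "poly P x = 0" and x: "x \<in> L"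
  shows "v x \<le> 1"
proof (rule ccontr)
  assume "\<not> v x \<le> 1"
  then have gt: "v x > 1" by simp
  define n where "n = Polynomial.degree P"
  obtain a where a: "\<And>i. Polynomial.coeff P i = of_int (a i)"
    using choice[of "\<lambda>i k. Polynomial.coeff P i = of_int k"] P(1) by (auto simp: Ints_def)
  have aL: "of_int (a i) \<in> L" for i by (rule subfld_of_int[OF subfld_L])
  have npos: "n > 0"
  proof (rule ccontr)
    assume "\<not> n > 0"
    then obtain c where c: "P = [:c:]" using n_def degree_eq_zeroE[of P] by auto
    then have "c = 0" using P(3) by simp
    then show False using P(2) c v_0 by simp
  qed
  have "poly P x = (\<Sum>i<n. of_int (a i) * x ^ i) + of_int (a n) * x ^ n"
    unfolding poly_altdef by (simp add: a n_def flip: lessThan_Suc_atMost)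
  then have e: "of_int (a n) * x ^ n = - (\<Sum>i<n. of_int (a i) * x ^ i)"
    using P(3) by (simp add: eq_neg_iff_add_eq_0 add.commute)
  have tL: "of_int (a i) * x ^ i \<in> L" for i using aL x Lc by simp
  have "v x ^ n = v (of_int (a n) * x ^ n)"
    using P(2) aL x by (simp add: avD(3) Lc v_power a n_def)
  also have "\<dots> = v (\<Sum>i<n. of_int (a i) * x ^ i)"
    unfolding e using tL by (intro v_minus subfld_sum[OF subfld_L])
  also have "\<dots> \<le> v x ^ (n - 1)"
  proof (rule v_sum_le)
    fix i assume i: "i \<in> {..<n}"
    have "v (of_int (a i) * x ^ i) = v (of_int (a i)) * v x ^ i" using aL x by (simp add: avD(3) Lc v_power)
    also have "\<dots> \<le> 1 * v x ^ (n - 1)"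
      using v_of_int[of "a i"] gt i by (intro mult_mono power_increasing) auto
    finally show "v (of_int (a i) * x ^ i) \<le> v x ^ (n - 1)" by simp
  qed (use tL gt in auto)
  also have "\<dots> < v x ^ n" using gt npos by (intro power_strict_increasing) simp_all
  finally show False by simp
qed

end

lemma padic_abs_of_int:
  assumes p: "Factorial_Ring.prime (p::nat)"
  shows "padic_abs p (of_int m) \<le> 1" "\<not> int p dvd m \<Longrightarrow> padic_abs p (of_int m) = 1"
proof -
  have p1: "real p > 1" using prime_gt_1_nat[OF p] by simp
  have q: "padic_abs p (of_int m) = (if m = 0 then 0 else real p powi (- int (multiplicity (int p) m)))"
    by (simp add: padic_abs_def)
  show "padic_abs p (of_int m) \<le> 1"
    unfolding q using p1 by (simp add: power_int_minus inverse_le_1_iff)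
  assume "\<not> int p dvd m"
  then show "padic_abs p (of_int m) = 1"
    unfolding q by (auto simp: not_dvd_imp_multiplicity_0)
qed

lemma padic_abs_prime:
  assumes p: "Factorial_Ring.prime (p::nat)"
  shows "padic_abs p (of_nat p) = 1 / p"
proof -
  have p1: "p > 1" using prime_gt_1_nat[OF p] by simp
  have "padic_abs p (of_int (int p)) = real p powi (- int (multiplicity (int p) (int p)))"
    using p1 by (simp add: padic_abs_def del: of_int_of_nat_eq)
  also have "multiplicity (int p) (int p) = 1"
    using p1 by (intro multiplicity_self) auto
  finally show ?thesis using p1 by (simp add: power_int_minus field_simps)
qed

subsection \<open>Completions\<close>

lemma abs_value_Rats: assumes "abs_value L v" shows "abs_value \<rat> v"
proof -
  interpret abs_value L v by fact
  have sub: "\<rat> \<subseteq> L" using subfld_of_rat[OF subfld_L] by (auto elim: Rats_cases)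
  show ?thesis
  proof
    show "subfld \<rat>" by (auto simp: subfld_def)
    show "absolute_value_on \<rat> v" using av sub unfolding absolute_value_on_def by blast
  qed
qed

definition cauchy_for :: "(complex \<Rightarrow> real) \<Rightarrow> (nat \<Rightarrow> complex) \<Rightarrow> bool" where
  "cauchy_for v x \<longleftrightarrow> (\<forall>\<epsilon>>0. \<exists>N. \<forall>m\<ge>N. \<forall>n\<ge>N. v (x m - x n) < \<epsilon>)"

lemma cauchy_forE:
  assumes "cauchy_for v x" "\<epsilon> > 0"
  obtains N where "\<And>m n. m \<ge> N \<Longrightarrow> n \<ge> N \<Longrightarrow> v (x m - x n) < \<epsilon>"
  using assms unfolding cauchy_for_def by (elim allE[of _ \<epsilon>]) auto

lemma carrier_cauchy_ring: "x \<in> carrier (cauchy_ring L v) \<longleftrightarrow> (\<forall>n. x n \<in> L) \<and> cauchy_for v x"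
  by (auto simp: cauchy_ring_def cauchy_for_def)

lemma cauchy_ring_simps:
  "x \<otimes>\<^bsub>cauchy_ring L v\<^esub> y = (\<lambda>n. x n * y n)" "\<one>\<^bsub>cauchy_ring L v\<^esub> = (\<lambda>n. 1)"
  "x \<oplus>\<^bsub>cauchy_ring L v\<^esub> y = (\<lambda>n. x n + y n)" "\<zero>\<^bsub>cauchy_ring L v\<^esub> = (\<lambda>n. 0)"
  by (simp_all add: cauchy_ring_def)

lemma null_sequences_iff: "x \<in> null_sequences L v \<longleftrightarrow> (\<forall>n. x n \<in> L) \<and> (\<lambda>n. v (x n)) \<longlonglongrightarrow> 0"
  by (auto simp: null_sequences_def)

context abs_value
begin

lemma cauchy_dominated:
  assumes "cauchy_for v x" "K > 0" "\<And>m n. v (y m - y n) \<le> K * v (x m - x n)"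
  shows "cauchy_for v y"
  unfolding cauchy_for_def
proof (intro allI impI)
  fix \<epsilon> :: real assume "\<epsilon> > 0"
  then have "\<epsilon> / K > 0" using assms(2) by simp
  then obtain N where N: "v (x m - x n) < \<epsilon> / K" if "m \<ge> N" "n \<ge> N" for m n
    using cauchy_forE[OF assms(1) \<open>\<epsilon> / K > 0\<close>] by blast
  have "v (y m - y n) < \<epsilon>" if "m \<ge> N" "n \<ge> N" for m n
  proof -
    have "v (y m - y n) \<le> K * v (x m - x n)" by (rule assms(3))
    also have "\<dots> < K * (\<epsilon> / K)" using N[OF that] assms(2) by (rule mult_strict_left_mono)
    finally show ?thesis using assms(2) by simp
  qed
  then show "\<exists>N. \<forall>m\<ge>N. \<forall>n\<ge>N. v (y m - y n) < \<epsilon>" by blast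
qed

lemma cauchy_dominated2:
  assumes "cauchy_for v x" "cauchy_for v y" "K > 0"
    "\<And>m n. v (z m - z n) \<le> K * (v (x m - x n) + v (y m - y n))"
  shows "cauchy_for v z"
  unfolding cauchy_for_def
proof (intro allI impI)
  fix \<epsilon> :: real assume "\<epsilon> > 0"
  then have e: "\<epsilon> / (2 * K) > 0" using assms(3) by simp
  obtain N where N: "v (x m - x n) < \<epsilon> / (2 * K)" if "m \<ge> N" "n \<ge> N" for m n
    using cauchy_forE[OF assms(1) e] by blast
  obtain N' where N': "v (y m - y n) < \<epsilon> / (2 * K)" if "m \<ge> N'" "n \<ge> N'" for m n
    using cauchy_forE[OF assms(2) e] by blast
  have "v (z m - z n) < \<epsilon>" if "m \<ge> max N N'" "n \<ge> max N N'" for m n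
  proof -
    have "v (z m - z n) \<le> K * (v (x m - x n) + v (y m - y n))" by (rule assms(4))
    also have "\<dots> < K * (\<epsilon> / (2 * K) + \<epsilon> / (2 * K))"
      using N[of m n] N'[of m n] that assms(3) by (intro mult_strict_left_mono add_strict_mono) simp_all
    also have "\<dots> = \<epsilon>" using assms(3) by simp
    finally show ?thesis .
  qed
  then show "\<exists>N. \<forall>m\<ge>N. \<forall>n\<ge>N. v (z m - z n) < \<epsilon>" by blast
qed

lemma cauchy_bounded:
  assumes x: "\<And>n. x n \<in> L" "cauchy_for v x"
  shows "\<exists>B>0. \<forall>n. v (x n) \<le> B"
proof -
  obtain N where N: "v (x m - x n) < 1" if "m \<ge> N" "n \<ge> N" for m n
    using cauchy_forE[OF x(2), of 1] by auto
  define B where "B = (\<Sum>i\<le>N. v (x i)) + 1"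
  have s0: "(\<Sum>i\<le>N. v (x i)) \<ge> 0" using avD(1)[OF x(1)] by (intro sum_nonneg) simp
  have le: "v (x i) \<le> (\<Sum>i\<le>N. v (x i))" if "i \<le> N" for i
    using that avD(1)[OF x(1)] by (intro member_le_sum) simp_all
  have "v (x n) \<le> B" for n
  proof (cases "n \<le> N")
    case True
    then show ?thesis using le[of n] by (simp add: B_def)
  next
    case False
    have "v (x n) - v (x N) \<le> v (x n - x N)" by (rule v_diff_ge[OF x(1) x(1)])
    also have "\<dots> < 1" using False by (intro N) simp_all
    finally show ?thesis using le[of N] by (simp add: B_def)
  qed
  moreover have "B > 0" using s0 by (simp add: B_def)
  ultimately show ?thesis by blast
qed

lemma cauchy_const: "cauchy_for v (\<lambda>n. c)"
  by (simp add: cauchy_for_def v_0)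

lemma cauchy_add:
  assumes x: "\<And>n. x n \<in> L" "cauchy_for v x" and y: "\<And>n. y n \<in> L" "cauchy_for v y"
  shows "cauchy_for v (\<lambda>n. x n + y n)"
proof (rule cauchy_dominated2[OF x(2) y(2), of 1])
  fix m n
  have "v ((x m - x n) + (y m - y n)) \<le> v (x m - x n) + v (y m - y n)" using x y by (intro avD(4) Lc)
  then show "v (x m + y m - (x n + y n)) \<le> 1 * (v (x m - x n) + v (y m - y n))" by (simp add: algebra_simps)
qed simp

lemma cauchy_minus:
  assumes x: "\<And>n. x n \<in> L" "cauchy_for v x" shows "cauchy_for v (\<lambda>n. - x n)"
proof (rule cauchy_dominated[OF x(2), of 1])
  fix m n
  have "- x m - - x n = - (x m - x n)" by simp
  then show "v (- x m - - x n) \<le> 1 * v (x m - x n)" using v_minus[OF Lc(3)[OF x(1) x(1), of m n]] by simp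
qed simp

lemma cauchy_mult:
  assumes x: "\<And>n. x n \<in> L" "cauchy_for v x" and y: "\<And>n. y n \<in> L" "cauchy_for v y"
  shows "cauchy_for v (\<lambda>n. x n * y n)"
proof -
  obtain B where B: "B > 0" "\<forall>n. v (x n) \<le> B" using cauchy_bounded[OF x] by blast
  obtain B' where B': "B' > 0" "\<forall>n. v (y n) \<le> B'" using cauchy_bounded[OF y] by blast
  show ?thesis
  proof (rule cauchy_dominated2[OF x(2) y(2), of "B + B'"])
    fix m n
    have "x m * y m - x n * y n = x m * (y m - y n) + y n * (x m - x n)" by (simp add: algebra_simps)
    also have "v \<dots> \<le> v (x m * (y m - y n)) + v (y n * (x m - x n))" using x y by (intro avD(4) Lc)
    also have "\<dots> = v (x m) * v (y m - y n) + v (y n) * v (x m - x n)" using x y Lc by (simp add: avD(3))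
    also have "\<dots> \<le> (B + B') * v (y m - y n) + (B + B') * v (x m - x n)"
      using B B' x y by (intro add_mono mult_right_mono avD(1) Lc) (simp_all add: add_increasing add_increasing2)
    finally show "v (x m * y m - x n * y n) \<le> (B + B') * (v (x m - x n) + v (y m - y n))"
      by (simp add: algebra_simps)
  qed (use B B' in simp)
qed

lemma cring_cauchy_ring: "cring (cauchy_ring L v)"
proof (rule cringI)
  show "abelian_group (cauchy_ring L v)"
  proof (rule abelian_groupI)
    fix x assume x: "x \<in> carrier (cauchy_ring L v)"
    show "\<exists>y\<in>carrier (cauchy_ring L v). y \<oplus>\<^bsub>cauchy_ring L v\<^esub> x = \<zero>\<^bsub>cauchy_ring L v\<^esub>"
      using x cauchy_minus[of x] Lc(6)
      by (intro bexI[of _ "\<lambda>n. - x n"]) (simp_all add: cauchy_ring_simps carrier_cauchy_ring)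
  qed (simp_all add: cauchy_ring_simps carrier_cauchy_ring cauchy_add cauchy_const Lc add_ac)
  show "comm_monoid (cauchy_ring L v)"
    by (rule comm_monoidI) (simp_all add: cauchy_ring_simps carrier_cauchy_ring cauchy_mult cauchy_const Lc mult_ac)
qed (simp add: cauchy_ring_simps distrib_right)

interpretation CR: cring "cauchy_ring L v" by (rule cring_cauchy_ring)

lemma cauchy_ring_minus:
  assumes "x \<in> carrier (cauchy_ring L v)" shows "\<ominus>\<^bsub>cauchy_ring L v\<^esub> x = (\<lambda>n. - x n)"
proof (rule CR.minus_equality)
  show "(\<lambda>n. - x n) \<in> carrier (cauchy_ring L v)"
    using assms cauchy_minus[of x] Lc(6) by (simp add: carrier_cauchy_ring)
qed (use assms in \<open>simp_all add: cauchy_ring_simps\<close>)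

lemma null_dominated:
  assumes "\<And>n. y n \<in> L" "\<And>n. v (y n) \<le> K * a n" "a \<longlonglongrightarrow> 0"
  shows "(\<lambda>n. v (y n)) \<longlonglongrightarrow> 0"
proof (rule tendsto_sandwich[OF _ _ tendsto_const])
  show "(\<lambda>n. K * a n) \<longlonglongrightarrow> 0" using tendsto_mult[OF tendsto_const[of K] assms(3)] by simp
qed (use assms avD(1) in simp_all)

lemma null_add:
  assumes x: "\<And>n. x n \<in> L" "(\<lambda>n. v (x n)) \<longlonglongrightarrow> 0" and y: "\<And>n. y n \<in> L" "(\<lambda>n. v (y n)) \<longlonglongrightarrow> 0"
  shows "(\<lambda>n. v (x n + y n)) \<longlonglongrightarrow> 0"
proof (rule null_dominated[of _ 1])
  show "(\<lambda>n. v (x n) + v (y n)) \<longlonglongrightarrow> 0" using tendsto_add[OF x(2) y(2)] by simp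
  show "x n + y n \<in> L" for n using x y Lc by simp
  show "v (x n + y n) \<le> 1 * (v (x n) + v (y n))" for n using avD(4)[OF x(1) y(1)] by simp
qed

lemma null_cauchy:
  assumes x: "\<And>n. x n \<in> L" "(\<lambda>n. v (x n)) \<longlonglongrightarrow> 0" shows "cauchy_for v x"
  unfolding cauchy_for_def
proof (intro allI impI)
  fix \<epsilon> :: real assume "\<epsilon> > 0"
  then have "\<forall>\<^sub>F n in sequentially. v (x n) < \<epsilon> / 2" by (intro order_tendstoD(2)[OF x(2)]) simp
  then obtain N where N: "\<And>n. n \<ge> N \<Longrightarrow> v (x n) < \<epsilon> / 2" unfolding eventually_sequentially by blast
  have "v (x m - x n) < \<epsilon>" if "m \<ge> N" "n \<ge> N" for m n
    using v_diff[OF x(1) x(1), of m n] N[OF that(1)] N[OF that(2)] by simp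
  then show "\<exists>N. \<forall>m\<ge>N. \<forall>n\<ge>N. v (x m - x n) < \<epsilon>" by blast
qed

lemma ideal_null_sequences: "ideal (null_sequences L v) (cauchy_ring L v)"
proof (rule idealI)
  show "subgroup (null_sequences L v) (add_monoid (cauchy_ring L v))"
  proof (rule CR.add.subgroupI)
    show sub: "null_sequences L v \<subseteq> carrier (cauchy_ring L v)"
      using null_cauchy by (auto simp: null_sequences_iff carrier_cauchy_ring)
    have "(\<lambda>n. 0) \<in> null_sequences L v" by (simp add: null_sequences_iff v_0 Lc)
    then show "null_sequences L v \<noteq> {}" by blast
    show "\<ominus>\<^bsub>cauchy_ring L v\<^esub> x \<in> null_sequences L v" if x: "x \<in> null_sequences L v" for x
      using x subsetD[OF sub x] by (simp add: cauchy_ring_minus null_sequences_iff v_minus Lc)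
    show "x \<oplus>\<^bsub>cauchy_ring L v\<^esub> y \<in> null_sequences L v" if "x \<in> null_sequences L v" "y \<in> null_sequences L v" for x y
      using that null_add by (simp add: null_sequences_iff cauchy_ring_simps Lc)
  qed
  fix a x assume a: "a \<in> null_sequences L v" and x: "x \<in> carrier (cauchy_ring L v)"
  have aL: "a n \<in> L" and xL: "x n \<in> L" for n using a x by (simp_all add: null_sequences_iff carrier_cauchy_ring)
  obtain B where B: "B > 0" "\<forall>n. v (x n) \<le> B"
    using cauchy_bounded[of x] x by (auto simp: carrier_cauchy_ring)
  have "(\<lambda>n. v (x n * a n)) \<longlonglongrightarrow> 0"
  proof (rule null_dominated[of _ B "\<lambda>n. v (a n)"])
    show "v (x n * a n) \<le> B * v (a n)" for n
      using B avD(3)[OF xL aL] avD(1)[OF aL] by (simp add: mult_right_mono)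
  qed (use a aL xL Lc in \<open>simp_all add: null_sequences_iff\<close>)
  then show "x \<otimes>\<^bsub>cauchy_ring L v\<^esub> a \<in> null_sequences L v" "a \<otimes>\<^bsub>cauchy_ring L v\<^esub> x \<in> null_sequences L v"
    using aL xL by (simp_all add: null_sequences_iff cauchy_ring_simps Lc mult.commute)
qed (rule CR.ring_axioms)

interpretation NI: ideal "null_sequences L v" "cauchy_ring L v" by (rule ideal_null_sequences)

lemma cring_completion: "cring (completion L v)"
  unfolding completion_def by (rule NI.quotient_is_cring[OF cring_cauchy_ring])

interpretation CO: cring "completion L v" by (rule cring_completion)

definition cls :: "(nat \<Rightarrow> complex) \<Rightarrow> (nat \<Rightarrow> complex) set" where
  "cls x = null_sequences L v +>\<^bsub>cauchy_ring L v\<^esub> x"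

lemma cls_hom: "ring_hom_ring (cauchy_ring L v) (completion L v) cls"
  using NI.rcos_ring_hom_ring unfolding completion_def cls_def[abs_def] .

interpretation CL: ring_hom_ring "cauchy_ring L v" "completion L v" cls by (rule cls_hom)

lemma cls_eqI:
  assumes "\<And>n. x n \<in> L" "\<And>n. y n \<in> L" "(\<lambda>n. v (x n - y n)) \<longlonglongrightarrow> 0"
  shows "cls x = cls y"
proof -
  have sub: "cls x \<subseteq> cls y" if xy: "\<And>n. x n \<in> L" "\<And>n. y n \<in> L" "(\<lambda>n. v (x n - y n)) \<longlonglongrightarrow> 0" for x y
  proof
    fix z assume "z \<in> cls x"
    then obtain h where h: "h \<in> null_sequences L v" "z = (\<lambda>n. h n + x n)"
      by (auto simp: cls_def a_r_coset_def' cauchy_ring_simps)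
    have "(\<lambda>n. h n + (x n - y n)) \<in> null_sequences L v"
      using h(1) xy null_add[of h "\<lambda>n. x n - y n"] Lc by (simp add: null_sequences_iff)
    moreover have "z = (\<lambda>n. h n + (x n - y n)) \<oplus>\<^bsub>cauchy_ring L v\<^esub> y" by (simp add: h(2) cauchy_ring_simps)
    ultimately show "z \<in> cls y" unfolding cls_def a_r_coset_def' by blast
  qed
  have "v (y n - x n) = v (x n - y n)" for n
    using v_minus[OF Lc(3)[OF assms(1,2)], of n] by simp
  then have "(\<lambda>n. v (y n - x n)) \<longlonglongrightarrow> 0" using assms(3) by (simp only:)
  from sub[OF assms] sub[OF assms(2,1) this] show ?thesis by (rule equalityI)
qed

lemma cls_eq_zero:
  assumes "cls x = \<zero>\<^bsub>completion L v\<^esub>" shows "(\<lambda>n. v (x n)) \<longlonglongrightarrow> 0"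
proof -
  have "(\<lambda>n. 0 + x n) \<in> cls x"
    by (auto simp: cls_def a_r_coset_def' cauchy_ring_simps null_sequences_iff v_0 Lc intro!: bexI[of _ "\<lambda>n. 0"])
  moreover have "\<zero>\<^bsub>completion L v\<^esub> = null_sequences L v" by (simp add: completion_def FactRing_def)
  ultimately show ?thesis using assms by (simp add: null_sequences_iff)
qed

lemma carrier_completion: "carrier (completion L v) = cls ` carrier (cauchy_ring L v)"
  by (auto simp: completion_def FactRing_def A_RCOSETS_def' cls_def)

lemma base_completion_cls: "base_completion L v = cls ` carrier (cauchy_ring \<rat> v)"
  by (simp add: base_completion_def cls_def[abs_def])

lemma Rats_sub: "\<rat> \<subseteq> L"
  using subfld_of_rat[OF subfld_L] by (auto elim: Rats_cases)

lemma carrier_Rats_sub: "carrier (cauchy_ring \<rat> v) \<subseteq> carrier (cauchy_ring L v)"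
  using Rats_sub by (auto simp: carrier_cauchy_ring subset_iff)

lemma cauchy_inverse:
  assumes x: "\<And>n. x n \<in> L" "cauchy_for v x" and nn: "\<not> (\<lambda>n. v (x n)) \<longlonglongrightarrow> 0"
  shows "cauchy_for v (\<lambda>n. inverse (x n))" "\<forall>\<^sub>F n in sequentially. x n \<noteq> 0"
proof -
  obtain \<delta> where d: "\<delta> > 0" "\<And>N. \<exists>n\<ge>N. v (x n) \<ge> \<delta>"
    using nn avD(1)[OF x(1)] unfolding LIMSEQ_iff by (auto simp: not_less)
  obtain N where N: "v (x m - x n) < \<delta> / 2" if "m \<ge> N" "n \<ge> N" for m n
    using cauchy_forE[OF x(2) half_gt_zero[OF d(1)]] by blast
  obtain n0 where n0: "n0 \<ge> N" "v (x n0) \<ge> \<delta>" using d(2) by blast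
  have big: "v (x n) \<ge> \<delta> / 2" if "n \<ge> N" for n
    using v_diff_ge[OF x(1) x(1), of n0 n] N[OF n0(1) that] n0(2) by simp
  have nz: "x n \<noteq> 0" if "n \<ge> N" for n using big[OF that] d(1) v_0 by auto
  show "\<forall>\<^sub>F n in sequentially. x n \<noteq> 0" using nz by (rule eventually_sequentiallyI)
  show "cauchy_for v (\<lambda>n. inverse (x n))"
    unfolding cauchy_for_def
  proof (intro allI impI)
    fix \<epsilon> :: real assume "\<epsilon> > 0"
    then have e: "\<epsilon> * (\<delta> / 2 * (\<delta> / 2)) > 0" using d(1) by simp
    obtain N' where N': "v (x m - x n) < \<epsilon> * (\<delta> / 2 * (\<delta> / 2))" if "m \<ge> N'" "n \<ge> N'" for m n
      using cauchy_forE[OF x(2) e] by blast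
    have "v (inverse (x m) - inverse (x n)) < \<epsilon>" if mn: "m \<ge> max N N'" "n \<ge> max N N'" for m n
    proof -
      have "inverse (x m) - inverse (x n) = (x n - x m) / (x m * x n)"
        using nz[of m] nz[of n] mn by (simp add: field_simps)
      then have "v (inverse (x m) - inverse (x n)) = v (x n - x m) / (v (x m) * v (x n))"
        using x(1) Lc by (simp add: v_divide avD(3))
      moreover have "\<delta> / 2 * (\<delta> / 2) \<le> v (x m) * v (x n)" using big mn d(1) by (intro mult_mono) (auto intro: avD(1) x)
      moreover have "\<delta> / 2 * (\<delta> / 2) > 0" using d(1) by simp
      moreover have "v (x n - x m) < \<epsilon> * (\<delta> / 2 * (\<delta> / 2))" using N' mn by simp
      ultimately have "v (inverse (x m) - inverse (x n)) \<le> v (x n - x m) / (\<delta> / 2 * (\<delta> / 2))"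
        using avD(1)[OF Lc(3)[OF x(1) x(1)], of n m] by (simp only: divide_left_mono mult_pos_pos order_less_le_trans)
      also have "\<dots> < \<epsilon>" using \<open>\<delta> / 2 * (\<delta> / 2) > 0\<close> \<open>v (x n - x m) < _\<close> by (simp only: pos_divide_less_eq)
      finally show ?thesis .
    qed
    then show "\<exists>N. \<forall>m\<ge>N. \<forall>n\<ge>N. v (inverse (x m) - inverse (x n)) < \<epsilon>" by blast
  qed
qed

text \<open>The dimension theory needs a field of scalars. A rational Cauchy sequence that is not
  null is bounded away from \<open>0\<close> eventually, so termwise inverses give its inverse up to
  null sequences.\<close>

lemma subfield_base_completion: "subfield (base_completion L v) (completion L v)"
proof (rule CO.subfieldI)
  interpret R: abs_value \<rat> v by (rule abs_value_Rats[OF abs_value_axioms])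
  have subC: "carrier (cauchy_ring \<rat> v) \<subseteq> carrier (cauchy_ring L v)" by (rule carrier_Rats_sub)
  have "subring (carrier (cauchy_ring \<rat> v)) (cauchy_ring L v)"
  proof (rule CR.subringI[OF subC])
    fix x assume x: "x \<in> carrier (cauchy_ring \<rat> v)"
    then show "\<ominus>\<^bsub>cauchy_ring L v\<^esub> x \<in> carrier (cauchy_ring \<rat> v)"
      using subsetD[OF subC x] R.cauchy_minus[of x] by (simp add: cauchy_ring_minus carrier_cauchy_ring)
  qed (simp_all add: cauchy_ring_simps carrier_cauchy_ring R.cauchy_add R.cauchy_mult R.cauchy_const)
  then have sr: "subring (base_completion L v) (completion L v)"
    unfolding base_completion_cls by (rule CL.img_is_subring)
  then show "subcring (base_completion L v) (completion L v)" by (rule CO.subcringI')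
  have nontriv: "\<one>\<^bsub>completion L v\<^esub> \<noteq> \<zero>\<^bsub>completion L v\<^esub>"
  proof
    assume "\<one>\<^bsub>completion L v\<^esub> = \<zero>\<^bsub>completion L v\<^esub>"
    then have "cls (\<lambda>n. 1) = \<zero>\<^bsub>completion L v\<^esub>" using CL.hom_one by (simp add: cauchy_ring_simps)
    then show False using cls_eq_zero[of "\<lambda>n. 1"] v_1 by (simp add: LIMSEQ_const_iff)
  qed
  let ?K = "base_completion L v"
  show "Units (completion L v\<lparr>carrier := ?K\<rparr>) = ?K - {\<zero>\<^bsub>completion L v\<^esub>}"
  proof (intro equalityI subsetI)
    fix k assume k: "k \<in> Units (completion L v\<lparr>carrier := ?K\<rparr>)"
    then obtain k' where k': "k \<in> ?K" "k' \<in> ?K" "k' \<otimes>\<^bsub>completion L v\<^esub> k = \<one>\<^bsub>completion L v\<^esub>"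
      by (auto simp: Units_def)
    have "k' \<in> carrier (completion L v)" using subringE(1)[OF sr] k'(2) by blast
    then have "k' \<otimes>\<^bsub>completion L v\<^esub> \<zero>\<^bsub>completion L v\<^esub> = \<zero>\<^bsub>completion L v\<^esub>" by (rule CO.r_null)
    then have "k \<noteq> \<zero>\<^bsub>completion L v\<^esub>" using k'(3) nontriv by force
    then show "k \<in> ?K - {\<zero>\<^bsub>completion L v\<^esub>}" using k'(1) by simp
  next
    fix k assume k: "k \<in> ?K - {\<zero>\<^bsub>completion L v\<^esub>}"
    then obtain x where x: "k = cls x" "x \<in> carrier (cauchy_ring \<rat> v)" by (auto simp: base_completion_cls)
    have xC: "x \<in> carrier (cauchy_ring L v)" using subC x(2) by blast
    have xR: "x n \<in> \<rat>" and xL: "x n \<in> L" for n using x(2) xC by (simp_all add: carrier_cauchy_ring)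
    have nn: "\<not> (\<lambda>n. v (x n)) \<longlonglongrightarrow> 0"
    proof
      assume "(\<lambda>n. v (x n)) \<longlonglongrightarrow> 0"
      then have "cls x = cls (\<lambda>n. 0)" using xL by (intro cls_eqI) (simp_all add: Lc)
      also have "\<dots> = \<zero>\<^bsub>completion L v\<^esub>" using CL.hom_zero by (simp add: cauchy_ring_simps)
      finally show False using k x(1) by simp
    qed
    define y where "y = (\<lambda>n. inverse (x n))"
    have y: "y \<in> carrier (cauchy_ring \<rat> v)"
      using R.cauchy_inverse(1)[of x] nn xR x(2) by (simp add: y_def carrier_cauchy_ring)
    have yC: "y \<in> carrier (cauchy_ring L v)" using subC y by blast
    have "\<forall>\<^sub>F n in sequentially. x n \<noteq> 0" using R.cauchy_inverse(2)[of x] nn xR x(2) by (simp add: carrier_cauchy_ring)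
    then have "\<forall>\<^sub>F n in sequentially. v (x n * y n - 1) = 0" by eventually_elim (simp add: y_def v_0)
    then have "(\<lambda>n. v (x n * y n - 1)) \<longlonglongrightarrow> 0" by (rule tendsto_eventually)
    then have e: "cls (\<lambda>n. x n * y n) = cls (\<lambda>n. 1)"
      using xL yC Lc by (intro cls_eqI) (simp_all add: carrier_cauchy_ring)
    have "cls x \<otimes>\<^bsub>completion L v\<^esub> cls y = \<one>\<^bsub>completion L v\<^esub>"
      using CL.hom_mult[OF xC yC] CL.hom_one e by (simp add: cauchy_ring_simps)
    moreover have "cls y \<otimes>\<^bsub>completion L v\<^esub> cls x = cls x \<otimes>\<^bsub>completion L v\<^esub> cls y"
      using xC yC by (intro CO.m_comm CL.hom_closed)
    moreover have "cls x \<in> ?K" "cls y \<in> ?K" using x(2) y by (auto simp: base_completion_cls)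
    ultimately show "k \<in> Units (completion L v\<lparr>carrier := ?K\<rparr>)" by (auto simp: Units_def x(1))
  qed
qed

text \<open>Completeness of finite-dimensional spaces, by induction on the list. If \<open>e\<close>
  is a limit of elements of the span of the rest, it is replaced by approximations. Otherwise its
  distance from that span is positive, so its coefficients form a Cauchy sequence and can be split
  off.\<close>

lemma cls_in_Span:
  assumes "set es \<subseteq> L" "x \<in> carrier (cauchy_ring L v)" "\<And>n. x n \<in> Qv.span (set es)"
  shows "cls x \<in> ring.Span (completion L v) (base_completion L v) (map (\<lambda>e. cls (\<lambda>n. e)) es)"
  using assms
proof (induction es arbitrary: x)
  case Nil
  then have "x = (\<lambda>n. 0)" by auto
  then show ?case using CL.hom_zero by (simp add: cauchy_ring_simps)
next
  case (Cons e es)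
  let ?K = "base_completion L v"
  let ?U = "map (\<lambda>e. cls (\<lambda>n. e)) es"
  note K = subfield_base_completion
  have eL: "e \<in> L" and esL: "set es \<subseteq> L" using Cons.prems(1) by auto
  have cC: "(\<lambda>n. c) \<in> carrier (cauchy_ring L v)" if "c \<in> L" for c using that by (simp add: carrier_cauchy_ring cauchy_const)
  have U: "set ?U \<subseteq> carrier (completion L v)" using cC esL by auto
  have qL: "of_rat q * z \<in> L" if "z \<in> L" for q z using that subfld_of_rat[OF subfld_L] Lc(4) by blast
  have spanL: "z \<in> L" if "z \<in> Qv.span (set es)" for z
    using that
  proof (induction rule: Qv.span_induct_alt)
    case base show ?case by (rule Lc(2))
  next
    case (step c z y) show ?case by (rule Lc(7)[OF qL]) (use esL step in auto)
  qed
  have xL: "x n \<in> L" and xc: "cauchy_for v x" for n using Cons.prems(2) by (simp_all add: carrier_cauchy_ring)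
  have "\<forall>n. \<exists>c. x n - of_rat c * e \<in> Qv.span (set es)"
    using Cons.prems(3) by (simp add: Qv.span_insert)
  then obtain c where c: "\<And>n. x n - of_rat (c n) * e \<in> Qv.span (set es)" by metis
  define y where "y = (\<lambda>n. x n - of_rat (c n) * e)"
  have yS: "y n \<in> Qv.span (set es)" for n using c by (simp add: y_def)
  have ceL: "of_rat (c n) * e \<in> L" for n by (rule qL[OF eL])
  show ?case
  proof (cases "\<forall>\<delta>>0. \<exists>z\<in>Qv.span (set es). v (e - z) < \<delta>")
    case True
    \<comment> \<open>The coefficients \<open>c n\<close> may be unbounded in this case, so the
      accuracy is divided by their size.\<close>
    have "\<exists>z\<in>Qv.span (set es). v (e - z) < inverse (Suc n) / (v (of_rat (c n)) + 1)" for n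
      using True avD(1)[OF subfld_of_rat[OF subfld_L]] by (simp add: add_nonneg_pos)
    then obtain z where z: "\<And>n. z n \<in> Qv.span (set es)" "\<And>n. v (e - z n) < inverse (Suc n) / (v (of_rat (c n)) + 1)"
      by metis
    have zL: "z n \<in> L" for n using spanL[OF z(1)] .
    define x' where "x' = (\<lambda>n. y n + of_rat (c n) * z n)"
    have x'S: "x' n \<in> Qv.span (set es)" for n
      unfolding x'_def by (intro Qv.span_add yS Qv.span_scale z(1))
    have x'L: "x' n \<in> L" for n using spanL[OF x'S] .
    have diff: "(\<lambda>n. v (x n - x' n)) \<longlonglongrightarrow> 0"
    proof (rule null_dominated[of _ 1 "\<lambda>n. inverse (real (Suc n))"])
      fix n
      have v0: "v (of_rat (c n)) \<ge> 0" using avD(1)[OF subfld_of_rat[OF subfld_L]] .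
      have "x n - x' n = of_rat (c n) * (e - z n)" by (simp add: x'_def y_def algebra_simps)
      then have "v (x n - x' n) = v (of_rat (c n)) * v (e - z n)"
        using avD(3)[OF subfld_of_rat[OF subfld_L] Lc(3)[OF eL zL]] by simp
      also have "\<dots> \<le> (v (of_rat (c n)) + 1) * v (e - z n)"
        using avD(1)[OF Lc(3)[OF eL zL]] by (intro mult_right_mono) simp_all
      also have "\<dots> \<le> inverse (Suc n)"
        using z(2)[of n] v0 by (simp add: pos_less_divide_eq mult.commute)
      finally show "v (x n - x' n) \<le> 1 * inverse (real (Suc n))" by simp
    qed (use xL x'L Lc LIMSEQ_inverse_real_of_nat in simp_all)
    have e: "cls x = cls x'" by (rule cls_eqI[OF xL x'L diff])
    have "cauchy_for v (\<lambda>n. - (x n - x' n))"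
      using xL x'L Lc diff by (intro cauchy_minus null_cauchy) simp_all
    then have "cauchy_for v (\<lambda>n. x n + - (x n - x' n))" using xL x'L Lc xc by (intro cauchy_add) simp_all
    then have "x' \<in> carrier (cauchy_ring L v)" using x'L by (simp add: carrier_cauchy_ring)
    then have "cls x' \<in> CO.Span ?K ?U" using Cons.IH[OF esL] x'S by blast
    moreover have "CO.Span ?K ?U \<subseteq> CO.Span ?K (map (\<lambda>e. cls (\<lambda>n. e)) (e # es))"
      using CO.mono_Span[OF K U, of "cls (\<lambda>n. e)"] cC[OF eL] by simp
    ultimately show ?thesis unfolding e by blast
  next
    case False
    then obtain \<delta> where d: "\<delta> > 0" "\<And>z. z \<in> Qv.span (set es) \<Longrightarrow> \<delta> \<le> v (e - z)" by (auto simp: not_less)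
    \<comment> \<open>Scaling the distance \<open>\<delta>\<close> bounds the coefficient of
      \<open>e\<close> by the size of the whole vector.\<close>
    have low: "\<delta> * v (of_rat q) \<le> v (w + of_rat q * e)" if w: "w \<in> Qv.span (set es)" for w q
    proof (cases "q = 0")
      case False
      define z where "z = of_rat (- 1 / q) * w"
      have zS: "z \<in> Qv.span (set es)" unfolding z_def by (rule Qv.span_scale[OF w])
      have "of_rat q * z = of_rat (q * (- 1 / q)) * w" unfolding z_def of_rat_mult by (simp only: mult.assoc)
      then have "of_rat q * z = - w" using False by simp
      then have "w + of_rat q * e = of_rat q * (e - z)" by (simp only: right_diff_distrib) simp
      then have "v (w + of_rat q * e) = v (of_rat q) * v (e - z)"
        using avD(3)[OF subfld_of_rat[OF subfld_L] Lc(3)[OF eL spanL[OF zS]]] by simp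
      then show ?thesis using mult_left_mono[OF d(2)[OF zS] avD(1)[OF subfld_of_rat[OF subfld_L, of q]]]
        by (simp add: mult.commute)
    qed (use avD(1)[OF spanL[OF w]] in \<open>simp add: v_0\<close>)
    have cc: "cauchy_for v (\<lambda>n. of_rat (c n))"
    proof (rule cauchy_dominated[OF xc, of "1 / \<delta>"])
      fix m n
      have "\<delta> * v (of_rat (c m - c n)) \<le> v ((y m - y n) + of_rat (c m - c n) * e)"
        by (intro low Qv.span_diff yS)
      also have "(y m - y n) + of_rat (c m - c n) * e = x m - x n"
        by (simp add: y_def of_rat_diff algebra_simps)
      finally show "v (of_rat (c m) - of_rat (c n)) \<le> 1 / \<delta> * v (x m - x n)"
        using d(1) by (simp add: of_rat_diff field_simps)
    qed (use d in simp)
    have cK: "(\<lambda>n. of_rat (c n)) \<in> carrier (cauchy_ring \<rat> v)" using cc by (simp add: carrier_cauchy_ring)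
    then have cCR: "(\<lambda>n. of_rat (c n)) \<in> carrier (cauchy_ring L v)" using carrier_Rats_sub by blast
    have ceC: "(\<lambda>n. of_rat (c n) * e) \<in> carrier (cauchy_ring L v)"
      using CR.m_closed[OF cCR cC[OF eL]] by (simp add: cauchy_ring_simps)
    have "cauchy_for v (\<lambda>n. x n + - (of_rat (c n) * e))"
      using xL xc ceC Lc(6)[OF ceL] by (intro cauchy_add cauchy_minus) (simp_all add: carrier_cauchy_ring)
    then have yC: "y \<in> carrier (cauchy_ring L v)" using spanL[OF yS] by (simp add: carrier_cauchy_ring y_def)
    have "x = (\<lambda>n. of_rat (c n) * e + y n)" by (simp add: y_def)
    then have "cls x = cls ((\<lambda>n. of_rat (c n) * e) \<oplus>\<^bsub>cauchy_ring L v\<^esub> y)" by (simp add: cauchy_ring_simps)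
    also have "\<dots> = cls ((\<lambda>n. of_rat (c n)) \<otimes>\<^bsub>cauchy_ring L v\<^esub> (\<lambda>n. e)) \<oplus>\<^bsub>completion L v\<^esub> cls y"
      using ceC yC by (simp only: CL.hom_add cauchy_ring_simps(1))
    also have "\<dots> = cls (\<lambda>n. of_rat (c n)) \<otimes>\<^bsub>completion L v\<^esub> cls (\<lambda>n. e) \<oplus>\<^bsub>completion L v\<^esub> cls y"
      using cCR cC[OF eL] by (simp only: CL.hom_mult)
    finally have "cls x = cls (\<lambda>n. of_rat (c n)) \<otimes>\<^bsub>completion L v\<^esub> cls (\<lambda>n. e) \<oplus>\<^bsub>completion L v\<^esub> cls y" .
    moreover have "cls y \<in> CO.Span ?K ?U" using Cons.IH[OF esL yC] yS by blast
    moreover have "cls (\<lambda>n. of_rat (c n)) \<in> ?K" using cK by (auto simp: base_completion_cls)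
    ultimately have "cls x \<in> CO.line_extension ?K (cls (\<lambda>n. e)) (CO.Span ?K ?U)"
      unfolding CO.line_extension_mem_iff by blast
    then show ?thesis by simp
  qed
qed

text \<open>\<open>ring.dim\<close> is under control only in finite dimension, so the completion is
  first shown to be spanned by the classes of a rational basis of \<open>L\<close>. Dimension
  \<open>0\<close> would make the constant sequence \<open>1\<close> null.\<close>

theorem local_degree_pos:
  assumes L: "L \<subseteq> Qv.span Bs" "finite Bs"
  shows "local_degree L v \<ge> 1"
proof -
  obtain es where es: "set es \<subseteq> L" "L \<subseteq> Qv.span (set es)"
  proof -
    obtain T where T: "T \<subseteq> L" "Qv.independent T" "L \<subseteq> Qv.span T" using Qv.maximal_independent_subset by blast
    have "finite T" using Qv.independent_span_bound[OF L(2) T(2)] T(1) L(1) by blast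
    then show ?thesis using T that finite_list by blast
  qed
  let ?K = "base_completion L v"
  let ?U = "map (\<lambda>e. cls (\<lambda>n. e)) es"
  have U: "set ?U \<subseteq> carrier (completion L v)" using es(1) by (auto intro!: CL.hom_closed simp: carrier_cauchy_ring cauchy_const)
  have "carrier (completion L v) = CO.Span ?K ?U"
  proof
    show "carrier (completion L v) \<subseteq> CO.Span ?K ?U"
    proof
      fix k assume "k \<in> carrier (completion L v)"
      then obtain x where x: "k = cls x" "x \<in> carrier (cauchy_ring L v)" by (auto simp: carrier_completion)
      show "k \<in> CO.Span ?K ?U" unfolding x(1)
        by (rule cls_in_Span[OF es(1) x(2)]) (use x(2) es(2) in \<open>auto simp: carrier_cauchy_ring\<close>)
    qed
    show "CO.Span ?K ?U \<subseteq> carrier (completion L v)" by (rule CO.Span_subgroup_props(1)[OF subfield_base_completion U])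
  qed
  then have "CO.finite_dimension ?K (carrier (completion L v))"
    using CO.Span_finite_dimension[OF subfield_base_completion U] by simp
  then have dim: "CO.dimension (local_degree L v) ?K (carrier (completion L v))"
    using CO.finite_dimensionE[OF subfield_base_completion] by (simp add: local_degree_def over_def)
  have "local_degree L v \<noteq> 0"
  proof
    assume "local_degree L v = 0"
    then have "carrier (completion L v) = {\<zero>\<^bsub>completion L v\<^esub>}"
      using dim CO.dimension_zero[OF subfield_base_completion] by simp
    then have "cls (\<lambda>n. 1) = \<zero>\<^bsub>completion L v\<^esub>" using CL.hom_one CO.one_closed by (simp add: cauchy_ring_simps)
    then show False using cls_eq_zero[of "\<lambda>n. 1"] v_1 by (simp add: LIMSEQ_const_iff)
  qed
  then show ?thesis by simp
qed

end

subsection \<open>Valuation rings\<close>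

definition subrng :: "complex set \<Rightarrow> bool" where
  "subrng A \<longleftrightarrow> 1 \<in> A \<and> (\<forall>x\<in>A. \<forall>y\<in>A. x - y \<in> A \<and> x * y \<in> A)"

lemma subrngD:
  assumes "subrng A"
  shows "1 \<in> A" "0 \<in> A" "x \<in> A \<Longrightarrow> y \<in> A \<Longrightarrow> x - y \<in> A" "x \<in> A \<Longrightarrow> y \<in> A \<Longrightarrow> x * y \<in> A"
    "x \<in> A \<Longrightarrow> - x \<in> A" "x \<in> A \<Longrightarrow> y \<in> A \<Longrightarrow> x + y \<in> A" "x \<in> A \<Longrightarrow> x ^ n \<in> A"
proof -
  show 1: "1 \<in> A" and d: "x \<in> A \<Longrightarrow> y \<in> A \<Longrightarrow> x - y \<in> A" and m: "x \<in> A \<Longrightarrow> y \<in> A \<Longrightarrow> x * y \<in> A" for x y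
    using assms by (auto simp: subrng_def)
  show 0: "0 \<in> A" using d[OF 1 1] by simp
  show n: "x \<in> A \<Longrightarrow> - x \<in> A" for x using d[OF 0] by simp
  show "x \<in> A \<Longrightarrow> y \<in> A \<Longrightarrow> x + y \<in> A" using d[of x "- y"] n by simp
  show "x \<in> A \<Longrightarrow> x ^ n \<in> A" by (induction n) (simp_all add: 1 m)
qed

lemma subrng_sum: "subrng A \<Longrightarrow> (\<And>i. i \<in> S \<Longrightarrow> g i \<in> A) \<Longrightarrow> sum g S \<in> A"
  by (induction S rule: infinite_finite_induct) (simp_all add: subrngD)

lemma subrng_of_int: assumes "subrng A" shows "of_int m \<in> A"
proof -
  have "of_nat n \<in> A" for n by (induction n) (simp_all add: subrngD[OF assms])
  then have "of_int (int n) \<in> A" for n by simp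
  then show ?thesis using subrngD(5)[OF assms] by (cases m rule: int_cases2) auto
qed

definition poly_ext :: "complex set \<Rightarrow> complex \<Rightarrow> complex set" where
  "poly_ext A x = {poly P x |P. \<forall>i. Polynomial.coeff P i \<in> A}"

lemma subrng_poly: "subrng A \<Longrightarrow> (\<And>i. Polynomial.coeff P i \<in> A) \<Longrightarrow> x \<in> A \<Longrightarrow> poly P x \<in> A"
  unfolding poly_altdef by (intro subrng_sum subrngD(4,7))

lemma subrng_poly_ext:
  assumes A: "subrng A" shows "subrng (poly_ext A x)" "A \<subseteq> poly_ext A x" "x \<in> poly_ext A x"
proof -
  have c: "\<forall>i. Polynomial.coeff [:c:] i \<in> A" if "c \<in> A" for c
    using that subrngD(2)[OF A] by (auto simp: coeff_pCons split: nat.split)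
  show "A \<subseteq> poly_ext A x"
  proof
    fix a assume "a \<in> A"
    then show "a \<in> poly_ext A x" unfolding poly_ext_def using c by (intro CollectI exI[of _ "[:a:]"]) simp
  qed
  then have "1 \<in> poly_ext A x" using subrngD(1)[OF A] by blast
  moreover have "y - z \<in> poly_ext A x \<and> y * z \<in> poly_ext A x" if "y \<in> poly_ext A x" "z \<in> poly_ext A x" for y z
  proof -
    obtain P Q where PQ: "y = poly P x" "z = poly Q x" "\<And>i. Polynomial.coeff P i \<in> A" "\<And>i. Polynomial.coeff Q i \<in> A"
      using \<open>y \<in> _\<close> \<open>z \<in> _\<close> by (auto simp: poly_ext_def)
    have "y - z = poly (P - Q) x" "\<forall>i. Polynomial.coeff (P - Q) i \<in> A"
      using PQ subrngD(3)[OF A] by simp_all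
    moreover have "y * z = poly (P * Q) x" "\<forall>i. Polynomial.coeff (P * Q) i \<in> A"
      using PQ by (simp_all add: coeff_mult subrng_sum[OF A] subrngD(4)[OF A])
    ultimately show ?thesis unfolding poly_ext_def by blast
  qed
  ultimately show "subrng (poly_ext A x)" by (simp add: subrng_def)
  show "x \<in> poly_ext A x"
    unfolding poly_ext_def using subrngD(1,2)[OF A]
    by (intro CollectI exI[of _ "[:0, 1:]"]) (auto simp: coeff_pCons split: nat.split)
qed

lemma subfld_subrng: "subfld L \<Longrightarrow> subrng L"
  by (simp add: subfld_def subrng_def)

lemma poly_ext_sub:
  assumes "subrng L" "A \<subseteq> L" "x \<in> L" shows "poly_ext A x \<subseteq> L"
  using assms by (auto simp: poly_ext_def intro!: subrng_poly)

text \<open>Chevalley's construction of a place: \<open>V\<close> will turn out to be a valuation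
  ring at which \<open>\<alpha>\<close> has a pole.\<close>

locale maximal_subring =
  fixes L V :: "complex set" and \<alpha> :: complex
  assumes subfld_L: "subfld L" and VL: "V \<subseteq> L" and subrng_V: "subrng V"
    and inv_in: "inverse \<alpha> \<in> V" and notin: "\<alpha> \<notin> V" and \<alpha>L: "\<alpha> \<in> L"
    and maximal: "\<And>W. W \<subseteq> L \<Longrightarrow> subrng W \<Longrightarrow> V \<subseteq> W \<Longrightarrow> \<alpha> \<notin> W \<Longrightarrow> W = V"
begin

lemmas Vc = subrngD[OF subrng_V]
lemmas Lc = subfldD[OF subfld_L]

abbreviation \<beta> :: complex where "\<beta> \<equiv> inverse \<alpha>"

lemma \<alpha>0: "\<alpha> \<noteq> 0" using notin Vc(2) by auto

lemma ext_mem: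
  assumes x: "x \<in> L" "x \<notin> V"
  obtains P where "\<And>i. Polynomial.coeff P i \<in> V" "\<alpha> = poly P x"
proof -
  have "\<alpha> \<in> poly_ext V x"
  proof (rule ccontr)
    assume "\<alpha> \<notin> poly_ext V x"
    then have "poly_ext V x = V"
      by (intro maximal poly_ext_sub subfld_subrng subfld_L VL x subrng_poly_ext subrng_V)
    then show False using subrng_poly_ext(3)[OF subrng_V, of x] x by simp
  qed
  then show ?thesis using that by (auto simp: poly_ext_def)
qed

text \<open>If \<open>u = 1 - \<beta> * a\<close> had no inverse in \<open>V\<close>, maximality
  would make \<open>\<alpha>\<close> a polynomial in \<open>inverse u\<close>. Multiplying by
  \<open>u ^ n\<close>, which is again of the form \<open>1 - \<beta> * a'\<close>, would put
  \<open>\<alpha> - a'\<close> and hence \<open>\<alpha>\<close> into \<open>V\<close>.\<close>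

lemma one_plus_unit:
  assumes a: "a \<in> V" shows "inverse (1 - \<beta> * a) \<in> V" "1 - \<beta> * a \<noteq> 0"
proof -
  define u where "u = 1 - \<beta> * a"
  have uV: "u \<in> V" unfolding u_def by (intro Vc inv_in a)
  have u0: "u \<noteq> 0"
  proof
    assume "u = 0"
    then have "a = \<alpha>" using \<alpha>0 by (simp add: u_def field_simps)
    then show False using a notin by simp
  qed
  have pw: "\<exists>a'\<in>V. u ^ n = 1 - \<beta> * a'" for n
  proof (induction n)
    case 0
    show ?case by (rule bexI[OF _ Vc(2)]) simp
  next
    case (Suc n)
    then obtain a' where a': "a' \<in> V" "u ^ n = 1 - \<beta> * a'" by blast
    have "u ^ Suc n = 1 - \<beta> * (a' + a - \<beta> * a * a')"
      by (simp add: a'(2)) (simp add: u_def algebra_simps)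
    then show ?case by (rule bexI) (intro Vc inv_in a a'(1))
  qed
  show "inverse (1 - \<beta> * a) \<in> V"
  proof (rule ccontr)
    assume "inverse (1 - \<beta> * a) \<notin> V"
    then obtain P where P: "\<And>i. Polynomial.coeff P i \<in> V" "\<alpha> = poly P (inverse u)"
      using ext_mem[of "inverse u"] Lc(5)[OF subsetD[OF VL uV]] by (auto simp: u_def)
    define n where "n = Polynomial.degree P"
    obtain a' where a': "a' \<in> V" "u ^ n = 1 - \<beta> * a'" using pw by blast
    have "u ^ n * \<alpha> = poly (reflect_poly P) u"
      unfolding n_def using poly_reflect_poly_nz[OF u0, of P] P(2) by simp
    moreover have "poly (reflect_poly P) u \<in> V"
      using P(1) Vc(2) by (intro subrng_poly[OF subrng_V] uV) (simp add: coeff_reflect_poly)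
    ultimately have "u ^ n * \<alpha> + a' \<in> V" using Vc(6) a'(1) by simp
    moreover have "u ^ n * \<alpha> + a' = \<alpha>" using \<alpha>0 by (simp add: a'(2) algebra_simps)
    ultimately show False using notin by simp
  qed
  show "1 - \<beta> * a \<noteq> 0" using u0 by (simp add: u_def)
qed

text \<open>A certificate of degree \<open>n\<close> that \<open>\<beta>\<close> generates the unit
  ideal of \<open>V\<close> with \<open>x\<close> adjoined.\<close>

definition rel :: "nat \<Rightarrow> complex \<Rightarrow> bool" where
  "rel n x \<longleftrightarrow> (\<exists>g. (\<forall>i. g i \<in> V) \<and> 1 = (\<Sum>i\<le>n. \<beta> * g i * x ^ i))"

lemma rel_exists:
  assumes "x \<in> L" "x \<notin> V" shows "\<exists>n. rel n x"
proof -
  obtain P where P: "\<And>i. Polynomial.coeff P i \<in> V" "\<alpha> = poly P x" using ext_mem[OF assms] by blast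
  have "1 = \<beta> * poly P x" using P(2) \<alpha>0 by simp
  also have "\<dots> = (\<Sum>i\<le>Polynomial.degree P. \<beta> * Polynomial.coeff P i * x ^ i)"
    by (simp add: poly_altdef sum_distrib_left mult.assoc)
  finally show ?thesis unfolding rel_def using P(1) by blast
qed

text \<open>In the relation for \<open>inverse x\<close> the constant part
  \<open>1 - \<beta> * h' 0\<close> is a unit of \<open>V\<close>. Multiplied by
  \<open>x ^ n\<close>, the relation therefore writes \<open>x ^ n\<close> through lower powers, and
  substitution shortens the relation for \<open>x\<close>.\<close>

lemma rel_descent:
  assumes n: "rel n x" and m: "rel m (inverse x)" and mn: "m \<le> n" and x: "x \<noteq> 0"
  shows "\<exists>n'<n. rel n' x"
proof -
  obtain g where g: "\<And>i. g i \<in> V" "1 = (\<Sum>i\<le>n. \<beta> * g i * x ^ i)" using n by (auto simp: rel_def)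
  obtain h where h: "\<And>i. h i \<in> V" "1 = (\<Sum>i\<le>m. \<beta> * h i * inverse x ^ i)" using m by (auto simp: rel_def)
  have n0: "n > 0"
  proof (rule ccontr)
    assume "\<not> n > 0"
    then have "1 = \<beta> * g 0" using g(2) by simp
    then have "\<alpha> = g 0" using \<alpha>0 by (simp add: field_simps)
    then show False using g(1) notin by metis
  qed
  then obtain k where k: "n = Suc k" by (cases n) auto
  define h' where "h' i = (if i \<le> m then h i else 0)" for i
  have h': "h' i \<in> V" for i using h(1) Vc(2) by (simp add: h'_def)
  have "(\<Sum>i\<le>m. \<beta> * h i * inverse x ^ i) = (\<Sum>i\<le>n. \<beta> * h' i * inverse x ^ i)"
    using mn by (intro sum.mono_neutral_cong_left) (auto simp: h'_def)
  then have "1 = \<beta> * h' 0 + (\<Sum>i\<le>k. \<beta> * h' (Suc i) * inverse x ^ Suc i)"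
    using h(2) unfolding k sum.atMost_Suc_shift by simp
  then have "1 - \<beta> * h' 0 = (\<Sum>i\<le>k. \<beta> * h' (Suc i) * inverse x ^ Suc i)" by (simp add: algebra_simps)
  moreover define w where "w = inverse (1 - \<beta> * h' 0)"
  have wV: "w \<in> V" and w: "w * (1 - \<beta> * h' 0) = 1" using one_plus_unit[OF h'[of 0]] by (simp_all add: w_def)
  ultimately have "x ^ n = w * (\<Sum>i\<le>k. \<beta> * h' (Suc i) * inverse x ^ Suc i) * x ^ n" by simp
  also have "\<dots> = (\<Sum>i\<le>k. w * (\<beta> * h' (Suc i)) * (inverse x ^ Suc i * x ^ n))"
    by (simp only: sum_distrib_left sum_distrib_right mult.assoc)
  also have "\<dots> = (\<Sum>i\<le>k. w * (\<beta> * h' (Suc i)) * x ^ (k - i))"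
  proof (rule sum.cong[OF refl])
    fix i assume i: "i \<in> {..k}"
    have "x ^ n = x ^ Suc i * x ^ (k - i)" using i by (simp add: k flip: power_add power_Suc)
    moreover have "inverse x ^ Suc i * x ^ Suc i = 1"
      using x by (simp add: power_mult_distrib[symmetric] del: power_Suc)
    ultimately have "inverse x ^ Suc i * x ^ n = x ^ (k - i)" by (simp only: mult.assoc[symmetric] mult_1)
    then show "w * (\<beta> * h' (Suc i)) * (inverse x ^ Suc i * x ^ n) = w * (\<beta> * h' (Suc i)) * x ^ (k - i)" by simp
  qed
  also have "\<dots> = (\<Sum>i\<le>k. w * (\<beta> * h' (Suc (k - i))) * x ^ (k - (k - i)))"
    using sum.nat_diff_reindex[of "\<lambda>i. w * (\<beta> * h' (Suc (k - i))) * x ^ (k - (k - i))" "Suc k"]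
      sum.nat_diff_reindex[of "\<lambda>i. w * (\<beta> * h' (Suc i)) * x ^ (k - i)" "Suc k"]
    by (simp add: lessThan_Suc_atMost)
  also have "\<dots> = (\<Sum>i\<le>k. w * (\<beta> * h' (Suc (k - i))) * x ^ i)" by (rule sum.cong) simp_all
  finally have xn: "x ^ n = (\<Sum>i\<le>k. w * (\<beta> * h' (Suc (k - i))) * x ^ i)" .
  have "1 = (\<Sum>i\<le>k. \<beta> * g i * x ^ i) + \<beta> * g n * x ^ n" using g(2) by (simp add: k)
  also have "\<beta> * g n * x ^ n = (\<Sum>i\<le>k. \<beta> * g n * (w * (\<beta> * h' (Suc (k - i))) * x ^ i))"
    unfolding xn by (rule sum_distrib_left)
  also have "(\<Sum>i\<le>k. \<beta> * g i * x ^ i) + \<dots> = (\<Sum>i\<le>k. \<beta> * (g i + \<beta> * (g n * (w * h' (Suc (k - i))))) * x ^ i)"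
    by (simp add: sum.distrib[symmetric] algebra_simps)
  finally have "rel k x"
    unfolding rel_def by (intro exI[of _ "\<lambda>i. g i + \<beta> * (g n * (w * h' (Suc (k - i))))"] conjI allI Vc inv_in g(1) wV h')
  then show ?thesis using k by blast
qed

lemma not_rel_both: "x \<noteq> 0 \<Longrightarrow> rel n x \<Longrightarrow> \<not> rel m (inverse x)"
proof (induction "n + m" arbitrary: n m x rule: less_induct)
  case less
  show ?case
  proof
    assume m: "rel m (inverse x)"
    show False
    proof (cases "m \<le> n")
      case True
      then obtain n' where "n' < n" "rel n' x" using rel_descent less.prems m by blast
      then show False using less.hyps[of n' m x] less.prems m by simp
    next
      case False
      then obtain m' where "m' < m" "rel m' (inverse x)"
        using rel_descent[of m "inverse x" n] less.prems m by auto
      then show False using less.hyps[of n m' x] less.prems by simp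
    qed
  qed
qed

lemma total: assumes "x \<in> L" "x \<notin> V" shows "inverse x \<in> V"
proof (rule ccontr)
  assume "inverse x \<notin> V"
  then obtain m where "rel m (inverse x)" using rel_exists[OF Lc(5)[OF assms(1)]] by blast
  moreover obtain n where "rel n x" using rel_exists[OF assms] by blast
  moreover have "x \<noteq> 0" using assms Vc(2) by auto
  ultimately show False using not_rel_both by blast
qed

end

text \<open>Zorn's lemma above the integers with \<open>inverse \<alpha>\<close> adjoined. That ring
  omits \<open>\<alpha>\<close>, as an integer polynomial in \<open>inverse \<alpha>\<close> with
  value \<open>\<alpha>\<close> would give a monic integer equation for
  \<open>\<alpha>\<close>.\<close>

lemma maximal_subring_exists:
  assumes L: "subfld L" and \<alpha>: "\<alpha> \<in> L" "\<not> algebraic_int \<alpha>"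
  shows "\<exists>V. maximal_subring L V \<alpha>"
proof -
  define \<A> where "\<A> = {A. A \<subseteq> L \<and> subrng A \<and> inverse \<alpha> \<in> A \<and> \<alpha> \<notin> A}"
  have \<alpha>0: "\<alpha> \<noteq> 0" using \<alpha>(2) by auto
  have Z: "subrng \<int>" by (simp add: subrng_def)
  have ZL: "\<int> \<subseteq> L" using subfld_of_int[OF L] by (auto elim: Ints_cases)
  have "poly_ext \<int> (inverse \<alpha>) \<in> \<A>"
  proof -
    have "\<alpha> \<notin> poly_ext \<int> (inverse \<alpha>)"
    proof
      assume "\<alpha> \<in> poly_ext \<int> (inverse \<alpha>)"
      then obtain P where P: "\<alpha> = poly P (inverse \<alpha>)" "\<And>i. Polynomial.coeff P i \<in> \<int>" by (auto simp: poly_ext_def)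
      \<comment> \<open>\<open>R\<close> vanishes at \<open>inverse \<alpha>\<close> and has
        constant term \<open>-1\<close>; its negated reflection is monic and vanishes at
        \<open>\<alpha>\<close>.\<close>
      define R where "R = pCons (- 1) P"
      have R0: "Polynomial.coeff R 0 = - 1" by (simp add: R_def)
      have "poly R (inverse \<alpha>) = - 1 + inverse \<alpha> * poly P (inverse \<alpha>)" by (simp add: R_def)
      then have "poly R (inverse \<alpha>) = 0" using P(1) \<alpha>0 by simp
      then have "poly (- reflect_poly R) \<alpha> = 0" using poly_reflect_poly_nz[OF \<alpha>0, of R] by simp
      moreover have "lead_coeff (- reflect_poly R) = 1"
        using R0 by (simp add: coeff_reflect_poly)
      moreover have "Polynomial.coeff R i \<in> \<int>" for i using P(2) by (cases i) (simp_all add: R_def)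
      then have "Polynomial.coeff (- reflect_poly R) i \<in> \<int>" for i by (simp add: coeff_reflect_poly)
      ultimately have "algebraic_int \<alpha>" by (intro algebraic_int.intros[of "- reflect_poly R"]) auto
      then show False using \<alpha>(2) by simp
    qed
    then show ?thesis
      unfolding \<A>_def using subrng_poly_ext[OF Z] poly_ext_sub[OF subfld_subrng[OF L] ZL subfldD(5)[OF L \<alpha>(1)]] by simp
  qed
  then have ne: "\<A> \<noteq> {}" by blast
  have "\<exists>V\<in>\<A>. \<forall>W\<in>\<A>. V \<subseteq> W \<longrightarrow> W = V"
  proof (rule subset_Zorn_nonempty[OF ne])
    fix C assume C: "C \<noteq> {}" "subset.chain \<A> C"
    have CA: "A \<in> \<A>" if "A \<in> C" for A using C(2) that by (auto simp: subset.chain_def)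
    have Cc: "A \<subseteq> B \<or> B \<subseteq> A" if "A \<in> C" "B \<in> C" for A B using C(2) that by (auto simp: subset_chain_def)
    have "x - y \<in> \<Union>C \<and> x * y \<in> \<Union>C" if xy: "x \<in> \<Union>C" "y \<in> \<Union>C" for x y
    proof -
      obtain A B where AB: "A \<in> C" "x \<in> A" "B \<in> C" "y \<in> B" using xy by blast
      then obtain D where D: "D \<in> C" "x \<in> D" "y \<in> D" using Cc[of A B] by blast
      then have "subrng D" using CA by (simp add: \<A>_def)
      then have "x - y \<in> D" "x * y \<in> D" using D subrngD by simp_all
      then show ?thesis using D(1) by blast
    qed
    moreover obtain A where "A \<in> C" using C(1) by blast
    then have "1 \<in> \<Union>C" "inverse \<alpha> \<in> \<Union>C" using CA[of A] subrngD(1) by (auto simp: \<A>_def)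
    ultimately have "subrng (\<Union>C)" "inverse \<alpha> \<in> \<Union>C" unfolding subrng_def by blast+
    moreover have "A \<subseteq> L" "\<alpha> \<notin> A" if "A \<in> C" for A using CA[OF that] by (simp_all add: \<A>_def)
    then have "\<Union>C \<subseteq> L" "\<alpha> \<notin> \<Union>C" by blast+
    ultimately show "\<Union>C \<in> \<A>" by (simp add: \<A>_def)
  qed
  then obtain V where V: "V \<in> \<A>" "\<And>W. W \<in> \<A> \<Longrightarrow> V \<subseteq> W \<Longrightarrow> W = V" by blast
  have "maximal_subring L V \<alpha>"
  proof
    fix W assume "W \<subseteq> L" "subrng W" "V \<subseteq> W" "\<alpha> \<notin> W"
    then show "W = V" using V by (intro V(2)) (auto simp: \<A>_def)
  qed (use V(1) L \<alpha> in \<open>auto simp: \<A>_def\<close>)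
  then show ?thesis by blast
qed

section \<open>The absolute value of a valuation ring above \<open>p\<close>\<close>

locale valuation_ring =
  fixes L V :: "complex set"
  assumes subfld_L: "subfld L" and VL: "V \<subseteq> L" and subrng_V: "subrng V"
    and total: "\<And>x. x \<in> L \<Longrightarrow> x \<notin> V \<Longrightarrow> inverse x \<in> V"
begin

lemmas Vc = subrngD[OF subrng_V]
lemmas Lc = subfldD[OF subfld_L]

definition "U = {x. x \<noteq> 0 \<and> x \<in> V \<and> inverse x \<in> V}"

lemma U_1: "1 \<in> U" by (simp add: U_def Vc)
lemma U_mult: "x \<in> U \<Longrightarrow> y \<in> U \<Longrightarrow> x * y \<in> U" by (simp add: U_def Vc)
lemma U_inverse: "x \<in> U \<Longrightarrow> inverse x \<in> U" by (simp add: U_def)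
lemma U_divide: "x \<in> U \<Longrightarrow> y \<in> U \<Longrightarrow> x / y \<in> U" using U_mult U_inverse by (simp add: divide_inverse)
lemma U_power: "x \<in> U \<Longrightarrow> x ^ n \<in> U" by (induction n) (simp_all add: U_1 U_mult)
lemma U_minus: "x \<in> U \<Longrightarrow> - x \<in> U" by (simp add: U_def Vc)

lemma V_powI:
  assumes x: "x \<in> L" "x ^ n \<in> V" "n > 0" shows "x \<in> V"
proof (rule ccontr)
  assume nx: "x \<notin> V"
  then have x0: "x \<noteq> 0" using Vc(2) by auto
  obtain k where k: "n = Suc k" using x(3) by (cases n) auto
  have "x ^ n * inverse x ^ k \<in> V" by (rule Vc(4)[OF x(2) Vc(7)[OF total[OF x(1) nx]]])
  moreover have "x ^ n * inverse x ^ k = x" using x0 by (simp add: k power_inverse)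
  ultimately show False using nx by simp
qed

text \<open>One of \<open>x / y\<close> and \<open>y / x\<close> lies in \<open>V\<close>; if
  \<open>x + y\<close> were a unit, the denominator of that quotient would be one too.\<close>

lemma nonunit_add:
  assumes x: "x \<in> V" "x \<notin> U" and y: "y \<in> V" "y \<notin> U" shows "x + y \<notin> U"
proof
  assume s: "x + y \<in> U"
  have aux: False if y: "y \<in> V" "y \<notin> U" "y \<noteq> 0" and q: "x / y \<in> V" and s: "x + y \<in> U" for x y
  proof -
    have "(1 + x / y) * inverse (x + y) \<in> V" using s q by (intro Vc) (simp_all add: U_def)
    moreover have "(1 + x / y) * inverse (x + y) = inverse y"
    proof -
      have "1 + x / y = (x + y) / y" using y(3) by (simp add: field_simps)
      moreover have "x + y \<noteq> 0" using s by (simp add: U_def)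
      ultimately show ?thesis by (simp add: field_simps)
    qed
    ultimately show False using y by (simp add: U_def)
  qed
  have x0: "x \<noteq> 0" using s y by auto
  have y0: "y \<noteq> 0" using s x by auto
  show False
  proof (cases "x / y \<in> V")
    case True
    then show ?thesis using aux y y0 s by blast
  next
    case False
    moreover have "x / y \<in> L" by (rule Lc(8)[OF subsetD[OF VL x(1)] subsetD[OF VL y(1)]])
    ultimately have "y / x \<in> V" using total[of "x / y"] by simp
    then show ?thesis using aux[of x y] x x0 s by (simp add: add.commute)
  qed
qed

lemma nonunit_mult: "x \<in> V \<Longrightarrow> a \<in> V \<Longrightarrow> x \<notin> U \<Longrightarrow> a * x \<notin> U"
proof
  assume x: "x \<in> V" "a \<in> V" "x \<notin> U" "a * x \<in> U"
  have "inverse (a * x) \<in> V" using x(4) unfolding U_def by blast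
  then have "a * inverse (a * x) \<in> V" by (rule Vc(4)[OF x(2)])
  moreover have "a \<noteq> 0" "x \<noteq> 0" using x by (auto simp: U_def)
  moreover from this have "a * inverse (a * x) = inverse x" by (simp add: field_simps)
  ultimately have "inverse x \<in> V" by (simp only:)
  then show False using x \<open>x \<noteq> 0\<close> by (simp add: U_def)
qed

lemma nonunit_sum:
  "finite A \<Longrightarrow> (\<And>i. i \<in> A \<Longrightarrow> g i \<in> V) \<Longrightarrow> (\<And>i. i \<in> A \<Longrightarrow> g i \<notin> U) \<Longrightarrow> sum g A \<notin> U"
proof (induction A rule: finite_induct)
  case (insert i A)
  have "g i + sum g A \<notin> U"
    using insert by (intro nonunit_add subrng_sum[OF subrng_V]) auto
  then show ?case using insert.hyps by simp
qed (simp add: U_def)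

lemma dominant_exists:
  "finite A \<Longrightarrow> A \<noteq> {} \<Longrightarrow> (\<And>i. i \<in> A \<Longrightarrow> t i \<in> L) \<Longrightarrow> (\<And>i. i \<in> A \<Longrightarrow> t i \<noteq> 0) \<Longrightarrow>
    \<exists>k\<in>A. \<forall>i\<in>A. t i / t k \<in> V"
proof (induction A rule: finite_ne_induct)
  case (singleton i)
  then show ?case using Vc(1) by simp
next
  case (insert j A)
  obtain k where k: "k \<in> A" "\<And>i. i \<in> A \<Longrightarrow> t i / t k \<in> V" using insert.IH insert.prems by auto
  show ?case
  proof (cases "t j / t k \<in> V")
    case True
    then show ?thesis using k by blast
  next
    case False
    have "t j / t k \<in> L" using insert.prems k(1) by (intro Lc) auto
    then have kj: "t k / t j \<in> V" using total False by fastforce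
    have "t i / t j \<in> V" if "i \<in> A" for i
    proof -
      have "t k \<noteq> 0" using insert.prems k(1) by blast
      then have "t i / t j = (t i / t k) * (t k / t j)" by simp
      then show ?thesis using Vc(4)[OF k(2)[OF that] kj] by (simp only:)
    qed
    moreover have "t j / t j \<in> V" using insert.prems Vc(1) by simp
    ultimately show ?thesis by blast
  qed
qed

text \<open>Otherwise \<open>V\<close> contains all rationals, and the equation of
  \<open>\<alpha>\<close>, divided by a power of \<open>\<alpha>\<close>, expresses
  \<open>\<alpha>\<close> through \<open>inverse \<alpha>\<close> inside \<open>V\<close>.\<close>

lemma nonunit_prime:
  assumes \<alpha>: "\<alpha> \<in> L" "\<alpha> \<notin> V" "algebraic \<alpha>"
  shows "\<exists>p. Factorial_Ring.prime p \<and> inverse (of_nat p) \<notin> V"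
proof (rule ccontr)
  assume "\<not> ?thesis"
  then have pr: "inverse (of_nat p) \<in> V" if "Factorial_Ring.prime p" for p using that by blast
  have inv: "inverse (of_nat m) \<in> V" if "m > 0" for m :: nat
    using that
  proof (induction m rule: prime_divisors_induct)
    case (factor p m)
    then have "inverse (of_nat p) * inverse (of_nat m) \<in> V" using pr by (intro Vc) auto
    then show ?case by (simp add: mult.commute)
  qed (use Vc in auto)
  have rat: "of_rat q \<in> V" for q
  proof -
    obtain a b where q: "q = Rat.Fract a b" "b > 0" by (cases q) auto
    have "of_int a * inverse (of_nat (nat b)) \<in> V" using q(2) by (intro Vc subrng_of_int[OF subrng_V] inv) simp
    then show ?thesis using q by (simp add: of_rat_rat divide_inverse)
  qed
  obtain h where h: "h \<noteq> 0" "rp h \<alpha> = 0" using \<alpha>(3) by (auto simp: algebraic_iff_rp)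
  define n where "n = Polynomial.degree h"
  define c where "c = Polynomial.coeff h"
  have cn: "c n \<noteq> 0" using h(1) by (simp add: c_def n_def)
  have "n \<noteq> 0" using h rp_degree_0[of h \<alpha>] by (auto simp: n_def)
  then obtain k where k: "n = Suc k" by (cases n) auto
  have \<alpha>0: "\<alpha> \<noteq> 0" using \<alpha>(2) Vc(2) by auto
  have "rp h \<alpha> = (\<Sum>i\<le>n. of_rat (c i) * \<alpha> ^ i)"
    by (simp add: rp_def poly_altdef coeff_map_poly n_def c_def)
  then have "0 = (\<Sum>i\<le>k. of_rat (c i) * \<alpha> ^ i) + of_rat (c n) * \<alpha> ^ n" using h(2) by (simp add: k)
  then have "0 = inverse \<alpha> ^ k * ((\<Sum>i\<le>k. of_rat (c i) * \<alpha> ^ i) + of_rat (c n) * \<alpha> ^ n)" by simp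
  also have "\<dots> = (\<Sum>i\<le>k. of_rat (c i) * (inverse \<alpha> ^ k * \<alpha> ^ i)) + of_rat (c n) * (inverse \<alpha> ^ k * \<alpha> ^ n)"
    by (simp add: distrib_left sum_distrib_left mult_ac)
  also have "(\<Sum>i\<le>k. of_rat (c i) * (inverse \<alpha> ^ k * \<alpha> ^ i)) = (\<Sum>i\<le>k. of_rat (c i) * inverse \<alpha> ^ (k - i))"
  proof (rule sum.cong[OF refl])
    fix i assume "i \<in> {..k}"
    then have "inverse \<alpha> ^ k = inverse \<alpha> ^ (k - i) * inverse \<alpha> ^ i" by (simp flip: power_add)
    then show "of_rat (c i) * (inverse \<alpha> ^ k * \<alpha> ^ i) = of_rat (c i) * inverse \<alpha> ^ (k - i)"
      using \<alpha>0 by (simp add: power_inverse)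
  qed
  also have "inverse \<alpha> ^ k * \<alpha> ^ n = \<alpha>" using \<alpha>0 by (simp add: k power_inverse)
  finally have e: "of_rat (c n) * \<alpha> = - (\<Sum>i\<le>k. of_rat (c i) * inverse \<alpha> ^ (k - i))"
    by (simp add: eq_neg_iff_add_eq_0 add.commute)
  have "of_rat (inverse (c n)) * (of_rat (c n) * \<alpha>) \<in> V"
    unfolding e using total[OF \<alpha>(1,2)] by (intro Vc(4,5,7) subrng_sum[OF subrng_V] rat)
  moreover have "of_rat (inverse (c n)) * (of_rat (c n) * \<alpha>) = \<alpha>" using cn by (simp add: of_rat_inverse)
  ultimately have "\<alpha> \<in> V" by (simp only:)
  then show False using \<alpha>(2) by simp
qed

end

locale padic_ring = valuation_ring +
  fixes p :: nat
  assumes p: "Factorial_Ring.prime p" and p_nonunit: "inverse (of_nat p) \<notin> V"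
    and alg: "\<And>x. x \<in> L \<Longrightarrow> algebraic x"
begin

lemma p0: "(of_nat p :: complex) \<noteq> 0" using prime_gt_0_nat[OF p] by simp

lemma pL: "of_nat p \<in> L" by (rule subfld_of_nat[OF subfld_L])

lemma U_of_int:
  assumes "\<not> int p dvd m" shows "of_int m \<in> U"
proof (rule ccontr)
  assume mU: "of_int m \<notin> U"
  have "coprime (int p) m" using assms p by (intro prime_imp_coprime) simp_all
  then obtain u w where uw: "u * int p + w * m = 1" using bezout_int[of "int p" m] by auto
  have V: "of_int k \<in> V" for k by (rule subrng_of_int[OF subrng_V])
  have "of_int (int p) \<notin> U" using p_nonunit by (simp add: U_def)
  then have "of_int u * of_int (int p) + of_int w * of_int m \<notin> U"
    using mU by (intro nonunit_add nonunit_mult V Vc(4))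
  moreover have "of_int u * of_int (int p) + of_int w * of_int m = (of_int (u * int p + w * m) :: complex)"
    by (simp only: of_int_add of_int_mult)
  ultimately show False using U_1 uw by simp
qed

lemma p_powi_V: "of_nat p powi k \<in> V \<Longrightarrow> k \<ge> 0"
proof (rule ccontr)
  assume h: "of_nat p powi k \<in> V" "\<not> k \<ge> 0"
  then have "inverse (of_nat p) ^ nat (- k) \<in> V" by (simp add: power_int_def)
  from V_powI[OF Lc(5)[OF pL] this] h(2) have "inverse (of_nat p) \<in> V" by simp
  then show False using p_nonunit by simp
qed

lemma p_powi_V_iff: "of_nat p powi k \<in> V \<longleftrightarrow> k \<ge> 0"
proof
  assume "k \<ge> 0"
  then have "(of_nat p :: complex) powi k = of_int (int p ^ nat k)" by (simp add: power_int_def)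
  then show "of_nat p powi k \<in> V" by (simp only: subrng_of_int[OF subrng_V])
qed (rule p_powi_V)

text \<open>Says that \<open>x\<close> has valuation \<open>j / n\<close>, normalised by valuation
  \<open>1\<close> for \<open>p\<close>, without introducing a value group.\<close>

definition pv :: "complex \<Rightarrow> nat \<Rightarrow> int \<Rightarrow> bool" where
  "pv x n j \<longleftrightarrow> n > 0 \<and> x \<noteq> 0 \<and> x ^ n / of_nat p powi j \<in> U"

text \<open>If the ratios differed, a nonzero power of \<open>p\<close> would be a unit of
  \<open>V\<close>.\<close>

lemma pv_unique:
  assumes "pv x n j" "pv x m k" shows "j * int m = k * int n"
proof -
  have x0: "x \<noteq> 0" using assms by (simp add: pv_def)
  define A where "A = x ^ n / of_nat p powi j"
  define B where "B = x ^ m / of_nat p powi k"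
  have AB: "A \<in> U" "B \<in> U" using assms by (simp_all add: pv_def A_def B_def)
  have Am: "A ^ m = x ^ (n * m) / of_nat p powi (j * int m)"
    by (simp add: A_def power_divide power_mult power_int_mult power_int_of_nat)
  have Bn: "B ^ n = x ^ (n * m) / of_nat p powi (k * int n)"
    by (simp add: B_def power_divide power_int_mult power_int_of_nat mult.commute[of n] flip: power_mult)
  have "A ^ m / B ^ n = of_nat p powi (k * int n - j * int m)"
    using x0 p0 by (simp add: Am Bn power_int_diff)
  moreover have "B ^ n / A ^ m = of_nat p powi (j * int m - k * int n)"
    using x0 p0 by (simp add: Am Bn power_int_diff)
  moreover have "A ^ m / B ^ n \<in> V" "B ^ n / A ^ m \<in> V"
    using U_divide[OF U_power[OF AB(1)] U_power[OF AB(2)]] U_divide[OF U_power[OF AB(2)] U_power[OF AB(1)]]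
    by (simp_all add: U_def)
  ultimately have "k * int n - j * int m \<ge> 0" "j * int m - k * int n \<ge> 0"
    using p_powi_V[of "k * int n - j * int m"] p_powi_V[of "j * int m - k * int n"] by (simp_all only:)
  then show ?thesis by simp
qed

lemma pv_mult:
  assumes "pv x n j" "pv y m k" shows "pv (x * y) (n * m) (j * int m + k * int n)"
proof -
  have "(x ^ n / of_nat p powi j) ^ m * (y ^ m / of_nat p powi k) ^ n \<in> U"
    using assms by (intro U_mult U_power) (simp_all add: pv_def)
  moreover have "(x ^ n / of_nat p powi j) ^ m * (y ^ m / of_nat p powi k) ^ n =
    (x * y) ^ (n * m) / of_nat p powi (j * int m + k * int n)"
    using p0 by (simp add: power_divide power_int_add power_int_mult power_int_of_nat power_mult_distrib
        mult.commute[of n m] flip: power_mult)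
  ultimately show ?thesis using assms by (simp add: pv_def)
qed

lemma pv_int:
  assumes "m \<noteq> 0" shows "pv (of_int m) 1 (int (multiplicity (int p) m))"
proof -
  obtain m' where m': "m = int p ^ multiplicity (int p) m * m'" "\<not> int p dvd m'"
    using multiplicity_decompose'[of m "int p"] assms prime_gt_1_nat[OF p] by auto
  have "of_int m / of_nat p ^ multiplicity (int p) m = (of_int m' :: complex)"
    by (subst m'(1)) (use p0 in simp)
  then show ?thesis using assms U_of_int[OF m'(2)] by (simp add: pv_def)
qed

lemma pv_inverse: "pv x n j \<Longrightarrow> pv (inverse x) n (- j)"
  using U_inverse[of "x ^ n / of_nat p powi j"]
  by (simp add: pv_def power_int_minus power_inverse field_simps)

lemma pv_rat: 
  assumes "q \<noteq> 0"
  shows "pv (of_rat q) 1 (int (multiplicity (int p) (fst (quotient_of q))) - int (multiplicity (int p) (snd (quotient_of q))))"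
proof -
  obtain a b where ab: "quotient_of q = (a, b)" by (cases "quotient_of q")
  have q: "q = of_int a / of_int b" by (rule quotient_of_div[OF ab])
  have b: "b \<noteq> 0" using quotient_of_denom_pos[OF ab] by simp
  have a: "a \<noteq> 0" using assms q by auto
  have "of_rat q = (of_int a * inverse (of_int b) :: complex)" 
    unfolding q of_rat_divide of_rat_of_int_eq by (rule divide_inverse)
  then show ?thesis using pv_mult[OF pv_int[OF a] pv_inverse[OF pv_int[OF b]]] by (simp add: ab)
qed

text \<open>In a vanishing sum of terms \<open>c i * x ^ i\<close> a dominant term cannot stand
  alone, so two terms have a unit quotient. It is a rational times \<open>x ^ (a - b)\<close>, hence
  the valuation of \<open>x\<close> has a denominator bounded by the degree.\<close>

lemma pv_exists:
  assumes x: "x \<in> L" "x \<noteq> 0" and h: "h \<noteq> 0" "rp h x = 0"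
  shows "\<exists>n j. pv x n j \<and> n \<le> Polynomial.degree h"
proof -
  define c where "c = Polynomial.coeff h"
  define I where "I = {i. i \<le> Polynomial.degree h \<and> c i \<noteq> 0}"
  define t where "t i = of_rat (c i) * x ^ i" for i
  have fI: "finite I" by (simp add: I_def)
  have neI: "I \<noteq> {}" using h(1) by (auto simp: I_def c_def intro!: exI[of _ "Polynomial.degree h"])
  have tL: "t i \<in> L" for i unfolding t_def by (intro Lc subfld_of_rat[OF subfld_L] x)
  have t0: "t i \<noteq> 0" if "i \<in> I" for i using that x by (simp add: t_def I_def)
  have "rp h x = (\<Sum>i\<le>Polynomial.degree h. t i)"
    by (simp add: rp_def poly_altdef coeff_map_poly t_def c_def)
  also have "\<dots> = sum t I" by (rule sum.mono_neutral_right) (auto simp: I_def t_def)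
  finally have s0: "sum t I = 0" using h(2) by simp
  have "\<exists>k\<in>I. \<forall>i\<in>I. t i / t k \<in> V" by (rule dominant_exists[OF fI neI tL t0])
  then obtain k where k: "k \<in> I" "\<And>i. i \<in> I \<Longrightarrow> t i / t k \<in> V" by blast
  \<comment> \<open>The other terms divided by \<open>t k\<close> sum to \<open>-1\<close>, and a
    sum of nonunits is not a unit.\<close>
  have "\<exists>i\<in>I - {k}. t i / t k \<in> U"
  proof (rule ccontr)
    assume "\<not> ?thesis"
    then have "(\<Sum>i\<in>I - {k}. t i / t k) \<notin> U" using fI k(2) by (intro nonunit_sum) auto
    moreover have "(\<Sum>i\<in>I - {k}. t i / t k) = - 1"
    proof -
      have "t k + (\<Sum>i\<in>I - {k}. t i) = 0" using s0 sum.remove[OF fI k(1), of t] by simp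
      then have "(\<Sum>i\<in>I - {k}. t i) = - t k" by (simp add: eq_neg_iff_add_eq_0 add.commute)
      then show ?thesis using t0[OF k(1)] by (simp flip: sum_divide_distrib)
    qed
    ultimately show False using U_minus[OF U_1] by simp
  qed
  then obtain i where i: "i \<in> I" "i \<noteq> k" "t i / t k \<in> U" by blast
  obtain a b where ab: "a \<in> I" "b \<in> I" "b < a" "t a / t b \<in> U"
  proof (cases "k < i")
    case True
    then show ?thesis using that i k by blast
  next
    case False
    then show ?thesis using that[of k i] i k(1) U_inverse[OF i(3)] by simp
  qed
  define q where "q = c a / c b"
  have q0: "q \<noteq> 0" using ab by (simp add: q_def I_def)
  obtain s where s: "pv (of_rat q) 1 s" using pv_rat[OF q0] by blast
  have "t a / t b = of_rat q * x ^ (a - b)"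
  proof -
    have "x ^ a = x ^ (a - b) * x ^ b" using ab(3) by (simp flip: power_add)
    then show ?thesis using x(2) ab by (simp add: t_def q_def of_rat_divide I_def)
  qed
  then have "of_rat q * x ^ (a - b) \<in> U" using ab(4) by (simp only:)
  moreover have "of_rat q / of_nat p powi s \<in> U" using s by (simp add: pv_def)
  ultimately have "of_rat q * x ^ (a - b) / (of_rat q / of_nat p powi s) \<in> U" by (rule U_divide)
  moreover have "of_rat q * x ^ (a - b) / (of_rat q / of_nat p powi s) = x ^ (a - b) / of_nat p powi (- s)"
    using q0 by (simp add: power_int_minus divide_inverse)
  ultimately have "pv x (a - b) (- s)" using ab(3) x by (simp add: pv_def)
  moreover have "a - b \<le> Polynomial.degree h" using ab(1) by (auto simp: I_def)
  ultimately show ?thesis by blast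
qed

definition vp :: "complex \<Rightarrow> real" where
  "vp x = (if x = 0 then 0 else real p powr - (SOME r. \<exists>n j. pv x n j \<and> r = real_of_int j / real n))"

lemma vp_eq: assumes "pv x n j" shows "vp x = real p powr - (real_of_int j / real n)"
proof -
  have "(SOME r. \<exists>n j. pv x n j \<and> r = real_of_int j / real n) = real_of_int j / real n"
  proof (rule some_equality)
    fix r assume "\<exists>n j. pv x n j \<and> r = real_of_int j / real n"
    then obtain m k where mk: "pv x m k" "r = real_of_int k / real m" by blast
    have "real_of_int (j * int m) = real_of_int (k * int n)" using pv_unique[OF assms mk(1)] by (simp only:)
    moreover have "real n \<noteq> 0" "real m \<noteq> 0" using assms mk(1) by (simp_all add: pv_def)
    ultimately show "r = real_of_int j / real n" by (simp add: mk(2) frac_eq_eq)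
  qed (use assms in blast)
  then show ?thesis using assms by (simp add: vp_def pv_def)
qed

lemma pv_ex: "x \<in> L \<Longrightarrow> x \<noteq> 0 \<Longrightarrow> \<exists>n j. pv x n j"
  using pv_exists alg algebraic_iff_rp by meson

lemma p_gt_1: "real p > 1" using prime_gt_1_nat[OF p] by simp

lemma vp_pos: "x \<in> L \<Longrightarrow> x \<noteq> 0 \<Longrightarrow> vp x > 0"
  using p_gt_1 by (simp add: vp_def)

lemma vp_mult: assumes "x \<in> L" "y \<in> L" shows "vp (x * y) = vp x * vp y"
proof (cases "x = 0 \<or> y = 0")
  case False
  then obtain n j m k where nj: "pv x n j" "pv y m k" using pv_ex assms by meson
  have nm: "n > 0" "m > 0" using nj by (simp_all add: pv_def)
  have "real_of_int (j * int m + k * int n) / real (n * m) = real_of_int j / real n + real_of_int k / real m"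
    unfolding of_int_add of_int_mult of_int_of_nat_eq of_nat_mult add_divide_distrib using nm by simp
  then show ?thesis unfolding vp_eq[OF pv_mult[OF nj]] vp_eq[OF nj(1)] vp_eq[OF nj(2)]
    by (simp only: powr_add[symmetric] minus_add_distrib)
qed (auto simp: vp_def)

lemma vp_le_1_iff: assumes x: "x \<in> L" shows "vp x \<le> 1 \<longleftrightarrow> x \<in> V"
proof (cases "x = 0")
  case False
  obtain n j where nj: "pv x n j" using pv_ex[OF x False] by blast
  have n: "n > 0" using nj by (simp add: pv_def)
  have u: "x ^ n / of_nat p powi j \<in> V" "of_nat p powi j / x ^ n \<in> V" using nj by (simp_all add: pv_def U_def)
  have pj: "(of_nat p :: complex) powi j \<noteq> 0" using p0 by simp
  have "vp x \<le> 1 \<longleftrightarrow> j \<ge> 0"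
  proof -
    have "vp x \<le> 1 \<longleftrightarrow> real p powr - (real_of_int j / real n) \<le> real p powr 0" using p_gt_1 by (simp add: vp_eq[OF nj])
    also have "\<dots> \<longleftrightarrow> real_of_int j / real n \<ge> 0" using p_gt_1 by (subst powr_le_cancel_iff) simp_all
    also have "\<dots> \<longleftrightarrow> j \<ge> 0" using n by (simp add: zero_le_divide_iff)
    finally show ?thesis .
  qed
  also have "\<dots> \<longleftrightarrow> x ^ n \<in> V"
  proof
    assume "j \<ge> 0"
    then have "(x ^ n / of_nat p powi j) * of_nat p powi j \<in> V" by (intro Vc(4)[OF u(1)] p_powi_V_iff[THEN iffD2])
    then show "x ^ n \<in> V" by (simp only: nonzero_eq_divide_eq[OF pj, THEN iffD1, OF refl])
  next
    assume "x ^ n \<in> V"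
    then have "(of_nat p powi j / x ^ n) * x ^ n \<in> V" by (rule Vc(4)[OF u(2)])
    then show "j \<ge> 0" using False p_powi_V by simp
  qed
  also have "\<dots> \<longleftrightarrow> x \<in> V" using V_powI[OF x _ n] Vc(7) by blast
  finally show ?thesis .
qed (simp add: vp_def Vc)

lemma vp_add_le: assumes x: "x \<in> L" and y: "y \<in> L" shows "vp (x + y) \<le> vp x + vp y"
proof -
  have nn: "vp z \<ge> 0" if "z \<in> L" for z using vp_pos[OF that] by (cases "z = 0") (simp_all add: vp_def)
  have aux: "vp (x + y) \<le> vp y" if x: "x \<in> L" and y: "y \<in> L" and le: "vp x \<le> vp y" for x y
  proof (cases "y = 0")
    case True
    then show ?thesis using le by simp
  next
    case False
    have q: "x / y \<in> L" using x y by (intro Lc)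
    have "vp x = vp (x / y) * vp y" using vp_mult[OF q y] False by simp
    then have "vp (x / y) \<le> 1" using le vp_pos[OF y False] by simp
    then have "1 + x / y \<in> V" using vp_le_1_iff[OF q] Vc(1,6) by blast
    then have "vp (1 + x / y) \<le> 1" using vp_le_1_iff VL by blast
    then have "vp (1 + x / y) * vp y \<le> 1 * vp y" using nn[OF y] by (rule mult_right_mono)
    moreover have "vp (1 + x / y) * vp y = vp (x + y)"
      using vp_mult[of "1 + x / y" y] q y False Lc by (simp add: distrib_right add.commute)
    ultimately show ?thesis by simp
  qed
  show ?thesis
  proof (cases "vp x \<le> vp y")
    case True
    then show ?thesis using aux[OF x y] nn[OF x] by simp
  next
    case False
    then show ?thesis using aux[OF y x] nn[OF y] by (simp add: add.commute)
  qed
qed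

lemma vp_rat: "vp (of_rat q) = padic_abs p q"
proof (cases "q = 0")
  case False
  obtain a b where ab: "quotient_of q = (a, b)" by (cases "quotient_of q")
  have "vp (of_rat q) = real p powr - real_of_int (int (multiplicity (int p) a) - int (multiplicity (int p) b))"
    using vp_eq[OF pv_rat[OF False]] by (simp add: ab)
  also have "\<dots> = real p powr real_of_int (int (multiplicity (int p) b) - int (multiplicity (int p) a))"
    by (simp only: of_int_minus[symmetric] minus_diff_eq)
  also have "\<dots> = real p powi (int (multiplicity (int p) b) - int (multiplicity (int p) a))"
    using p_gt_1 by (intro powr_real_of_int') simp_all
  also have "\<dots> = padic_abs p q" using False by (simp add: padic_abs_def ab)
  finally show ?thesis .
qed (simp add: vp_def padic_abs_def)

lemma vp_place: "restrict vp L \<in> places L"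
proof -
  have pp: "padic_abs p (of_nat p) = 1 / real p" by (rule padic_abs_prime[OF p])
  have "vp (of_nat p) = 1 / real p" using vp_rat[of "of_nat p"] pp by simp
  then have "vp (of_nat p) \<noteq> 1" using p_gt_1 by simp
  then have "\<exists>x\<in>L. x \<noteq> 0 \<and> restrict vp L x \<noteq> 1" using pL p0 by (intro bexI[of _ "of_nat p"]) simp_all
  moreover have "absolute_value_on L (restrict vp L)"
    unfolding absolute_value_on_def
  proof (intro conjI ballI)
    fix x assume x: "x \<in> L"
    have "vp 0 = 0" by (simp add: vp_def)
    then show "restrict vp L x \<ge> 0" "restrict vp L x = 0 \<longleftrightarrow> x = 0" using x vp_pos[OF x] by (cases "x = 0"; simp)+
    fix y assume y: "y \<in> L"
    show "restrict vp L (x * y) = restrict vp L x * restrict vp L y" using x y Lc(4)[OF x y] vp_mult[OF x y] by simp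
    show "restrict vp L (x + y) \<le> restrict vp L x + restrict vp L y" using x y Lc(7)[OF x y] vp_add_le[OF x y] by simp
  qed
  moreover have "\<forall>q. restrict vp L (of_rat q) = padic_abs p q" using vp_rat subfld_of_rat[OF subfld_L] by simp
  ultimately show ?thesis unfolding places_def using p by auto
qed

end

text \<open>The valuation \<open>j / n\<close> of \<open>\<alpha>\<close> is negative, so
  \<open>j \<le> -1\<close>, while \<open>n \<le> D\<close> and \<open>p \<ge> 2\<close>.\<close>

theorem nonintegral_place:
  assumes L: "subfld L" "\<And>x. x \<in> L \<Longrightarrow> algebraic x" and \<alpha>: "\<alpha> \<in> L" "\<not> algebraic_int \<alpha>"
    and h: "h \<noteq> 0" "rp h \<alpha> = 0" "Polynomial.degree h \<le> D"
  shows "\<exists>v\<in>places L. (\<exists>p. Factorial_Ring.prime p \<and> (\<forall>q. v (of_rat q) = padic_abs p q)) \<and> v \<alpha> \<ge> 2 powr (1 / D)"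
proof -
  obtain V where "maximal_subring L V \<alpha>" using maximal_subring_exists[OF L(1) \<alpha>] by blast
  then interpret ms: maximal_subring L V \<alpha> .
  interpret valuation_ring L V by unfold_locales (use ms.VL ms.subrng_V ms.total L in auto)
  obtain p where p: "Factorial_Ring.prime p" "inverse (of_nat p) \<notin> V"
    using nonunit_prime[OF \<alpha>(1) ms.notin L(2)[OF \<alpha>(1)]] by blast
  interpret padic_ring L V p by unfold_locales (use p L in auto)
  obtain n j where nj: "pv \<alpha> n j" "n \<le> Polynomial.degree h" using pv_exists[OF \<alpha>(1) ms.\<alpha>0 h(1,2)] by blast
  have n: "n > 0" using nj by (simp add: pv_def)
  have "\<not> vp \<alpha> \<le> 1" using vp_le_1_iff[OF \<alpha>(1)] ms.notin by simp
  then have gt: "vp \<alpha> > 1" by simp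
  have j: "j < 0"
  proof (rule ccontr)
    assume "\<not> j < 0"
    then have "real p powr - (real_of_int j / real n) \<le> real p powr 0"
      using p_gt_1 by (intro powr_mono) simp_all
    then show False using gt p_gt_1 by (simp add: vp_eq[OF nj(1)])
  qed
  have "2 powr (1 / D) \<le> 2 powr (1 / n)" using n nj(2) h(3) by (intro powr_mono frac_le) simp_all
  also have "\<dots> \<le> real p powr (1 / n)" using prime_ge_2_nat[OF p(1)] by (intro powr_mono2) simp_all
  also have "\<dots> \<le> real p powr - (real_of_int j / real n)"
  proof (rule powr_mono)
    have "1 / real n \<le> real_of_int (- j) / real n" using j by (intro divide_right_mono) simp_all
    then show "1 / real n \<le> - (real_of_int j / real n)" by simp
  qed (use p_gt_1 in simp)
  finally have "restrict vp L \<alpha> \<ge> 2 powr (1 / D)" using \<alpha>(1) by (simp add: vp_eq[OF nj(1)])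
  moreover have "\<forall>q. restrict vp L (of_rat q) = padic_abs p q" using vp_rat subfld_of_rat[OF L(1)] by simp
  ultimately show ?thesis using vp_place p(1) by blast
qed

subsection \<open>Degrees of number fields\<close>

interpretation CF: cring complex_field
  by (rule cring_from_type_algebra)

lemma complex_field_simps:
  "carrier complex_field = UNIV" "x \<otimes>\<^bsub>complex_field\<^esub> y = x * y" "x \<oplus>\<^bsub>complex_field\<^esub> y = x + y"
  "\<one>\<^bsub>complex_field\<^esub> = 1" "\<zero>\<^bsub>complex_field\<^esub> = 0"
  by (simp_all add: ring_of_type_algebra_def)

lemma complex_field_minus: "\<ominus>\<^bsub>complex_field\<^esub> x = - x"
  by (rule CF.minus_equality) (simp_all add: complex_field_simps)

lemma complex_field_inv: "x \<noteq> 0 \<Longrightarrow> inv\<^bsub>complex_field\<^esub> x = inverse x"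
  by (rule CF.comm_inv_char) (simp_all add: complex_field_simps)

lemma subfield_Rats: "subfield \<rat> complex_field"
proof (rule field.subfieldI'[OF field_from_type_algebra])
  show "subring \<rat> complex_field"
    by (rule CF.subringI) (simp_all add: complex_field_simps complex_field_minus)
qed (auto simp: complex_field_simps complex_field_inv)

text \<open>Links the list-based spans behind \<open>field_degree\<close> with those of the vector
  space library.\<close>

lemma Span_eq_span: "CF.Span \<rat> us = Qv.span (set us)"
proof (induction us)
  case (Cons u us)
  have "x \<in> CF.line_extension \<rat> u (Qv.span (set us)) \<longleftrightarrow> (\<exists>k. x - of_rat k * u \<in> Qv.span (set us))" for x
  proof
    assume "x \<in> CF.line_extension \<rat> u (Qv.span (set us))"
    then obtain q w where "q \<in> \<rat>" "w \<in> Qv.span (set us)" "x = q * u + w"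
      unfolding CF.line_extension_mem_iff by (auto simp: complex_field_simps)
    moreover from this obtain r where "q = of_rat r" by (auto elim: Rats_cases)
    ultimately show "\<exists>k. x - of_rat k * u \<in> Qv.span (set us)" by (intro exI[of _ r]) simp
  next
    assume "\<exists>k. x - of_rat k * u \<in> Qv.span (set us)"
    then obtain k where "x - of_rat k * u \<in> Qv.span (set us)" by blast
    then show "x \<in> CF.line_extension \<rat> u (Qv.span (set us))"
      unfolding CF.line_extension_mem_iff
      by (intro bexI[of _ "of_rat k"] bexI[of _ "x - of_rat k * u"]) (simp_all add: complex_field_simps)
  qed
  then show ?case using Cons by (auto simp: Qv.span_insert)
qed (simp add: complex_field_simps)

lemma independent_list: "distinct us \<Longrightarrow> Qv.independent (set us) \<Longrightarrow> CF.independent \<rat> us"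
proof (induction us)
  case (Cons u us)
  then have "Qv.independent (set us)" "u \<notin> Qv.span (set us)"
    by (simp_all add: Qv.independent_insert)
  then show ?case using Cons by (intro CF.li_Cons) (simp_all add: Span_eq_span complex_field_simps del: CF.Span.simps)
qed simp

lemma field_degree_span:
  assumes "finite T" "Qv.independent T" shows "field_degree (Qv.span T) = card T"
proof -
  obtain us where us: "set us = T" "distinct us" using finite_distinct_list[OF assms(1)] by blast
  have "CF.dimension (length us) \<rat> (CF.Span \<rat> us)"
    using us assms by (intro CF.dimension_independent independent_list) simp_all
  then have "CF.dimension (length us) \<rat> (Qv.span T)" by (simp only: Span_eq_span us(1))
  from CF.dimI[OF subfield_Rats this] show ?thesis
    using distinct_card[OF us(2)] us(1) by (simp add: field_degree_def over_def)
qed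

lemma subfld_subspace: "subfld E \<Longrightarrow> Qv.subspace E"
  by (rule Qv.subspaceI) (simp_all add: subfldD subfld_of_rat)

lemma subfld_basis:
  assumes E: "subfld E" and B: "E \<subseteq> Qv.span B" "finite B"
  obtains T where "T \<subseteq> E" "finite T" "Qv.independent T" "Qv.span T = E" "card T = field_degree E" "card T \<le> card B"
proof -
  obtain T where T: "T \<subseteq> E" "Qv.independent T" "E \<subseteq> Qv.span T" using Qv.maximal_independent_subset by blast
  have "T \<subseteq> Qv.span B" using T(1) B(1) by blast
  from Qv.independent_span_bound[OF B(2) T(2) this] have fin: "finite T" and le: "card T \<le> card B" by auto
  have sp: "Qv.span T = E" using T Qv.span_minimal[OF T(1) subfld_subspace[OF E]] by blast
  show ?thesis using that[OF T(1) fin T(2) sp _ le] field_degree_span[OF fin T(2)] sp by simp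
qed

lemma field_degree_bounds:
  assumes E: "subfld E" and B: "E \<subseteq> Qv.span B" "finite B"
  shows "field_degree E \<ge> 1" "field_degree E \<le> card B"
proof -
  obtain T where T: "T \<subseteq> E" "finite T" "Qv.independent T" "Qv.span T = E" "card T = field_degree E" "card T \<le> card B"
    using subfld_basis[OF assms] .
  show "field_degree E \<le> card B" using T by simp
  have "T \<noteq> {}"
  proof
    assume "T = {}"
    then have "E = {0}" using T(4) by simp
    then show False using subfldD(1)[OF E] by simp
  qed
  then have "card T > 0" using T(2) by (simp add: card_gt_0_iff)
  then show "field_degree E \<ge> 1" using T(5) by simp
qed

text \<open>One power of \<open>x\<close> more than the dimension forces a dependence. Equal powers
  are treated apart, because the set of powers does not record the repetition.\<close>

lemma annihilator_degree_le:
  assumes E: "subfld E" and B: "E \<subseteq> Qv.span B" "finite B" and x: "x \<in> E"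
  shows "\<exists>h. h \<noteq> 0 \<and> rp h x = 0 \<and> Polynomial.degree h \<le> field_degree E"
proof -
  obtain T where T: "T \<subseteq> E" "finite T" "Qv.independent T" "Qv.span T = E" "card T = field_degree E" "card T \<le> card B"
    using subfld_basis[OF E B] .
  define d where "d = field_degree E"
  have rpm: "rp (Polynomial.monom c i) x = of_rat c * x ^ i" for c i
    by (simp add: rp_def map_poly_monom poly_monom)
  show ?thesis
  proof (cases "inj_on (\<lambda>i. x ^ i) {..d}")
    case False
    then obtain i j where ij: "i \<le> d" "j \<le> d" "x ^ i = x ^ j" "i \<noteq> j" by (auto simp: inj_on_def)
    define h where "h = (Polynomial.monom 1 i - Polynomial.monom 1 j :: rat poly)"
    have "Polynomial.coeff h i = 1" using ij by (simp add: h_def)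
    then have "h \<noteq> 0" by auto
    moreover have "rp h x = 0" using ij by (simp add: h_def rpm)
    moreover have "Polynomial.degree h \<le> d"
      unfolding h_def using ij by (intro degree_diff_le order.trans[OF degree_monom_le])
    ultimately show ?thesis unfolding d_def by blast
  next
    case True
    have "\<not> Qv.independent ((\<lambda>i. x ^ i) ` {..d})"
    proof
      assume ind: "Qv.independent ((\<lambda>i. x ^ i) ` {..d})"
      have "(\<lambda>i. x ^ i) ` {..d} \<subseteq> Qv.span T" unfolding T(4) using subfldD(9)[OF E x] by blast
      from Qv.independent_span_bound[OF T(2) ind this] have "card ((\<lambda>i. x ^ i) ` {..d}) \<le> d" using T(5) by (simp add: d_def)
      then show False by (simp add: card_image[OF True])
    qed
    then obtain c where c: "\<exists>y\<in>(\<lambda>i. x ^ i) ` {..d}. c y \<noteq> 0" "(\<Sum>y\<in>(\<lambda>i. x ^ i) ` {..d}. of_rat (c y) * y) = 0"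
      using Qv.dependent_finite[of "(\<lambda>i. x ^ i) ` {..d}"] by auto
    define h where "h = (\<Sum>i\<le>d. Polynomial.monom (c (x ^ i)) i)"
    have co: "Polynomial.coeff h i = (if i \<le> d then c (x ^ i) else 0)" for i
      by (simp add: h_def coeff_sum)
    obtain i where "i \<le> d" "c (x ^ i) \<noteq> 0" using c(1) by blast
    then have "Polynomial.coeff h i \<noteq> 0" by (simp add: co)
    then have "h \<noteq> 0" by auto
    moreover have "rp h x = 0" using c(2) by (simp add: h_def rpm sum.reindex[OF True])
    moreover have "Polynomial.degree h \<le> d" by (rule degree_le) (simp add: co)
    ultimately show ?thesis unfolding d_def by blast
  qed
qed

lemma range_rp_span:
  assumes h: "h \<noteq> 0" "rp h x = 0"
  shows "range (\<lambda>g. rp g x) \<subseteq> Qv.span ((\<lambda>i. x ^ i) ` {..<Polynomial.degree h})"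
proof
  fix y assume "y \<in> range (\<lambda>g. rp g x)"
  then obtain g where "y = rp g x" by blast
  also have "\<dots> = rp (h * (g div h) + g mod h) x" by simp
  also have "\<dots> = rp (g mod h) x" by (simp only: rp_add rp_mult h(2)) simp
  finally have y: "y = rp (g mod h) x" .
  have "Polynomial.degree h \<noteq> 0" using rp_degree_0 h by blast
  then have deg: "Polynomial.degree (g mod h) < Polynomial.degree h"
    using degree_mod_less[OF h(1), of g] by auto
  have "y = (\<Sum>i\<le>Polynomial.degree (g mod h). of_rat (Polynomial.coeff (g mod h) i) * x ^ i)"
    unfolding y rp_def by (simp add: poly_altdef coeff_map_poly)
  also have "\<dots> \<in> Qv.span ((\<lambda>i. x ^ i) ` {..<Polynomial.degree h})"
    using deg by (intro Qv.span_sum Qv.span_scale Qv.span_base) auto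
  finally show "y \<in> Qv.span ((\<lambda>i. x ^ i) ` {..<Polynomial.degree h})" .
qed

lemma span_mult:
  assumes x: "x \<in> Qv.span A" and y: "y \<in> Qv.span B"
  shows "x * y \<in> Qv.span ((\<lambda>(a, b). a * b) ` (A \<times> B))"
  using x
proof (induction rule: Qv.span_induct_alt)
  case base
  then show ?case by (simp add: Qv.span_zero)
next
  case (step c a w)
  have "a * y \<in> Qv.span ((\<lambda>(a, b). a * b) ` (A \<times> B))"
    using y
  proof (induction rule: Qv.span_induct_alt)
    case base
    then show ?case by (simp add: Qv.span_zero)
  next
    case (step d b w')
    have "a * b \<in> Qv.span ((\<lambda>(a, b). a * b) ` (A \<times> B))" using step \<open>a \<in> A\<close> by (intro Qv.span_base) auto
    then have "of_rat d * (a * b) + a * w' \<in> Qv.span ((\<lambda>(a, b). a * b) ` (A \<times> B))"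
      using step by (intro Qv.span_add Qv.span_scale)
    then show ?case by (simp add: algebra_simps)
  qed
  then have "of_rat c * (a * y) + w * y \<in> Qv.span ((\<lambda>(a, b). a * b) ` (A \<times> B))"
    using step by (intro Qv.span_add Qv.span_scale)
  then show ?case by (simp add: algebra_simps)
qed

lemma subfld_subrng_algebraic:
  assumes A: "subrng A" "\<And>q. of_rat q \<in> A" "\<And>x. x \<in> A \<Longrightarrow> algebraic x" shows "subfld A"
  unfolding subfld_def
proof (intro conjI ballI)
  fix x assume x: "x \<in> A"
  have "x \<in> range (\<lambda>h. rp h x)" by (rule image_eqI[of _ _ "[:0, 1:]"]) simp_all
  then have "inverse x \<in> range (\<lambda>h. rp h x)" by (rule subfldD(5)[OF subfld_range_rp[OF A(3)[OF x]]])
  then obtain h where "inverse x = rp h x" by blast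
  then show "inverse x \<in> A" unfolding rp_def using A(2) x by (simp add: subrng_poly[OF A(1)] coeff_map_poly)
qed (use subrngD[OF A(1)] in auto)

lemma adjoin_min:
  assumes E: "subfld E" "A \<subseteq> E" shows "adjoin A \<subseteq> E"
proof
  fix x assume "x \<in> adjoin A"
  then have "x \<in> generate_field complex_field A" by (simp add: adjoin_def)
  then show "x \<in> E"
    by induction (use E in \<open>auto simp: complex_field_simps complex_field_minus complex_field_inv subfldD[OF E(1)]\<close>)
qed

lemma subfld_adjoin: "subfld (adjoin A)"
proof -
  have one: "1 \<in> adjoin A" unfolding adjoin_def using generate_field.one[of complex_field A] by (simp add: complex_field_simps)
  have minus: "- x \<in> adjoin A" if "x \<in> adjoin A" for x
    using that generate_field.a_inv[of x complex_field A] by (simp add: adjoin_def complex_field_minus)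
  have add: "x + y \<in> adjoin A" if "x \<in> adjoin A" "y \<in> adjoin A" for x y
    using that generate_field.eng_add[of x complex_field A y] by (simp add: adjoin_def complex_field_simps)
  have mult: "x * y \<in> adjoin A" if "x \<in> adjoin A" "y \<in> adjoin A" for x y
    using that generate_field.eng_mult[of x complex_field A y] by (simp add: adjoin_def complex_field_simps)
  have inv: "inverse x \<in> adjoin A" if "x \<in> adjoin A" for x
  proof (cases "x = 0")
    case False
    then show ?thesis using that generate_field.m_inv[of x complex_field A]
      by (simp add: adjoin_def complex_field_inv complex_field_simps)
  qed (use that in simp)
  have "x - y \<in> adjoin A" if "x \<in> adjoin A" "y \<in> adjoin A" for x y using add[OF that(1) minus[OF that(2)]] by simp
  then show ?thesis unfolding subfld_def using one mult inv by blast
qed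

lemma adjoin_incl: "A \<subseteq> adjoin A"
  unfolding adjoin_def by (intro subsetI generate_field.incl)

text \<open>The ring obtained from the field of \<open>x\<close> by adjoining \<open>y\<close>
  consists of algebraic numbers, so it is a field, and the products of powers of \<open>x\<close>
  and \<open>y\<close> span it.\<close>

lemma adjoin_pair_span:
  assumes x: "g \<noteq> 0" "rp g x = 0" and y: "h \<noteq> 0" "rp h y = 0" and S: "S \<subseteq> range (\<lambda>k. rp k x) \<union> range (\<lambda>k. rp k y)"
    and E: "subfld E" "x \<in> E" "y \<in> E" "\<And>z. z \<in> E \<Longrightarrow> algebraic z"
  obtains B where "finite B" "card B \<le> Polynomial.degree g * Polynomial.degree h" "adjoin S \<subseteq> Qv.span B"
proof -
  define A where "A = range (\<lambda>k. rp k x)"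
  define W where "W = poly_ext A y"
  have ax: "algebraic x" using E by auto
  have Af: "subfld A" unfolding A_def by (rule subfld_range_rp[OF ax])
  note W = subrng_poly_ext[OF subfld_subrng[OF Af], of y, folded W_def]
  have AE: "A \<subseteq> E" unfolding A_def using subfld_rp[OF E(1)] E(2) by blast
  have WE: "W \<subseteq> E" unfolding W_def by (rule poly_ext_sub[OF subfld_subrng[OF E(1)] AE E(3)])
  have ratW: "of_rat q \<in> W" for q using W(2) subfld_of_rat[OF Af] by blast
  have Wf: "subfld W" by (rule subfld_subrng_algebraic[OF W(1) ratW]) (use WE E(4) in auto)
  have "range (\<lambda>k. rp k y) \<subseteq> W" using subfld_rp[OF Wf W(3)] by blast
  moreover have "range (\<lambda>k. rp k x) \<subseteq> W" using W(2) by (simp only: A_def)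
  ultimately have "S \<subseteq> W" using S by (metis Un_subset_iff subset_trans Un_least)
  then have sub: "adjoin S \<subseteq> W" by (rule adjoin_min[OF Wf])
  define BA BB where "BA = (\<lambda>i. x ^ i) ` {..<Polynomial.degree g}" and "BB = (\<lambda>i. y ^ i) ` {..<Polynomial.degree h}"
  define B where "B = (\<lambda>(a, b). a * b) ` (BA \<times> BB)"
  have fin: "finite B" by (simp add: B_def BA_def BB_def)
  have "card B \<le> card (BA \<times> BB)" unfolding B_def by (rule card_image_le) (simp add: BA_def BB_def)
  also have "\<dots> \<le> Polynomial.degree g * Polynomial.degree h"
    unfolding card_cartesian_product BA_def BB_def
    by (intro mult_le_mono order.trans[OF card_image_le]) simp_all
  finally have card: "card B \<le> Polynomial.degree g * Polynomial.degree h" .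
  have "W \<subseteq> Qv.span B"
  proof
    fix w assume "w \<in> W"
    then obtain P where P: "w = poly P y" "\<And>i. Polynomial.coeff P i \<in> A" by (auto simp: W_def poly_ext_def)
    have "y ^ i \<in> Qv.span BB" for i
    proof -
      have "y ^ i \<in> range (\<lambda>k. rp k y)"
        by (rule image_eqI[of _ _ "Polynomial.monom 1 i"]) (simp_all add: rp_def map_poly_monom poly_monom)
      then show ?thesis using range_rp_span[OF y] unfolding BB_def by blast
    qed
    moreover have "Polynomial.coeff P i \<in> Qv.span BA" for i
      using P(2) range_rp_span[OF x] unfolding A_def BA_def by blast
    ultimately have "Polynomial.coeff P i * y ^ i \<in> Qv.span B" for i unfolding B_def by (intro span_mult)
    then show "w \<in> Qv.span B" unfolding P(1) poly_altdef by (intro Qv.span_sum)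
  qed
  then show ?thesis using that[OF fin card] sub by blast
qed

subsection \<open>Local heights\<close>

context abs_value
begin

lemmas uni_iterate_L = uni_iterate_M[OF subfld_L]

lemma local_green_tendsto:
  assumes q: "q \<ge> 2" and c: "c \<in> L" and x: "x \<in> L"
  shows "\<exists>l. (\<lambda>k. log_plus (v ((uni q c ^^ k) x)) / real q ^ k) \<longlonglongrightarrow> l"
proof -
  have vc: "v c \<ge> 0" by (rule avD(1)[OF c])
  have "\<bar>log_plus (v ((uni q c ^^ Suc k) x)) - q * log_plus (v ((uni q c ^^ k) x))\<bar> \<le> growth_const (v c)" for k
  proof (rule log_plus_power_perturb)
    define w where "w = (uni q c ^^ k) x"
    have w: "w \<in> L" unfolding w_def by (rule uni_iterate_L[OF c x])
    have wq: "w ^ q \<in> L" by (rule Lc(9)[OF w])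
    show "v ((uni q c ^^ Suc k) x) \<le> v ((uni q c ^^ k) x) ^ q + v c"
      using avD(4)[OF wq c] by (simp add: uni_def v_power[OF w] flip: w_def)
    show "v ((uni q c ^^ k) x) ^ q \<le> v ((uni q c ^^ Suc k) x) + v c"
      using v_diff[OF Lc(7)[OF wq c] c] by (simp add: uni_def v_power[OF w] flip: w_def)
  qed (simp_all add: vc avD(1)[OF uni_iterate_L[OF c x]])
  from log_plus_tendsto[where t = "\<lambda>k. v ((uni q c ^^ k) x)", OF q growth_const_nonneg[OF vc] this]
  show ?thesis by blast
qed

lemma local_green_nonneg:
  assumes "q \<ge> 2" "c \<in> L" "x \<in> L"
  shows "lim (\<lambda>k. log_plus (v ((uni q c ^^ k) x)) / real q ^ k) \<ge> 0"
proof -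
  obtain l where l: "(\<lambda>k. log_plus (v ((uni q c ^^ k) x)) / real q ^ k) \<longlonglongrightarrow> l"
    using local_green_tendsto[OF assms] by blast
  have "l \<ge> 0" by (rule LIMSEQ_le_const[OF l]) (simp add: log_plus_nonneg)
  then show ?thesis by (simp only: limI[OF l])
qed

end

context na_value
begin

lemma v_algebraic_int: assumes "x \<in> L" "algebraic_int x" shows "v x \<le> 1"
  using assms(2)
proof cases
  case (1 P)
  then show ?thesis using assms(1) v_1 by (intro v_integral[of P]) simp_all
qed

lemma v_uni_gt:
  assumes c: "c \<in> L" "v c \<le> 1" and x: "x \<in> L" "v x > 1" and q: "q > 0"
  shows "v (uni q c x) = v x ^ q"
proof -
  have xq: "x ^ q \<in> L" by (rule Lc(9)[OF x(1)])
  have gt: "v x ^ q > 1" using x(2) q by (simp add: one_less_power)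
  have "v (x ^ q + c) \<le> max (v (x ^ q)) (v c)" by (rule v_add_le_max[OF xq c(1)])
  then have 1: "v (x ^ q + c) \<le> v x ^ q" using gt c(2) by (simp add: v_power[OF x(1)])
  have "v ((x ^ q + c) + (- c)) \<le> max (v (x ^ q + c)) (v (- c))"
    by (intro v_add_le_max Lc(6,7) xq c(1))
  then have "v x ^ q \<le> max (v (x ^ q + c)) (v c)" by (simp add: v_power[OF x(1)] v_minus[OF c(1)])
  then show ?thesis using 1 gt c(2) by (simp add: uni_def max_def split: if_splits)
qed

text \<open>Good reduction: either the orbit stays in the unit disc, or the \<open>q\<close>-th
  power dominates at each step and the quotient is constant in \<open>k\<close>.\<close>

lemma local_green:
  assumes q: "q \<ge> 2" and c: "c \<in> L" "v c \<le> 1" and x: "x \<in> L"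
  shows "lim (\<lambda>k. log_plus (v ((uni q c ^^ k) x)) / real q ^ k) = log_plus (v x)"
proof -
  have "log_plus (v ((uni q c ^^ k) x)) / real q ^ k = log_plus (v x)" for k
  proof (cases "v x \<le> 1")
    case True
    have "v ((uni q c ^^ k) x) \<le> 1"
    proof (induction k)
      case (Suc k)
      define w where "w = (uni q c ^^ k) x"
      have w: "w \<in> L" unfolding w_def by (rule uni_iterate_L[OF c(1) x])
      have "v (w ^ q + c) \<le> max (v (w ^ q)) (v c)" by (rule v_add_le_max[OF Lc(9)[OF w] c(1)])
      also have "\<dots> \<le> 1" using Suc c(2) avD(1)[OF w] by (simp add: v_power[OF w] power_le_one flip: w_def)
      finally have "v (uni q c w) \<le> 1" by (simp only: uni_def)
      then show ?case by (simp add: w_def)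
    qed (use True in simp)
    then show ?thesis using True by (simp add: log_plus_def)
  next
    case False
    have "v ((uni q c ^^ k) x) = v x ^ (q ^ k)"
    proof (induction k)
      case (Suc k)
      have gt: "v ((uni q c ^^ k) x) > 1" using Suc False q by (simp add: one_less_power)
      have "v ((uni q c ^^ Suc k) x) = v ((uni q c ^^ k) x) ^ q"
        using v_uni_gt[OF c uni_iterate_L[OF c(1) x] gt, of q] q by simp
      then show ?case by (simp add: Suc mult.commute flip: power_mult)
    qed simp
    then show ?thesis using q False by (simp add: log_plus_power)
  qed
  then show ?thesis by simp
qed

end

lemma na_value_padic:
  assumes "abs_value L v" "Factorial_Ring.prime p" "\<And>q. v (of_rat q) = padic_abs p q"
  shows "na_value L v"
proof -
  interpret abs_value L v by fact
  show ?thesis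
  proof
    fix m :: int
    have "v (of_int m) = padic_abs p (of_int m)" using assms(3)[of "of_int m"] by simp
    then show "v (of_int m) \<le> 1" using padic_abs_of_int(1)[OF assms(2)] by simp
  qed
qed

lemma place_abs_value: "subfld L \<Longrightarrow> v \<in> places L \<Longrightarrow> abs_value L v"
  by (simp add: places_def abs_value_def)

lemma place_cases:
  assumes "v \<in> places L"
  obtains "\<And>q. v (of_rat q) = \<bar>of_rat q\<bar>" | p where "Factorial_Ring.prime p" "\<And>q. v (of_rat q) = padic_abs p q"
  using assms unfolding places_def by blast

section \<open>Lower bounds for the canonical height\<close>

locale galois_height = galois +
  fixes q :: nat and b \<alpha> :: complex and f :: "complex poly"
  assumes q2: "q \<ge> 2" and f: "f = Polynomial.monom 1 q + [:b:]"
    and bM: "b \<in> M" and \<alpha>M: "\<alpha> \<in> M" and b_int: "algebraic_int b"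
    and alg_M: "\<And>x. x \<in> M \<Longrightarrow> algebraic x"
begin

definition K :: "complex set" where "K = adjoin (insert \<alpha> (set (coeffs f)))"
definition D :: nat where "D = card (orb G \<alpha>)"

lemma poly_f: "poly f = uni q b"
  by (rule ext) (simp add: f uni_def poly_monom)

lemma degree_f: "Polynomial.degree f = q"
proof -
  have "Polynomial.degree [:b:] < Polynomial.degree (Polynomial.monom (1::complex) q)" using q2 by (simp add: Polynomial.degree_monom_eq)
  then show ?thesis unfolding f by (simp only: degree_add_eq_left) (simp add: Polynomial.degree_monom_eq)
qed

lemma coeff_f: "Polynomial.coeff f i = (if i = q then 1 else if i = 0 then b else 0)"
  using q2 by (auto simp: f coeff_pCons split: nat.split)

lemma D_pos: "D > 0" unfolding D_def by (rule card_orb_pos[OF subgrp_G])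

lemma annihilator:
  obtains h where "h \<noteq> 0" "rp h \<alpha> = 0" "Polynomial.degree h = D"
proof -
  obtain h where h: "map_poly of_rat h = root_poly (orb G \<alpha>)"
    using rats_coeffs_rat_poly[of "root_poly (orb G \<alpha>)"] coeff_root_poly_orb_Rats[OF \<alpha>M] by blast
  have "rp h \<alpha> = 0" unfolding rp_def h by (rule poly_root_poly_orb[OF subgrp_G])
  moreover have "Polynomial.degree h = D"
  proof -
    have "Polynomial.degree (map_poly of_rat h :: complex poly) = Polynomial.degree h" by (simp add: degree_map_poly)
    then show ?thesis using h by (simp add: D_def degree_root_poly)
  qed
  moreover from this have "h \<noteq> 0" using D_pos by auto
  ultimately show ?thesis using that by blast
qed

lemma subfld_K: "subfld K" unfolding K_def by (rule subfld_adjoin)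

lemma \<alpha>K: "\<alpha> \<in> K" unfolding K_def using adjoin_incl by blast

lemma bK: "b \<in> K"
proof (cases "b = 0")
  case False
  have "Polynomial.coeff f 0 = b" using q2 by (simp add: coeff_f)
  then have "b \<in> range (Polynomial.coeff f)" by (metis rangeI)
  then have "b \<in> set (coeffs f)" using False by (metis range_coeff insert_iff)
  then show ?thesis unfolding K_def using adjoin_incl by blast
qed (simp add: subfldD(2)[OF subfld_K])

lemma coeffs_f: "set (coeffs f) \<subseteq> {0, 1, b}"
proof
  fix c assume "c \<in> set (coeffs f)"
  then have "c \<in> range (Polynomial.coeff f)" by (simp add: range_coeff)
  then obtain i where "c = Polynomial.coeff f i" by blast
  then show "c \<in> {0, 1, b}" by (simp add: coeff_f)
qed

lemma K_M: "K \<subseteq> M"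
  unfolding K_def using coeffs_f bM \<alpha>M M(1,2) by (intro adjoin_min[OF subfld_M]) auto

text \<open>The height is taken over a field that also contains \<open>b\<close>; relative to the
  degree of \<open>\<alpha>\<close> this costs a factor that goes into the constant.\<close>

lemma K_span:
  obtains Bs where "finite Bs" "card Bs \<le> D * Polynomial.degree (minpoly b)" "K \<subseteq> Qv.span Bs"
proof -
  obtain h where h: "h \<noteq> 0" "rp h \<alpha> = 0" "Polynomial.degree h = D" by (rule annihilator)
  have b: "algebraic b" by (rule alg_M[OF bM])
  have r: "0 \<in> range (\<lambda>k. rp k b)" "1 \<in> range (\<lambda>k. rp k b)" "b \<in> range (\<lambda>k. rp k b)" "\<alpha> \<in> range (\<lambda>k. rp k \<alpha>)"
    by (rule range_eqI[of _ _ 0], simp) (rule range_eqI[of _ _ 1], simp, (rule range_eqI[of _ _ "[:0, 1:]"], simp)+)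
  have "insert \<alpha> (set (coeffs f)) \<subseteq> range (\<lambda>k. rp k \<alpha>) \<union> range (\<lambda>k. rp k b)"
    using coeffs_f r by blast
  from adjoin_pair_span[OF h(1,2) minpoly(1,2)[OF b] this subfld_M \<alpha>M bM alg_M]
  show ?thesis using that unfolding K_def h(3) by blast
qed

lemma degree_K: "field_degree K \<ge> 1" "field_degree K \<le> D * Polynomial.degree (minpoly b)"
proof -
  obtain Bs where Bs: "finite Bs" "card Bs \<le> D * Polynomial.degree (minpoly b)" "K \<subseteq> Qv.span Bs" by (rule K_span)
  show "field_degree K \<ge> 1" "field_degree K \<le> D * Polynomial.degree (minpoly b)"
    using field_degree_bounds[OF subfld_K Bs(3,1)] Bs(2) by simp_all
qed

lemma D_le_degree: "D \<le> field_degree (adjoin {\<alpha>})"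
proof -
  obtain Bs where Bs: "finite Bs" "K \<subseteq> Qv.span Bs" by (rule K_span)
  have "adjoin {\<alpha>} \<subseteq> K" using \<alpha>K by (intro adjoin_min[OF subfld_K]) simp
  then have "adjoin {\<alpha>} \<subseteq> Qv.span Bs" using Bs(2) by blast
  then obtain h where h: "h \<noteq> 0" "rp h \<alpha> = 0" "Polynomial.degree h \<le> field_degree (adjoin {\<alpha>})"
    using annihilator_degree_le[OF subfld_adjoin _ Bs(1), of "{\<alpha>}" \<alpha>] adjoin_incl[of "{\<alpha>}"] by auto
  then show ?thesis using card_orb_le_degree[OF \<alpha>M h(1,2)] by (simp add: D_def)
qed

abbreviation "lh v \<equiv> local_height f v \<alpha>"

lemma lh_eq: "lh v = lim (\<lambda>k. log_plus (v ((uni q b ^^ k) \<alpha>)) / real q ^ k)"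
  by (simp add: local_height_def poly_f degree_f)

lemma lh_nonneg: assumes v: "v \<in> places K" shows "lh v \<ge> 0"
proof -
  interpret v: abs_value K v by (rule place_abs_value[OF subfld_K v])
  show ?thesis unfolding lh_eq by (rule v.local_green_nonneg[OF q2 bK \<alpha>K])
qed

lemma lh_padic:
  assumes v: "v \<in> places K" and p: "Factorial_Ring.prime p" "\<And>q. v (of_rat q) = padic_abs p q"
  shows "lh v = log_plus (v \<alpha>)"
proof -
  interpret v: na_value K v by (rule na_value_padic[OF place_abs_value[OF subfld_K v] p])
  show ?thesis unfolding lh_eq by (rule v.local_green[OF q2 bK v.v_algebraic_int[OF bK b_int] \<alpha>K])
qed

text \<open>A nonarchimedean place with nonzero local height lies above a prime factor of a
  denominator \<open>N\<close> of \<open>\<alpha>\<close>, and each rational place has finitely many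
  extensions to \<open>K\<close>.\<close>

lemma finite_support: "finite {v \<in> places K. lh v \<noteq> 0}"
proof -
  obtain Bs where Bs: "finite Bs" "K \<subseteq> Qv.span Bs" by (rule K_span)
  obtain N :: nat where N: "N > 0" "algebraic_int (of_nat N * \<alpha>)" using algebraic_scaled_int[OF alg_M[OF \<alpha>M]] by blast
  define S where "S w = {v \<in> extensional K. abs_value K v \<and> (\<forall>r. v (of_rat r) = w r)}" for w :: "rat \<Rightarrow> real"
  have fin: "finite (S w)" if "0 < w r" "w r < 1" for w r
    unfolding S_def using finite_places_over[of K Bs w r] Bs that by simp
  have "finite (S (\<lambda>r. \<bar>of_rat r\<bar>))" by (rule fin[of _ "1/2"]) (simp_all add: of_rat_divide)
  moreover have "finite (S (padic_abs p))" if "p \<in> prime_factors N" for p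
  proof -
    have p: "Factorial_Ring.prime p" using that by auto
    show ?thesis by (rule fin[of _ "of_nat p"]) (use prime_gt_1_nat[OF p] padic_abs_prime[OF p] in simp_all)
  qed
  ultimately have fin2: "finite (S (\<lambda>r. \<bar>of_rat r\<bar>) \<union> (\<Union>p\<in>prime_factors N. S (padic_abs p)))" by blast
  show ?thesis
  proof (rule finite_subset[OF _ fin2], rule subsetI)
    fix v assume "v \<in> {v \<in> places K. lh v \<noteq> 0}"
    then have v: "v \<in> places K" "lh v \<noteq> 0" by simp_all
    have av: "abs_value K v" by (rule place_abs_value[OF subfld_K v(1)])
    have ext: "v \<in> extensional K" using v(1) by (simp add: places_def)
    show "v \<in> S (\<lambda>r. \<bar>of_rat r\<bar>) \<union> (\<Union>p\<in>prime_factors N. S (padic_abs p))"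
    proof (rule place_cases[OF v(1)])
      assume "\<And>q. v (of_rat q) = \<bar>of_rat q\<bar>"
      then show ?thesis using av ext by (simp add: S_def)
    next
      fix p :: nat assume p: "Factorial_Ring.prime p" "\<And>q. v (of_rat q) = padic_abs p q"
      interpret v: na_value K v by (rule na_value_padic[OF av p])
      have "p dvd N"
      proof (rule ccontr)
        assume "\<not> p dvd N"
        then have "padic_abs p (of_int (int N)) = 1" by (intro padic_abs_of_int(2)[OF p(1)]) simp
        then have vN: "v (of_nat N) = 1" using p(2)[of "of_nat N"] by simp
        have NK: "of_nat N \<in> K" by (rule subfld_of_nat[OF subfld_K])
        have "v (of_nat N * \<alpha>) \<le> 1" using N(2) v.Lc(4)[OF NK \<alpha>K] by (rule v.v_algebraic_int[rotated])
        then have "v \<alpha> \<le> 1" by (simp add: v.avD(3)[OF NK \<alpha>K] vN)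
        then have "lh v = 0" using lh_padic[OF v(1) p] by (simp add: log_plus_def)
        then show False using v(2) by simp
      qed
      then have "p \<in> prime_factors N" using p(1) N(1) by (simp add: in_prime_factors_iff)
      then show ?thesis using av ext p(2) by (auto simp: S_def)
    qed
  qed
qed

text \<open>All terms are nonnegative, so finitely many places can be selected, and each local
  degree is replaced by the bound \<open>1\<close>. Summability has to be established because
  \<open>infsum\<close> is \<open>0\<close> without it.\<close>

lemma canonical_height_ge:
  assumes T: "finite T" "T \<subseteq> places K"
  shows "canonical_height f \<alpha> \<ge> (\<Sum>v\<in>T. lh v) / field_degree K"
proof -
  obtain Bs where Bs: "finite Bs" "K \<subseteq> Qv.span Bs" by (rule K_span)
  define g where "g v = real (local_degree K v) / real (field_degree K) * lh v" for v
  have ld: "local_degree K v \<ge> 1" if "v \<in> places K" for v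
    by (rule abs_value.local_degree_pos[OF place_abs_value[OF subfld_K that] Bs(2,1)])
  have ge: "g v \<ge> lh v / field_degree K" if v: "v \<in> places K" for v
  proof -
    have "1 * lh v \<le> local_degree K v * lh v" using ld[OF v] lh_nonneg[OF v] by (intro mult_right_mono) simp_all
    then have "lh v / field_degree K \<le> local_degree K v * lh v / field_degree K" by (intro divide_right_mono) simp_all
    then show ?thesis by (simp add: g_def)
  qed
  have nn: "g v \<ge> 0" if "v \<in> places K" for v
    unfolding g_def using lh_nonneg[OF that] by (intro mult_nonneg_nonneg divide_nonneg_nonneg) simp_all
  have "finite {v \<in> places K. g v \<noteq> 0}" by (rule finite_subset[OF _ finite_support]) (auto simp: g_def)
  then have sm: "g summable_on places K" by (rule finite_nonzero_values_imp_summable_on)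
  have "(\<Sum>v\<in>T. lh v) / field_degree K = (\<Sum>v\<in>T. lh v / field_degree K)" by (rule sum_divide_distrib)
  also have "\<dots> \<le> sum g T" using T(2) ge by (intro sum_mono) auto
  also have "\<dots> \<le> infsum g (places K)" by (rule finite_sum_le_infsum[OF sm T]) (use nn in auto)
  also have "\<dots> = canonical_height f \<alpha>" by (simp add: canonical_height_def canonical_height_over_def K_def g_def[abs_def])
  finally show ?thesis .
qed

text \<open>One place contributes \<open>ln 2 / D\<close>; the division by the degree of
  \<open>K\<close> brings the second factor \<open>D\<close>.\<close>

lemma nonintegral_bound:
  assumes "\<not> algebraic_int \<alpha>"
  shows "canonical_height f \<alpha> \<ge> ln 2 / Polynomial.degree (minpoly b) / D\<^sup>2"
proof -
  obtain h where h: "h \<noteq> 0" "rp h \<alpha> = 0" "Polynomial.degree h = D" by (rule annihilator)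
  have "\<exists>v\<in>places K. (\<exists>p. Factorial_Ring.prime p \<and> (\<forall>q. v (of_rat q) = padic_abs p q)) \<and> v \<alpha> \<ge> 2 powr (1 / D)"
    using K_M alg_M h(3) by (intro nonintegral_place[OF subfld_K _ \<alpha>K assms h(1,2)]) auto
  then obtain v p where v: "v \<in> places K" "Factorial_Ring.prime p" "\<And>q. v (of_rat q) = padic_abs p q" "v \<alpha> \<ge> 2 powr (1 / D)"
    by blast
  have "ln 2 / D = ln (2 powr (1 / D))" by (simp add: ln_powr)
  also have "\<dots> \<le> log_plus (2 powr (1 / D))" by (rule ln_le_log_plus) simp
  also have "\<dots> \<le> log_plus (v \<alpha>)" by (rule log_plus_mono[OF v(4)])
  also have "\<dots> = lh v" using lh_padic[OF v(1-3)] by simp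
  finally have lh: "ln 2 / D \<le> lh v" .
  have N: "real (field_degree K) > 0" "real (field_degree K) \<le> real (D * Polynomial.degree (minpoly b))"
    using degree_K by (simp_all only: of_nat_le_iff of_nat_0_less_iff)
  have "ln 2 / Polynomial.degree (minpoly b) / D\<^sup>2 = (ln 2 / D) / real (D * Polynomial.degree (minpoly b))"
    by (simp add: power2_eq_square)
  also have "\<dots> \<le> lh v / field_degree K" using lh lh_nonneg[OF v(1)] N by (intro frac_le) simp_all
  also have "\<dots> \<le> canonical_height f \<alpha>" using canonical_height_ge[of "{v}"] v(1) by simp
  finally show ?thesis .
qed

text \<open>Restricted to \<open>K\<close> because places are extensional functions; distinct
  elements of \<open>G\<close> may give the same place.\<close>

definition emb :: "(complex \<Rightarrow> complex) \<Rightarrow> complex \<Rightarrow> real" where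
  "emb s = restrict (\<lambda>x. norm (s x)) K"

lemma emb_place: assumes s: "s \<in> G" shows "emb s \<in> places K"
proof -
  have KM: "x \<in> K \<Longrightarrow> x \<in> M" for x using K_M by blast
  have "absolute_value_on K (emb s)"
    unfolding absolute_value_on_def
  proof (intro conjI ballI)
    fix x assume x: "x \<in> K"
    show "emb s x \<ge> 0" "emb s x = 0 \<longleftrightarrow> x = 0" using x eq_0_G[OF s] by (simp_all add: emb_def)
    fix y assume y: "y \<in> K"
    show "emb s (x * y) = emb s x * emb s y"
      using x y subfldD(4)[OF subfld_K x y] mult_G[OF s KM KM, OF x y] by (simp add: emb_def norm_mult)
    show "emb s (x + y) \<le> emb s x + emb s y"
      using x y subfldD(7)[OF subfld_K x y] add_G[OF s KM KM, OF x y] by (simp add: emb_def norm_triangle_ineq)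
  qed
  moreover have rat: "emb s (of_rat r) = \<bar>of_rat r\<bar>" for r
  proof -
    have "norm (complex_of_real (of_rat r)) = \<bar>of_rat r\<bar>" by (rule norm_of_real)
    moreover have "complex_of_real (of_rat r) = of_rat r" by (cases r) (simp add: of_rat_rat)
    moreover have "emb s (of_rat r) = norm (of_rat r :: complex)"
      using subfld_of_rat[OF subfld_K, of r] of_rat_G[OF s, of r] by (simp add: emb_def)
    ultimately show ?thesis by (simp only:)
  qed
  moreover have "\<exists>x\<in>K. x \<noteq> 0 \<and> emb s x \<noteq> 1"
    using rat[of 2] subfld_of_rat[OF subfld_K, of 2] by (intro bexI[of _ "of_rat 2"]) simp_all
  ultimately show ?thesis by (simp add: places_def emb_def)
qed

lemma emb_iterate: "s \<in> G \<Longrightarrow> (uni q (s b) ^^ k) (s \<alpha>) = s ((uni q b ^^ k) \<alpha>)"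
proof (induction k)
  case (Suc k)
  define w where "w = (uni q b ^^ k) \<alpha>"
  have w: "w \<in> M" unfolding w_def by (rule uni_iterate_M[OF subfld_M bM \<alpha>M])
  have "s (uni q b w) = uni q (s b) (s w)"
    using add_G[OF Suc.prems M(9)[OF w] bM, of q] power_G[OF Suc.prems w, of q] by (simp add: uni_def)
  then show ?case using Suc by (simp add: w_def)
qed simp

lemma lh_emb: assumes s: "s \<in> G" shows "lh (emb s) = grn q (s b) (s \<alpha>)"
proof -
  interpret v: abs_value K "emb s" by (rule place_abs_value[OF subfld_K emb_place[OF s]])
  have "emb s ((uni q b ^^ k) \<alpha>) = norm ((uni q (s b) ^^ k) (s \<alpha>))" for k
    using v.uni_iterate_L[OF bK \<alpha>K, where q = q and k = k] by (simp add: emb_def emb_iterate[OF s])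
  then show ?thesis by (simp add: lh_eq grn_def)
qed

text \<open>The absolute values of \<open>s \<alpha>\<close> and \<open>s \<alpha> + 1\<close> determine \<open>s \<alpha>\<close> up to complex conjugation.\<close>

lemma card_emb_fiber:
  assumes t: "t \<in> G" shows "card {s \<in> G. emb s = emb t} * D \<le> 2 * card G"
proof -
  have fib: "card {s \<in> G. s \<alpha> = y} * D \<le> card G" for y
  proof (cases "y \<in> orb G \<alpha>")
    case True
    then show ?thesis using card_fiber_G[OF True] by (simp add: D_def)
  next
    case False
    then have empty: "{s \<in> G. s \<alpha> = y} = {}" by (auto simp: orb_def)
    show ?thesis unfolding empty by simp
  qed
  have conj: "x = y \<or> x = cnj y" if "norm x = norm y" "norm (x + 1) = norm (y + 1)" for x y :: complex
  proof -
    have 1: "(Re x)\<^sup>2 + (Im x)\<^sup>2 = (Re y)\<^sup>2 + (Im y)\<^sup>2" using that(1) by (simp add: cmod_def)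
    have 2: "(Re x + 1)\<^sup>2 + (Im x)\<^sup>2 = (Re y + 1)\<^sup>2 + (Im y)\<^sup>2" using that(2) by (simp add: cmod_def)
    have re: "Re x = Re y" using 1 2 by (simp add: power2_eq_square algebra_simps)
    then have "(Im x)\<^sup>2 = (Im y)\<^sup>2" using 1 by simp
    then have "Im x = Im y \<or> Im x = - Im y" by (simp add: power2_eq_iff)
    then show ?thesis using re by (auto simp: complex_eq_iff)
  qed
  have "{s \<in> G. emb s = emb t} \<subseteq> {s \<in> G. s \<alpha> = t \<alpha>} \<union> {s \<in> G. s \<alpha> = cnj (t \<alpha>)}"
  proof
    fix s assume "s \<in> {s \<in> G. emb s = emb t}"
    then have s: "s \<in> G" "emb s = emb t" by simp_all
    have a1: "\<alpha> + 1 \<in> K" using subfldD(7)[OF subfld_K \<alpha>K subfldD(1)[OF subfld_K]] .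
    have "norm (s \<alpha>) = norm (t \<alpha>)" using fun_cong[OF s(2), of \<alpha>] \<alpha>K by (simp add: emb_def)
    moreover have "norm (s \<alpha> + 1) = norm (t \<alpha> + 1)"
      using fun_cong[OF s(2), of "\<alpha> + 1"] a1 add_G[OF s(1) \<alpha>M M(1)] add_G[OF t \<alpha>M M(1)] one_G[OF s(1)] one_G[OF t]
      by (simp add: emb_def)
    ultimately show "s \<in> {s \<in> G. s \<alpha> = t \<alpha>} \<union> {s \<in> G. s \<alpha> = cnj (t \<alpha>)}" using conj s(1) by blast
  qed
  then have "card {s \<in> G. emb s = emb t} \<le> card ({s \<in> G. s \<alpha> = t \<alpha>} \<union> {s \<in> G. s \<alpha> = cnj (t \<alpha>)})"
    using finite_G by (intro card_mono) auto
  also have "\<dots> \<le> card {s \<in> G. s \<alpha> = t \<alpha>} + card {s \<in> G. s \<alpha> = cnj (t \<alpha>)}" by (rule card_Un_le)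
  finally have "card {s \<in> G. emb s = emb t} * D \<le> (card {s \<in> G. s \<alpha> = t \<alpha>} + card {s \<in> G. s \<alpha> = cnj (t \<alpha>)}) * D"
    by (rule mult_right_mono) simp
  then show ?thesis using fib[of "t \<alpha>"] fib[of "cnj (t \<alpha>)"] by (simp add: distrib_right)
qed

text \<open>At most \<open>2 * card G / D\<close> elements of \<open>G\<close> induce a given place,
  and the degree of \<open>K\<close> is at most \<open>D\<close> times that of \<open>b\<close>. So
  the bound \<open>1\<close> for local degrees loses only the factor
  \<open>2 * degree (minpoly b)\<close> against the average over \<open>G\<close>.\<close>

lemma archimedean_bound:
  "canonical_height f \<alpha> \<ge> (\<Sum>s\<in>G. grn q (s b) (s \<alpha>)) / card G / (2 * Polynomial.degree (minpoly b))"
proof -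
  define T where "T = emb ` G"
  have T: "finite T" "T \<subseteq> places K" using finite_G emb_place by (auto simp: T_def)
  have "(\<Sum>s\<in>G. grn q (s b) (s \<alpha>)) = (\<Sum>s\<in>G. lh (emb s))" by (simp add: lh_emb)
  also have "\<dots> = (\<Sum>v\<in>T. \<Sum>s | s \<in> G \<and> emb s = v. lh (emb s))"
    unfolding T_def by (rule sum.image_gen[OF finite_G])
  also have "\<dots> = (\<Sum>v\<in>T. card {s \<in> G. emb s = v} * lh v)" by (intro sum.cong) simp_all
  finally have eq: "(\<Sum>s\<in>G. grn q (s b) (s \<alpha>)) = (\<Sum>v\<in>T. card {s \<in> G. emb s = v} * lh v)" .
  have "(\<Sum>s\<in>G. grn q (s b) (s \<alpha>)) * D = (\<Sum>v\<in>T. real (card {s \<in> G. emb s = v} * D) * lh v)"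
    unfolding eq sum_distrib_right by (rule sum.cong) simp_all
  also have "\<dots> \<le> (\<Sum>v\<in>T. real (2 * card G) * lh v)"
  proof (rule sum_mono)
    fix v assume v: "v \<in> T"
    then obtain t where t: "t \<in> G" "v = emb t" by (auto simp: T_def)
    have "real (card {s \<in> G. emb s = v} * D) \<le> real (2 * card G)"
      unfolding t(2) of_nat_le_iff by (rule card_emb_fiber[OF t(1)])
    then show "real (card {s \<in> G. emb s = v} * D) * lh v \<le> real (2 * card G) * lh v"
      using lh_nonneg[of v] T(2) v by (intro mult_right_mono) auto
  qed
  also have "\<dots> = 2 * card G * (\<Sum>v\<in>T. lh v)" by (simp add: sum_distrib_left)
  finally have main: "(\<Sum>s\<in>G. grn q (s b) (s \<alpha>)) * D \<le> 2 * card G * (\<Sum>v\<in>T. lh v)" .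
  define Gs where "Gs = (\<Sum>s\<in>G. grn q (s b) (s \<alpha>))"
  define m where "m = Polynomial.degree (minpoly b)"
  have N: "real (field_degree K) > 0" "real (field_degree K) \<le> real (D * m)"
    using degree_K by (simp_all only: of_nat_le_iff of_nat_0_less_iff m_def)
  have m: "m > 0" using N by (cases m) simp_all
  have Gs: "Gs \<ge> 0" unfolding Gs_def by (intro sum_nonneg grn_nonneg[OF q2])
  have cG: "real (card G) > 0" using card_G_pos by simp
  have "Gs / card G / (2 * m) = (Gs * D / (2 * card G)) / real (D * m)"
    using D_pos m cG by (simp add: field_simps)
  also have "\<dots> \<le> (\<Sum>v\<in>T. lh v) / field_degree K"
  proof (rule frac_le)
    show "Gs * D / (2 * card G) \<le> (\<Sum>v\<in>T. lh v)" using main cG by (simp add: Gs_def field_simps)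
    show "0 \<le> (\<Sum>v\<in>T. lh v)" using T(2) lh_nonneg by (intro sum_nonneg) auto
  qed (use N in simp_all)
  also have "\<dots> \<le> canonical_height f \<alpha>" by (rule canonical_height_ge[OF T])
  finally show ?thesis by (simp only: Gs_def m_def)
qed

end

section \<open>Integrality of \<open>b\<close> and the final constant\<close>

text \<open>The iterates of \<open>0\<close> are monic integer polynomials in \<open>b\<close> of
  positive degree, and one of them vanishes.\<close>

lemma periodic_algebraic_int:
  assumes q: "q \<ge> 2" and n: "n \<ge> 1" "(uni q b ^^ n) 0 = 0" shows "algebraic_int b"
proof -
  have "\<exists>P. poly P b = (uni q b ^^ Suc k) 0 \<and> lead_coeff P = 1 \<and> Polynomial.degree P \<ge> 1 \<and> (\<forall>i. Polynomial.coeff P i \<in> \<int>)" for k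
  proof (induction k)
    case 0
    have "\<forall>i. Polynomial.coeff [:0, 1 :: complex:] i \<in> \<int>" by (auto simp: coeff_pCons split: nat.split)
    then show ?case using q by (intro exI[of _ "[:0, 1:]"]) (simp add: uni_def)
  next
    case (Suc k)
    then obtain P where P: "poly P b = (uni q b ^^ Suc k) 0" "lead_coeff P = 1" "Polynomial.degree P \<ge> 1"
      "\<And>i. Polynomial.coeff P i \<in> \<int>" by blast
    define R where "R = P ^ q + [:0, 1:]"
    have dP: "Polynomial.degree (P ^ q) = q * Polynomial.degree P" using P(2) by (subst degree_power_eq) auto
    moreover have "2 * 1 \<le> q * Polynomial.degree P" using q P(3) by (rule mult_le_mono)
    ultimately have lt: "Polynomial.degree [:0, 1 :: complex:] < Polynomial.degree (P ^ q)" using q by simp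
    have "Polynomial.degree R = Polynomial.degree (P ^ q)" unfolding R_def using lt by (rule degree_add_eq_left)
    moreover have "lead_coeff R = lead_coeff (P ^ q)"
      unfolding R_def using lead_coeff_add_le[OF lt] by (simp only: add.commute)
    moreover have Z: "subrng \<int>" by (simp add: subrng_def)
    have int: "Polynomial.coeff (P ^ j) i \<in> \<int>" for j i
    proof (induction j arbitrary: i)
      case (Suc j)
      show ?case unfolding power_Suc coeff_mult by (intro subrng_sum[OF Z] Ints_mult P(4) Suc)
    qed (simp add: one_pCons coeff_pCons split: nat.split)
    have "Polynomial.coeff R i \<in> \<int>" for i
      unfolding R_def using int[of q i] by (auto simp: coeff_pCons split: nat.split)
    moreover have "poly R b = (uni q b ^^ Suc (Suc k)) 0" by (simp add: R_def P(1)[simplified] uni_def)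
    ultimately show ?case using P(2) lt by (intro exI[of _ R]) (simp add: lead_coeff_power)
  qed
  from this[of "n - 1"] obtain P where P: "poly P b = (uni q b ^^ n) 0" "lead_coeff P = 1" "\<And>i. Polynomial.coeff P i \<in> \<int>"
    using n(1) by auto
  then show ?thesis using n(2) by (intro algebraic_int.intros[of P]) auto
qed

theorem theorem1p1:
  fixes p e :: nat and b :: complex and f :: "complex poly"
  assumes "Factorial_Ring.prime p" and "e \<ge> 1"
    and "algebraic b"
    and "f = Polynomial.monom 1 (p ^ e) + [:b:]"
    and "periodic_point f 0"
  shows "\<exists>c::real. c > 0 \<and>
    (\<forall>\<alpha>::complex. algebraic \<alpha> \<longrightarrow> wandering_point f \<alpha> \<longrightarrow>
       canonical_height f \<alpha> \<ge> c / real (field_degree (adjoin {\<alpha>})) ^ 2)"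
proof -
  note p = assms(1) and e = assms(2) and b = assms(3) and f = assms(4)
  have "p ^ 1 \<le> p ^ e" using prime_gt_0_nat[OF p] e by (intro power_increasing) simp_all
  then have q2: "p ^ e \<ge> 2" using prime_ge_2_nat[OF p] by simp
  have pf: "poly f = uni (p ^ e) b" by (rule ext) (simp add: f uni_def poly_monom)
  obtain n where n: "n \<ge> 1" "(uni (p ^ e) b ^^ n) 0 = 0" using assms(5) by (auto simp: periodic_point_def pf)
  have b_int: "algebraic_int b" by (rule periodic_algebraic_int[OF q2 n])
  define Rb where "Rb = {y. rp (minpoly b) y = 0}"
  have finR: "finite Rb" unfolding Rb_def by (rule card_roots_minpoly(1)[OF b])
  \<comment> \<open>A bound for the number of images of the pair \<open>b\<close>, \<open>z\<close>
    that is valid in every Galois field containing both.\<close>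
  define B where "B = card (Rb \<times> {y::complex. y ^ p = 1})"
  define R where "R = Max (norm ` Rb)"
  define m where "m = Polynomial.degree (minpoly b)"
  have m: "m > 0" unfolding m_def using rp_degree_0[of "minpoly b" b] minpoly(1,2)[OF b] by auto
  obtain z where z: "z ^ p = 1" "z \<noteq> (1::complex)"
  proof -
    have "card {y::complex. y ^ p = 1} = p" using prime_gt_0_nat[OF p] by (intro card_roots_unity_eq) 
    then have "\<not> {y::complex. y ^ p = 1} \<subseteq> {1}" using card_mono[of "{1::complex}" "{y. y ^ p = 1}"] prime_ge_2_nat[OF p] by auto
    then show ?thesis using that by blast
  qed
  have z_int: "algebraic_int z"
  proof -
    have "algebraic_int (z ^ p)" using z by simp
    then show ?thesis using prime_gt_0_nat[OF p] by (simp add: algebraic_int_power_iff)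
  qed
  \<comment> \<open>The locale constants appear with explicit parameters: they involve
    \<open>p\<close>, \<open>e\<close>, \<open>n\<close>, \<open>B\<close> and \<open>R\<close>, but
    neither \<open>\<alpha>\<close> nor the field built from it.\<close>
  define c1 where "c1 = min (unicritical_height.cst1 p e n B R) (unicritical_height.cst2 p e n B R) / (2 * m)"
  define c2 where "c2 = ln 2 / real m"
  \<comment> \<open>\<open>c1\<close> is known to be positive only once an integral wandering point exists.\<close>
  define c where "c = (if c1 > 0 then min c1 c2 else c2)"
  have c2: "c2 > 0" using m by (simp add: c2_def)
  have "c > 0" using c2 by (simp add: c_def)
  moreover have "canonical_height f \<alpha> \<ge> c / real (field_degree (adjoin {\<alpha>})) ^ 2"
    if \<alpha>: "algebraic \<alpha>" and w: "wandering_point f \<alpha>" for \<alpha>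
  proof -
    have "\<exists>M G. galois M G \<and> {\<alpha>, b, z} \<subseteq> M"
      using \<alpha> b z_int by (intro galois_exists) auto
    then obtain M G where MG: "galois M G" "\<alpha> \<in> M" "b \<in> M" "z \<in> M" by blast
    interpret galois M G by fact
    have alg_M: "algebraic x" if x: "x \<in> M" for x
    proof -
      have "map_poly of_rat h = root_poly (orb G x) \<Longrightarrow> rp h x = 0" for h
        unfolding rp_def using poly_root_poly_orb[OF subgrp_G] by simp
      moreover obtain h where h: "map_poly of_rat h = root_poly (orb G x)"
        using rats_coeffs_rat_poly[of "root_poly (orb G x)"] coeff_root_poly_orb_Rats[OF x] by blast
      moreover have "root_poly (orb G x) \<noteq> 0" using lead_coeff_root_poly[of "orb G x"] by auto
      ultimately show ?thesis unfolding algebraic_iff_rp by (metis map_poly_of_rat_eq_0_iff)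
    qed
    interpret galois_height M G "p ^ e" b \<alpha> f
      by unfold_locales (use q2 f MG b_int alg_M in auto)
    define d where "d = real (field_degree (adjoin {\<alpha>}))"
    have Dd: "0 < real D" "real D \<le> d" using D_pos D_le_degree by (simp_all add: d_def)
    show ?thesis
    proof (cases "algebraic_int \<alpha>")
      case False
      have "c / d ^ 2 \<le> c2 / real D ^ 2"
        using c2 Dd \<open>c > 0\<close> by (intro frac_le power_mono) (auto simp: c_def)
      also have "\<dots> = ln 2 / Polynomial.degree (minpoly b) / D\<^sup>2" by (simp add: c2_def m_def)
      also have "\<dots> \<le> canonical_height f \<alpha>" by (rule nonintegral_bound[OF False])
      finally show ?thesis by (simp only: d_def)
    next
      case True
      have sb: "s b \<in> Rb" if "s \<in> G" for s
        using rp_G[OF that bM, of "minpoly b"] minpoly(2)[OF b] zero_G[OF that] by (simp add: Rb_def)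
      have sz: "s z ^ p = 1" if "s \<in> G" for s
        using power_G[OF that MG(4), of p] z(1) one_G[OF that] by simp
      have "card ((\<lambda>s. (s b, s z)) ` G) \<le> B"
        unfolding B_def using sb sz finR finite_roots_unity[of p] prime_gt_0_nat[OF p] by (intro card_mono) auto
      moreover have "norm (s b) \<le> R" if "s \<in> G" for s
        unfolding R_def using sb[OF that] finR by (intro Max_ge) auto
      moreover have "infinite (range (\<lambda>k. (uni (p ^ e) b ^^ k) \<alpha>))" using w by (simp add: wandering_point_def pf)
      ultimately interpret uh: unicritical_height M G p e n B b z \<alpha> R
        by unfold_locales (use p e n MG z b_int True in auto)
      have c1: "c1 > 0" unfolding c1_def using uh.cst_pos m by (intro divide_pos_pos) simp_all
      \<comment> \<open>The degree over the base field is at most the degree over the rationals, so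
        a bound in terms of \<open>Dg\<close> is the stronger one.\<close>
      have "uh.Dg \<le> D" unfolding uh.Dg_def D_def uh.orbs_def orb_def stab_def
        using finite_G by (intro card_mono) auto
      then have Dg: "0 < real uh.Dg" "real uh.Dg \<le> d" using uh.Dg_pos Dd by simp_all
      have "c / d ^ 2 \<le> c1 / real uh.Dg ^ 2"
        using c1 Dg \<open>c > 0\<close> by (intro frac_le power_mono) (auto simp: c_def)
      also have "\<dots> = (min uh.cst1 uh.cst2 / uh.Dg ^ 2) / (2 * m)" by (simp add: c1_def)
      also have "\<dots> \<le> uh.ht / (2 * m)" using uh.ht_lower_bound by (intro divide_right_mono) simp_all
      also have "\<dots> \<le> canonical_height f \<alpha>" using archimedean_bound by (simp add: uh.ht_def m_def)
      finally show ?thesis by (simp only: d_def)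
    qed
  qed
  ultimately show ?thesis by blast
qed

end
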